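(* Let $P$ be an orthogonal projection and $U$ a unitary acting on a finite-dimensional (nonzero) complex Hilbert space, and write $P^\perp=I-P$. Then the set $$\mathcal W_{P,U}:=\{(z_1,z_2)\in\mathbb C^2:(z_1,z_2)\in\sigma_T(P^\perp U+z_1z_2PU,\;U^*P+z_1z_2U^*P^\perp)\}$$ is a symmetric algebraic variety in $\mathbb C^2$ for which the following are equivalent: (i) $\mathcal W_{P,U}$ is a distinguished variety with respect to $\mathbb D^2$; (ii) for all $z\in\mathbb D$, $\nu(U^*(P+zP^\perp))<1$ and $\nu((P^\perp+zP)U)<1$; (iii) $\mathcal W_{P,U}\subset\mathbb D^2\cup\mathbb T^2\cup\mathbb E^2$. Moreover, $$\mathcal W_{P,U}=\bigcup_{z\in\mathbb C}\sigma_T(P^\perp U+zPU,\;U^*P+zU^*P^\perp).$$ Conversely, if $\mathcal W$ is any distinguished variety with respect to $\mathbb D^2$ (the zero set of one polynomial in $\mathbb C[z_1,z_2]$), then there exist an orthogonal projection $P$ and a unitary $U$ acting on a finite-dimensional Hilbert space such that $$\mathcal W\cap\mathbb D^2=\mathcal W_{P,U}\cap\mathbb D^2.$$ Moreover, (for such $\mathcal W,P,U$) $\mathcal W=\mathcal W_{P,U}$ if and only if both $\mathcal W$ and $\mathcal W_{P,U}$ are contained in $\mathbb D^2\cup\mathbb T^2\cup\mathbb E^2$.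
   Context: $\mathbb D$ is the open unit disc, $\mathbb T$ the unit circle, $\mathbb E=\mathbb C\setminus\overline{\mathbb D}$. $\nu(A)=\sup\{|\langle Ah,h\rangle|:\|h\|=1\}$ is the numerical radius. For a commuting pair $(T_1,T_2)$ of operators on a finite-dimensional space, $\sigma_T(T_1,T_2)$ is the joint spectrum, i.e. the set of joint eigenvalues: $(\lambda_1,\lambda_2)$ such that there is $x\ne0$ with $T_ix=\lambda_ix$, $i=1,2$. (For every $z\in\mathbb C$ the two matrices $P^\perp U+zPU$ and $U^*P+zU^*P^\perp$ commute, with product $zI$.) An algebraic variety in $\mathbb C^2$ is the common zero set of a family of polynomials in $\mathbb C[z_1,z_2]$. It is a distinguished variety with respect to $\mathbb D^2$ if $\mathcal W\cap\mathbb D^2\neq\emptyset$ and $\mathcal W\cap\partial\mathbb D^2=\mathcal W\cap\mathbb T^2$, where $\partial\mathbb D^2$ is the topological boundary. A variety $\mathcal W\subset\mathbb C^2$ is symmetric if for all $z_1\ne0$, $z_2\neq0$: $(z_1,z_2)\in\mathcal W$ if and only if $(1/\overline{z_1},1/\overline{z_2})\in\mathcal W$. *)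

theory Defs
  imports
    "HOL-Analysis.Elementary_Metric_Spaces"
    "Jordan_Normal_Form.Schur_Decomposition"
    "Jordan_Normal_Form.Char_Poly"
begin

text \<open>Operators on an \<open>n\<close>-dimensional complex Hilbert space are taken to be complex
  \<open>n \<times> n\<close> matrices acting on \<open>\<complex>\<^sup>n\<close> with its standard inner product, so that \<open>mat_adjoint\<close> is the
  Hilbert space adjoint. The dimension is a natural number and can be quantified over.\<close>

definition orthogonal_projection :: "nat \<Rightarrow> complex mat \<Rightarrow> bool" where
  "orthogonal_projection n P \<longleftrightarrow> P \<in> carrier_mat n n \<and> P * P = P \<and> mat_adjoint P = P"

definition unitary_mat :: "nat \<Rightarrow> complex mat \<Rightarrow> bool" where
  "unitary_mat n U \<longleftrightarrow>
     U \<in> carrier_mat n n \<and> mat_adjoint U * U = 1\<^sub>m n \<and> U * mat_adjoint U = 1\<^sub>m n"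

definition mat_perp :: "complex mat \<Rightarrow> complex mat" where
  "mat_perp P = 1\<^sub>m (dim_row P) - P"

text \<open>\<open>h \<bullet>c h = 1\<close> says that \<open>h\<close> is a unit vector. For matrices of positive size the set below is
  nonempty and bounded, so the supremum is the genuine one.\<close>

definition numerical_radius :: "complex mat \<Rightarrow> real" where
  "numerical_radius A =
     Sup {cmod ((A *\<^sub>v h) \<bullet>c h) | h. h \<in> carrier_vec (dim_row A) \<and> h \<bullet>c h = 1}"

text \<open>Used only for commuting pairs of square matrices of the same size; \<open>eigenvector\<close> includes
  \<open>x \<noteq> 0\<close>.\<close>

definition joint_spectrum :: "complex mat \<Rightarrow> complex mat \<Rightarrow> (complex \<times> complex) set" where
  "joint_spectrum T1 T2 =
     {(l1, l2). \<exists>x. eigenvector T1 x l1 \<and> eigenvector T2 x l2}"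

definition pencil1 :: "complex mat \<Rightarrow> complex mat \<Rightarrow> complex \<Rightarrow> complex mat" where
  "pencil1 P U z = mat_perp P * U + z \<cdot>\<^sub>m (P * U)"

definition pencil2 :: "complex mat \<Rightarrow> complex mat \<Rightarrow> complex \<Rightarrow> complex mat" where
  "pencil2 P U z = mat_adjoint U * P + z \<cdot>\<^sub>m (mat_adjoint U * mat_perp P)"

definition W_set :: "complex mat \<Rightarrow> complex mat \<Rightarrow> (complex \<times> complex) set" where
  "W_set P U =
     {(z1, z2). (z1, z2) \<in> joint_spectrum (pencil1 P U (z1 * z2)) (pencil2 P U (z1 * z2))}"

text \<open>The type \<open>complex poly poly\<close> represents \<open>\<complex>[z1][z2]\<close>: the outer variable is \<open>z2\<close>, the
  inner one \<open>z1\<close>.\<close>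

definition zero_set :: "complex poly poly \<Rightarrow> (complex \<times> complex) set" where
  "zero_set p = {(z1, z2). poly (poly p [:z2:]) z1 = 0}"

definition algebraic_variety :: "(complex \<times> complex) set \<Rightarrow> bool" where
  "algebraic_variety W \<longleftrightarrow> (\<exists>F. W = (\<Inter>p\<in>F. zero_set p))"

definition unit_disc :: "complex set" where
  "unit_disc = ball 0 1"

definition unit_circle :: "complex set" where
  "unit_circle = sphere 0 1"

definition exterior_disc :: "complex set" where
  "exterior_disc = - cball 0 1"

definition distinguished_variety :: "(complex \<times> complex) set \<Rightarrow> bool" where
  "distinguished_variety W \<longleftrightarrow>
     algebraic_variety W \<and>
     W \<inter> (unit_disc \<times> unit_disc) \<noteq> {} \<and>
     W \<inter> frontier (unit_disc \<times> unit_disc) = W \<inter> (unit_circle \<times> unit_circle)"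

definition symmetric_set :: "(complex \<times> complex) set \<Rightarrow> bool" where
  "symmetric_set W \<longleftrightarrow>
     (\<forall>z1 z2. z1 \<noteq> 0 \<longrightarrow> z2 \<noteq> 0 \<longrightarrow>
        ((z1, z2) \<in> W \<longleftrightarrow> (1 / cnj z1, 1 / cnj z2) \<in> W))"

definition toral_region :: "(complex \<times> complex) set" where
  "toral_region =
     unit_disc \<times> unit_disc \<union> unit_circle \<times> unit_circle \<union> exterior_disc \<times> exterior_disc"

end

theory Submission
  imports
    "HOL-Complex_Analysis.Complex_Analysis"
    "HOL-Computational_Algebra.Field_as_Ring"
    "Jordan_Normal_Form.Spectral_Radius"
    Defs
begin

text \<open>With \<open>Q = 1 - P\<close>, a vector \<open>x\<close> is a joint eigenvector at \<open>(z1, z2)\<close> if and only if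
  \<open>P x = z2 P U x\<close> and \<open>Q U x = z1 Q x\<close>. Hence the variety of \<open>(P, U)\<close> is the zero set of the
  determinant of \<open>P - z2 P U + Q U - z1 Q\<close>, and the equivalences reduce to norm computations with
  the orthogonal decomposition given by \<open>P\<close> and the equality case of the Cauchy--Schwarz inequality.

  Conversely, let \<open>p\<close> define a distinguished variety. The monic polynomial in \<open>z2\<close> of the roots of
  \<open>p z1\<close> in the disc has coefficients holomorphic in \<open>z1\<close>, and since the roots tend to the circle as
  \<open>z1\<close> does, it is asymptotically self-inversive; a reflection argument makes its coefficients
  rational. Clearing denominators and passing to a squarefree polynomial \<open>f\<close>, let \<open>C\<close> be the
  companion matrix of \<open>f\<close>. The Gram matrix \<open>G\<close> of the roots satisfies \<open>C* G C = G\<close> on the circle and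
  is positive there off a finite set, so the Fejer--Riesz theorem and an \<open>L D L*\<close> factorisation give
  \<open>G = A* A\<close> up to a scalar factor, with \<open>A\<close> polynomial and invertible in the disc. Then
  \<open>A C A\<^sup>-\<^sup>1\<close> is a rational inner function whose eigenvalues are the roots of \<open>f\<close>. Splitting off
  Blaschke factors realizes it as the transfer function of a finite-dimensional unitary, and this
  unitary together with the projection onto the input space is the required pair.\<close>

unbundle no inner_syntax
unbundle no vec_syntax
unbundle no fps_syntax
no_notation fps_nth (infixl "$" 75)

section \<open>Boundary behaviour of holomorphic functions on the disc\<close>

text \<open>Over the circle only the limiting modulus of the roots is known, so boundary statements
  are limits of functions on the open disc. The reflected equation relates the coefficients through
  the product of the roots, whose modulus tends to 1; this product is a finite Blaschke product up
  to a constant, and its denominator is a common denominator of all coefficients.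

  Squarefreeness makes the Gram matrix definite: distinct roots give independent vectors of powers.
  The companion identity holds because the vector of powers of a root \<open>x\<close> is a left
  eigenvector with eigenvalue \<open>x\<close>, of modulus 1 over the circle. Invertibility of the
  factor inside the disc keeps the conjugated function free of poles there and preserves its
  eigenvalues; on the circle the factor may degenerate, and the resulting common zeros are
  cancelled.

  A colligation preserves norms, which determines the state uniquely for \<open>z\<close> in the
  disc; so eigenvectors of the transfer function correspond to joint eigenvectors. This is confined
  to \<open>z1\<close> in the disc, and equality of whole varieties needs a divisibility argument on
  prime factors of the defining polynomials.\<close>

definition boundary :: "complex filter" where
  "boundary = filtercomap cmod (at_left 1)"

text \<open>The inner radius is independent of the argument, so limits along \<open>boundary\<close>
  are uniform in the angle and make sense for functions known on the open disc only.\<close>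

lemma eventually_boundary:
  "eventually P boundary \<longleftrightarrow> (\<exists>r<1. \<forall>z. r < cmod z \<and> cmod z < 1 \<longrightarrow> P z)"
proof
  assume "eventually P boundary"
  then obtain Q b where Q: "b < 1" "\<forall>y>b. y < 1 \<longrightarrow> Q y" "\<forall>x. Q (cmod x) \<longrightarrow> P x"
    unfolding boundary_def eventually_filtercomap eventually_at_left_field by blast
  then show "\<exists>r<1. \<forall>z. r < cmod z \<and> cmod z < 1 \<longrightarrow> P z" by blast
next
  assume "\<exists>r<1. \<forall>z. r < cmod z \<and> cmod z < 1 \<longrightarrow> P z"
  then obtain r where r: "r < 1" "\<forall>z. r < cmod z \<and> cmod z < 1 \<longrightarrow> P z" by blast
  then show "eventually P boundary"
    unfolding boundary_def eventually_filtercomap eventually_at_left_field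
    by (intro exI[of _ "\<lambda>y. r < y \<and> y < 1"]) blast
qed

lemma boundary_in_disc: "eventually (\<lambda>z. cmod z < 1) boundary"
  unfolding eventually_boundary by (auto intro!: exI[of _ 0])

lemma boundary_eventually_norm_gt:
  assumes "r < 1" shows "eventually (\<lambda>z. r < cmod z \<and> cmod z < 1) boundary"
  unfolding eventually_boundary using assms by auto

lemma boundary_half: "eventually (\<lambda>z. 1 / 2 < cmod z \<and> cmod z < 1) boundary"
  by (rule boundary_eventually_norm_gt) simp

lemma norm_tendsto_boundary: "(cmod \<longlongrightarrow> 1) boundary"
proof (rule tendsto_mono)
  show "boundary \<le> filtercomap cmod (nhds 1)"
    unfolding boundary_def by (intro filtercomap_mono) (simp add: at_within_def)
qed (simp add: filterlim_filtercomap)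

text \<open>Maximum principle on discs of radius close to 1, since \<open>f\<close> need not extend to the circle.\<close>

lemma Re_le_of_boundary:
  assumes holo: "f holomorphic_on ball 0 1"
    and ev: "eventually (\<lambda>z. Re (f z) \<le> B) boundary" and z: "cmod z < 1"
  shows "Re (f z) \<le> B"
proof -
  obtain r where r: "r < 1" "\<And>w. r < cmod w \<Longrightarrow> cmod w < 1 \<Longrightarrow> Re (f w) \<le> B"
    using ev unfolding eventually_boundary by blast
  define s where "s = (max (max r (cmod z)) 0 + 1) / 2"
  have s: "s < 1" "r < s" "cmod z < s" "0 < s" using r(1) z by (auto simp: s_def)
  show ?thesis
  proof (rule maximum_real_frontier[of f "cball 0 s" B z])
    show "f holomorphic_on interior (cball 0 s)"
      using s by (auto intro: holomorphic_on_subset[OF holo])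
    show "continuous_on (closure (cball 0 s)) f"
      using s by (auto intro!: holomorphic_on_imp_continuous_on holomorphic_on_subset[OF holo])
  next
    fix w assume "w \<in> frontier (cball (0::complex) s)"
    then show "Re (f w) \<le> B" using r(2)[of w] s by auto
  qed (use s in auto)
qed

text \<open>The maximum principle for \<open>f\<close> and \<open>- f\<close> makes the real part
  vanish on the whole disc; the image of a nonconstant \<open>f\<close> would be open, so it cannot
  lie in the imaginary axis.\<close>

lemma constant_of_Re_boundary:
  assumes holo: "f holomorphic_on ball 0 1" and lim: "((\<lambda>z. Re (f z)) \<longlongrightarrow> 0) boundary"
  shows "f constant_on ball 0 1"
proof (rule ccontr)
  assume nc: "\<not> f constant_on ball 0 1"
  have Re0: "Re (f z) = 0" if z: "cmod z < 1" for z
  proof (rule antisym)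
    have *: "Re (f z) \<le> e \<and> Re (- f z) \<le> e" if e: "e > 0" for e
    proof
      have ev: "eventually (\<lambda>z. \<bar>Re (f z)\<bar> < e) boundary"
        using tendstoD[OF lim e] by (simp add: dist_real_def)
      show "Re (f z) \<le> e"
        by (rule Re_le_of_boundary[OF holo _ z], rule eventually_mono[OF ev]) auto
      show "Re (- f z) \<le> e"
        by (rule Re_le_of_boundary[of "\<lambda>z. - f z", OF _ _ z],
            use holo in \<open>auto intro!: holomorphic_intros\<close>, rule eventually_mono[OF ev]) auto
    qed
    show "Re (f z) \<le> 0" by (rule field_le_epsilon) (use * in auto)
    show "0 \<le> Re (f z)" using field_le_epsilon[of "- Re (f z)" 0] * by auto
  qed
  have "open (f ` ball 0 1)"
    by (rule open_mapping_thm[OF holo]) (use nc in auto)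
  then obtain e where e: "e > 0" "ball (f 0) e \<subseteq> f ` ball 0 1"
    using openE[of "f ` ball 0 1" "f 0"] by auto
  have "f 0 + of_real (e/2) \<in> f ` ball 0 1"
    using e by (intro subsetD[OF e(2)]) (auto simp: dist_norm)
  then obtain z where "cmod z < 1" "f z = f 0 + of_real (e/2)" by auto
  then have "Re (f 0 + of_real (e/2)) = 0" using Re0 by metis
  then show False using Re0[of 0] e(1) by auto
qed

text \<open>Conjugation keeps the real part and flips the imaginary part, so the real parts of
  \<open>g - h\<close> and of \<open>\<i> * (g + h)\<close> tend to 0. Both functions are constant,
  hence so is \<open>g\<close>.\<close>

lemma constant_of_cnj_boundary:
  assumes g: "g holomorphic_on ball 0 1" and h: "h holomorphic_on ball 0 1"
    and lim: "((\<lambda>z. g z - cnj (h z)) \<longlongrightarrow> 0) boundary"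
  shows "g constant_on ball 0 1"
proof -
  have "(\<lambda>z. g z - h z) constant_on ball 0 1"
  proof (rule constant_of_Re_boundary)
    have "((\<lambda>z. Re (g z - cnj (h z))) \<longlongrightarrow> Re 0) boundary" by (intro tendsto_intros lim)
    then show "((\<lambda>z. Re (g z - h z)) \<longlongrightarrow> 0) boundary" by simp
  qed (intro holomorphic_intros g h)
  moreover have "(\<lambda>z. \<i> * (g z + h z)) constant_on ball 0 1"
  proof (rule constant_of_Re_boundary)
    have "((\<lambda>z. - Im (g z - cnj (h z))) \<longlongrightarrow> - Im 0) boundary" by (intro tendsto_intros lim)
    then show "((\<lambda>z. Re (\<i> * (g z + h z))) \<longlongrightarrow> 0) boundary" by simp
  qed (intro holomorphic_intros g h)
  ultimately obtain a b where
    "\<And>z. z \<in> ball 0 1 \<Longrightarrow> g z - h z = a" "\<And>z. z \<in> ball 0 1 \<Longrightarrow> \<i> * (g z + h z) = b"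
    unfolding constant_on_def by metis
  then have "(g z - h z) * \<i> + \<i> * (g z + h z) = a * \<i> + b" if "z \<in> ball 0 1" for z
    using that by simp
  then have "2 * \<i> * g z = b + \<i> * a" if "z \<in> ball 0 1" for z
    using that by (simp add: algebra_simps)
  then have "g z = (b + \<i> * a) / (2 * \<i>)" if "z \<in> ball 0 1" for z
    using that by (simp add: field_simps)
  then show ?thesis unfolding constant_on_def by blast
qed

text \<open>The disc is contractible and \<open>f\<close> has no zeros, so \<open>f = exp L\<close>;
  the real part of \<open>L\<close> is \<open>ln (cmod (f z))\<close> and tends to 0.\<close>

lemma constant_of_norm_boundary:
  assumes f: "f holomorphic_on ball 0 1" and nz: "\<And>z. cmod z < 1 \<Longrightarrow> f z \<noteq> 0"
    and lim: "((\<lambda>z. cmod (f z)) \<longlongrightarrow> 1) boundary"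
  shows "f constant_on ball 0 1"
proof -
  obtain L where L: "L holomorphic_on ball 0 1" "\<And>z. z \<in> ball 0 1 \<Longrightarrow> f z = exp (L z)"
    using contractible_imp_holomorphic_log[OF f convex_imp_contractible[OF convex_ball]] nz by auto
  have "((\<lambda>z. ln (cmod (f z))) \<longlongrightarrow> ln 1) boundary"
    by (intro tendsto_intros lim) auto
  moreover have "eventually (\<lambda>z. ln (cmod (f z)) = Re (L z)) boundary"
    by (rule eventually_mono[OF boundary_in_disc]) (simp add: L(2))
  ultimately have "((\<lambda>z. Re (L z)) \<longlongrightarrow> 0) boundary"
    using tendsto_cong by force
  from constant_of_Re_boundary[OF L(1) this] show ?thesis
    using L(2) unfolding constant_on_def by metis
qed

lemma holomorphic_divide_zero:
  assumes f: "f holomorphic_on ball 0 1"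
  obtains g where "g holomorphic_on ball 0 1" "\<And>z. f z = f a + (z - a) * g z"
proof
  show "(\<lambda>z. if z = a then deriv f a else (f z - f a)/(z-a)) holomorphic_on ball 0 1"
    by (rule pole_lemma_open[OF f]) simp
qed auto

lemma eventually_nonzero_boundary: "eventually (\<lambda>z::complex. z \<noteq> 0) boundary"
  using boundary_eventually_norm_gt[of 0] by (auto elim: eventually_mono)

text \<open>The difference equals \<open>(cmod z ^ (2 * d) - 1) / z ^ d\<close>.\<close>

lemma cnj_minus_inverse_boundary: "((\<lambda>z. cnj z ^ d - 1 / z ^ d) \<longlongrightarrow> 0) boundary"
proof (rule tendsto_norm_zero_cancel)
  have "((\<lambda>z. \<bar>(cmod z ^ 2) ^ d - 1\<bar> / cmod z ^ d) \<longlongrightarrow> \<bar>(1 ^ 2) ^ d - 1\<bar> / 1 ^ d) boundary"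
    by (intro tendsto_intros norm_tendsto_boundary) auto
  moreover have "eventually (\<lambda>z. \<bar>(cmod z ^ 2) ^ d - 1\<bar> / cmod z ^ d
      = cmod (cnj z ^ d - 1 / z ^ d)) boundary"
  proof (rule eventually_mono[OF eventually_nonzero_boundary])
    fix z :: complex assume z: "z \<noteq> 0"
    have "cnj z ^ d * z ^ d = of_real ((cmod z ^ 2) ^ d)"
      unfolding power_mult_distrib[symmetric] of_real_power
      by (metis complex_norm_square mult.commute of_real_power)
    then have "cnj z ^ d - 1 / z ^ d = (of_real ((cmod z ^ 2) ^ d) - 1) / z ^ d"
      using z by (simp add: diff_divide_distrib eq_divide_eq del: of_real_power)
    then have "cmod (cnj z ^ d - 1 / z ^ d) = cmod (of_real ((cmod z ^ 2) ^ d - 1)) / cmod z ^ d"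
      by (simp add: norm_divide norm_power norm_mult)
    then show "\<bar>(cmod z ^ 2) ^ d - 1\<bar> / cmod z ^ d = cmod (cnj z ^ d - 1 / z ^ d)"
      by (simp only: norm_of_real)
  qed
  ultimately show "((\<lambda>z. cmod (cnj z ^ d - 1 / z ^ d)) \<longlongrightarrow> 0) boundary"
    using tendsto_cong by force
qed

text \<open>Induction on \<open>d\<close>: near the circle \<open>1/z\<close> may be replaced by \<open>cnj z\<close>.\<close>

lemma polynomial_of_boundary:
  assumes "g holomorphic_on ball 0 1" "h holomorphic_on ball 0 1"
    and "((\<lambda>z. g z / z ^ d - cnj (h z)) \<longlongrightarrow> 0) boundary"
  shows "\<exists>q. \<forall>z\<in>ball 0 1. g z = poly q z"
  using assms
proof (induction d arbitrary: g h)
  case 0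
  then have "g constant_on ball 0 1" by (intro constant_of_cnj_boundary[of g h]) auto
  then obtain c where "\<And>z. z \<in> ball 0 1 \<Longrightarrow> g z = c" unfolding constant_on_def by blast
  then show ?case by (intro exI[of _ "[:c:]"]) auto
next
  case (Suc d)
  obtain g1 where g1: "g1 holomorphic_on ball 0 1" "\<And>z. g z = g 0 + (z - 0) * g1 z"
    using holomorphic_divide_zero[OF Suc.prems(1)] by blast
  \<comment> \<open>The constant term of \<open>g\<close> contributes
    \<open>g 0 / z ^ Suc d\<close>, asymptotically \<open>g 0 * cnj z ^ Suc d\<close>, which is
    moved into the antiholomorphic part.\<close>
  define h1 where "h1 z = h z - cnj (g 0) * z ^ Suc d" for z
  have h1: "h1 holomorphic_on ball 0 1" unfolding h1_def by (intro holomorphic_intros Suc.prems)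
  note nz = eventually_nonzero_boundary and inv0 = cnj_minus_inverse_boundary[of "Suc d"]
  have "((\<lambda>z. (g z / z ^ Suc d - cnj (h z)) + g 0 * (cnj z ^ Suc d - 1 / z ^ Suc d)) \<longlongrightarrow> 0 + g 0 * 0) boundary"
    by (intro tendsto_intros Suc.prems inv0)
  moreover have "eventually (\<lambda>z. (g z / z ^ Suc d - cnj (h z)) + g 0 * (cnj z ^ Suc d - 1 / z ^ Suc d)
     = g1 z / z ^ d - cnj (h1 z)) boundary"
  proof (rule eventually_mono[OF nz])
    fix z :: complex assume z: "z \<noteq> 0"
    have "g z / z ^ Suc d = g 0 / z ^ Suc d + g1 z / z ^ d"
      using z by (subst g1(2)) (simp add: add_divide_distrib)
    then show "(g z / z ^ Suc d - cnj (h z)) + g 0 * (cnj z ^ Suc d - 1 / z ^ Suc d)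
     = g1 z / z ^ d - cnj (h1 z)" by (simp add: h1_def algebra_simps del: power_Suc)
  qed
  ultimately have "((\<lambda>z. g1 z / z ^ d - cnj (h1 z)) \<longlongrightarrow> 0) boundary"
    using tendsto_cong by force
  from Suc.IH[OF g1(1) h1 this] obtain q where q: "\<forall>z\<in>ball 0 1. g1 z = poly q z" by blast
  show ?case
    by (rule exI[of _ "pCons (g 0) q"], subst g1(2)) (use q in auto)
qed

section \<open>Zeros in the disc and finite Blaschke products\<close>

lemma factor_order_of_zero_disc:
  assumes f: "f holomorphic_on ball 0 1" and nc: "\<not> f constant_on ball 0 1"
    and a: "a \<in> ball 0 1" "f a = 0"
  obtains n g where "0 < n" "g holomorphic_on ball 0 1" "g a \<noteq> 0"
    "\<And>z. z \<in> ball 0 1 \<Longrightarrow> f z = (z - a) ^ n * g z"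
proof -
  obtain g r n where g: "0 < n" "0 < r" "ball a r \<subseteq> ball 0 1" "g holomorphic_on ball a r"
    "\<And>w. w \<in> ball a r \<Longrightarrow> f w = (w - a) ^ n * g w" "\<And>w. w \<in> ball a r \<Longrightarrow> g w \<noteq> 0"
    using holomorphic_factor_zero_nonconstant[OF f open_ball connected_ball a nc] by metis
  define g1 where "g1 z = (if z \<in> ball a r then g z else f z / (z - a) ^ n)" for z
  have "g1 holomorphic_on ball a r"
    by (rule holomorphic_transform[OF g(4)]) (simp add: g1_def)
  moreover have "g1 holomorphic_on ball 0 1 - {a}"
  proof (rule holomorphic_transform)
    show "(\<lambda>z. f z / (z - a) ^ n) holomorphic_on ball 0 1 - {a}"
      by (intro holomorphic_intros holomorphic_on_subset[OF f]) auto
  qed (auto simp: g1_def g(5))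
  ultimately have "g1 holomorphic_on ball a r \<union> (ball 0 1 - {a})"
    by (intro holomorphic_on_Un) auto
  then have "g1 holomorphic_on ball 0 1"
    by (rule holomorphic_on_subset) (use g(2) in auto)
  moreover have "g1 a \<noteq> 0" using g(2,6) by (simp add: g1_def)
  moreover have "f z = (z - a) ^ n * g1 z" if "z \<in> ball 0 1" for z
    using g(2,5) by (cases "z = a") (auto simp: g1_def)
  ultimately show ?thesis using that g(1) by blast
qed

text \<open>Induction on the number of distinct zeros: dividing out one zero with its full
  multiplicity removes that point from the zero set. The multiset \<open>A\<close> lists the zeros
  with multiplicity.\<close>

lemma factor_zeros_disc:
  assumes "f holomorphic_on ball 0 1" "finite {z\<in>ball 0 1. f z = 0}"
  shows "\<exists>A g. (\<forall>a\<in>#A. cmod a < 1) \<and> g holomorphic_on ball 0 1 \<and> (\<forall>z\<in>ball 0 1. g z \<noteq> 0)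
    \<and> (\<forall>z\<in>ball 0 1. f z = poly (\<Prod>a\<in>#A. [:-a, 1:]) z * g z)"
  using assms
proof (induction "card {z\<in>ball 0 1. f z = 0}" arbitrary: f rule: less_induct)
  case less
  show ?case
  proof (cases "\<exists>a\<in>ball 0 1. f a = 0")
    case False
    then show ?thesis using less.prems(1) by (intro exI[of _ "{#}"] exI[of _ f]) auto
  next
    case True
    then obtain a where a: "a \<in> ball 0 1" "f a = 0" by blast
    have "\<not> f constant_on ball 0 1"
    proof
      assume "f constant_on ball 0 1"
      then have "{z\<in>ball 0 1. f z = 0} = ball 0 1" using a by (auto simp: constant_on_def)
      moreover have "infinite (ball (0::complex) 1)"
        using finite_imp_not_open[OF _ open_ball, of "0::complex" 1] by auto
      ultimately show False using less.prems(2) by metis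
    qed
    from factor_order_of_zero_disc[OF less.prems(1) this a]
    obtain n g where g: "0 < n" "g holomorphic_on ball 0 1" "g a \<noteq> 0"
      "\<And>z. z \<in> ball 0 1 \<Longrightarrow> f z = (z - a) ^ n * g z" by metis
    have sub: "{z\<in>ball 0 1. g z = 0} \<subset> {z\<in>ball 0 1. f z = 0}"
      using g a by auto
    from less.hyps[OF psubset_card_mono[OF less.prems(2) sub] g(2)]
    obtain A h where A: "\<forall>a\<in>#A. cmod a < 1" "h holomorphic_on ball 0 1" "\<forall>z\<in>ball 0 1. h z \<noteq> 0"
      "\<forall>z\<in>ball 0 1. g z = poly (\<Prod>a\<in>#A. [:-a, 1:]) z * h z"
      using finite_subset[OF psubset_imp_subset[OF sub] less.prems(2)] by blast
    show ?thesis
      using A a g(4)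
      by (intro exI[of _ "A + replicate_mset n a"] exI[of _ h])
         (auto split: if_splits)
  qed
qed

lemma bounded_poly_disc:
  fixes q :: "complex poly"
  obtains B where "B > 0" "\<And>z. cmod z \<le> 1 \<Longrightarrow> cmod (poly q z) \<le> B"
proof -
  have "compact (poly q ` cball 0 1)"
    by (intro compact_continuous_image continuous_intros) auto
  then show ?thesis using that unfolding compact_eq_bounded_closed bounded_pos by auto
qed

lemma poly_reflected_prod_nonzero:
  assumes "\<forall>a\<in>#A. cmod a < 1" "cmod z \<le> 1"
  shows "poly (\<Prod>a\<in>#A. [:1, -cnj a:]) z \<noteq> 0"
  using assms(1)
proof (induction A)
  case (add a A)
  have "1 - z * cnj a \<noteq> 0"
  proof
    assume "1 - z * cnj a = 0"
    then have "cmod z * cmod a = 1" by (metis complex_mod_cnj norm_mult norm_one right_minus_eq)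
    moreover have "cmod z * cmod a \<le> cmod a"
      using mult_right_mono[OF assms(2), of "cmod a"] by simp
    ultimately show False using add.prems by auto
  qed
  then show ?case using add by simp
qed simp

text \<open>On the circle \<open>(z - a) / z\<close> is the conjugate of
  \<open>1 - cnj a * z\<close>; this is the asymptotic form of that identity, multiplied up over
  \<open>A\<close>.\<close>

lemma poly_reflected_prod_tendsto:
  assumes "\<forall>a\<in>#A. cmod a < 1"
  shows "((\<lambda>z. poly (\<Prod>a\<in>#A. [:-a, 1:]) z / z ^ size A
    - cnj (poly (\<Prod>a\<in>#A. [:1, -cnj a:]) z)) \<longlongrightarrow> 0) boundary"
  using assms
proof (induction A)
  case (add a A)
  define U V where "U = (\<lambda>z. poly (\<Prod>a\<in>#A. [:-a, 1:]) z / z ^ size A)"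
    and "V = (\<lambda>z. cnj (poly (\<Prod>a\<in>#A. [:1, -cnj a:]) z))"
  obtain B where B: "B > 0" "\<And>z. cmod z \<le> 1 \<Longrightarrow> cmod (V z) \<le> B"
    using bounded_poly_disc[of "\<Prod>a\<in>#A. [:1, -cnj a:]"] by (auto simp: V_def)
  have UV: "((\<lambda>z. U z - V z) \<longlongrightarrow> 0) boundary" using add by (auto simp: U_def V_def)
  have "((\<lambda>z. (U z - V z) * (1 - a / z)) \<longlongrightarrow> 0) boundary"
  proof (rule lim_null_mult_right_bounded[OF UV, of _ "1 + 2"])
    show "eventually (\<lambda>z. cmod (1 - a / z) \<le> 1 + 2) boundary"
    proof (rule eventually_mono[OF boundary_half])
      fix z assume z: "1 / 2 < cmod z \<and> cmod z < 1"
      have "cmod (a / z) \<le> 2" using add.prems z by (simp add: norm_divide divide_simps)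
      then show "cmod (1 - a / z) \<le> 1 + 2"
        using norm_triangle_ineq4[of 1 "a / z"] by simp
    qed
  qed
  moreover have "((\<lambda>z. (a * (cnj z ^ 1 - 1 / z ^ 1)) * V z) \<longlongrightarrow> 0) boundary"
  proof (rule lim_null_mult_right_bounded[where B = B])
    have "((\<lambda>z. a * (cnj z ^ 1 - 1 / z ^ 1)) \<longlongrightarrow> a * 0) boundary"
      by (intro tendsto_intros cnj_minus_inverse_boundary)
    then show "((\<lambda>z. a * (cnj z ^ 1 - 1 / z ^ 1)) \<longlongrightarrow> 0) boundary" by simp
  qed (rule eventually_mono[OF boundary_in_disc], use B in auto)
  ultimately have "((\<lambda>z. (U z - V z) * (1 - a / z) + (a * (cnj z ^ 1 - 1 / z ^ 1)) * V z) \<longlongrightarrow> 0 + 0) boundary"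
    by (rule tendsto_add)
  moreover have "eventually (\<lambda>z. (U z - V z) * (1 - a / z) + (a * (cnj z ^ 1 - 1 / z ^ 1)) * V z
     = poly (\<Prod>a\<in>#add_mset a A. [:-a, 1:]) z / z ^ size (add_mset a A)
    - cnj (poly (\<Prod>a\<in>#add_mset a A. [:1, -cnj a:]) z)) boundary"
  proof (rule eventually_mono[OF eventually_nonzero_boundary])
    fix z :: complex assume z: "z \<noteq> 0"
    have "poly (\<Prod>a\<in>#add_mset a A. [:-a, 1:]) z / z ^ size (add_mset a A) = (1 - a / z) * U z"
      using z by (simp add: U_def divide_simps algebra_simps)
    moreover have "cnj (poly (\<Prod>a\<in>#add_mset a A. [:1, -cnj a:]) z) = (1 - a * cnj z) * V z"
      by (simp add: V_def algebra_simps)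
    ultimately show "(U z - V z) * (1 - a / z) + (a * (cnj z ^ 1 - 1 / z ^ 1)) * V z
     = poly (\<Prod>a\<in>#add_mset a A. [:-a, 1:]) z / z ^ size (add_mset a A)
    - cnj (poly (\<Prod>a\<in>#add_mset a A. [:1, -cnj a:]) z)"
      by (simp only:) (simp add: algebra_simps)
  qed
  ultimately show ?case using tendsto_cong by force
qed simp

text \<open>\<open>R\<close> is bounded away from 0 on the closed disc, so
  \<open>poly_reflected_prod_tendsto\<close> may be divided by \<open>cnj (R z)\<close>: the
  quotient of \<open>Q z\<close> and \<open>z ^ size A * cnj (R z)\<close> tends to 1.\<close>

lemma blaschke_norm_tendsto:
  assumes A: "\<forall>a\<in>#A. cmod a < 1"
  shows "((\<lambda>z. cmod (poly (\<Prod>a\<in>#A. [:1, -cnj a:]) z / poly (\<Prod>a\<in>#A. [:-a, 1:]) z)) \<longlongrightarrow> 1) boundary"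
proof -
  define Q R where "Q = poly (\<Prod>a\<in>#A. [:-a, 1:])" and "R = poly (\<Prod>a\<in>#A. [:1, -cnj a:])"
  have "compact ((\<lambda>z. 1 / R z) ` cball 0 1)"
    using poly_reflected_prod_nonzero[OF A]
    by (intro compact_continuous_image continuous_intros) (auto simp: R_def intro!: continuous_intros)
  then have "bounded ((\<lambda>z. 1 / R z) ` cball 0 1)" by (rule compact_imp_bounded)
  then obtain B where B: "\<And>z. cmod z \<le> 1 \<Longrightarrow> cmod (1 / R z) \<le> B"
    unfolding bounded_iff by force
  have "((\<lambda>z. (Q z / z ^ size A - cnj (R z)) * (1 / cnj (R z))) \<longlongrightarrow> 0) boundary"
  proof (rule lim_null_mult_right_bounded[where B = B])
    show "eventually (\<lambda>z. cmod (1 / cnj (R z)) \<le> B) boundary"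
      by (rule eventually_mono[OF boundary_in_disc]) (use B in \<open>auto simp: norm_divide\<close>)
  qed (use poly_reflected_prod_tendsto[OF A] in \<open>simp add: Q_def R_def\<close>)
  then have "((\<lambda>z. cmod z ^ size A * cmod (1 + (Q z / z ^ size A - cnj (R z)) * (1 / cnj (R z)))) \<longlongrightarrow> 1 ^ size A * cmod (1 + 0)) boundary"
    by (intro tendsto_intros norm_tendsto_boundary)
  then have "((\<lambda>z. inverse (cmod z ^ size A * cmod (1 + (Q z / z ^ size A - cnj (R z)) * (1 / cnj (R z))))) \<longlongrightarrow> inverse 1) boundary"
    by (intro tendsto_inverse) auto
  moreover have "eventually (\<lambda>z. inverse (cmod z ^ size A * cmod (1 + (Q z / z ^ size A - cnj (R z)) * (1 / cnj (R z))))
    = cmod (R z / Q z)) boundary"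
    using eventually_conj[OF eventually_nonzero_boundary boundary_in_disc]
  proof (rule eventually_mono, clarify)
    fix z :: complex assume z: "z \<noteq> 0" "cmod z < 1"
    have R: "R z \<noteq> 0" using poly_reflected_prod_nonzero[OF A, of z] z by (simp add: R_def)
    then have "1 + (Q z / z ^ size A - cnj (R z)) * (1 / cnj (R z)) = Q z / (z ^ size A * cnj (R z))"
      using z by (simp add: field_simps)
    then show "inverse (cmod z ^ size A * cmod (1 + (Q z / z ^ size A - cnj (R z)) * (1 / cnj (R z)))) = cmod (R z / Q z)"
      using z by (simp add: norm_divide norm_mult norm_power)
  qed
  ultimately show ?thesis unfolding Q_def R_def using tendsto_cong by force
qed

text \<open>Near the circle \<open>b\<close> has no zeros, so only finitely many lie in the disc.
  Dividing them out by a Blaschke product, whose modulus also tends to 1, leaves a zero-free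
  function to which \<open>constant_of_norm_boundary\<close> applies.\<close>

lemma blaschke_quotient_constant:
  assumes b: "b holomorphic_on ball 0 1" and lim: "((\<lambda>z. cmod (b z)) \<longlongrightarrow> 1) boundary"
  obtains A c where "\<forall>a\<in>#A. cmod a < 1"
    "\<And>z. cmod z < 1 \<Longrightarrow> b z * poly (\<Prod>a\<in>#A. [:1, -cnj a:]) z = c * poly (\<Prod>a\<in>#A. [:-a, 1:]) z"
proof -
  obtain r where r: "r < 1" "\<And>z. r < cmod z \<Longrightarrow> cmod z < 1 \<Longrightarrow> \<bar>cmod (b z) - 1\<bar> < 1"
    using tendstoD[OF lim, of 1] unfolding eventually_boundary dist_real_def by auto
  have fin: "finite {z\<in>ball 0 1. b z = 0}"
  proof (cases "b constant_on ball 0 1")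
    case True
    then obtain k where k: "\<And>z. z \<in> ball 0 1 \<Longrightarrow> b z = k" unfolding constant_on_def by blast
    obtain t where t: "max r 0 < t" "t < 1" using r(1) dense[of "max r 0" 1] by auto
    then have "b (of_real t) \<noteq> 0" using r(2)[of "of_real t"] by auto
    then have "k \<noteq> 0" using k[of "of_real t"] t by auto
    then have "{z\<in>ball 0 1. b z = 0} = {}" using k by auto
    then show ?thesis by (metis finite.emptyI)
  next
    case False
    have "finite {z\<in>cball 0 r. b z = 0}"
      by (rule holomorphic_compact_finite_zeros[OF b _ _ _ _ False]) (use r(1) in auto)
    moreover have "{z\<in>ball 0 1. b z = 0} \<subseteq> {z\<in>cball 0 r. b z = 0}"
      using r(2) by (force simp: not_le[symmetric])
    ultimately show ?thesis by (rule rev_finite_subset)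
  qed
  from factor_zeros_disc[OF b fin] obtain A g where A: "\<forall>a\<in>#A. cmod a < 1"
    and g: "g holomorphic_on ball 0 1" "\<forall>z\<in>ball 0 1. g z \<noteq> 0"
      "\<forall>z\<in>ball 0 1. b z = poly (\<Prod>a\<in>#A. [:-a, 1:]) z * g z" by blast
  define Q R where "Q = poly (\<Prod>a\<in>#A. [:-a, 1:])" and "R = poly (\<Prod>a\<in>#A. [:1, -cnj a:])"
  have lim2: "((\<lambda>z. cmod (b z) * cmod (R z / Q z)) \<longlongrightarrow> 1 * 1) boundary"
    unfolding Q_def R_def by (intro tendsto_intros lim blaschke_norm_tendsto A)
  have "(\<lambda>z. g z * R z) constant_on ball 0 1"
  proof (rule constant_of_norm_boundary)
    show "(\<lambda>z. g z * R z) holomorphic_on ball 0 1" unfolding R_def by (intro holomorphic_intros g)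
    show "\<And>z. cmod z < 1 \<Longrightarrow> g z * R z \<noteq> 0"
      using g(2) poly_reflected_prod_nonzero[OF A] by (auto simp: R_def)
    have "eventually (\<lambda>z. cmod (b z) * cmod (R z / Q z) = cmod (g z * R z)) boundary"
      unfolding eventually_boundary
    proof (intro exI[of _ r] conjI r(1) allI impI, elim conjE)
      fix z assume z: "r < cmod z" "cmod z < 1"
      then have "b z \<noteq> 0" using r(2)[of z] by auto
      moreover have "b z = Q z * g z" using g(3) z by (auto simp: Q_def)
      ultimately show "cmod (b z) * cmod (R z / Q z) = cmod (g z * R z)"
        by (simp add: norm_mult norm_divide)
    qed
    then show "((\<lambda>z. cmod (g z * R z)) \<longlongrightarrow> 1) boundary"
      using tendsto_cong lim2 by force
  qed
  then obtain c where c: "\<And>z. z \<in> ball 0 1 \<Longrightarrow> g z * R z = c" unfolding constant_on_def by blast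
  have "b z * R z = c * Q z" if "cmod z < 1" for z
    using g(3) c[of z] that by (simp add: Q_def mult_ac)
  then show ?thesis using that[OF A] unfolding Q_def R_def by blast
qed

text \<open>One denominator \<open>R\<close> has to serve all pairs \<open>E\<close>,
  \<open>H\<close>, hence the elimination form. The Blaschke representation gives
  \<open>b * R = c * Q\<close>, and \<open>Q / z ^ d\<close> is asymptotic to \<open>cnj R\<close>.
  So \<open>E * R / z ^ d\<close> is asymptotic to the conjugate of a holomorphic function, and
  \<open>polynomial_of_boundary\<close> applies.\<close>

lemma rational_of_boundary:
  assumes b: "b holomorphic_on ball 0 1" and lim: "((\<lambda>z. cmod (b z)) \<longlongrightarrow> 1) boundary"
  obtains R where "\<And>z. cmod z \<le> 1 \<Longrightarrow> poly R z \<noteq> 0"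
    "\<And>E H B. E holomorphic_on ball 0 1 \<Longrightarrow> H holomorphic_on ball 0 1 \<Longrightarrow>
      (\<And>z. cmod z < 1 \<Longrightarrow> cmod (H z) \<le> B) \<Longrightarrow>
      ((\<lambda>z. E z - b z * cnj (H z)) \<longlongrightarrow> 0) boundary \<Longrightarrow> \<exists>q. \<forall>z\<in>ball 0 1. E z * poly R z = poly q z"
proof -
  obtain A c where A: "\<forall>a\<in>#A. cmod a < 1"
    and bA: "\<And>z. cmod z < 1 \<Longrightarrow> b z * poly (\<Prod>a\<in>#A. [:1, -cnj a:]) z = c * poly (\<Prod>a\<in>#A. [:-a, 1:]) z"
    using blaschke_quotient_constant[OF b lim] by blast
  define Q R d where "Q = poly (\<Prod>a\<in>#A. [:-a, 1:])" and "R = (\<Prod>a\<in>#A. [:1, -cnj a:])" and "d = size A"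
  show ?thesis
  proof (rule that)
    show "\<And>z. cmod z \<le> 1 \<Longrightarrow> poly R z \<noteq> 0"
      using poly_reflected_prod_nonzero[OF A] by (auto simp: R_def)
  next
    fix E H B assume E: "E holomorphic_on ball 0 1" and H: "H holomorphic_on ball 0 1"
      and B: "\<And>z. cmod z < 1 \<Longrightarrow> cmod (H z) \<le> B"
      and EH: "((\<lambda>z. E z - b z * cnj (H z)) \<longlongrightarrow> 0) boundary"
    obtain K where K: "K > 0" "\<And>z. cmod z \<le> 1 \<Longrightarrow> cmod (poly R z) \<le> K"
      using bounded_poly_disc[of R] by blast
    have 1: "((\<lambda>z. (E z - b z * cnj (H z)) * (poly R z / z ^ d)) \<longlongrightarrow> 0) boundary"
    proof (rule lim_null_mult_right_bounded[OF EH, of _ "K * 2 ^ d"])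
      show "eventually (\<lambda>z. cmod (poly R z / z ^ d) \<le> K * 2 ^ d) boundary"
      proof (rule eventually_mono[OF boundary_half])
        fix z assume z: "1 / 2 < cmod z \<and> cmod z < 1"
        have "(1 / 2) ^ d \<le> cmod z ^ d" using z by (intro power_mono) auto
        moreover have "0 < cmod z ^ d" using z by (intro zero_less_power) auto
        ultimately have "1 / cmod z ^ d \<le> 2 ^ d" by (simp add: field_simps)
        then have "cmod (poly R z) * (1 / cmod z ^ d) \<le> K * 2 ^ d"
          using K z by (intro mult_mono) auto
        then show "cmod (poly R z / z ^ d) \<le> K * 2 ^ d" by (simp add: norm_divide norm_power)
      qed
    qed
    have 2: "((\<lambda>z. (Q z / z ^ d - cnj (poly R z)) * (c * cnj (H z))) \<longlongrightarrow> 0) boundary"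
    proof (rule lim_null_mult_right_bounded[where B = "cmod c * B"])
      show "((\<lambda>z. Q z / z ^ d - cnj (poly R z)) \<longlongrightarrow> 0) boundary"
        using poly_reflected_prod_tendsto[OF A] by (simp add: Q_def R_def d_def)
      show "eventually (\<lambda>z. cmod (c * cnj (H z)) \<le> cmod c * B) boundary"
        by (rule eventually_mono[OF boundary_in_disc]) (use B in \<open>auto simp: norm_mult intro: mult_left_mono\<close>)
    qed
    have "((\<lambda>z. (E z - b z * cnj (H z)) * (poly R z / z ^ d) + (Q z / z ^ d - cnj (poly R z)) * (c * cnj (H z))) \<longlongrightarrow> 0 + 0) boundary"
      by (intro tendsto_add 1 2)
    moreover have "eventually (\<lambda>z. (E z - b z * cnj (H z)) * (poly R z / z ^ d) + (Q z / z ^ d - cnj (poly R z)) * (c * cnj (H z))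
       = (E z * poly R z) / z ^ d - cnj (cnj c * poly R z * H z)) boundary"
    proof (rule eventually_mono[OF boundary_in_disc])
      fix z assume z: "cmod z < 1"
      have "b z * poly R z = c * Q z" using bA[OF z] by (simp add: R_def Q_def)
      moreover have "(E z - b z * cnj (H z)) * (poly R z / z ^ d)
          = E z * poly R z / z ^ d - (b z * poly R z) * cnj (H z) / z ^ d"
        by (simp add: algebra_simps diff_divide_distrib)
      ultimately have "(E z - b z * cnj (H z)) * (poly R z / z ^ d)
          = E z * poly R z / z ^ d - (c * Q z) * cnj (H z) / z ^ d" by (simp only:)
      then show "(E z - b z * cnj (H z)) * (poly R z / z ^ d) + (Q z / z ^ d - cnj (poly R z)) * (c * cnj (H z))
       = (E z * poly R z) / z ^ d - cnj (cnj c * poly R z * H z)"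
        by (simp add: algebra_simps)
    qed
    ultimately have "((\<lambda>z. (E z * poly R z) / z ^ d - cnj (cnj c * poly R z * H z)) \<longlongrightarrow> 0) boundary"
      using tendsto_cong by force
    then show "\<exists>q. \<forall>z\<in>ball 0 1. E z * poly R z = poly q z"
      by (intro polynomial_of_boundary[where d = d and h = "\<lambda>z. cnj c * poly R z * H z"]) (auto intro!: holomorphic_intros E H)
  qed
qed

section \<open>The inner part of a polynomial in two variables\<close>

text \<open>The fibre polynomial: its roots are the points of the zero set above \<open>z\<close>.
  Its degree drops where the leading coefficient vanishes.\<close>

definition spec :: "complex poly poly \<Rightarrow> complex \<Rightarrow> complex poly" where
  "spec p z = map_poly (\<lambda>c. poly c z) p"

lemma coeff_spec [simp]: "coeff (spec p z) i = poly (coeff p i) z"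
  by (simp add: spec_def coeff_map_poly)

lemma spec_pCons [simp]: "spec (pCons c p) z = pCons (poly c z) (spec p z)"
  by (rule poly_eqI) (simp add: coeff_pCons split: nat.splits)

lemma spec_0 [simp]: "spec 0 z = 0" by (simp add: spec_def)

lemma poly_spec: "poly (poly p [:t:]) z = poly (spec p z) t"
  by (induction p) auto

lemma spec_mult: "spec (p * q) z = spec p z * spec q z"
  unfolding poly_eq_poly_eq_iff[symmetric] by (rule ext) (simp flip: poly_spec)

lemma spec_pderiv: "spec (pderiv p) z = pderiv (spec p z)"
  by (rule poly_eqI) (simp add: coeff_pderiv)

lemma spec_power: "spec (p ^ n) z = spec p z ^ n"
  unfolding poly_eq_poly_eq_iff[symmetric] by (rule ext) (simp flip: poly_spec)

lemma continuous_on_poly_UNIV: "continuous_on UNIV (poly (q :: complex poly))"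
  by (auto intro: continuous_at_imp_continuous_on)

lemma continuous_on_poly2:
  fixes q :: "complex poly poly"
  assumes "continuous_on A f" "continuous_on A g"
  shows "continuous_on A (\<lambda>x. poly (poly q [:g x:]) (f x))"
proof (induction q)
  case (pCons a q)
  have "continuous_on A (\<lambda>x. poly a (f x))"
    by (rule continuous_on_compose2[OF continuous_on_poly_UNIV assms(1)]) auto
  with pCons show ?case by (auto intro!: continuous_on_add continuous_on_mult assms)
qed simp

text \<open>The derivative in the inner variable is again a polynomial in both variables; this gives
  the joint continuity required for differentiation under the integral sign.\<close>

lemma pderiv_poly_const: "pderiv (poly q [:t:]) = poly (map_poly pderiv q) [:t:]"
proof (induction q)
  case (pCons c q)
  then show ?case by (simp add: map_poly_pCons pderiv_add pderiv_smult)
qed simp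

section \<open>Newton's identities and self-inversive coefficients\<close>

lemma degree_linear_prod [simp]: "degree (\<Prod>x\<in>#M. [:- x, 1:]) = size (M :: 'a :: idom multiset)"
proof (induction M)
  case (add x M)
  have "(\<Prod>x\<in>#M. [:- x, 1:]) \<noteq> 0" by (auto simp: prod_mset_zero_iff)
  then show ?case using add by (simp add: degree_mult_eq del: mult_pCons_left)
qed simp

lemma reflect_linear_prod:
  "reflect_poly (\<Prod>x\<in>#M. [:- x, 1:]) = (\<Prod>x\<in>#M. [:1, - x :: 'a :: idom:])"
proof (induction M)
  case (add x M)
  have "reflect_poly [:- x, 1:] = [:1, - x:]"
    by (cases "x = 0") (auto simp: reflect_poly_def)
  then show ?case using add by (simp add: reflect_poly_mult del: mult_pCons_left)
qed simp

text \<open>Comparison of coefficients in \<open>X * P' = - P * S\<close>, where \<open>P\<close> is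
  the product of the factors \<open>1 - x * X\<close> and \<open>S\<close> the generating series of
  the power sums without its constant term; adding a root to the multiset is the product
  rule.\<close>

lemma newton_identity:
  fixes M :: "complex multiset"
  defines "e \<equiv> coeff (\<Prod>x\<in>#M. [:1, - x:])"
  shows "of_nat j * e j = - (\<Sum>i<j. e i * (\<Sum>x\<in>#M. x ^ (j - i)))"
proof -
  define P where "P N = fps_of_poly (\<Prod>x\<in>#N. [:1, - x:])" for N :: "complex multiset"
  define S where "S N = Abs_fps (\<lambda>k. if k = 0 then 0 else \<Sum>x\<in>#N. x ^ k)" for N :: "complex multiset"
  have "fps_X * fps_deriv (P M) = - (P M * S M)"
  proof (induction M)
    case empty
    have "S {#} = 0" by (rule fps_ext) (simp add: S_def)
    then show ?case by (simp add: P_def)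
  next
    case (add a M)
    define L where "L = fps_of_poly [:1, - a:]"
    have P: "P (add_mset a M) = L * P M" by (simp add: P_def L_def fps_of_poly_mult del: mult_pCons_left)
    have S: "S (add_mset a M) = S {#a#} + S M" by (rule fps_ext) (simp add: S_def)
    have L: "L = 1 - fps_const a * fps_X"
      by (rule fps_ext) (auto simp: L_def coeff_pCons split: nat.splits)
    have dL: "fps_deriv L = - fps_const a" by (simp add: L)
    have LS: "L * S {#a#} = fps_const a * fps_X"
    proof (rule fps_ext)
      fix n show "fps_nth (L * S {#a#}) n = fps_nth (fps_const a * fps_X) n"
        by (cases n) (auto simp: L S_def left_diff_distrib mult.assoc)
    qed
    have "fps_X * fps_deriv (P (add_mset a M)) = fps_X * fps_deriv L * P M + L * (fps_X * fps_deriv (P M))"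
      by (simp add: P algebra_simps)
    also have "\<dots> = - (L * S {#a#}) * P M - L * (P M * S M)"
      unfolding add LS dL by (simp add: algebra_simps flip: fps_const_neg)
    also have "\<dots> = - (P (add_mset a M) * S (add_mset a M))" by (simp add: P S algebra_simps)
    finally show ?case .
  qed
  then have "fps_nth (fps_X * fps_deriv (P M)) j = - fps_nth (P M * S M) j" by simp
  moreover have "fps_nth (fps_X * fps_deriv (P M)) j = of_nat j * e j"
    by (cases j) (auto simp: P_def e_def)
  moreover have "fps_nth (P M * S M) j = (\<Sum>i\<in>insert j {..<j}. e i * fps_nth (S M) (j - i))"
    unfolding fps_mult_nth by (rule sum.cong) (auto simp: P_def e_def)
  ultimately show ?thesis by (simp add: S_def)
qed

text \<open>For m roots on the circle \<open>e j = e m * cnj (e (m - j))\<close> holds exactly, and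
  a root \<open>a\<close> off the circle adds an error with the factor
  \<open>1 - cmod a ^ 2\<close>. The step from m to m + 1 yields at most two copies of the old error
  and a term \<open>\<epsilon> * 4 ^ m\<close>, which the base 8 absorbs.\<close>

lemma self_inversive_approx:
  fixes M :: "complex multiset"
  assumes "\<forall>x\<in>#M. cmod x \<le> 1 \<and> 1 - (cmod x)\<^sup>2 \<le> \<epsilon>" "0 \<le> \<epsilon>"
  defines "e \<equiv> \<lambda>M. coeff (\<Prod>x\<in>#M. [:1, - x:])"
  shows "(\<forall>j. cmod (e M j) \<le> 2 ^ size M) \<and>
    (\<forall>j\<le>size M. cmod (e M j - e M (size M) * cnj (e M (size M - j))) \<le> \<epsilon> * 8 ^ size M)"
  using assms(1)
proof (induction M)
  case empty
  then show ?case using assms(2) by (auto simp: e_def coeff_pCons split: nat.splits)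
next
  case (add a M)
  define m where "m = size M"
  define pe where "pe j = (case j of 0 \<Rightarrow> 0 | Suc i \<Rightarrow> e M i)" for j
  have rec: "e (add_mset a M) j = e M j - a * pe j" for j
    by (simp add: e_def pe_def coeff_pCons split: nat.splits)
  have deg: "e M j = 0" if "j > m" for j
  proof -
    have "degree (\<Prod>x\<in>#M. [:1, - x:]) \<le> m"
      unfolding reflect_linear_prod[symmetric] m_def using degree_reflect_poly_le[of "\<Prod>x\<in>#M. [:- x, 1:]"] by simp
    then show ?thesis using that unfolding e_def by (intro coeff_eq_0) simp
  qed
  have e0: "e M 0 = 1" for M by (induction M) (auto simp: e_def)
  have a: "cmod a \<le> 1" "1 - (cmod a)\<^sup>2 \<le> \<epsilon>" and
    IH1: "\<And>j. cmod (e M j) \<le> 2 ^ m" and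
    IH2: "\<And>j. j \<le> m \<Longrightarrow> cmod (e M j - e M m * cnj (e M (m - j))) \<le> \<epsilon> * 8 ^ m"
    using add by (auto simp: m_def)
  have pe: "cmod (pe j) \<le> 2 ^ m" for j using IH1 by (auto simp: pe_def split: nat.splits)
  have am: "cmod (a * x) \<le> cmod x" for x
    using mult_right_mono[OF a(1), of "cmod x"] by (simp add: norm_mult)
  show ?case
  proof (intro conjI allI impI)
    fix j
    have "cmod (e (add_mset a M) j) \<le> cmod (e M j) + cmod (a * pe j)"
      unfolding rec by (rule norm_triangle_ineq4)
    also have "\<dots> \<le> 2 ^ m + 2 ^ m" using IH1[of j] pe[of j] am[of "pe j"] by linarith
    finally show "cmod (e (add_mset a M) j) \<le> 2 ^ size (add_mset a M)" by (simp add: m_def)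
  next
    fix j assume j: "j \<le> size (add_mset a M)"
    have top: "e (add_mset a M) (Suc m) = - a * e M m" using deg[of "Suc m"] by (simp add: rec pe_def)
    show "cmod (e (add_mset a M) j - e (add_mset a M) (size (add_mset a M)) *
        cnj (e (add_mset a M) (size (add_mset a M) - j))) \<le> \<epsilon> * 8 ^ size (add_mset a M)"
    proof (cases "j = Suc m")
      case True
      then show ?thesis using assms(2) by (simp add: e0 flip: m_def)
    next
      case False
      with j have jm: "j \<le> m" by (simp add: m_def)
      define D where "D i = e M i - e M m * cnj (e M (m - i))" for i
      define X where "X = (case j of 0 \<Rightarrow> 0 | Suc i \<Rightarrow> D i)"
      \<comment> \<open>The contribution that does not come from the induction hypothesis; it
        vanishes when the new root lies on the circle.\<close>
      define Y where "Y = of_real (1 - (cmod a)\<^sup>2) * e M m * cnj (e M (m - j))"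
      have aa: "a * cnj a = of_real ((cmod a)\<^sup>2)" by (metis complex_norm_square of_real_power)
      have "e (add_mset a M) j - e (add_mset a M) (Suc m) * cnj (e (add_mset a M) (Suc m - j))
         = D j - a * X + Y"
      proof (cases j)
        case 0
        have "Suc m - j = Suc m" using 0 by simp
        then show ?thesis using 0 deg[of "Suc m"]
          by (simp add: rec pe_def X_def D_def Y_def e0 algebra_simps aa)
      next
        case (Suc i)
        have 1: "Suc m - j = Suc (m - j)" "m - i = Suc (m - j)" using Suc jm by auto
        show ?thesis unfolding top 1 rec
          by (simp add: pe_def X_def D_def Y_def Suc 1(2) algebra_simps aa[symmetric])
            (use Suc 1 deg[of "Suc m"] in \<open>simp add: algebra_simps aa\<close>)
      qed
      also have "cmod (D j - a * X + Y) \<le> cmod (D j) + cmod (a * X) + cmod Y"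
        by (meson add_right_mono norm_triangle_ineq norm_triangle_ineq4 order_trans)
      also have "\<dots> \<le> \<epsilon> * 8 ^ m + \<epsilon> * 8 ^ m + \<epsilon> * (2 ^ m * 2 ^ m)"
      proof (intro add_mono)
        show "cmod (D j) \<le> \<epsilon> * 8 ^ m" using IH2[OF jm] by (simp add: D_def)
        have "cmod X \<le> \<epsilon> * 8 ^ m" using IH2 jm assms(2) by (auto simp: X_def D_def split: nat.splits)
        then show "cmod (a * X) \<le> \<epsilon> * 8 ^ m" using am[of X] by linarith
        have "cmod Y = (1 - (cmod a)\<^sup>2) * (cmod (e M m) * cmod (e M (m - j)))"
          using a(1) power_mono[OF a(1), of 2] by (simp add: Y_def norm_mult del: of_real_diff)
        also have "\<dots> \<le> \<epsilon> * (2 ^ m * 2 ^ m)"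
          by (intro mult_mono a(2) IH1 assms(2) mult_nonneg_nonneg) auto
        finally show "cmod Y \<le> \<epsilon> * (2 ^ m * 2 ^ m)" .
      qed
      also have "\<dots> \<le> \<epsilon> * 8 ^ Suc m"
      proof -
        have "(2::real) ^ m * 2 ^ m \<le> 8 ^ m" by (simp add: power_mult_distrib[symmetric] power_mono)
        then have "\<epsilon> * (2 ^ m * 2 ^ m) \<le> \<epsilon> * 8 ^ m" using assms(2) by (intro mult_left_mono)
        moreover have "0 \<le> \<epsilon> * 8 ^ m" using assms(2) by simp
        ultimately show ?thesis unfolding power_Suc by linarith
      qed
      finally show ?thesis by (simp add: m_def)
    qed
  qed
qed

section \<open>Power sums of the roots in the disc as contour integrals\<close>

lemma logarithmic_derivative_prod:
  assumes "z \<notin># M"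
  shows "poly (pderiv (\<Prod>x\<in>#M. [:- x, 1:])) z = poly (\<Prod>x\<in>#M. [:- x, 1:]) z * (\<Sum>x\<in>#M. 1 / (z - x :: complex))"
  using assms
proof (induction M)
  case (add x M)
  define P S where "P = (\<Prod>x\<in>#M. [:- x, 1:])" and "S = (\<Sum>x\<in>#M. 1 / (z - x))"
  have "z - x \<noteq> 0" "poly (pderiv P) z = poly P z * S" using add by (auto simp: P_def S_def)
  moreover have "poly (pderiv ([:- x, 1:] * P)) z = poly P z + (z - x) * poly (pderiv P) z"
    by (simp add: pderiv_mult pderiv_pCons del: mult_pCons_left)
  moreover have "poly ([:- x, 1:] * P) z = (z - x) * poly P z" by (simp add: algebra_simps)
  ultimately have "poly (pderiv ([:- x, 1:] * P)) z = poly ([:- x, 1:] * P) z * (1 / (z - x) + S)"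
    by (simp only: distrib_left) (simp add: mult_ac)
  then show ?case by (simp add: P_def S_def del: mult_pCons_left)
qed simp

text \<open>A root inside the circle contributes its residue \<open>x ^ k\<close>; a root outside
  contributes nothing, because its term is holomorphic on a larger disc.\<close>

lemma has_contour_integral_power_sum:
  assumes "\<forall>x\<in>#M. cmod x \<noteq> 1"
  shows "((\<lambda>z. z ^ k * (\<Sum>x\<in>#M. 1 / (z - x))) has_contour_integral
     2 * of_real pi * \<i> * (\<Sum>x\<in>#filter_mset (\<lambda>x. cmod x < 1) M. x ^ k)) (circlepath 0 1)"
  using assms
proof (induction M)
  case (add x M)
  have "((\<lambda>z. z ^ k / (z - x)) has_contour_integral
      2 * of_real pi * \<i> * (if cmod x < 1 then x ^ k else 0)) (circlepath 0 1)"
  proof (cases "cmod x < 1")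
    case True
    then show ?thesis
      using Cauchy_integral_circlepath_simple[of "\<lambda>z. z ^ k" 0 1 x]
      by (simp add: holomorphic_on_power holomorphic_on_ident)
  next
    case False
    with add have x: "cmod x > 1" by auto
    have "((\<lambda>z. z ^ k / (z - x)) has_contour_integral 0) (circlepath 0 1)"
      by (rule Cauchy_theorem_disc_simple[of _ 0 "cmod x"])
         (use x in \<open>auto intro!: holomorphic_intros\<close>)
    then show ?thesis using False by simp
  qed
  from has_contour_integral_add[OF this add.IH] add.prems
  show ?case by (auto simp: algebra_simps)
qed (simp add: has_contour_integral_0)

definition inner_roots :: "complex poly poly \<Rightarrow> complex \<Rightarrow> complex multiset" where
  "inner_roots p z = filter_mset (\<lambda>x. cmod x < 1) (proots (spec p z))"

text \<open>The argument principle with weight \<open>w ^ k\<close>. The integrand no longer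
  mentions individual roots, only \<open>p\<close> and its derivative.\<close>

lemma power_sum_inner_roots:
  assumes nz: "\<And>w. cmod w = 1 \<Longrightarrow> poly (spec p z) w \<noteq> 0"
  shows "((\<lambda>w. w ^ k * (poly (spec (pderiv p) z) w / poly (spec p z) w)) has_contour_integral
     2 * of_real pi * \<i> * (\<Sum>x\<in>#inner_roots p z. x ^ k)) (circlepath 0 1)"
proof -
  define f where "f = spec p z"
  have f0: "f \<noteq> 0" using nz[of 1] by (auto simp: f_def)
  have fac: "f = Polynomial.smult (lead_coeff f) (\<Prod>x\<in>#proots f. [:- x, 1:])"
  proof -
    obtain A where A: "f = Polynomial.smult (lead_coeff f) (\<Prod>x\<in>#A. [:- x, 1:])"
      using alg_closed_imp_factorization[OF f0] by auto
    have "proots f = proots (\<Prod>x\<in>#A. [:- x, 1:])"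
      by (subst A, rule proots_smult) (use f0 in auto)
    also have "\<dots> = A"
    proof (induction A)
      case (add x A)
      have "(\<Prod>x\<in>#A. [:- x, 1:]) \<noteq> 0" by (auto simp: prod_mset_zero_iff)
      then show ?case using add by (simp add: proots_mult del: mult_pCons_left)
    qed simp
    finally show ?thesis using A by simp
  qed
  have nroot: "cmod x \<noteq> 1" if "x \<in># proots f" for x
    using that nz[of x] f0 by (auto simp: f_def)
  show ?thesis
  proof (rule has_contour_integral_eq)
    show "((\<lambda>w. w ^ k * (\<Sum>x\<in>#proots f. 1 / (w - x))) has_contour_integral
      2 * of_real pi * \<i> * (\<Sum>x\<in>#inner_roots p z. x ^ k)) (circlepath 0 1)"
      unfolding inner_roots_def f_def[symmetric]
      by (rule has_contour_integral_power_sum) (use nroot in auto)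
  next
    fix w assume "w \<in> path_image (circlepath 0 1)"
    then have w: "cmod w = 1" by simp
    then have "w \<notin># proots f" using nroot by blast
    define S where "S = (\<Sum>x\<in>#proots f. 1 / (w - x))"
    from logarithmic_derivative_prod[OF \<open>w \<notin># proots f\<close>, folded S_def]
    have "poly (pderiv f) w = poly f w * S"
      using arg_cong[OF fac, of "\<lambda>f. poly (pderiv f) w"] arg_cong[OF fac, of "\<lambda>f. poly f w"]
      by (simp only: pderiv_smult poly_smult mult.assoc)
    moreover have "poly f w \<noteq> 0" using nz[OF w] by (simp add: f_def)
    ultimately show "w ^ k * (\<Sum>x\<in>#proots f. 1 / (w - x))
      = w ^ k * (poly (spec (pderiv p) z) w / poly (spec p z) w)"
      unfolding S_def[symmetric] spec_pderiv f_def[symmetric] by simp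
  qed
qed

text \<open>The contour integral is written over the parameter interval so that Leibniz's rule
  applies; no root meets the circle while \<open>z\<close> stays in the disc, so the integrand is
  holomorphic in \<open>z\<close>.\<close>

lemma holomorphic_power_sum:
  assumes nz: "\<And>z w. cmod z < 1 \<Longrightarrow> cmod w = 1 \<Longrightarrow> poly (spec p z) w \<noteq> 0"
  shows "(\<lambda>z. \<Sum>x\<in>#inner_roots p z. x ^ k) holomorphic_on ball 0 1"
proof -
  define c where "c t = exp (2 * of_real pi * \<i> * of_real t)" for t :: real
  have c1: "cmod (c t) = 1" for t
    by (simp add: c_def)
  have cc: "continuous_on A c" for A unfolding c_def by (intro continuous_intros)
  define N where "N z t = poly (poly (pderiv p) [:c t:]) z" for z t
  define D where "D z t = poly (poly p [:c t:]) z" for z t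
  define N' where "N' z t = poly (pderiv (poly (pderiv p) [:c t:])) z" for z t
  define D' where "D' z t = poly (pderiv (poly p [:c t:])) z" for z t
  define u where "u t = c t ^ k * (2 * of_real pi * \<i> * c t)" for t
  have D0: "D z t \<noteq> 0" if "cmod z < 1" for z t using nz[OF that c1] by (simp add: D_def poly_spec)
  have S: "(\<Sum>x\<in>#inner_roots p z. x ^ k) =
     integral (cbox 0 1) (\<lambda>t. N z t / D z t * u t) / (2 * of_real pi * \<i>)" if z: "cmod z < 1" for z
  proof -
    from power_sum_inner_roots[of p z k, OF nz[OF z]]
    have "2 * of_real pi * \<i> * (\<Sum>x\<in>#inner_roots p z. x ^ k)
      = contour_integral (circlepath 0 1) (\<lambda>w. w ^ k * (poly (spec (pderiv p) z) w / poly (spec p z) w))"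
      by (simp add: contour_integral_unique)
    also have "\<dots> = integral (cbox 0 1) (\<lambda>t. N z t / D z t * u t)"
      unfolding contour_integral_integral vector_derivative_circlepath
      by (auto intro!: integral_cong simp: N_def D_def u_def c_def circlepath poly_spec)
    finally show ?thesis by (simp add: field_simps)
  qed
  have "(\<lambda>z. integral (cbox 0 1) (\<lambda>t. N z t / D z t * u t)) holomorphic_on ball 0 1"
  proof (rule leibniz_rule_holomorphic)
    fix z :: complex and t :: real assume z: "z \<in> ball 0 1"
    have "((\<lambda>z. N z t / D z t * u t) has_field_derivative
        (N' z t * D z t - N z t * D' z t) / (D z t * D z t) * u t) (at z)"
      using D0[of z t] z unfolding N_def D_def N'_def D'_def
      by (auto intro!: derivative_eq_intros simp: algebra_simps)
    then show "((\<lambda>z. N z t / D z t * u t) has_field_derivative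
        (N' z t * D z t - N z t * D' z t) / (D z t * D z t) * u t) (at z within ball 0 1)"
      by (rule DERIV_subset) auto
  next
    fix z :: complex assume z: "z \<in> ball 0 1"
    show "(\<lambda>t. N z t / D z t * u t) integrable_on cbox 0 1"
      using D0[of z] z unfolding N_def D_def u_def
      by (intro integrable_continuous continuous_intros continuous_on_poly2 cc) auto
  next
    have cs: "continuous_on (ball 0 1 \<times> cbox 0 1) (\<lambda>x::complex\<times>real. c (snd x))"
      by (rule continuous_on_compose2[OF cc[of UNIV]]) (auto intro!: continuous_intros)
    have "continuous_on (ball 0 1 \<times> cbox 0 1) (\<lambda>x. (N' (fst x) (snd x) * D (fst x) (snd x)
      - N (fst x) (snd x) * D' (fst x) (snd x)) / (D (fst x) (snd x) * D (fst x) (snd x)) * u (snd x))"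
      using D0 unfolding N_def D_def N'_def D'_def u_def pderiv_poly_const
      by (intro continuous_intros continuous_on_poly2 cs) auto
    then show "continuous_on (ball 0 1 \<times> cbox 0 1) (\<lambda>(z, t). (N' z t * D z t - N z t * D' z t) / (D z t * D z t) * u t)"
      by (simp add: case_prod_unfold)
  qed simp
  then have "(\<lambda>z. integral (cbox 0 1) (\<lambda>t. N z t / D z t * u t) / (2 * of_real pi * \<i>)) holomorphic_on ball 0 1"
    by (intro holomorphic_intros) auto
  then show ?thesis by (rule holomorphic_transform) (simp add: S)
qed

text \<open>The bidisc conditions say that no root in the disc of \<open>spec p z\<close> can cross the circle, so the
  monic polynomial of these roots has coefficients that are holomorphic in \<open>z\<close>; they satisfy
  the functional equation of a self-inversive polynomial asymptotically at the boundary, which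
  forces them to be rational.\<close>

locale distinguished_poly =
  fixes p :: "complex poly poly"
  assumes no_side1: "\<And>z w. cmod z < 1 \<Longrightarrow> cmod w = 1 \<Longrightarrow> poly (spec p z) w \<noteq> 0"
    and no_side2: "\<And>z w. cmod z = 1 \<Longrightarrow> cmod w < 1 \<Longrightarrow> poly (spec p z) w \<noteq> 0"
    and inner_point: "\<exists>z w. cmod z < 1 \<and> cmod w < 1 \<and> poly (spec p z) w = 0"
begin

text \<open>Up to the sign \<open>(- 1) ^ j\<close> the elementary symmetric functions of the inner
  roots. The reversed factors \<open>1 - x * t\<close> make \<open>j\<close> count from the leading
  coefficient.\<close>

definition e where "e j z = coeff (\<Prod>x\<in>#inner_roots p z. [:1, - x:]) j"

text \<open>The value at 0 stands for the common number of inner roots, by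
  \<open>size_inner_roots\<close>.\<close>

definition m where "m = size (inner_roots p 0)"

lemma spec_nonzero: "cmod z < 1 \<Longrightarrow> spec p z \<noteq> 0"
  using no_side1[of z 1] by auto

lemma in_inner_roots_iff:
  "cmod z < 1 \<Longrightarrow> x \<in># inner_roots p z \<longleftrightarrow> cmod x < 1 \<and> poly (spec p z) x = 0"
  using spec_nonzero[of z] by (auto simp: inner_roots_def)

text \<open>The count is the power sum with exponent 0: a continuous integer-valued function on a
  connected set.\<close>

lemma size_inner_roots:
  assumes "cmod z < 1" shows "size (inner_roots p z) = m"
proof -
  have "(\<lambda>z. \<Sum>x\<in>#inner_roots p z. x ^ 0) constant_on ball 0 1"
  proof (rule continuous_discrete_range_constant)
    show "continuous_on (ball 0 1) (\<lambda>z. \<Sum>x\<in>#inner_roots p z. x ^ 0)"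
      by (intro holomorphic_on_imp_continuous_on holomorphic_power_sum no_side1)
    fix z :: complex assume "z \<in> ball 0 1"
    have "1 \<le> cmod (of_nat a - of_nat b)" if "(of_nat a :: complex) \<noteq> of_nat b" for a b
    proof -
      have "cmod (of_nat a - of_nat b) = \<bar>real a - real b\<bar>"
        by (metis norm_of_real of_real_diff of_real_of_nat_eq)
      moreover have "a \<noteq> b" using that by auto
      ultimately show ?thesis by linarith
    qed
    then show "\<exists>e>0. \<forall>y. y \<in> ball 0 1 \<and> (\<Sum>x\<in>#inner_roots p y. x ^ 0) \<noteq> (\<Sum>x\<in>#inner_roots p z. x ^ 0)
      \<longrightarrow> e \<le> cmod ((\<Sum>x\<in>#inner_roots p y. x ^ 0) - (\<Sum>x\<in>#inner_roots p z. x ^ 0))"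
      by (intro exI[of _ 1]) simp
  qed simp
  then obtain y where y: "\<And>z. z \<in> ball 0 1 \<Longrightarrow> of_nat (size (inner_roots p z)) = (y::complex)"
    unfolding constant_on_def by auto
  have "(of_nat (size (inner_roots p z)) :: complex) = of_nat m"
    using y[of z] y[of 0] assms by (simp add: m_def)
  then show ?thesis by (simp only: of_nat_eq_iff)
qed

lemma m_pos: "m > 0"
proof -
  obtain z w where zw: "cmod z < 1" "cmod w < 1" "poly (spec p z) w = 0" using inner_point by blast
  then have "w \<in># inner_roots p z" by (simp add: in_inner_roots_iff)
  then show ?thesis using size_inner_roots[OF zw(1)] by (metis empty_iff gr0I set_mset_empty size_eq_0_iff_empty)
qed

lemma e_0 [simp]: "e 0 z = 1"
proof -
  have "coeff (\<Prod>x\<in>#M. [:1, - x:]) 0 = (1::complex)" for M by (induction M) auto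
  then show ?thesis by (simp add: e_def)
qed

text \<open>Individual roots need not depend holomorphically on \<open>z\<close>; their power sums
  do, and Newton's identities recover \<open>e j\<close> from them.\<close>

lemma holomorphic_e: "e j holomorphic_on ball 0 1"
proof (induction j rule: less_induct)
  case (less j)
  show ?case
  proof (cases "j = 0")
    case True
    have "e 0 = (\<lambda>_. 1)" by (rule ext) simp
    then show ?thesis using True by simp
  next
    case False
    have "(\<lambda>z. - (\<Sum>i<j. e i z * (\<Sum>x\<in>#inner_roots p z. x ^ (j - i))) / of_nat j) holomorphic_on ball 0 1"
      by (intro holomorphic_intros holomorphic_power_sum no_side1 less) (use False in auto)
    moreover have "(\<lambda>z. - (\<Sum>i<j. e i z * (\<Sum>x\<in>#inner_roots p z. x ^ (j - i))) / of_nat j) = e j"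
    proof
      fix z show "- (\<Sum>i<j. e i z * (\<Sum>x\<in>#inner_roots p z. x ^ (j - i))) / of_nat j = e j z"
        using newton_identity[of j "inner_roots p z"] False by (simp add: e_def field_simps)
    qed
    ultimately show ?thesis by simp
  qed
qed

text \<open>Zeros over the closed disc with \<open>cmod w \<le> 1 - \<delta>\<close> form a compact
  set, which by \<open>no_side2\<close> contains no point with \<open>cmod z = 1\<close>; so the
  maximum of \<open>cmod z\<close> on it is less than 1.\<close>

lemma inner_roots_tend_to_circle:
  assumes "\<delta> > 0"
  shows "eventually (\<lambda>z. cmod z < 1 \<and> (\<forall>x\<in>#inner_roots p z. 1 - \<delta> < cmod x \<and> cmod x < 1)) boundary"
proof -
  define K where "K = {(z,w). cmod z \<le> 1 \<and> cmod w \<le> 1 - \<delta> \<and> poly (poly p [:w:]) z = 0}"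
  have "K = (cball 0 1 \<times> cball 0 (1 - \<delta>)) \<inter> (\<lambda>x. poly (poly p [:snd x:]) (fst x)) -` {0}"
    by (auto simp: K_def)
  moreover have "compact \<dots>"
    by (intro compact_Int_closed compact_Times compact_cball closed_vimage continuous_on_poly2
        continuous_intros)
  ultimately have "compact K" by simp
  obtain r where r: "r < 1" "\<And>z w. (z, w) \<in> K \<Longrightarrow> cmod z \<le> r"
  proof (cases "K = {}")
    case True
    then show ?thesis using that[of 0] by auto
  next
    case False
    have "continuous_on K (\<lambda>x. cmod (fst x))" by (intro continuous_intros)
    from continuous_attains_sup[OF \<open>compact K\<close> False this]
    obtain z w where zw: "(z, w) \<in> K" "\<And>x. x \<in> K \<Longrightarrow> cmod (fst x) \<le> cmod z" by force
    have "cmod z \<noteq> 1"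
      using no_side2[of z w] zw(1) assms by (auto simp: K_def poly_spec)
    then have "cmod z < 1" using zw(1) by (auto simp: K_def)
    then show ?thesis using that[of "cmod z"] zw(2) by force
  qed
  show ?thesis unfolding eventually_boundary
  proof (intro exI[of _ r] conjI r(1) allI impI ballI; (elim conjE)?)
    fix z x assume z: "r < cmod z" "cmod z < 1" and x: "x \<in># inner_roots p z"
    then have x: "cmod x < 1" "poly (spec p z) x = 0" by (auto simp: in_inner_roots_iff)
    then show "cmod x < 1" by simp
    show "1 - \<delta> < cmod x"
      using r(2)[of z x] x z by (force simp: K_def poly_spec not_less[symmetric])
  qed
qed

lemma e_boundary:
  assumes j: "j \<le> m"
  shows "((\<lambda>z. e j z - e m z * cnj (e (m - j) z)) \<longlongrightarrow> 0) boundary"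
proof (rule tendstoI)
  fix \<epsilon> :: real assume e: "\<epsilon> > 0"
  \<comment> \<open>\<open>8 ^ m\<close> is the factor in \<open>self_inversive_approx\<close>;
    roots within \<open>\<eta> / 2\<close> of the circle satisfy
    \<open>1 - cmod x ^ 2 \<le> \<eta>\<close>.\<close>
  define \<eta> where "\<eta> = min 1 (\<epsilon> / (2 * 8 ^ m))"
  have \<eta>: "0 < \<eta>" "\<eta> \<le> 1" "\<eta> * 8 ^ m < \<epsilon>"
    using e by (auto simp: \<eta>_def min_def field_simps)
  have \<eta>2: "1 - (1 - \<eta> / 2)\<^sup>2 \<le> \<eta>" by (simp add: power2_eq_square algebra_simps)
  show "eventually (\<lambda>z. dist (e j z - e m z * cnj (e (m - j) z)) 0 < \<epsilon>) boundary"
  proof (rule eventually_mono[OF inner_roots_tend_to_circle[of "\<eta> / 2"]])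
    fix z assume z: "cmod z < 1 \<and> (\<forall>x\<in>#inner_roots p z. 1 - \<eta> / 2 < cmod x \<and> cmod x < 1)"
    have "1 - (cmod x)\<^sup>2 \<le> \<eta>" if "x \<in># inner_roots p z" for x
    proof -
      have "(1 - \<eta> / 2)\<^sup>2 \<le> (cmod x)\<^sup>2"
        using z that \<eta> by (intro power_mono) auto
      then show ?thesis using \<eta>2 by linarith
    qed
    then have "cmod (e j z - e m z * cnj (e (m - j) z)) \<le> \<eta> * 8 ^ m"
      using self_inversive_approx[of "inner_roots p z" \<eta>] z \<eta> j size_inner_roots[of z]
      by (auto simp: e_def less_imp_le)
    then show "dist (e j z - e m z * cnj (e (m - j) z)) 0 < \<epsilon>" using \<eta> by simp
  qed (use \<eta> in simp)
qed

lemma e_bounded: "cmod z < 1 \<Longrightarrow> cmod (e j z) \<le> 2 ^ m"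
  using self_inversive_approx[of "inner_roots p z" 1] size_inner_roots[of z]
  by (auto simp: e_def in_inner_roots_iff less_imp_le)

text \<open>The case \<open>j = 0\<close> of \<open>e_boundary\<close>, where the expression is
  \<open>1 - cmod (e m z) ^ 2\<close>. Hence \<open>e m\<close> can play the role of
  \<open>b\<close> in \<open>rational_of_boundary\<close>.\<close>

lemma e_m_boundary: "((\<lambda>z. cmod (e m z)) \<longlongrightarrow> 1) boundary"
proof -
  have "((\<lambda>z. sqrt (cmod (1 - (e 0 z - e m z * cnj (e (m - 0) z))))) \<longlongrightarrow> sqrt (cmod (1 - 0))) boundary"
    by (intro tendsto_intros e_boundary) simp
  then show ?thesis by (simp add: norm_mult)
qed

text \<open>Multiplying the monic polynomial of the inner roots by the common denominator
  \<open>R\<close> of its coefficients makes it polynomial in \<open>z\<close>; \<open>R\<close>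
  becomes the leading coefficient.\<close>

lemma inner_factor:
  obtains f :: "complex poly poly" where
    "degree f = m" "\<And>z. cmod z \<le> 1 \<Longrightarrow> poly (lead_coeff f) z \<noteq> 0"
    "\<And>z. cmod z < 1 \<Longrightarrow> spec f z = Polynomial.smult (poly (lead_coeff f) z) (\<Prod>x\<in>#inner_roots p z. [:- x, 1:])"
proof -
  obtain R where R: "\<And>z. cmod z \<le> 1 \<Longrightarrow> poly R z \<noteq> 0"
    and rat: "\<And>E H B. E holomorphic_on ball 0 1 \<Longrightarrow> H holomorphic_on ball 0 1 \<Longrightarrow>
      (\<And>z. cmod z < 1 \<Longrightarrow> cmod (H z) \<le> B) \<Longrightarrow>
      ((\<lambda>z. E z - e m z * cnj (H z)) \<longlongrightarrow> 0) boundary \<Longrightarrow> \<exists>q. \<forall>z\<in>ball 0 1. E z * poly R z = poly q z"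
    by (rule rational_of_boundary[OF holomorphic_e[of m] e_m_boundary]) (rule that; blast)
  have "\<exists>q. \<forall>z\<in>ball 0 1. e j z * poly R z = poly q z" if "j \<le> m" for j
    by (rule rat[OF holomorphic_e holomorphic_e e_bounded e_boundary[OF that]])
  then obtain q where q': "\<And>j. j \<le> m \<Longrightarrow> \<forall>z\<in>ball 0 1. e j z * poly R z = poly (q j) z"
    by metis
  have q: "e j z * poly R z = poly (q j) z" if "j \<le> m" "cmod z < 1" for j z
    using q'[OF that(1)] that(2) by simp
  define f where "f = (\<Sum>i<m. monom (q (m - i)) i) + monom R m"
  have cf: "coeff f i = (if i < m then q (m - i) else if i = m then R else 0)" for i
    by (auto simp: f_def coeff_sum)
  have R0: "R \<noteq> 0" using R[of 0] by auto
  have deg: "degree f = m"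
    by (rule antisym[OF degree_le le_degree]) (use R0 in \<open>auto simp: cf\<close>)
  show ?thesis
  proof (rule that[OF deg])
    show "\<And>z. cmod z \<le> 1 \<Longrightarrow> poly (lead_coeff f) z \<noteq> 0" using R by (simp add: deg cf)
  next
    fix z assume z: "cmod z < 1"
    define P where "P = (\<Prod>x\<in>#inner_roots p z. [:- x, 1:])"
    have dP: "degree P = m" using size_inner_roots[OF z] by (simp add: P_def)
    have eP: "e j z = coeff (reflect_poly P) j" for j by (simp add: e_def P_def reflect_linear_prod)
    have mon: "coeff P m = 1" using e_0[of z] unfolding eP by (simp add: dP)
    show "spec f z = Polynomial.smult (poly (lead_coeff f) z) (\<Prod>x\<in>#inner_roots p z. [:- x, 1:])"
      unfolding P_def[symmetric]
    proof (rule poly_eqI)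
      fix i
      consider "i < m" | "i = m" | "i > m" by linarith
      then show "coeff (spec f z) i = coeff (Polynomial.smult (poly (lead_coeff f) z) P) i"
      proof cases
        case 1
        then have "\<not> m < m - i" "m - (m - i) = i" by auto
        then have "poly (q (m - i)) z = coeff P i * poly R z"
          using q[of "m - i" z] z by (simp add: eP coeff_reflect_poly dP)
        then show ?thesis using 1 by (simp add: cf deg)
      qed (auto simp: cf deg mon dP coeff_eq_0)
    qed
  qed
qed

text \<open>The factorization over the inner roots is known in the open disc only, so a root
  \<open>w\<close> off the circle is excluded by a radial limit: near the boundary all inner roots
  keep a fixed distance from \<open>w\<close>, and the resulting lower bound of
  \<open>spec f\<close> at \<open>w\<close> survives in the limit.\<close>

lemma inner_factor_circle:
  assumes lc: "\<And>z. cmod z \<le> 1 \<Longrightarrow> poly (lead_coeff f) z \<noteq> 0"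
    and f: "\<And>z. cmod z < 1 \<Longrightarrow> spec f z = Polynomial.smult (poly (lead_coeff f) z) (\<Prod>x\<in>#inner_roots p z. [:- x, 1:])"
    and z: "cmod z = 1" and w: "poly (spec f z) w = 0"
  shows "cmod w = 1"
proof (rule ccontr)
  assume w1: "cmod w \<noteq> 1"
  \<comment> \<open>Half the distance of \<open>w\<close> to the circle: roots within \<delta> of
    the circle are at least \<delta> away from \<open>w\<close>.\<close>
  define \<delta> where "\<delta> = \<bar>cmod w - 1\<bar> / 2"
  have \<delta>: "\<delta> > 0" using w1 by (simp add: \<delta>_def)
  have prod: "cmod (poly (\<Prod>x\<in>#M. [:- x, 1:]) w) \<ge> \<delta> ^ size M"
    if "\<forall>x\<in>#M. 1 - \<delta> < cmod x \<and> cmod x < 1" for M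
    using that
  proof (induction M)
    case (add x M)
    have "cmod (w - x) \<ge> \<delta>"
    proof -
      have "\<bar>cmod w - cmod x\<bar> \<le> cmod (w - x)" by (rule norm_triangle_ineq3)
      moreover have "\<bar>cmod w - cmod x\<bar> \<ge> \<delta>"
      proof (cases "cmod w < 1")
        case True
        then have "\<bar>cmod w - 1\<bar> = 1 - cmod w" by simp
        then have "\<delta> \<le> cmod x - cmod w"
          using add.prems[rule_format, of x] unfolding \<delta>_def by (simp add: field_simps)
        then show ?thesis by linarith
      next
        case False
        then have "\<bar>cmod w - 1\<bar> = cmod w - 1" by simp
        then have "\<delta> \<le> cmod w - cmod x"
          using add.prems[rule_format, of x] False unfolding \<delta>_def by (simp add: field_simps)
        then show ?thesis by linarith
      qed
      ultimately show ?thesis by linarith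
    qed
    then have "\<delta> * \<delta> ^ size M \<le> cmod (w - x) * cmod (poly (\<Prod>x\<in>#M. [:- x, 1:]) w)"
      using add \<delta> by (intro mult_mono) auto
    moreover have "poly ([:- x, 1:] * (\<Prod>x\<in>#M. [:- x, 1:])) w = (w - x) * poly (\<Prod>x\<in>#M. [:- x, 1:]) w"
      by (simp add: algebra_simps)
    ultimately show ?case by (simp add: norm_mult del: mult_pCons_left)
  qed simp
  have lim: "((\<lambda>r::real. of_real r * z) \<longlongrightarrow> z) (at_left 1)"
    by (rule tendsto_eq_intros refl)+ simp
  have ev: "eventually (\<lambda>r::real. cmod (poly (lead_coeff f) (of_real r * z)) * \<delta> ^ m
      \<le> cmod (poly (poly f [:w:]) (of_real r * z))) (at_left 1)"
  proof -
    have "filterlim (\<lambda>r::real. of_real r * z) boundary (at_left 1)"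
      unfolding boundary_def filterlim_filtercomap_iff
    proof (rule filterlim_cong[THEN iffD1, OF refl refl _ filterlim_ident])
      have "eventually (\<lambda>r::real. 0 < r) (at_left 1)" by (rule eventually_at_left_real[of 0 1, THEN eventually_mono]) auto
      then show "eventually (\<lambda>r::real. r = (cmod \<circ> (\<lambda>r. of_real r * z)) r) (at_left 1)"
        by (rule eventually_mono) (simp add: norm_mult z)
    qed
    from filterlim_iff[THEN iffD1, OF this, rule_format, OF inner_roots_tend_to_circle[OF \<delta>]]
    show ?thesis
    proof (rule eventually_mono)
      fix r :: real
      assume r: "cmod (of_real r * z) < 1 \<and> (\<forall>x\<in>#inner_roots p (of_real r * z). 1 - \<delta> < cmod x \<and> cmod x < 1)"
      then show "cmod (poly (lead_coeff f) (of_real r * z)) * \<delta> ^ m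
        \<le> cmod (poly (poly f [:w:]) (of_real r * z))"
        using prod[of "inner_roots p (of_real r * z)"] size_inner_roots[of "of_real r * z"]
        unfolding poly_spec
        by (subst f) (auto simp: norm_mult intro!: mult_left_mono simp del: poly_prod_mset)
    qed
  qed
  have "cmod (poly (lead_coeff f) z) * \<delta> ^ m \<le> cmod (poly (poly f [:w:]) z)"
  proof (rule tendsto_le[OF _ _ _ ev])
    show "((\<lambda>r::real. cmod (poly (poly f [:w:]) (of_real r * z))) \<longlongrightarrow> cmod (poly (poly f [:w:]) z)) (at_left 1)"
      by (intro tendsto_intros isCont_tendsto_compose[OF _ lim]) auto
    show "((\<lambda>r::real. cmod (poly (lead_coeff f) (of_real r * z)) * \<delta> ^ m) \<longlongrightarrow> cmod (poly (lead_coeff f) z) * \<delta> ^ m) (at_left 1)"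
      by (intro tendsto_intros isCont_tendsto_compose[OF _ lim]) auto
  qed simp
  moreover have "cmod (poly (lead_coeff f) z) * \<delta> ^ m > 0" using lc[of z] z \<delta> by simp
  ultimately show False using w by (simp add: poly_spec)
qed

theorem inner_polynomial:
  obtains f :: "complex poly poly" where
    "degree f > 0" "\<And>z. cmod z \<le> 1 \<Longrightarrow> poly (lead_coeff f) z \<noteq> 0"
    "\<And>z w. cmod z < 1 \<Longrightarrow> poly (spec f z) w = 0 \<longleftrightarrow> cmod w < 1 \<and> poly (spec p z) w = 0"
    "\<And>z w. cmod z = 1 \<Longrightarrow> poly (spec f z) w = 0 \<Longrightarrow> cmod w = 1"
proof (rule inner_factor)
  fix f assume f: "degree f = m" "\<And>z. cmod z \<le> 1 \<Longrightarrow> poly (lead_coeff f) z \<noteq> 0"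
    "\<And>z. cmod z < 1 \<Longrightarrow> spec f z = Polynomial.smult (poly (lead_coeff f) z) (\<Prod>x\<in>#inner_roots p z. [:- x, 1:])"
  show thesis
  proof (rule that)
    show "degree f > 0" using f(1) m_pos by simp
    show "\<And>z. cmod z \<le> 1 \<Longrightarrow> poly (lead_coeff f) z \<noteq> 0" by (rule f(2))
    show "\<And>z w. cmod z = 1 \<Longrightarrow> poly (spec f z) w = 0 \<Longrightarrow> cmod w = 1"
      by (rule inner_factor_circle[OF f(2,3)])
    fix z w :: complex assume z: "cmod z < 1"
    have root: "poly (\<Prod>x\<in>#M. [:- x, 1:]) w = 0 \<longleftrightarrow> w \<in># M" for M
      by (induction M) auto
    show "poly (spec f z) w = 0 \<longleftrightarrow> cmod w < 1 \<and> poly (spec p z) w = 0"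
      unfolding f(3)[OF z] poly_smult mult_eq_0_iff root using f(2)[of z] z in_inner_roots_iff[OF z]
      by (simp del: poly_prod_mset)
  qed
qed

end

section \<open>Divisibility: inclusions of zero sets and repeated factors\<close>

lemma spec_add: "spec (p + q) z = spec p z + spec q z"
  by (rule poly_eqI) simp

lemma spec_smult: "spec (Polynomial.smult a p) z = Polynomial.smult (poly a z) (spec p z)"
  by (rule poly_eqI) simp

lemma spec_dvd: "p dvd q \<Longrightarrow> spec p z dvd spec q z"
  by (auto simp: dvd_def spec_mult)

lemma degree_spec_le: "degree (spec p z) \<le> degree p"
  by (rule degree_le) (simp add: coeff_eq_0)

lemma degree_spec: "poly (lead_coeff p) z \<noteq> 0 \<Longrightarrow> degree (spec p z) = degree p"
  by (rule antisym[OF degree_spec_le le_degree]) simp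

lemma spec_eq_0_infinite:
  assumes "infinite {z. spec p z = 0}" shows "p = 0"
proof (rule poly_eqI)
  fix i
  have "infinite {z. poly (coeff p i) z = 0}"
    by (rule infinite_super[OF _ assms]) (auto simp flip: coeff_spec)
  then show "coeff p i = coeff 0 i" using poly_roots_finite[of "coeff p i"] by auto
qed

lemma prime_decomposition:
  fixes g :: "complex poly poly"
  assumes "g \<noteq> 0"
  obtains A where "\<And>q. q \<in># A \<Longrightarrow> prime_elem q \<and> q dvd g" "g dvd prod_mset A"
proof -
  obtain A where A: "\<forall>x. x \<in># A \<longrightarrow> prime_elem x" "normalize (prod_mset A) = normalize g"
    using prime_factorization_exists[OF assms] by blast
  then have "prod_mset A dvd g" "g dvd prod_mset A" by (metis associatedD1 associatedD2)+
  moreover have "q dvd prod_mset A" if "q \<in># A" for q using that by (rule dvd_prod_mset)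
  ultimately show ?thesis using that A(1) by (meson dvd_trans)
qed

lemma prime_factor_pos_degree:
  fixes g :: "complex poly poly"
  assumes "degree g > 0"
  obtains q where "prime_elem q" "q dvd g" "degree q > 0"
proof -
  have g0: "g \<noteq> 0" using assms by auto
  obtain A where A: "\<And>q. q \<in># A \<Longrightarrow> prime_elem q \<and> q dvd g" "g dvd prod_mset A"
    using prime_decomposition[OF g0] by blast
  have "\<exists>q\<in>#A. degree q > 0"
  proof (rule ccontr)
    assume "\<not> (\<exists>q\<in>#A. degree q > 0)"
    then have "\<forall>q\<in>#A. q \<noteq> 0 \<and> degree q = 0" using A(1) by (metis gr0I not_prime_elem_zero)
    then have "prod_mset A \<noteq> 0 \<and> degree (prod_mset A) = 0"
      by (induction A) (auto simp: degree_mult_eq)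
    then show False using dvd_imp_degree_le[OF A(2)] assms by auto
  qed
  then show ?thesis using that A(1) by blast
qed

lemma prime_not_dvd_const:
  fixes q :: "complex poly poly"
  assumes "degree q > 0" "a \<noteq> 0" shows "\<not> q dvd [:a:]"
  using dvd_imp_degree_le[of q "[:a:]"] assms by auto

text \<open>Each root of \<open>u\<close>, counted with multiplicity, is matched with one factor
  \<open>v\<close>, and there are \<open>degree u\<close> of them.\<close>

lemma dvd_power_of_roots:
  fixes u v :: "complex poly"
  assumes u: "u \<noteq> 0" and roots: "\<And>x. poly u x = 0 \<Longrightarrow> poly v x = 0"
  shows "u dvd v ^ degree u"
proof -
  obtain A where A: "size A = degree u" "u = Polynomial.smult (lead_coeff u) (\<Prod>x\<in>#A. [:- x, 1:])"
    using alg_closed_imp_factorization[OF u] by auto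
  have root: "poly (\<Prod>x\<in>#B. [:- x, 1:]) w = 0 \<longleftrightarrow> w \<in># B" for w :: complex and B
    by (induction B) auto
  have "poly u x = 0" if "x \<in># A" for x
    by (subst A(2)) (use that root[of A x] in \<open>simp del: poly_prod_mset\<close>)
  then have "\<forall>x\<in>#A. [:- x, 1:] dvd v" using roots by (simp add: poly_eq_0_iff_dvd)
  then have "(\<Prod>x\<in>#A. [:- x, 1:]) dvd v ^ size A"
  proof (induction A)
    case (add x A)
    then have "[:- x, 1:] * (\<Prod>x\<in>#A. [:- x, 1:]) dvd v * v ^ size A" by (intro mult_dvd_mono) auto
    then show ?case by (simp del: mult_pCons_left)
  qed simp
  then show ?thesis by (subst A(2)) (use u A(1) in \<open>simp add: smult_dvd_iff\<close>)
qed

text \<open>The prime factor \<open>r\<close> of \<open>p\<close> through the given point has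
  positive degree in the outer variable, since otherwise \<open>spec p z0\<close> would be zero.
  Over infinitely many \<open>z\<close> the roots of \<open>r\<close> are roots of \<open>q\<close>,
  so a power of \<open>q\<close> has zero pseudo-remainder modulo \<open>r\<close>; primality turns
  this into \<open>r dvd q\<close>.\<close>

lemma zero_subset_of_infinite_fibres:
  assumes inf: "infinite {z. \<forall>w. poly (spec p z) w = 0 \<longrightarrow> poly (spec q z) w = 0}"
    and nz: "spec p z0 \<noteq> 0" and zero: "poly (spec p z0) w0 = 0"
  shows "poly (spec q z0) w0 = 0"
proof -
  have p0: "p \<noteq> 0" using nz by auto
  obtain A where A: "\<And>q. q \<in># A \<Longrightarrow> prime_elem q \<and> q dvd p" "p dvd prod_mset A"
    using prime_decomposition[OF p0] by blast
  have "poly (spec (prod_mset A) z0) w0 = 0"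
    using spec_dvd[OF A(2), of z0] zero by (auto elim!: dvdE)
  then have "\<exists>r\<in>#A. poly (spec r z0) w0 = 0"
    by (induction A) (auto simp: spec_mult one_pCons)
  then obtain r where r: "prime_elem r" "r dvd p" "poly (spec r z0) w0 = 0" using A(1) by blast
  have dr: "degree r > 0"
  proof (rule ccontr)
    assume "\<not> degree r > 0"
    then obtain c where "r = [:c:]" by (metis degree_0_id gr0I degree_eq_zeroE)
    then have "spec r z0 = 0" using r(3) by simp
    then show False using spec_dvd[OF r(2), of z0] nz by simp
  qed
  have r0: "r \<noteq> 0" using dr by auto
  obtain a h where ah: "a \<noteq> 0" "Polynomial.smult a (q ^ degree r) = r * h + pseudo_mod (q ^ degree r) r"
    using pseudo_mod(1)[OF r0, of "q ^ degree r"] by blast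
  define s where "s = pseudo_mod (q ^ degree r) r"
  have s: "s = 0 \<or> degree s < degree r" using pseudo_mod(2)[OF r0] by (simp add: s_def)
  have "s = 0"
  proof (rule spec_eq_0_infinite, rule infinite_super)
    have "finite {z. poly (lead_coeff r) z = 0}" using r0 by (intro poly_roots_finite) auto
    \<comment> \<open>Fibres over zeros of the leading coefficient of \<open>r\<close> are
      discarded, so that \<open>spec r z\<close> keeps the degree of \<open>r\<close>, which exceeds
      that of the remainder.\<close>
    then show "infinite ({z. \<forall>w. poly (spec p z) w = 0 \<longrightarrow> poly (spec q z) w = 0} - {z. poly (lead_coeff r) z = 0})"
      using inf by (rule Diff_infinite_finite)
    show "{z. \<forall>w. poly (spec p z) w = 0 \<longrightarrow> poly (spec q z) w = 0} - {z. poly (lead_coeff r) z = 0} \<subseteq> {z. spec s z = 0}"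
    proof clarsimp
      fix z assume z: "\<forall>w. poly (spec p z) w = 0 \<longrightarrow> poly (spec q z) w = 0" "poly (lead_coeff r) z \<noteq> 0"
      have d: "degree (spec r z) = degree r" by (rule degree_spec[OF z(2)])
      then have nz: "spec r z \<noteq> 0" using dr by auto
      have "spec r z dvd spec q z ^ degree (spec r z)"
      proof (rule dvd_power_of_roots[OF nz])
        fix x assume "poly (spec r z) x = 0"
        then have "poly (spec p z) x = 0" using spec_dvd[OF r(2), of z] by (auto elim!: dvdE)
        then show "poly (spec q z) x = 0" using z(1) by blast
      qed
      then have "spec r z dvd spec (Polynomial.smult a (q ^ degree r)) z"
        unfolding d by (simp add: spec_smult spec_power dvd_smult)
      then have "spec r z dvd spec r z * spec h z + spec s z"
        unfolding ah(2) s_def[symmetric] by (simp add: spec_add spec_mult)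
      then have "spec r z dvd spec s z" by (simp add: dvd_add_right_iff)
      then show "spec s z = 0"
        using s dvd_imp_degree_le[of "spec r z" "spec s z"] d degree_spec_le[of s z] by (cases "s = 0") auto
    qed
  qed
  then have "r dvd [:a:] * q ^ degree r" using ah(2) by (simp flip: s_def)
  then have "r dvd q ^ degree r"
    using prime_elem_dvd_multD[OF r(1)] prime_not_dvd_const[OF dr ah(1)] by blast
  then have "r dvd q" using r(1) prime_elem_dvd_power by blast
  then show ?thesis using spec_dvd[of r q z0] r(3) by (auto elim!: dvdE)
qed

text \<open>A nonzero element of least degree in the ideal generated by \<open>f\<close> and its derivative is either
  constant or shares a prime factor with both of them.\<close>

lemma bezout_or_multiple_factor:
  fixes f :: "complex poly poly"
  assumes f: "degree f > 0"
  shows "(\<exists>c u v. c \<noteq> 0 \<and> u * f + v * pderiv f = [:c:]) \<or> (\<exists>r. prime_elem r \<and> degree r > 0 \<and> r * r dvd f)"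
proof -
  define I where "I g \<longleftrightarrow> g \<noteq> 0 \<and> (\<exists>u v. g = u * f + v * pderiv f)" for g
  have "f = 1 * f + 0 * pderiv f" "f \<noteq> 0" using f by auto
  then have "I f" unfolding I_def by blast
  then obtain g where g: "I g" "\<And>h. I h \<Longrightarrow> degree g \<le> degree h"
    using ex_has_least_nat[of I f degree] by blast
  then obtain u v where uv: "g \<noteq> 0" "g = u * f + v * pderiv f" by (auto simp: I_def)
  show ?thesis
  proof (cases "degree g = 0")
    case True
    then obtain c where "g = [:c:]" by (metis degree_eq_zeroE)
    then show ?thesis using uv by (metis pCons_eq_0_iff)
  next
    case False
    then obtain r where r: "prime_elem r" "r dvd g" "degree r > 0"
      using prime_factor_pos_degree[of g] by auto
    have div: "r dvd h" if h: "h = u' * f + v' * pderiv f" for h u' v'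
    proof -
      obtain a k where ak: "a \<noteq> 0" "Polynomial.smult a h = g * k + pseudo_mod h g"
        using pseudo_mod(1)[OF uv(1), of h] by blast
      have "pseudo_mod h g = ([:a:] * u' - k * u) * f + ([:a:] * v' - k * v) * pderiv f"
      proof -
        have "([:a:] * u' - k * u) * f + ([:a:] * v' - k * v) * pderiv f
          = [:a:] * (u' * f + v' * pderiv f) - k * (u * f + v * pderiv f)"
          by (simp add: algebra_simps del: mult_pCons_left mult_pCons_right)
        also have "\<dots> = [:a:] * h - k * g" by (simp only: h[symmetric] uv(2)[symmetric])
        also have "\<dots> = pseudo_mod h g" using ak(2) by (simp add: mult.commute)
        finally show ?thesis by simp
      qed
      then have "pseudo_mod h g = 0"
        using g(2)[of "pseudo_mod h g"] pseudo_mod(2)[OF uv(1), of h] unfolding I_def by (metis not_less)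
      then have "g dvd [:a:] * h" using ak(2) by simp
      then have "r dvd [:a:] * h" using r(2) dvd_trans by blast
      then show ?thesis using prime_elem_dvd_multD[OF r(1)] prime_not_dvd_const[OF r(3) ak(1)] by blast
    qed
    have "r dvd f" using div[of f 1 0] by simp
    then obtain h where h: "f = r * h" by (elim dvdE)
    have "r dvd pderiv f" using div[of "pderiv f" 0 1] by simp
    then have "r dvd pderiv r * h"
      unfolding h pderiv_mult by (metis dvd_add_right_iff dvd_triv_left mult.commute)
    moreover have "\<not> r dvd pderiv r"
    proof
      assume "r dvd pderiv r"
      moreover have "pderiv r \<noteq> 0" using r(3) by (simp add: pderiv_eq_0_iff)
      ultimately show False using dvd_imp_degree_le[of r "pderiv r"] r(3) degree_pderiv[of r] by simp
    qed
    ultimately have "r dvd h" using prime_elem_dvd_multD[OF r(1)] by blast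
    then show ?thesis using r h by (metis mult_dvd_mono dvd_refl)
  qed
qed

context distinguished_poly begin

text \<open>Among all polynomials with the required zeros one of least degree is chosen. A repeated
  prime factor could be removed once without changing the zeros, so the Bezout alternative of
  \<open>bezout_or_multiple_factor\<close> remains.\<close>

theorem inner_polynomial_separable:
  obtains f :: "complex poly poly" and c u v where
    "degree f > 0" "\<And>z. cmod z \<le> 1 \<Longrightarrow> poly (lead_coeff f) z \<noteq> 0"
    "\<And>z w. cmod z < 1 \<Longrightarrow> poly (spec f z) w = 0 \<longleftrightarrow> cmod w < 1 \<and> poly (spec p z) w = 0"
    "\<And>z w. cmod z = 1 \<Longrightarrow> poly (spec f z) w = 0 \<Longrightarrow> cmod w = 1"
    "c \<noteq> 0" "u * f + v * pderiv f = [:c:]"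
proof -
  define G where "G f \<longleftrightarrow> degree f > 0 \<and> (\<forall>z. cmod z \<le> 1 \<longrightarrow> poly (lead_coeff f) z \<noteq> 0) \<and>
    (\<forall>z w. cmod z < 1 \<longrightarrow> (poly (spec f z) w = 0 \<longleftrightarrow> cmod w < 1 \<and> poly (spec p z) w = 0)) \<and>
    (\<forall>z w. cmod z = 1 \<longrightarrow> poly (spec f z) w = 0 \<longrightarrow> cmod w = 1)" for f
  obtain f0 where "G f0"
    by (rule inner_polynomial, unfold G_def) blast
  then obtain f where f: "G f" "\<And>g. G g \<Longrightarrow> degree f \<le> degree g"
    using ex_has_least_nat[of G f0 degree] by blast
  have "\<not> (\<exists>r. prime_elem r \<and> degree r > 0 \<and> r * r dvd f)"
  proof clarify
    fix r assume r: "prime_elem r" "degree r > 0" "r * r dvd f"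
    then obtain k where k: "f = r * (r * k)" by (auto simp: dvd_def mult.assoc)
    have f0: "f \<noteq> 0" using f(1) by (auto simp: G_def)
    then have k0: "r \<noteq> 0" "r * k \<noteq> 0" using k by auto
    have "G (r * k)"
    proof -
      have lc: "lead_coeff f = lead_coeff r * lead_coeff (r * k)" 
        using arg_cong[OF k, of lead_coeff] by (simp only: lead_coeff_mult)
      have roots: "poly (spec f z) w = 0 \<longleftrightarrow> poly (spec (r * k) z) w = 0" for z w
        by (subst k) (auto simp: spec_mult)
      have "degree (r * k) > 0" using r(2) k0 by (simp add: degree_mult_eq)
      then show ?thesis using f(1) unfolding G_def roots lc by auto
    qed
    from f(2)[OF this] have "degree f \<le> degree (r * k)" .
    moreover have "degree f = degree r + degree (r * k)" by (subst k) (rule degree_mult_eq[OF k0])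
    ultimately show False using r(2) by simp
  qed
  moreover have "degree f > 0" using f(1) by (simp add: G_def)
  ultimately have "\<exists>c u v. c \<noteq> 0 \<and> u * f + v * pderiv f = [:c:]"
    using bezout_or_multiple_factor[of f] by blast
  then obtain c u v where "c \<noteq> 0" "u * f + v * pderiv f = [:c:]" by blast
  then show ?thesis using f(1) that[of f c u v] unfolding G_def by blast
qed

end

section \<open>Positive definite matrix functions on the circle\<close>

text \<open>Trigonometric polynomials without negative exponents: on the circle \<open>cnj z\<close>
  is the inverse of \<open>z\<close>. Values off the circle are left free.\<close>

definition trig :: "(complex \<Rightarrow> complex) \<Rightarrow> bool" where
  "trig g \<longleftrightarrow> (\<exists>a K. \<forall>z. cmod z = 1 \<longrightarrow> g z = poly a z * cnj z ^ K)"

lemma circle_cnj_mult: "cmod z = 1 \<Longrightarrow> cnj z * z = 1"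
  by (metis complex_norm_square mult.commute of_real_1 one_power2)

lemma circle_cnj_mult_power: "cmod z = 1 \<Longrightarrow> cnj z ^ k * z ^ k = 1"
  by (metis circle_cnj_mult power_mult_distrib power_one)

lemma circle_cnj: "cmod z = 1 \<Longrightarrow> cnj z = inverse z"
  by (metis circle_cnj_mult inverse_unique mult.commute)

lemma trig_const: "trig (\<lambda>_. c)"
  unfolding trig_def by (intro exI[of _ "[:c:]"] exI[of _ 0]) simp

lemma trig_poly: "trig (poly p)"
  unfolding trig_def by (intro exI[of _ p] exI[of _ 0]) simp

lemma trig_mult:
  assumes "trig f" "trig g" shows "trig (\<lambda>z. f z * g z)"
proof -
  obtain a K b L where "\<And>z. cmod z = 1 \<Longrightarrow> f z = poly a z * cnj z ^ K"
    "\<And>z. cmod z = 1 \<Longrightarrow> g z = poly b z * cnj z ^ L" using assms unfolding trig_def by blast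
  then show ?thesis unfolding trig_def
    by (intro exI[of _ "a * b"] exI[of _ "K + L"]) (simp add: power_add)
qed

lemma trig_add:
  assumes "trig f" "trig g" shows "trig (\<lambda>z. f z + g z)"
proof -
  obtain a K b L where ab: "\<And>z. cmod z = 1 \<Longrightarrow> f z = poly a z * cnj z ^ K"
    "\<And>z. cmod z = 1 \<Longrightarrow> g z = poly b z * cnj z ^ L" using assms unfolding trig_def by blast
  show ?thesis unfolding trig_def
  proof (intro exI allI impI)
    fix z assume z: "cmod z = 1"
    have "f z + g z = poly a z * cnj z ^ K * (cnj z ^ L * z ^ L) + poly b z * cnj z ^ L * (cnj z ^ K * z ^ K)"
      using ab z by (simp add: circle_cnj_mult_power)
    then show "f z + g z = poly (a * monom 1 L + b * monom 1 K) z * cnj z ^ (K + L)"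
      by (simp add: poly_monom power_add algebra_simps)
  qed
qed

lemma trig_diff: "trig f \<Longrightarrow> trig g \<Longrightarrow> trig (\<lambda>z. f z - g z)"
  using trig_add[of f "\<lambda>z. (- 1) * g z"] trig_mult[OF trig_const[of "- 1"], of g] by simp

lemma trig_sum: "(\<And>i. i \<in> A \<Longrightarrow> trig (f i)) \<Longrightarrow> trig (\<lambda>z. \<Sum>i\<in>A. f i z)"
  by (induction A rule: infinite_finite_induct) (auto intro: trig_add trig_const)

lemma cnj_poly: "cnj (poly p z) = poly (map_poly cnj p) (cnj z)"
  by (induction p) (auto simp: map_poly_pCons)

lemma circle_cnj_poly:
  assumes "cmod z = 1"
  shows "cnj (poly p z) = poly (reflect_poly (map_poly cnj p)) z * cnj z ^ degree p"
proof -
  have d: "degree (map_poly cnj p) = degree p" by (rule degree_map_poly) simp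
  have "z \<noteq> 0" using assms by auto
  then have "poly (reflect_poly (map_poly cnj p)) z = z ^ degree p * cnj (poly p z)"
    unfolding cnj_poly circle_cnj[OF assms] by (simp add: poly_reflect_poly_nz d)
  then show ?thesis using circle_cnj_mult_power[OF assms, of "degree p"] by (simp add: mult_ac)
qed

lemma trig_cnj:
  assumes "trig f" shows "trig (\<lambda>z. cnj (f z))"
proof -
  obtain a K where a: "\<And>z. cmod z = 1 \<Longrightarrow> f z = poly a z * cnj z ^ K"
    using assms unfolding trig_def by blast
  show ?thesis unfolding trig_def
    by (intro exI[of _ "reflect_poly (map_poly cnj a) * monom 1 K"] exI[of _ "degree a"])
       (simp add: a circle_cnj_poly poly_monom)
qed

section \<open>The Fejer--Riesz factorization\<close>

lemma infinite_circle_near: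
  assumes "\<delta> > 0" shows "infinite {z. cmod z = 1 \<and> cmod (z - 1) < \<delta>}"
proof -
  have "isCont cis 0" unfolding cis_conv_exp[abs_def] by (intro continuous_intros)
  then obtain s where s: "s > 0" "\<And>t. \<bar>t\<bar> < s \<Longrightarrow> cmod (cis t - 1) < \<delta>"
    using assms unfolding continuous_at_eps_delta by (auto simp: dist_norm)
  have "inj_on cis {0<..<min s 1}"
  proof (rule inj_onI)
    fix x y assume xy: "x \<in> {0<..<min s 1}" "y \<in> {0<..<min s 1}" "cis x = cis y"
    then have "sin x = sin y" by (metis cis.sel(2))
    moreover have "x \<in> {- (pi/2)..pi/2}" "y \<in> {- (pi/2)..pi/2}"
      using xy pi_gt3 by auto
    ultimately show "x = y" by (metis atLeastAtMost_iff arcsin_sin)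
  qed
  then have "infinite (cis ` {0<..<min s 1})"
    using s(1) finite_imageD[of cis "{0<..<min s 1}"] by (auto simp: infinite_Ioo)
  moreover have "cis ` {0<..<min s 1} \<subseteq> {z. cmod z = 1 \<and> cmod (z - 1) < \<delta>}" using s(2) by auto
  ultimately show ?thesis using infinite_super by blast
qed

lemma infinite_circle: "infinite {z::complex. cmod z = 1}"
  by (rule infinite_super[OF _ infinite_circle_near[of 1]]) auto

lemma poly_eq_on_circle:
  fixes p q :: "complex poly"
  assumes "finite S" "\<And>z. cmod z = 1 \<Longrightarrow> z \<notin> S \<Longrightarrow> poly p z = poly q z"
  shows "p = q"
proof -
  have "infinite {z. poly (p - q) z = 0}"
    by (rule infinite_super[OF _ Diff_infinite_finite[OF assms(1) infinite_circle]]) (auto simp: assms(2))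
  then show ?thesis using poly_roots_finite[of "p - q"] by auto
qed

text \<open>The powers \<open>K\<close> and \<open>L\<close> absorb the shift that turns a
  trigonometric polynomial into a polynomial, and \<open>S\<close> the points where positivity is
  unknown. The form is stable under dividing out roots, as the induction in
  \<open>fejer_riesz\<close> requires.\<close>

definition nonneg_on_circle :: "complex poly \<Rightarrow> bool" where
  "nonneg_on_circle a \<longleftrightarrow> (\<exists>S K L. finite S \<and>
    (\<forall>z. cmod z = 1 \<longrightarrow> z \<notin> S \<longrightarrow> poly a z * cnj z ^ K * z ^ L \<in> \<real>\<^sub>\<ge>\<^sub>0))"

text \<open>A function real on the circle equals its conjugate there; up to powers of
  \<open>z\<close> this says that \<open>a\<close> is its own reflection. The identity extends from
  the circle to the plane, and reflection exchanges \<alpha> with its mirror point.\<close>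

lemma nonneg_on_circle_reflected_root:
  assumes a: "nonneg_on_circle a" and \<alpha>: "\<alpha> \<noteq> 0" "poly a \<alpha> = 0"
  shows "poly a (inverse (cnj \<alpha>)) = 0"
proof -
  obtain S K L where S: "finite S"
    and nn: "\<And>z. cmod z = 1 \<Longrightarrow> z \<notin> S \<Longrightarrow> poly a z * cnj z ^ K * z ^ L \<in> \<real>\<^sub>\<ge>\<^sub>0"
    using a unfolding nonneg_on_circle_def by blast
  define b where "b = reflect_poly (map_poly cnj a)"
  have "monom 1 (2 * L + degree a) * a = monom 1 (2 * K) * b"
  proof (rule poly_eq_on_circle[OF S])
    fix z assume z: "cmod z = 1" "z \<notin> S"
    have "poly a z * cnj z ^ K * z ^ L \<in> \<real>" using nn[OF z] nonneg_Reals_subset_Reals by auto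
    then have "poly a z * cnj z ^ K * z ^ L = cnj (poly a z * cnj z ^ K * z ^ L)"
      by (simp add: Reals_cnj_iff)
    also have "\<dots> = poly b z * cnj z ^ degree a * z ^ K * cnj z ^ L"
      by (simp add: b_def circle_cnj_poly[OF z(1)])
    finally have "poly a z * cnj z ^ K * z ^ L * (z ^ K * z ^ L * z ^ degree a)
       = poly b z * cnj z ^ degree a * z ^ K * cnj z ^ L * (z ^ K * z ^ L * z ^ degree a)" by simp
    then have "poly a z * z ^ L * z ^ L * z ^ degree a * (cnj z ^ K * z ^ K)
       = poly b z * z ^ K * z ^ K * (cnj z ^ degree a * z ^ degree a) * (cnj z ^ L * z ^ L)"
      by (simp only: mult_ac)
    then have "poly a z * z ^ L * z ^ L * z ^ degree a = poly b z * z ^ K * z ^ K"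
      by (simp only: circle_cnj_mult_power[OF z(1)] mult_1_right)
    then show "poly (monom 1 (2 * L + degree a) * a) z = poly (monom 1 (2 * K) * b) z"
      by (simp add: poly_monom power_add mult_2 mult_2_right mult_ac)
  qed
  then have "poly (monom 1 (2 * L + degree a) * a) (inverse (cnj \<alpha>)) = poly (monom 1 (2 * K) * b) (inverse (cnj \<alpha>))"
    by simp
  moreover have "poly b (inverse (cnj \<alpha>)) = 0"
    using \<alpha> by (simp add: b_def poly_reflect_poly_nz flip: cnj_poly)
  ultimately show ?thesis using \<alpha>(1) by (simp add: poly_monom)
qed

text \<open>A simple zero on the circle would be a sign change; this is detected by comparing the values
  at \<open>\<alpha> w\<close> and \<open>\<alpha> cnj w\<close> for \<open>w\<close> close to 1.\<close>

lemma nonneg_on_circle_double_root: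
  assumes a: "nonneg_on_circle ([:- \<alpha>, 1:] * b)" and \<alpha>: "cmod \<alpha> = 1"
  shows "poly b \<alpha> = 0"
proof (rule ccontr)
  assume b: "poly b \<alpha> \<noteq> 0"
  obtain S K L where S: "finite S"
    and nn: "\<And>z. cmod z = 1 \<Longrightarrow> z \<notin> S \<Longrightarrow> poly ([:- \<alpha>, 1:] * b) z * cnj z ^ K * z ^ L \<in> \<real>\<^sub>\<ge>\<^sub>0"
    using a unfolding nonneg_on_circle_def by blast
  define B where "B w = \<alpha> * poly b (\<alpha> * w) * cnj (\<alpha> * w) ^ K * (\<alpha> * w) ^ L" for w
  \<comment> \<open>For \<open>w\<close> on the circle \<open>cnj w - 1 = - cnj w * (w - 1)\<close>,
    so \<open>h w\<close> is the quotient of the values at \<open>\<alpha> * cnj w\<close> and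
    \<open>\<alpha> * w\<close>. It ought to be nonnegative, yet \<open>h 1 = - 1\<close>.\<close>
  define h where "h w = - cnj w * B (cnj w) / B w" for w
  have \<alpha>0: "\<alpha> \<noteq> 0" using \<alpha> by auto
  have B1: "B 1 \<noteq> 0" using b \<alpha>0 by (simp add: B_def)
  have "isCont h 1" unfolding h_def B_def
    using B1 by (intro continuous_intros isCont_o2[OF _ poly_isCont]) (auto simp: B_def)
  moreover have h1: "h 1 = - 1" using B1 by (simp add: h_def)
  ultimately have "\<exists>\<delta>>0. \<forall>w. cmod (w - 1) < \<delta> \<longrightarrow> cmod (h w - h 1) < 1"
    unfolding continuous_at_eps_delta dist_norm by (auto dest: spec[of _ 1])
  then obtain \<delta> where \<delta>: "\<delta> > 0" "\<And>w. cmod (w - 1) < \<delta> \<Longrightarrow> cmod (h w - (- 1)) < 1"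
    unfolding h1 by blast
  have finS: "finite ({1} \<union> (\<lambda>w. w / \<alpha>) ` S \<union> cnj ` ((\<lambda>w. w / \<alpha>) ` S))" using S by simp
  obtain w where w: "cmod w = 1" "cmod (w - 1) < \<delta>" "w \<noteq> 1" "\<alpha> * w \<notin> S" "\<alpha> * cnj w \<notin> S"
  proof -
    have "infinite ({z. cmod z = 1 \<and> cmod (z - 1) < \<delta>} - ({1} \<union> (\<lambda>w. w / \<alpha>) ` S \<union> cnj ` ((\<lambda>w. w / \<alpha>) ` S)))"
      by (rule Diff_infinite_finite[OF finS infinite_circle_near[OF \<delta>(1)]])
    then obtain w where w: "cmod w = 1" "cmod (w - 1) < \<delta>"
      "w \<notin> {1} \<union> (\<lambda>w. w / \<alpha>) ` S \<union> cnj ` ((\<lambda>w. w / \<alpha>) ` S)"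
      using infinite_imp_nonempty by blast
    have "\<alpha> * w \<notin> S" using w(3) \<alpha>0 by (auto simp: image_iff field_simps)
    moreover have "\<alpha> * cnj w \<notin> S"
    proof
      assume "\<alpha> * cnj w \<in> S"
      then have "cnj (cnj w) \<in> cnj ` ((\<lambda>w. w / \<alpha>) ` S)"
        using \<alpha>0 by (intro imageI) (auto simp: image_iff intro!: bexI[of _ "\<alpha> * cnj w"])
      then show False using w(3) by simp
    qed
    ultimately show ?thesis using that w by blast
  qed
  have val: "poly ([:- \<alpha>, 1:] * b) (\<alpha> * u) * cnj (\<alpha> * u) ^ K * (\<alpha> * u) ^ L = (u - 1) * B u" for u
    by (simp add: B_def algebra_simps)
  have "(w - 1) * B w \<in> \<real>\<^sub>\<ge>\<^sub>0" unfolding val[symmetric] using w \<alpha> by (intro nn) (simp_all add: norm_mult)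
  then obtain r where r: "r \<ge> 0" "(w - 1) * B w = of_real r" by (elim nonneg_Reals_cases)
  have "(cnj w - 1) * B (cnj w) \<in> \<real>\<^sub>\<ge>\<^sub>0" unfolding val[symmetric] using w \<alpha> by (intro nn) (simp_all add: norm_mult)
  then obtain s where s: "s \<ge> 0" "(cnj w - 1) * B (cnj w) = of_real s" by (elim nonneg_Reals_cases)
  have "cnj w - 1 = - cnj w * (w - 1)" using circle_cnj_mult[OF w(1)] by (simp add: algebra_simps)
  then have "h w = ((cnj w - 1) * B (cnj w)) / ((w - 1) * B w)"
    using w(3) by (simp add: h_def)
  also have "\<dots> = of_real (s / r)" by (simp add: r s)
  finally have "h w - (- 1) = of_real (s / r + 1)" by simp
  then have "cmod (h w - (- 1)) = \<bar>s / r + 1\<bar>" by (simp only: norm_of_real)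
  then have "cmod (h w - (- 1)) \<ge> 1" using r s by simp
  then show False using \<delta>(2)[OF w(2)] by simp
qed

text \<open>Nonzero roots occur in pairs \<alpha>, \<open>inverse (cnj \<alpha>)\<close>, doubled on
  the circle, and each pair contributes \<open>cmod (z - \<alpha>) ^ 2\<close> up to a constant
  times \<open>z\<close>. The conclusion compares moduli, so powers of \<open>z\<close>, unimodular
  on the circle, need not be tracked.\<close>

theorem fejer_riesz:
  assumes "nonneg_on_circle a" "a \<noteq> 0"
  shows "\<exists>g. g \<noteq> 0 \<and> (\<forall>z. cmod z = 1 \<longrightarrow> cmod (poly a z) = (cmod (poly g z))\<^sup>2)"
  using assms
proof (induction "degree a" arbitrary: a rule: less_induct)
  case less
  show ?case
  proof (cases "degree a = 0")
    case True
    then obtain c where c: "a = [:c:]" by (metis degree_eq_zeroE)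
    show ?thesis
      by (rule exI[of _ "[:of_real (sqrt (cmod c)):]"]) (use c less.prems in auto)
  next
    case False
    then obtain \<alpha> where \<alpha>: "poly a \<alpha> = 0"
      using fundamental_theorem_of_algebra[of a] constant_degree[of a] by auto
    obtain S K L where S: "finite S"
      and nn: "\<And>z. cmod z = 1 \<Longrightarrow> z \<notin> S \<Longrightarrow> poly a z * cnj z ^ K * z ^ L \<in> \<real>\<^sub>\<ge>\<^sub>0"
      using less.prems unfolding nonneg_on_circle_def by blast
    show ?thesis
    proof (cases "\<alpha> = 0")
      case True
      then obtain b where b: "a = [:0, 1:] * b" using \<alpha> by (auto simp: poly_eq_0_iff_dvd elim: dvdE)
      have b0: "b \<noteq> 0" using less.prems b by auto
      then have deg: "degree b < degree a" by (simp add: b)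
      have "nonneg_on_circle b" unfolding nonneg_on_circle_def
        using S nn by (intro exI[of _ S] exI[of _ K] exI[of _ "Suc L"]) (auto simp: b mult_ac)
      from less.hyps[OF deg this b0] show ?thesis by (auto simp: b norm_mult)
    next
      case False
      define \<beta> where "\<beta> = inverse (cnj \<alpha>)"
      have "[:- \<alpha>, 1:] * [:- \<beta>, 1:] dvd a"
      proof -
        obtain b where b: "a = [:- \<alpha>, 1:] * b" using \<alpha> by (auto simp: poly_eq_0_iff_dvd elim: dvdE)
        have "poly b \<beta> = 0"
        proof (cases "cmod \<alpha> = 1")
          case True
          then have "\<beta> = \<alpha>" by (metis \<beta>_def circle_cnj inverse_inverse_eq)
          then show ?thesis using nonneg_on_circle_double_root[of \<alpha> b] True less.prems b by simp
        next
          case False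
          have "\<beta> \<noteq> \<alpha>"
          proof
            assume "\<beta> = \<alpha>"
            then have "cnj \<alpha> * \<alpha> = 1" using \<open>\<alpha> \<noteq> 0\<close> by (auto simp: \<beta>_def field_simps)
            then have "cmod \<alpha> * cmod \<alpha> = 1" by (metis complex_mod_cnj norm_mult norm_one)
            then show False using False by (metis abs_norm_cancel power2_eq_square power2_eq_1_iff real_sqrt_abs real_sqrt_one)
          qed
          moreover have "poly a \<beta> = 0"
            unfolding \<beta>_def by (rule nonneg_on_circle_reflected_root[OF less.prems(1) \<open>\<alpha> \<noteq> 0\<close> \<alpha>])
          ultimately show ?thesis by (simp add: b)
        qed
        then show ?thesis unfolding b by (intro mult_dvd_mono) (auto simp: poly_eq_0_iff_dvd)
      qed
      then obtain b0 where b0: "a = [:- \<alpha>, 1:] * [:- \<beta>, 1:] * b0" by (elim dvdE)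
      \<comment> \<open>On the circle
        \<open>z - \<beta> = - \<beta> * (z * cnj (z - \<alpha>))\<close>; the constant goes into
        \<open>b\<close>, the factor \<open>z\<close> into the exponent \<open>L\<close>.\<close>
      define b where "b = Polynomial.smult (- \<beta>) b0"
      have \<beta>0: "\<beta> \<noteq> 0" using False by (simp add: \<beta>_def)
      have bn: "b \<noteq> 0" "b0 \<noteq> 0" using less.prems b0 \<beta>0 by (auto simp: b_def)
      have "degree a = 2 + degree b" using bn \<beta>0 by (simp add: b0 b_def degree_mult_eq del: mult_pCons_left)
      then have deg: "degree b < degree a" by simp
      have fac: "poly a z = of_real ((cmod (z - \<alpha>))\<^sup>2) * (z * poly b z)" if z: "cmod z = 1" for z
      proof -
        have "z - \<beta> = - \<beta> * (z * cnj (z - \<alpha>))"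
          using circle_cnj_mult[OF z] False by (simp add: \<beta>_def field_simps)
        moreover have "poly a z = (z - \<alpha>) * (z - \<beta>) * poly b0 z"
          unfolding b0 by (simp add: algebra_simps)
        ultimately have "poly a z = (z - \<alpha>) * cnj (z - \<alpha>) * (z * (- \<beta> * poly b0 z))"
          by (simp only:) (simp add: mult_ac)
        then show ?thesis by (simp only: b_def poly_smult complex_norm_square)
      qed
      have "nonneg_on_circle b" unfolding nonneg_on_circle_def
      proof (rule exI[of _ "insert \<alpha> S"], rule exI[of _ K], rule exI[of _ "Suc L"], intro conjI allI impI)
        fix z assume z: "cmod z = 1" "z \<notin> insert \<alpha> S"
        define r where "r = (cmod (z - \<alpha>))\<^sup>2"
        have r: "r > 0" using z by (simp add: r_def)
        obtain s where s: "s \<ge> 0" "poly a z * cnj z ^ K * z ^ L = of_real s"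
          using nn z by (auto elim: nonneg_Reals_cases)
        have "of_real r * (poly b z * cnj z ^ K * z ^ Suc L) = of_real s"
          unfolding s(2)[symmetric] fac[OF z(1)] r_def by (simp add: mult_ac)
        then have "poly b z * cnj z ^ K * z ^ Suc L = of_real (s / r)"
          using r by (simp add: field_simps)
        then show "poly b z * cnj z ^ K * z ^ Suc L \<in> \<real>\<^sub>\<ge>\<^sub>0" using r s by simp
      qed (use S in auto)
      from less.hyps[OF deg this bn(1)] obtain g where
        g: "g \<noteq> 0" "\<forall>z. cmod z = 1 \<longrightarrow> cmod (poly b z) = (cmod (poly g z))\<^sup>2" by blast
      show ?thesis
      proof (intro exI[of _ "[:- \<alpha>, 1:] * g"] conjI allI impI)
        fix z assume z: "cmod z = 1"
        have "poly ([:- \<alpha>, 1:] * g) z = (z - \<alpha>) * poly g z" by (simp add: algebra_simps)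
        then show "cmod (poly a z) = (cmod (poly ([:- \<alpha>, 1:] * g) z))\<^sup>2"
          using g(2) z by (simp add: fac norm_mult norm_power power_mult_distrib)
      qed (use g in \<open>simp del: mult_pCons_left\<close>)
    qed
  qed
qed

text \<open>One step of the \<open>L D L*\<close> factorisation; \<open>y\<close> is chosen to annihilate the first component.\<close>

lemma schur_complement_form:
  fixes A :: "nat \<Rightarrow> nat \<Rightarrow> complex" and x :: "nat \<Rightarrow> complex"
  assumes herm: "\<And>i j. i \<le> m \<Longrightarrow> j \<le> m \<Longrightarrow> A j i = cnj (A i j)" and g: "A 0 0 \<noteq> 0"
  defines "y \<equiv> \<lambda>i. case i of 0 \<Rightarrow> - (\<Sum>j<m. A 0 (Suc j) * x j) / A 0 0 | Suc i \<Rightarrow> x i"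
  shows "A 0 0 * (\<Sum>i<Suc m. \<Sum>j<Suc m. cnj (y i) * A i j * y j)
    = (\<Sum>i<m. \<Sum>j<m. cnj (x i) * (A 0 0 * A (Suc i) (Suc j) - A (Suc i) 0 * A 0 (Suc j)) * x j)"
proof -
  define h where "h = (\<Sum>j<m. A 0 (Suc j) * x j)"
  have row: "(\<Sum>j<Suc m. A i j * y j) = A i 0 * y 0 + (\<Sum>j<m. A i (Suc j) * x j)" for i
    by (subst sum.lessThan_Suc_shift) (simp add: y_def)
  have y0: "A 0 0 * y 0 = - h" using g by (simp add: y_def h_def)
  have row0: "(\<Sum>j<Suc m. A 0 j * y j) = 0" unfolding row y0 by (simp add: h_def)
  have "A 0 0 * (\<Sum>i<Suc m. \<Sum>j<Suc m. cnj (y i) * A i j * y j)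
     = A 0 0 * (\<Sum>i<Suc m. cnj (y i) * (\<Sum>j<Suc m. A i j * y j))"
    by (simp only: sum_distrib_left mult.assoc)
  also have "\<dots> = A 0 0 * (\<Sum>i<m. cnj (x i) * (A (Suc i) 0 * y 0 + (\<Sum>j<m. A (Suc i) (Suc j) * x j)))"
    by (subst sum.lessThan_Suc_shift) (simp only: row0 row, simp add: y_def)
  also have "\<dots> = (\<Sum>i<m. cnj (x i) * (A (Suc i) 0 * (A 0 0 * y 0) + A 0 0 * (\<Sum>j<m. A (Suc i) (Suc j) * x j)))"
    by (simp add: sum_distrib_left algebra_simps)
  also have "\<dots> = (\<Sum>i<m. cnj (x i) * (\<Sum>j<m. (A 0 0 * A (Suc i) (Suc j) - A (Suc i) 0 * A 0 (Suc j)) * x j))"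
    unfolding y0 h_def
    by (intro sum.cong refl arg_cong2[where f = "(*)"])
       (simp add: sum_distrib_left left_diff_distrib sum_subtractf mult.assoc)
  also have "\<dots> = (\<Sum>i<m. \<Sum>j<m. cnj (x i) * (A 0 0 * A (Suc i) (Suc j) - A (Suc i) 0 * A 0 (Suc j)) * x j)"
    by (simp only: sum_distrib_left mult.assoc)
  finally show ?thesis .
qed

text \<open>The Schur complement is multiplied by \<open>G 0 0\<close> to keep its entries
  trigonometric polynomials. By \<open>fejer_riesz\<close> this entry is the squared modulus of a
  polynomial on the circle, so the extra factors combine into the squared modulus of
  \<open>c\<close>.\<close>

theorem matrix_factorization_on_circle:
  fixes G :: "nat \<Rightarrow> nat \<Rightarrow> complex \<Rightarrow> complex"
  assumes "\<And>i j. i < m \<Longrightarrow> j < m \<Longrightarrow> trig (G i j)" "finite S"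
    and "\<And>z i j. cmod z = 1 \<Longrightarrow> z \<notin> S \<Longrightarrow> i < m \<Longrightarrow> j < m \<Longrightarrow> G j i z = cnj (G i j z)"
    and "\<And>z x. cmod z = 1 \<Longrightarrow> z \<notin> S \<Longrightarrow> \<exists>i<m. x i \<noteq> 0 \<Longrightarrow>
      Re (\<Sum>i<m. \<Sum>j<m. cnj (x i) * G i j z * x j) > 0"
  shows "\<exists>c F. c \<noteq> 0 \<and> (\<forall>z k l. cmod z = 1 \<longrightarrow> z \<notin> S \<longrightarrow> k < m \<longrightarrow> l < m \<longrightarrow>
    (\<Sum>i<m. cnj (poly (F i k) z) * poly (F i l) z) = of_real ((cmod (poly c z))\<^sup>2) * G k l z)"
  using assms
proof (induction m arbitrary: G)
  case 0
  then show ?case by (intro exI[of _ 1]) auto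
next
  case (Suc m)
  note trig = Suc.prems(1) and S = Suc.prems(2) and herm = Suc.prems(3) and pos = Suc.prems(4)
  define g where "g = G 0 0"
  have gpos: "g z \<in> \<real>\<^sub>\<ge>\<^sub>0 \<and> g z \<noteq> 0" if z: "cmod z = 1" "z \<notin> S" for z
  proof -
    define x where "x = (\<lambda>i::nat. if i = 0 then 1 else (0::complex))"
    have "(\<Sum>i<Suc m. \<Sum>j<Suc m. cnj (x i) * G i j z * x j) = g z"
      unfolding sum.lessThan_Suc_shift by (simp add: x_def g_def)
    moreover have "x 0 \<noteq> 0" by (simp add: x_def)
    ultimately have "Re (g z) > 0" using pos[OF z, of x] by auto
    moreover have "g z \<in> \<real>" using herm[OF z, of 0 0] by (simp add: g_def Reals_cnj_iff)
    ultimately show ?thesis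
      by (auto simp: complex_nonneg_Reals_iff complex_is_Real_iff)
  qed
  define H where "H i j z = g z * G (Suc i) (Suc j) z - G (Suc i) 0 z * G 0 (Suc j) z" for i j z
  have "\<exists>c F. c \<noteq> 0 \<and> (\<forall>z k l. cmod z = 1 \<longrightarrow> z \<notin> S \<longrightarrow> k < m \<longrightarrow> l < m \<longrightarrow>
    (\<Sum>i<m. cnj (poly (F i k) z) * poly (F i l) z) = of_real ((cmod (poly c z))\<^sup>2) * H k l z)"
  proof (rule Suc.IH[OF _ S])
    show "trig (H i j)" if "i < m" "j < m" for i j
      unfolding H_def[abs_def] g_def using that by (intro trig_diff trig_mult trig) auto
    show "H j i z = cnj (H i j z)" if "cmod z = 1" "z \<notin> S" "i < m" "j < m" for z i j
      using herm[OF that(1,2), of "Suc i" "Suc j"] herm[OF that(1,2), of 0 "Suc i"]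
        herm[OF that(1,2), of 0 "Suc j"] herm[OF that(1,2), of 0 0] that(3,4)
      by (simp add: H_def g_def mult.commute)
    show "Re (\<Sum>i<m. \<Sum>j<m. cnj (x i) * H i j z * x j) > 0"
      if z: "cmod z = 1" "z \<notin> S" and x: "\<exists>i<m. x i \<noteq> 0" for z x
    proof -
      define y where "y = (\<lambda>i. case i of 0 \<Rightarrow> - (\<Sum>j<m. G 0 (Suc j) z * x j) / G 0 0 z | Suc i \<Rightarrow> x i)"
      obtain i where "i < m" "x i \<noteq> 0" using x by blast
      then have "\<exists>i<Suc m. y i \<noteq> 0" by (intro exI[of _ "Suc i"]) (simp add: y_def)
      then have Y: "Re (\<Sum>i<Suc m. \<Sum>j<Suc m. cnj (y i) * G i j z * y j) > 0" by (rule pos[OF z])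
      have eq: "g z * (\<Sum>i<Suc m. \<Sum>j<Suc m. cnj (y i) * G i j z * y j)
        = (\<Sum>i<m. \<Sum>j<m. cnj (x i) * H i j z * x j)"
        unfolding y_def H_def g_def
      proof (rule schur_complement_form[where A = "\<lambda>i j. G i j z"])
        show "G j i z = cnj (G i j z)" if "i \<le> m" "j \<le> m" for i j
          using that by (intro herm[OF z]) auto
      qed (use gpos[OF z] in \<open>simp add: g_def\<close>)
      obtain r where r: "g z = of_real r" "r \<ge> 0" using nonneg_Reals_cases[of "g z"] gpos[OF z] by blast
      then have "r > 0" using gpos[OF z] by (auto simp: less_le)
      then show ?thesis using Y by (simp only: eq[symmetric] r(1) times_complex.sel Re_complex_of_real Im_complex_of_real) simp
    qed
  qed
  then obtain c' F' where c': "c' \<noteq> 0" and F': "\<And>z k l. cmod z = 1 \<Longrightarrow> z \<notin> S \<Longrightarrow> k < m \<Longrightarrow> l < m \<Longrightarrow>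
    (\<Sum>i<m. cnj (poly (F' i k) z) * poly (F' i l) z) = of_real ((cmod (poly c' z))\<^sup>2) * H k l z"
    by blast
  obtain a K where a: "\<And>l z. l < Suc m \<Longrightarrow> cmod z = 1 \<Longrightarrow> G 0 l z = poly (a l) z * cnj z ^ K l"
  proof -
    have "\<forall>l. \<exists>a K. l < Suc m \<longrightarrow> (\<forall>z. cmod z = 1 \<longrightarrow> G 0 l z = poly a z * cnj z ^ K)"
      using trig[of 0] unfolding trig_def by blast
    then obtain a K where "\<forall>l. l < Suc m \<longrightarrow> (\<forall>z. cmod z = 1 \<longrightarrow> G 0 l z = poly (a l) z * cnj z ^ K l)"
      by metis
    then show ?thesis using that by blast
  qed
  have "nonneg_on_circle (a 0)" unfolding nonneg_on_circle_def
    using gpos a[of 0] by (intro exI[of _ S] exI[of _ "K 0"] exI[of _ 0]) (auto simp: g_def S)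
  moreover have "a 0 \<noteq> 0"
  proof
    assume "a 0 = 0"
    obtain z where "cmod z = 1" "z \<notin> S"
      using infinite_imp_nonempty[OF Diff_infinite_finite[OF S infinite_circle]] by auto
    then show False using gpos[of z] a[of 0 z] \<open>a 0 = 0\<close> by (simp add: g_def)
  qed
  ultimately obtain \<gamma> where \<gamma>: "\<gamma> \<noteq> 0" "\<And>z. cmod z = 1 \<Longrightarrow> cmod (poly (a 0) z) = (cmod (poly \<gamma> z))\<^sup>2"
    using fejer_riesz by blast
  have g\<gamma>: "g z = of_real ((cmod (poly \<gamma> z))\<^sup>2)" if z: "cmod z = 1" "z \<notin> S" for z
  proof -
    have "g z = of_real (cmod (g z))" using gpos[OF z] by (auto elim!: nonneg_Reals_cases)
    also have "cmod (g z) = (cmod (poly \<gamma> z))\<^sup>2"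
      using a[of 0 z] z by (simp add: g_def norm_mult norm_power \<gamma>)
    finally show ?thesis .
  qed
  \<comment> \<open>A common exponent: multiplying the first row by \<open>z ^ N\<close> makes it
    polynomial, and this unimodular factor drops out of the Gram sums.\<close>
  define N where "N = (\<Sum>l<Suc m. K l)"
  define F where "F i l = (case i of 0 \<Rightarrow> c' * (a l * monom 1 (N - K l))
     | Suc i \<Rightarrow> (case l of 0 \<Rightarrow> 0 | Suc l \<Rightarrow> F' i l))" for i l
  have F0: "poly (F 0 l) z = poly c' z * z ^ N * G 0 l z" if "l < Suc m" "cmod z = 1" for l z
  proof -
    have "K l \<le> N" unfolding N_def using that(1) by (intro member_le_sum) auto
    then have "z ^ N * cnj z ^ K l = z ^ (N - K l) * (cnj z ^ K l * z ^ K l)"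
      by (simp add: mult_ac flip: power_add)
    then have "z ^ N * cnj z ^ K l = z ^ (N - K l)" by (simp only: circle_cnj_mult_power[OF that(2)] mult_1_right)
    then show ?thesis using a[OF that] by (simp add: F_def poly_monom mult_ac)
  qed
  have row0: "cnj (poly (F 0 k) z) * poly (F 0 l) z
      = of_real ((cmod (poly c' z))\<^sup>2) * (G k 0 z * G 0 l z)"
    if "k < Suc m" "l < Suc m" "cmod z = 1" "z \<notin> S" for k l z
  proof -
    have "cnj (poly (F 0 k) z) * poly (F 0 l) z
      = (poly c' z * cnj (poly c' z)) * (cnj z ^ N * z ^ N) * (cnj (G 0 k z) * G 0 l z)"
      using that by (simp add: F0 mult_ac)
    also have "\<dots> = of_real ((cmod (poly c' z))\<^sup>2) * (G k 0 z * G 0 l z)"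
      unfolding complex_norm_square circle_cnj_mult_power[OF that(3)]
      using herm[OF that(3,4), of 0 k] that by simp
    finally show ?thesis .
  qed
  show ?case
  proof (intro exI[of _ "c' * \<gamma>"] exI[of _ F] conjI allI impI)
    show "c' * \<gamma> \<noteq> 0" using c' \<gamma> by simp
    fix z k l assume z: "cmod z = 1" "z \<notin> S" and k: "k < Suc m" and l: "l < Suc m"
    define C where "C = complex_of_real ((cmod (poly c' z))\<^sup>2)"
    have tot: "of_real ((cmod (poly (c' * \<gamma>) z))\<^sup>2) = C * g z"
      using g\<gamma>[OF z] by (simp add: C_def norm_mult power_mult_distrib)
    have "(\<Sum>i<Suc m. cnj (poly (F i k) z) * poly (F i l) z)
      = C * (G k 0 z * G 0 l z) + (\<Sum>i<m. cnj (poly (F (Suc i) k) z) * poly (F (Suc i) l) z)"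
      unfolding sum.lessThan_Suc_shift[of _ m] row0[OF k l z] C_def ..
    also have "(\<Sum>i<m. cnj (poly (F (Suc i) k) z) * poly (F (Suc i) l) z)
       = C * (g z * G k l z - G k 0 z * G 0 l z)"
    \<comment> \<open>With an index 0 both sides vanish: the later rows of \<open>F\<close> begin
      with 0, and the Schur complement expression cancels by the definition of
      \<open>g\<close>.\<close>
    proof (cases "k = 0 \<or> l = 0")
      case True
      then show ?thesis by (auto simp: F_def g_def)
    next
      case False
      then obtain k' l' where "k = Suc k'" "l = Suc l'" by (metis not0_implies_Suc)
      then show ?thesis using F'[OF z, of k' l'] k l by (simp add: F_def H_def C_def)
    qed
    finally show "(\<Sum>i<Suc m. cnj (poly (F i k) z) * poly (F i l) z)
      = of_real ((cmod (poly (c' * \<gamma>) z))\<^sup>2) * G k l z"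
      unfolding tot by (simp add: algebra_simps)
  qed
qed

section \<open>Outer matrix polynomials\<close>

lemma adjoint_dim [simp]: "dim_row (mat_adjoint A) = dim_col A" "dim_col (mat_adjoint A) = dim_row A"
  by (auto simp: mat_adjoint_def)

lemma adjoint_carrier [simp]: "A \<in> carrier_mat n m \<Longrightarrow> mat_adjoint A \<in> carrier_mat m n"
  unfolding carrier_mat_def by simp

lemma adjoint_index [simp]:
  "i < dim_col A \<Longrightarrow> j < dim_row A \<Longrightarrow> mat_adjoint A $$ (i, j) = cnj (A $$ (j, i))"
  unfolding mat_adjoint_def by (subst mat_of_rows_index) auto

lemma mult_index:
  "A \<in> carrier_mat n k \<Longrightarrow> B \<in> carrier_mat k m \<Longrightarrow> i < n \<Longrightarrow> j < m \<Longrightarrow>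
    (A * B) $$ (i, j) = (\<Sum>l<k. A $$ (i, l) * B $$ (l, j))"
  by (auto simp: scalar_prod_def atLeast0LessThan)

lemma mult_vec_index:
  "A \<in> carrier_mat n k \<Longrightarrow> v \<in> carrier_vec k \<Longrightarrow> i < n \<Longrightarrow> (A *\<^sub>v v) $ i = (\<Sum>l<k. A $$ (i, l) * v $ l)"
  by (auto simp: scalar_prod_def atLeast0LessThan)

lemma cinner_sum: "w \<in> carrier_vec n \<Longrightarrow> v \<bullet>c w = (\<Sum>i<n. v $ i * cnj (w $ i))"
  by (auto simp: scalar_prod_def atLeast0LessThan)

lemma adjoint_adjoint: "mat_adjoint (mat_adjoint A) = (A :: complex mat)"
  by (rule eq_matI) auto

lemma adjoint_mult:
  assumes "A \<in> carrier_mat n k" "B \<in> carrier_mat k m"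
  shows "mat_adjoint (A * B) = mat_adjoint B * (mat_adjoint A :: complex mat)"
proof (rule eq_matI)
  fix i j assume "i < dim_row (mat_adjoint B * mat_adjoint A)" "j < dim_col (mat_adjoint B * mat_adjoint A)"
  then have ij: "i < m" "j < n" using assms by auto
  have "mat_adjoint (A * B) $$ (i, j) = cnj ((A * B) $$ (j, i))" using ij assms by (intro adjoint_index) auto
  also have "\<dots> = (\<Sum>l<k. mat_adjoint B $$ (i, l) * mat_adjoint A $$ (l, j))"
    unfolding mult_index[OF assms ij(2,1)] cnj_sum using assms ij
    by (intro sum.cong) (auto simp: mult.commute)
  also have "\<dots> = (mat_adjoint B * mat_adjoint A) $$ (i, j)"
    by (rule mult_index[symmetric, of _ m k _ n]) (use assms ij in auto)
  finally show "mat_adjoint (A * B) $$ (i, j) = (mat_adjoint B * mat_adjoint A) $$ (i, j)" .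
qed (use assms in auto)

lemma adjoint_add:
  "A \<in> carrier_mat n k \<Longrightarrow> B \<in> carrier_mat n k \<Longrightarrow> mat_adjoint (A + B) = mat_adjoint A + (mat_adjoint B :: complex mat)"
  by (rule eq_matI) auto

lemma adjoint_smult: "mat_adjoint (c \<cdot>\<^sub>m A) = cnj c \<cdot>\<^sub>m (mat_adjoint A :: complex mat)"
  by (rule eq_matI) auto

lemma adjoint_one: "mat_adjoint (1\<^sub>m n) = (1\<^sub>m n :: complex mat)"
  by (rule eq_matI) auto

lemma cinner_adjoint:
  fixes A :: "complex mat"
  assumes A: "A \<in> carrier_mat m n" and x: "x \<in> carrier_vec n" and y: "y \<in> carrier_vec m"
  shows "(A *\<^sub>v x) \<bullet>c y = x \<bullet>c (mat_adjoint A *\<^sub>v y)"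
proof -
  have "(A *\<^sub>v x) \<bullet>c y = (\<Sum>i<m. \<Sum>j<n. A $$ (i, j) * x $ j * cnj (y $ i))"
    unfolding cinner_sum[OF y] by (intro sum.cong) (auto simp: mult_vec_index[OF A x] sum_distrib_right)
  also have "\<dots> = (\<Sum>j<n. \<Sum>i<m. A $$ (i, j) * x $ j * cnj (y $ i))" by (rule sum.swap)
  also have "\<dots> = (\<Sum>j<n. x $ j * cnj ((mat_adjoint A *\<^sub>v y) $ j))"
  proof (rule sum.cong[OF refl])
    fix j assume j: "j \<in> {..<n}"
    have "cnj ((mat_adjoint A *\<^sub>v y) $ j) = (\<Sum>i<m. A $$ (i, j) * cnj (y $ i))"
      using A j by (subst mult_vec_index[of _ n m]) (auto simp: y)
    then show "(\<Sum>i<m. A $$ (i, j) * x $ j * cnj (y $ i)) = x $ j * cnj ((mat_adjoint A *\<^sub>v y) $ j)"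
      by (simp add: sum_distrib_left mult_ac)
  qed
  also have "\<dots> = x \<bullet>c (mat_adjoint A *\<^sub>v y)"
    by (rule cinner_sum[symmetric]) (use A y in \<open>simp add: mult_mat_vec_carrier[of _ n m]\<close>)
  finally show ?thesis .
qed

lemma unitary_mat_carrier [dest]: "unitary_mat n U \<Longrightarrow> U \<in> carrier_mat n n"
  by (simp add: unitary_mat_def)

lemma unitary_matI:
  assumes "U \<in> carrier_mat n n" "mat_adjoint U * U = 1\<^sub>m n" shows "unitary_mat n U"
  using assms mat_mult_left_right_inverse[of "mat_adjoint U" n U] by (simp add: unitary_mat_def)

lemma unitary_mat_adjoint: "unitary_mat n U \<Longrightarrow> unitary_mat n (mat_adjoint U)"
  by (auto simp: unitary_mat_def adjoint_adjoint)

lemma unitary_mat_mult: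
  assumes U: "unitary_mat n U" and V: "unitary_mat n V" shows "unitary_mat n (U * V)"
proof (rule unitary_matI)
  have c: "U \<in> carrier_mat n n" "V \<in> carrier_mat n n" using U V by auto
  then show "U * V \<in> carrier_mat n n" by simp
  have "mat_adjoint (U * V) * (U * V) = mat_adjoint V * (mat_adjoint U * U) * V"
  proof -
    have "mat_adjoint V * mat_adjoint U * (U * V) = mat_adjoint V * (mat_adjoint U * (U * V))"
      using c by (intro assoc_mult_mat[of _ n n _ n _ n]) auto
    also have "mat_adjoint U * (U * V) = mat_adjoint U * U * V"
      using c by (intro assoc_mult_mat[symmetric, of _ n n _ n _ n]) auto
    also have "mat_adjoint V * \<dots> = mat_adjoint V * (mat_adjoint U * U) * V"
      using c by (intro assoc_mult_mat[symmetric, of _ n n _ n _ n]) auto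
    finally show ?thesis by (simp add: adjoint_mult[OF c])
  qed
  then show "mat_adjoint (U * V) * (U * V) = 1\<^sub>m n" using U V c by (simp add: unitary_mat_def)
qed

lemma unitary_mat_cancel:
  assumes "unitary_mat n U" "x \<in> carrier_vec n"
  shows "mat_adjoint U *\<^sub>v (U *\<^sub>v x) = x" "U *\<^sub>v (mat_adjoint U *\<^sub>v x) = x"
  using assms by (auto simp: unitary_mat_def simp flip: assoc_mult_mat_vec[of _ n n _ n])

lemma unitary_mat_cinner:
  assumes U: "unitary_mat n U" and x: "x \<in> carrier_vec n" "y \<in> carrier_vec n"
  shows "(U *\<^sub>v x) \<bullet>c (U *\<^sub>v y) = x \<bullet>c y"
  using cinner_adjoint[of U n n x "U *\<^sub>v y"] unitary_mat_cancel[OF U x(2)] U x by auto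

section \<open>Matrices with polynomial entries\<close>

definition polyfun :: "(complex \<Rightarrow> complex) \<Rightarrow> bool" where
  "polyfun g \<longleftrightarrow> (\<exists>p. g = poly p)"

lemma polyfun_poly [intro]: "polyfun (poly p)" by (auto simp: polyfun_def)

lemma polyfun_const [intro]: "polyfun (\<lambda>_. c)"
  unfolding polyfun_def by (intro exI[of _ "[:c:]"]) auto

lemma polyfun_id [intro]: "polyfun (\<lambda>z. z)"
  unfolding polyfun_def by (intro exI[of _ "[:0, 1:]"]) auto

lemma polyfun_add [intro]: "polyfun f \<Longrightarrow> polyfun g \<Longrightarrow> polyfun (\<lambda>z. f z + g z)"
  unfolding polyfun_def by (elim exE, rule exI[of _ "_ + _"], rule ext, simp)

lemma polyfun_mult [intro]: "polyfun f \<Longrightarrow> polyfun g \<Longrightarrow> polyfun (\<lambda>z. f z * g z)"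
  unfolding polyfun_def by (elim exE, rule exI[of _ "_ * _"], rule ext, simp)

lemma polyfun_minus [intro]: "polyfun f \<Longrightarrow> polyfun (\<lambda>z. - f z)"
  unfolding polyfun_def by (elim exE, rule exI[of _ "- _"], rule ext, simp)

lemma polyfun_diff [intro]: "polyfun f \<Longrightarrow> polyfun g \<Longrightarrow> polyfun (\<lambda>z. f z - g z)"
  unfolding polyfun_def by (elim exE, rule exI[of _ "_ - _"], rule ext, simp)

lemma polyfun_sum [intro]: "(\<And>i. i \<in> A \<Longrightarrow> polyfun (f i)) \<Longrightarrow> polyfun (\<lambda>z. \<Sum>i\<in>A. f i z)"
  by (induction A rule: infinite_finite_induct) auto

lemma polyfun_prod [intro]: "(\<And>i. i \<in> A \<Longrightarrow> polyfun (f i)) \<Longrightarrow> polyfun (\<lambda>z. \<Prod>i\<in>A. f i z)"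
  by (induction A rule: infinite_finite_induct) auto

lemma polyfun_trig: "polyfun f \<Longrightarrow> trig f"
  by (auto simp: polyfun_def trig_poly)

text \<open>A matrix polynomial is given by its values, so that matrix arithmetic at each point is
  available directly; being polynomial is a property of the entry functions.\<close>

definition polymat :: "nat \<Rightarrow> (complex \<Rightarrow> complex mat) \<Rightarrow> bool" where
  "polymat m F \<longleftrightarrow> (\<forall>z. F z \<in> carrier_mat m m) \<and> (\<forall>i<m. \<forall>j<m. polyfun (\<lambda>z. F z $$ (i, j)))"

lemma polymat_carrier: "polymat m F \<Longrightarrow> F z \<in> carrier_mat m m" by (simp add: polymat_def)

lemma polymat_dims: "polymat m F \<Longrightarrow> dim_row (F z) = m \<and> dim_col (F z) = m"
  by (auto dest: polymat_carrier[of _ _ z])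

lemma polymat_entry: "polymat m F \<Longrightarrow> i < m \<Longrightarrow> j < m \<Longrightarrow> polyfun (\<lambda>z. F z $$ (i, j))"
  by (simp add: polymat_def)

lemma polymat_mat:
  assumes "\<And>i j. i < m \<Longrightarrow> j < m \<Longrightarrow> polyfun (\<lambda>z. f z i j)"
  shows "polymat m (\<lambda>z. mat m m (\<lambda>(i, j). f z i j))"
  unfolding polymat_def using assms by auto

lemma polymat_mult:
  assumes "polymat m F" "polymat m G" shows "polymat m (\<lambda>z. F z * G z)"
  unfolding polymat_def
proof (intro conjI allI impI)
  fix i j assume ij: "i < m" "j < m"
  have "(F z * G z) $$ (i, j) = (\<Sum>l<m. F z $$ (i, l) * G z $$ (l, j))" for z
    by (rule mult_index[OF polymat_carrier[OF assms(1), of z] polymat_carrier[OF assms(2), of z] ij])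
  then show "polyfun (\<lambda>z. (F z * G z) $$ (i, j))"
    using ij by (simp only:) (intro polyfun_sum polyfun_mult polymat_entry[OF assms(1)] polymat_entry[OF assms(2)]; simp)
next
  fix z show "F z * G z \<in> carrier_mat m m"
    using polymat_carrier[OF assms(1), of z] polymat_carrier[OF assms(2), of z] by simp
qed

lemma polyfun_det:
  assumes "polymat m F" shows "polyfun (\<lambda>z. det (F z))"
proof -
  have "det (F z) = (\<Sum> p \<in> {p. p permutes {0 ..< m}}. signof p * (\<Prod> i = 0 ..< m. F z $$ (i, p i)))" for z
    by (rule det_def'[OF polymat_carrier[OF assms]])
  moreover have "polyfun (\<lambda>z. \<Sum> p \<in> {p. p permutes {0 ..< m}}. signof p * (\<Prod> i = 0 ..< m. F z $$ (i, p i)))"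
    by (intro polyfun_sum polyfun_mult polyfun_prod polyfun_const polymat_entry[OF assms])
       (auto simp: permutes_in_image)
  ultimately show ?thesis by simp
qed

text \<open>The adjugate serves as the polynomial substitute for the inverse.\<close>

lemma polymat_adj:
  assumes F: "polymat m F" shows "polymat m (\<lambda>z. adj_mat (F z))"
  unfolding polymat_def
proof (intro conjI allI impI)
  fix z show "adj_mat (F z) \<in> carrier_mat m m" by (rule adj_mat(1)[OF polymat_carrier[OF F]])
next
  fix i j assume ij: "i < m" "j < m"
  have del: "polymat (m - 1) (\<lambda>z. mat_delete (F z) j i)"
    unfolding polymat_def
  proof (intro conjI allI impI)
    fix z show "mat_delete (F z) j i \<in> carrier_mat (m - 1) (m - 1)"
      using polymat_dims[OF F, of z] by (auto simp: mat_delete_def)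
  next
    fix k l assume "k < m - 1" "l < m - 1"
    then have "mat_delete (F z) j i $$ (k, l) = F z $$ (if k < j then k else Suc k, if l < i then l else Suc l)" for z
      using polymat_dims[OF F, of z] by (simp add: mat_delete_def)
    then show "polyfun (\<lambda>z. mat_delete (F z) j i $$ (k, l))"
      using polymat_entry[OF F] \<open>k < m - 1\<close> \<open>l < m - 1\<close> by simp
  qed
  have "adj_mat (F z) $$ (i, j) = (- 1) ^ (j + i) * det (mat_delete (F z) j i)" for z
    using polymat_dims[OF F, of z] ij by (simp add: adj_mat_def cofactor_def)
  then show "polyfun (\<lambda>z. adj_mat (F z) $$ (i, j))"
    using polyfun_det[OF del] by (simp add: polyfun_mult polyfun_const)
qed

text \<open>For a unit vector \<open>u\<close> this is the identity plus \<open>c\<close> times the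
  orthogonal projection onto \<open>u\<close>: it scales the direction of \<open>u\<close> by
  \<open>1 + c\<close>. With a Blaschke factor as \<open>1 + c\<close> it is an elementary
  Blaschke--Potapov factor.\<close>

definition rank_one_update :: "complex \<Rightarrow> complex vec \<Rightarrow> complex mat" where
  "rank_one_update c u = mat (dim_vec u) (dim_vec u) (\<lambda>(i, j). (if i = j then 1 else 0) + c * u $ i * cnj (u $ j))"

lemma rank_one_update_index:
  assumes u: "u \<in> carrier_vec n" and ij: "i < n" "j < n"
  shows "rank_one_update c u $$ (i, j) = (if i = j then 1 else 0) + c * u $ i * cnj (u $ j)"
proof -
  have d: "dim_vec u = n" using u by (rule carrier_vecD)
  show ?thesis unfolding rank_one_update_def d using ij by (simp only: index_mat(1) prod.case)
qed

lemma rank_one_update_carrier [simp]: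
  "u \<in> carrier_vec n \<Longrightarrow> rank_one_update c u \<in> carrier_mat n n"
  by (auto simp: rank_one_update_def)

lemma rank_one_update_dims:
  "u \<in> carrier_vec n \<Longrightarrow> dim_row (rank_one_update c u) = n"
  "u \<in> carrier_vec n \<Longrightarrow> dim_col (rank_one_update c u) = n"
  by (auto simp: rank_one_update_def)

lemma rank_one_update_mult_index:
  assumes A: "A \<in> carrier_mat n k" and u: "u \<in> carrier_vec n" and ij: "i < n" "j < k"
  shows "(rank_one_update c u * A) $$ (i, j) = A $$ (i, j) + c * u $ i * (\<Sum>l<n. cnj (u $ l) * A $$ (l, j))"
proof -
  have "(rank_one_update c u * A) $$ (i, j) = (\<Sum>l<n. ((if i = l then 1 else 0) + c * u $ i * cnj (u $ l)) * A $$ (l, j))"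
    unfolding mult_index[OF rank_one_update_carrier[OF u] A ij]
    by (intro sum.cong refl arg_cong2[where f = "(*)"] rank_one_update_index[OF u ij(1)]) simp
  also have "\<dots> = (\<Sum>l<n. (if i = l then A $$ (l, j) else 0) + c * u $ i * (cnj (u $ l) * A $$ (l, j)))"
    by (intro sum.cong) (auto simp: algebra_simps)
  finally show ?thesis using ij by (simp add: sum.distrib sum_distrib_left)
qed

lemma rank_one_update_mult_vec:
  assumes u: "u \<in> carrier_vec n" and x: "x \<in> carrier_vec n"
  shows "rank_one_update c u *\<^sub>v x = x + (c * (x \<bullet>c u)) \<cdot>\<^sub>v u"
proof -
  define s where "s = x \<bullet>c u"
  have s: "s = (\<Sum>l<n. x $ l * cnj (u $ l))" unfolding s_def by (rule cinner_sum[OF u])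
  have "rank_one_update c u *\<^sub>v x = x + (c * s) \<cdot>\<^sub>v u"
  proof (rule eq_vecI)
    fix i assume "i < dim_vec (x + (c * s) \<cdot>\<^sub>v u)"
    then have i: "i < n" using u by simp
    have "(rank_one_update c u *\<^sub>v x) $ i = (\<Sum>l<n. ((if i = l then 1 else 0) + c * u $ i * cnj (u $ l)) * x $ l)"
      unfolding mult_vec_index[OF rank_one_update_carrier[OF u] x i]
      by (intro sum.cong refl arg_cong2[where f = "(*)"] rank_one_update_index[OF u i]) simp
    also have "\<dots> = (\<Sum>l<n. (if i = l then x $ l else 0) + c * u $ i * (x $ l * cnj (u $ l)))"
      by (intro sum.cong) (auto simp: algebra_simps)
    also have "\<dots> = x $ i + c * u $ i * s"
      using i by (simp add: sum.distrib sum_distrib_left s)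
    finally show "(rank_one_update c u *\<^sub>v x) $ i = (x + (c * s) \<cdot>\<^sub>v u) $ i" using u x i by simp
  qed (use u x in \<open>auto simp: rank_one_update_def\<close>)
  then show ?thesis by (simp only: s_def)
qed

text \<open>Both \<open>M * L\<close> and \<open>L * M\<close> are block upper triangular, one with
  diagonal blocks the update and 1, the other with the identity and \<open>1 + c\<close>; their
  determinants agree.\<close>

lemma det_rank_one_update:
  assumes u: "u \<in> carrier_vec n" and unit: "u \<bullet>c u = 1"
  shows "det (rank_one_update c u) = 1 + c"
proof -
  define R where "R = mat 1 n (\<lambda>(_ :: nat, j). cnj (u $ j))"
  define N where "N = mat 1 n (\<lambda>(_ :: nat, j). - cnj (u $ j))"
  define K where "K = mat n 1 (\<lambda>(i, _ :: nat). - c * u $ i)"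
  define I1 where "I1 = (1\<^sub>m 1 :: complex mat)"
  define In where "In = (1\<^sub>m n :: complex mat)"
  define Z where "Z = (0\<^sub>m n 1 :: complex mat)"
  define Z' where "Z' = (0\<^sub>m 1 n :: complex mat)"
  have dims: "R \<in> carrier_mat 1 n" "N \<in> carrier_mat 1 n" "K \<in> carrier_mat n 1" "I1 \<in> carrier_mat 1 1"
    "In \<in> carrier_mat n n" "Z \<in> carrier_mat n 1" "Z' \<in> carrier_mat 1 n"
    unfolding R_def K_def I1_def In_def N_def Z_def Z'_def by (rule mat_carrier one_carrier_mat zero_carrier_mat)+
  have one: "0 < (1::nat)" by simp
  have sq: "(\<Sum>l<n. u $ l * cnj (u $ l)) = 1" using unit unfolding cinner_sum[OF u] .
  have NK: "(N * K) $$ (0, 0) = c"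
  proof -
    have "(N * K) $$ (0, 0) = (\<Sum>l<n. c * (u $ l * cnj (u $ l)))"
      unfolding mult_index[OF dims(2,3) one one]
      by (intro sum.cong refl) (simp add: N_def K_def)
    then show ?thesis by (simp add: sq flip: sum_distrib_left)
  qed
  have KN: "In * In + K * N = rank_one_update c u"
  proof (rule eq_matI)
    fix i j assume "i < dim_row (rank_one_update c u)" "j < dim_col (rank_one_update c u)"
    then have ij: "i < n" "j < n" using rank_one_update_dims[OF u] by simp_all
    have "(K * N) $$ (i, j) = c * u $ i * cnj (u $ j)"
      unfolding mult_index[OF dims(3,2) ij] using ij by (simp add: N_def K_def)
    then show "(In * In + K * N) $$ (i, j) = rank_one_update c u $$ (i, j)"
      unfolding rank_one_update_index[OF u ij]
      using ij dims by (simp add: In_def)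
  qed (use dims carrier_matD[OF rank_one_update_carrier[OF u]] in simp_all)
  have RN: "R * In + I1 * N = Z'" "N * In + I1 * R = Z'"
    unfolding right_mult_one_mat[OF dims(1), folded In_def] right_mult_one_mat[OF dims(2), folded In_def]
      left_mult_one_mat[OF dims(1), folded I1_def] left_mult_one_mat[OF dims(2), folded I1_def]
    by (rule eq_matI; simp add: R_def N_def Z'_def)+
  have K_eq: "In * Z + K * I1 = K" "In * K + Z * I1 = K"
    unfolding In_def I1_def Z_def using dims(3) by (simp_all add: right_mult_one_mat[OF dims(3)] left_mult_one_mat[OF dims(3)])
  have In_eq: "In * In + Z * R = In"
    unfolding In_def Z_def using dims(1) by simp
  have I1_eq: "R * Z + I1 * I1 = I1"
    unfolding I1_def Z_def using dims(1) by simp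
  define M where "M = four_block_mat In K R I1"
  define L where "L = four_block_mat In Z N I1"
  have Mc: "M \<in> carrier_mat (n + 1) (n + 1)" "L \<in> carrier_mat (n + 1) (n + 1)"
    unfolding M_def L_def by (rule four_block_carrier_mat[OF dims(5,4)])+
  have prod1: "M * L = four_block_mat (rank_one_update c u) K Z' I1"
    unfolding M_def L_def mult_four_block_mat[OF dims(5,3,1,4,5,6,2,4)] KN RN K_eq I1_eq by (rule refl)
  have prod2: "L * M = four_block_mat In K Z' (N * K + I1 * I1)"
    unfolding M_def L_def mult_four_block_mat[OF dims(5,6,2,4,5,3,1,4)] In_eq RN K_eq by (rule refl)
  have "det (rank_one_update c u) * det I1 = det M * det L"
    unfolding det_mult[OF Mc, symmetric] prod1
    by (rule det_four_block_mat_lower_left_zero[symmetric, OF rank_one_update_carrier[OF u] dims(3) _ dims(4)])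
       (simp add: Z'_def)
  also have "\<dots> = det L * det M" by simp
  also have "\<dots> = det In * det (N * K + I1 * I1)"
    unfolding det_mult[OF Mc(2,1), symmetric] prod2
    by (rule det_four_block_mat_lower_left_zero[OF dims(5,3)]) (use dims in \<open>simp_all add: Z'_def\<close>)
  also have "det (N * K + I1 * I1) = (N * K + I1 * I1) $$ (0, 0)"
    by (rule det_single) (use dims in simp)
  also have "\<dots> = 1 + c" using NK dims by (simp add: I1_def)
  finally show ?thesis by (simp add: In_def I1_def)
qed

lemma unit_vec_sum:
  "u \<in> carrier_vec n \<Longrightarrow> u \<bullet>c u = 1 \<Longrightarrow> (\<Sum>l<n. cnj (u $ l) * u $ l) = 1"
  using cinner_sum[of u n u] by (simp add: mult.commute)

text \<open>In the direction of \<open>u\<close> the scalars multiply as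
  \<open>(1 + c) * (1 + d)\<close>.\<close>

lemma rank_one_update_mult:
  assumes u: "u \<in> carrier_vec n" "u \<bullet>c u = 1"
  shows "rank_one_update c u * rank_one_update d u = rank_one_update (c + d + c * d) u"
proof (rule eq_matI)
  fix i j assume "i < dim_row (rank_one_update (c + d + c * d) u)" "j < dim_col (rank_one_update (c + d + c * d) u)"
  then have ij: "i < n" "j < n" using rank_one_update_dims[OF u(1)] by simp_all
  have "(\<Sum>l<n. cnj (u $ l) * rank_one_update d u $$ (l, j))
      = (\<Sum>l<n. (if l = j then cnj (u $ l) else 0) + d * cnj (u $ j) * (cnj (u $ l) * u $ l))"
    using ij by (intro sum.cong refl) (simp add: rank_one_update_index[OF u(1)] algebra_simps)
  also have "\<dots> = cnj (u $ j) + d * cnj (u $ j) * (\<Sum>l<n. cnj (u $ l) * u $ l)"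
    using ij unfolding sum.distrib sum_distrib_left by simp
  also have "\<dots> = cnj (u $ j) * (1 + d)"
    unfolding unit_vec_sum[OF u] by (simp add: algebra_simps)
  finally have "(rank_one_update c u * rank_one_update d u) $$ (i, j)
      = rank_one_update d u $$ (i, j) + c * u $ i * (cnj (u $ j) * (1 + d))"
    using rank_one_update_mult_index[OF rank_one_update_carrier[OF u(1)] u(1) ij] by simp
  then show "(rank_one_update c u * rank_one_update d u) $$ (i, j) = rank_one_update (c + d + c * d) u $$ (i, j)"
    unfolding rank_one_update_index[OF u(1) ij] by (simp add: algebra_simps)
qed (use carrier_matD[OF rank_one_update_carrier[OF u(1)]] in simp_all)

lemma rank_one_update_0: "u \<in> carrier_vec n \<Longrightarrow> rank_one_update 0 u = 1\<^sub>m n"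
  by (rule eq_matI) (auto simp: rank_one_update_def)

lemma rank_one_update_adjoint:
  assumes u: "u \<in> carrier_vec n"
  shows "mat_adjoint (rank_one_update c u) = rank_one_update (cnj c) u"
proof (rule eq_matI)
  fix i j assume "i < dim_row (rank_one_update (cnj c) u)" "j < dim_col (rank_one_update (cnj c) u)"
  then have ij: "i < n" "j < n" using rank_one_update_dims[OF u] by simp_all
  then show "mat_adjoint (rank_one_update c u) $$ (i, j) = rank_one_update (cnj c) u $$ (i, j)"
    using carrier_matD[OF rank_one_update_carrier[OF u]]
    by (subst adjoint_index) (auto simp: rank_one_update_index[OF u])
qed (use carrier_matD[OF rank_one_update_carrier[OF u]] in simp_all)

lemma rank_one_update_unitary:
  assumes u: "u \<in> carrier_vec n" "u \<bullet>c u = 1" and c: "cmod (1 + c) = 1"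
  shows "unitary_mat n (rank_one_update c u)"
proof (rule unitary_matI[OF rank_one_update_carrier[OF u(1)]])
  have "(1 + c) * cnj (1 + c) = 1" using c by (metis complex_norm_square of_real_1 one_power2)
  then have "cnj c + c + cnj c * c = 0" by (simp add: algebra_simps)
  then show "mat_adjoint (rank_one_update c u) * rank_one_update c u = 1\<^sub>m n"
    unfolding rank_one_update_adjoint[OF u(1)] rank_one_update_mult[OF u] by (simp add: rank_one_update_0[OF u(1)])
qed

text \<open>A null vector of the transpose, conjugated so that the adjoint of \<open>u\<close>
  annihilates \<open>A\<close> from the left, and normalised as \<open>rank_one_update\<close>
  requires.\<close>

lemma left_null_vector:
  fixes A :: "complex mat"
  assumes A: "A \<in> carrier_mat n n" and det: "det A = 0"
  obtains u :: "complex Matrix.vec"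
    where "u \<in> carrier_vec n" "u \<bullet>c u = 1" "\<And>j. j < n \<Longrightarrow> (\<Sum>l<n. cnj (u $ l) * A $$ (l, j)) = 0"
proof -
  have T: "transpose_mat A \<in> carrier_mat n n" using A by simp
  have "det (transpose_mat A) = 0" using det det_transpose[OF A] by simp
  then obtain v where v: "v \<in> carrier_vec n" "v \<noteq> 0\<^sub>v n" "transpose_mat A *\<^sub>v v = 0\<^sub>v n"
    using det_0_iff_vec_prod_zero[OF T] by blast
  define s where "s = (\<Sum>i<n. (cmod (v $ i))\<^sup>2)"
  have "\<exists>i<n. v $ i \<noteq> 0"
  proof (rule ccontr)
    assume "\<not> (\<exists>i<n. v $ i \<noteq> 0)"
    then have "v = 0\<^sub>v n" using v(1) by (intro eq_vecI) auto
    then show False using v(2) by blast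
  qed
  then obtain i where "i < n" "v $ i \<noteq> 0" by blast
  then have s: "s > 0" unfolding s_def by (intro sum_pos2[of _ i]) auto
  define u where "u = vec n (\<lambda>i. cnj (v $ i) / of_real (sqrt s))"
  have uc: "u \<in> carrier_vec n" by (simp add: u_def)
  have "u \<bullet>c u = (\<Sum>i<n. of_real ((cmod (v $ i))\<^sup>2) / of_real s)"
    unfolding cinner_sum[OF uc]
  proof (intro sum.cong refl)
    fix i assume i: "i \<in> {..<n}"
    have "complex_of_real (sqrt s) * of_real (sqrt s) = of_real s"
      using s by (simp flip: of_real_mult)
    moreover have "u $ i * cnj (u $ i) = (v $ i * cnj (v $ i)) / (of_real (sqrt s) * of_real (sqrt s))"
      using i by (simp add: u_def)
    ultimately show "u $ i * cnj (u $ i) = of_real ((cmod (v $ i))\<^sup>2) / of_real s"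
      by (simp only: complex_norm_square)
  qed
  also have "\<dots> = of_real s / of_real s" unfolding s_def of_real_sum sum_divide_distrib ..
  finally have unit: "u \<bullet>c u = 1" using s by simp
  have "(\<Sum>l<n. cnj (u $ l) * A $$ (l, j)) = 0" if j: "j < n" for j
  proof -
    have "(\<Sum>l<n. transpose_mat A $$ (j, l) * v $ l) = 0"
      using mult_vec_index[OF T v(1) j] v(3) j by simp
    moreover have "(\<Sum>l<n. transpose_mat A $$ (j, l) * v $ l) = (\<Sum>l<n. A $$ (l, j) * v $ l)"
      using A j by (intro sum.cong refl) simp
    moreover have "(\<Sum>l<n. cnj (u $ l) * A $$ (l, j)) = (\<Sum>l<n. A $$ (l, j) * v $ l) / of_real (sqrt s)"
      unfolding sum_divide_distrib by (intro sum.cong refl) (simp add: u_def mult.commute)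
    ultimately show ?thesis by simp
  qed
  then show ?thesis using that uc unit by blast
qed

text \<open>Left division by an elementary Blaschke factor moves a zero of the determinant out of the
  disc.\<close>

lemma blaschke_divide_left:
  assumes F: "polymat m F" and a: "cmod a < 1" and det: "det (F a) = 0"
  obtains F1 u where "polymat m F1" "u \<in> carrier_vec m" "u \<bullet>c u = 1"
    "\<And>z. z \<noteq> a \<Longrightarrow> F1 z = rank_one_update ((1 - cnj a * z) / (z - a) - 1) u * F z"
    "\<And>z. 1 - cnj a * z \<noteq> 0 \<Longrightarrow> F z = rank_one_update ((z - a) / (1 - cnj a * z) - 1) u * F1 z"
proof -
  obtain u where u: "u \<in> carrier_vec m" "u \<bullet>c u = 1"
    "\<And>j. j < m \<Longrightarrow> (\<Sum>l<m. cnj (u $ l) * F a $$ (l, j)) = 0"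
    using left_null_vector[OF polymat_carrier[OF F] det] by blast
  have "\<exists>r. \<forall>z. (\<Sum>l<m. cnj (u $ l) * F z $$ (l, j)) = (z - a) * poly r z" if j: "j < m" for j
  proof -
    have "polyfun (\<lambda>z. \<Sum>l<m. cnj (u $ l) * F z $$ (l, j))"
      by (intro polyfun_sum polyfun_mult polyfun_const polymat_entry[OF F]) (use j in auto)
    then obtain q where q: "\<And>z. (\<Sum>l<m. cnj (u $ l) * F z $$ (l, j)) = poly q z"
      unfolding polyfun_def by metis
    then have "poly q a = 0" using u(3)[OF j] by simp
    then obtain r where r: "q = [:- a, 1:] * r" by (auto simp: poly_eq_0_iff_dvd elim: dvdE)
    have "poly q z = (z - a) * poly r z" for z unfolding r by (simp add: algebra_simps)
    then show ?thesis using q by auto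
  qed
  then obtain r where r: "\<And>j z. j < m \<Longrightarrow> (\<Sum>l<m. cnj (u $ l) * F z $$ (l, j)) = (z - a) * poly (r j) z"
    by metis
  \<comment> \<open>Adding \<open>\<kappa> z\<close> times the rank one matrix formed by
    \<open>u\<close> and the quotients \<open>r\<close> turns the component
    \<open>(z - a) * r\<close> of \<open>F z\<close> along \<open>u\<close> into
    \<open>(1 - cnj a * z) * r\<close>. The result is polynomial and also defined at
    \<open>a\<close>.\<close>
  define \<kappa> where "\<kappa> z = 1 - cnj a * z - (z - a)" for z
  define F1 where "F1 z = mat m m (\<lambda>(i, j). F z $$ (i, j) + \<kappa> z * (u $ i * poly (r j) z))" for z
  have pm: "polymat m F1" unfolding F1_def \<kappa>_def
    by (intro polymat_mat polyfun_add polyfun_mult polyfun_diff polyfun_const polyfun_id polyfun_poly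
        polymat_entry[OF F])
  have Fc: "F z \<in> carrier_mat m m" for z by (rule polymat_carrier[OF F])
  have F1c: "F1 z \<in> carrier_mat m m" for z by (rule polymat_carrier[OF pm])
  have F1i: "F1 z $$ (i, j) = F z $$ (i, j) + \<kappa> z * (u $ i * poly (r j) z)" if "i < m" "j < m" for i j z
    using that by (simp add: F1_def)
  have uF1: "(\<Sum>l<m. cnj (u $ l) * F1 z $$ (l, j)) = (1 - cnj a * z) * poly (r j) z" if j: "j < m" for j z
  proof -
    have "(\<Sum>l<m. cnj (u $ l) * F1 z $$ (l, j))
      = (\<Sum>l<m. cnj (u $ l) * F z $$ (l, j) + \<kappa> z * poly (r j) z * (cnj (u $ l) * u $ l))"
      using j by (intro sum.cong refl) (simp add: F1i algebra_simps)
    also have "\<dots> = (z - a) * poly (r j) z + \<kappa> z * poly (r j) z"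
      using unit_vec_sum[OF u(1,2)] by (simp add: sum.distrib r[OF j] flip: sum_distrib_left)
    finally show ?thesis by (simp add: \<kappa>_def algebra_simps)
  qed
  have swap: "c * b * (d * e) = (c * d) * (b * e)" for b c d e :: complex by (simp only: mult_ac)
  show ?thesis
  proof (rule that[OF pm u(1,2)])
    fix z assume z: "z \<noteq> a"
    show "F1 z = rank_one_update ((1 - cnj a * z) / (z - a) - 1) u * F z"
    proof (rule eq_matI)
      fix i j assume "i < dim_row (rank_one_update ((1 - cnj a * z) / (z - a) - 1) u * F z)"
        "j < dim_col (rank_one_update ((1 - cnj a * z) / (z - a) - 1) u * F z)"
      then have ij: "i < m" "j < m" using carrier_matD[OF rank_one_update_carrier[OF u(1)]] Fc[of z] by auto
      have "((1 - cnj a * z) / (z - a) - 1) * (z - a) = \<kappa> z" using z by (simp add: \<kappa>_def field_simps)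
      then show "F1 z $$ (i, j) = (rank_one_update ((1 - cnj a * z) / (z - a) - 1) u * F z) $$ (i, j)"
        unfolding rank_one_update_mult_index[OF Fc u(1) ij] r[OF ij(2)] F1i[OF ij] by (subst swap) simp
    qed (use carrier_matD[OF rank_one_update_carrier[OF u(1)]] Fc[of z] F1c[of z] in auto)
  next
    fix z assume z: "1 - cnj a * z \<noteq> 0"
    show "F z = rank_one_update ((z - a) / (1 - cnj a * z) - 1) u * F1 z"
    proof (rule eq_matI)
      fix i j assume "i < dim_row (rank_one_update ((z - a) / (1 - cnj a * z) - 1) u * F1 z)"
        "j < dim_col (rank_one_update ((z - a) / (1 - cnj a * z) - 1) u * F1 z)"
      then have ij: "i < m" "j < m" using carrier_matD[OF rank_one_update_carrier[OF u(1)]] F1c[of z] by auto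
      have "((z - a) / (1 - cnj a * z) - 1) * (1 - cnj a * z) = - \<kappa> z" using z by (simp add: \<kappa>_def field_simps)
      then have "((z - a) / (1 - cnj a * z) - 1) * u $ i * ((1 - cnj a * z) * poly (r j) z)
          = - \<kappa> z * (u $ i * poly (r j) z)"
        by (subst swap) simp
      then show "F z $$ (i, j) = (rank_one_update ((z - a) / (1 - cnj a * z) - 1) u * F1 z) $$ (i, j)"
        unfolding rank_one_update_mult_index[OF F1c u(1) ij] uF1[OF ij(2)] F1i[OF ij] by simp
    qed (use carrier_matD[OF rank_one_update_carrier[OF u(1)]] Fc[of z] F1c[of z] in auto)
  qed
qed

section \<open>Moving zeros of the determinant out of the disc\<close>

lemma polymat_det_poly:
  assumes "polymat m F" obtains D where "\<And>z. det (F z) = poly D z"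
  using polyfun_det[OF assms] unfolding polyfun_def by metis

text \<open>The induction measure for splitting off Blaschke factors.\<close>

definition inner_count :: "complex poly \<Rightarrow> nat" where
  "inner_count D = size (filter_mset (\<lambda>x. cmod x < 1) (proots D))"

lemma inner_count_0:
  assumes "D \<noteq> 0" shows "inner_count D = 0 \<longleftrightarrow> (\<forall>z. cmod z < 1 \<longrightarrow> poly D z \<noteq> 0)"
  using assms by (auto simp: inner_count_def)

text \<open>The zero \<open>a\<close> is traded for a possible zero of \<open>1 - cnj a * z\<close>,
  which lies outside the disc.\<close>

lemma inner_count_move:
  assumes eq: "D1 * [:- a, 1:] = D * [:1, - cnj a:]" and D: "D \<noteq> 0" and a: "cmod a < 1"
  shows "D1 \<noteq> 0" "inner_count D = Suc (inner_count D1)"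
proof -
  have nz: "[:1, - cnj a:] \<noteq> 0" "[:- a, 1:] \<noteq> 0" by auto
  show D1: "D1 \<noteq> 0" using eq D nz by (metis mult_eq_0_iff)
  have "proots D1 + proots [:- a, 1:] = proots D + proots [:1, - cnj a:]"
    using arg_cong[OF eq, of proots] by (simp only: proots_mult[OF D1 nz(2)] proots_mult[OF D nz(1)])
  moreover have "filter_mset (\<lambda>x. cmod x < 1) (proots [:1, - cnj a:]) = {#}"
  proof -
    have "\<not> cmod x < 1" if "poly [:1, - cnj a:] x = 0" for x
    proof
      assume x: "cmod x < 1"
      have "x * cnj a = 1" using that by simp
      then have "cmod x * cmod a = 1" by (metis complex_mod_cnj norm_mult norm_one)
      moreover have "cmod x * cmod a < 1 * 1" by (rule mult_strict_mono) (use x a in auto)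
      ultimately show False by simp
    qed
    then show ?thesis using nz(1) by auto
  qed
  ultimately have fil: "filter_mset (\<lambda>x. cmod x < 1) (proots D) = filter_mset (\<lambda>x. cmod x < 1) (proots D1 + proots [:- a, 1:])"
    by simp
  show "inner_count D = Suc (inner_count D1)"
    using a unfolding inner_count_def fil by simp
qed

lemma blaschke_divide_det:
  assumes F: "polymat m F" and F1: "polymat m F1" and u: "u \<in> carrier_vec m" "u \<bullet>c u = 1"
    and eq: "\<And>z. z \<noteq> a \<Longrightarrow> F1 z = rank_one_update ((1 - cnj a * z) / (z - a) - 1) u * F z"
    and D: "\<And>z. det (F z) = poly D z" and D1: "\<And>z. det (F1 z) = poly D1 z"
  shows "D1 * [:- a, 1:] = D * [:1, - cnj a:]"
proof (rule poly_eq_on_circle[of "{a}"])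
  fix z assume "z \<notin> {a}"
  then have z: "z \<noteq> a" by simp
  have "poly D1 z = (1 - cnj a * z) / (z - a) * poly D z"
    unfolding D[symmetric] D1[symmetric] eq[OF z]
    by (simp add: det_mult[OF rank_one_update_carrier[OF u(1)] polymat_carrier[OF F]] det_rank_one_update[OF u])
  then show "poly (D1 * [:- a, 1:]) z = poly (D * [:1, - cnj a:]) z"
    using z by (simp add: field_simps)
qed simp

lemma blaschke_modulus_on_circle:
  assumes "cmod z = 1" "cmod a < 1"
  shows "cmod (1 - cnj a * z) = cmod (z - a)" "z \<noteq> a" "1 - cnj a * z \<noteq> 0"
proof -
  have "1 - cnj a * z = z * cnj (z - a)" using circle_cnj_mult[OF assms(1)] by (simp add: algebra_simps)
  then show "cmod (1 - cnj a * z) = cmod (z - a)" using assms(1) by (simp add: norm_mult del: complex_cnj_diff)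
  moreover show "z \<noteq> a" using assms by auto
  ultimately show "1 - cnj a * z \<noteq> 0" by auto
qed

lemma unitary_left_gram:
  fixes A V :: "complex mat"
  assumes V: "unitary_mat m V" and A: "A \<in> carrier_mat m m"
  shows "mat_adjoint (V * A) * (V * A) = mat_adjoint A * A"
proof -
  have Vc: "V \<in> carrier_mat m m" using V by auto
  have "mat_adjoint A * mat_adjoint V * (V * A) = mat_adjoint A * (mat_adjoint V * (V * A))"
    using A Vc by (intro assoc_mult_mat[of _ m m _ m _ m]) auto
  also have "mat_adjoint V * (V * A) = mat_adjoint V * V * A"
    using A Vc by (intro assoc_mult_mat[symmetric, of _ m m _ m _ m]) auto
  also have "\<dots> = A" using V A by (simp add: unitary_mat_def)
  finally show ?thesis by (simp add: adjoint_mult[OF Vc A])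
qed

lemma blaschke_divide_gram:
  assumes F: "polymat m F" and u: "u \<in> carrier_vec m" "u \<bullet>c u = 1" and a: "cmod a < 1" "cmod z = 1"
    and eq: "\<And>z. z \<noteq> a \<Longrightarrow> F1 z = rank_one_update ((1 - cnj a * z) / (z - a) - 1) u * F z"
  shows "mat_adjoint (F1 z) * F1 z = mat_adjoint (F z) * F z"
proof -
  note b = blaschke_modulus_on_circle[OF a(2,1)]
  have "cmod ((1 - cnj a * z) / (z - a)) = 1" using b by (simp add: norm_divide)
  then have "unitary_mat m (rank_one_update ((1 - cnj a * z) / (z - a) - 1) u)"
    by (intro rank_one_update_unitary[OF u]) simp
  from unitary_left_gram[OF this polymat_carrier[OF F]] show ?thesis using eq[OF b(2)] by simp
qed

text \<open>Induction on \<open>inner_count\<close>: every Blaschke factor split off is unitary on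
  the circle, so the Gram matrix there is unchanged. The hypothesis at \<open>z0\<close> makes the
  determinant a nonzero polynomial, with finitely many zeros.\<close>

theorem outer_factor:
  assumes "polymat m F" "det (F z0) \<noteq> 0"
  shows "\<exists>F1. polymat m F1 \<and> (\<forall>z. cmod z < 1 \<longrightarrow> det (F1 z) \<noteq> 0) \<and>
    (\<forall>z. cmod z = 1 \<longrightarrow> mat_adjoint (F1 z) * F1 z = mat_adjoint (F z) * F z)"
proof -
  obtain D where D: "\<And>z. det (F z) = poly D z" using polymat_det_poly[OF assms(1)] by blast
  have "D \<noteq> 0" using assms(2) D by auto
  with assms(1) D show ?thesis
  proof (induction "inner_count D" arbitrary: D F)
    case 0
    then show ?case using inner_count_0[of D] by (intro exI[of _ F]) auto
  next
    case (Suc n)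
    then obtain a where a: "cmod a < 1" "poly D a = 0" using inner_count_0[of D] by auto
    then have "det (F a) = 0" using Suc by simp
    from blaschke_divide_left[OF Suc.prems(1) a(1) this] obtain F1 u where
      F1: "polymat m F1" "u \<in> carrier_vec m" "u \<bullet>c u = 1"
      "\<And>z. z \<noteq> a \<Longrightarrow> F1 z = rank_one_update ((1 - cnj a * z) / (z - a) - 1) u * F z" by metis
    obtain D1 where D1: "\<And>z. det (F1 z) = poly D1 z" using polymat_det_poly[OF F1(1)] by blast
    have mv: "D1 * [:- a, 1:] = D * [:1, - cnj a:]"
      by (rule blaschke_divide_det[OF Suc.prems(1) F1 Suc.prems(2) D1])
    note im = inner_count_move[OF mv Suc.prems(3) a(1)]
    have "n = inner_count D1" using im(2) Suc.hyps(2) by simp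
    from Suc.hyps(1)[OF this F1(1) D1 im(1)] obtain F2 where F2: "polymat m F2"
      "\<forall>z. cmod z < 1 \<longrightarrow> det (F2 z) \<noteq> 0"
      "\<forall>z. cmod z = 1 \<longrightarrow> mat_adjoint (F2 z) * F2 z = mat_adjoint (F1 z) * F1 z" by blast
    show ?case
      using F2 blaschke_divide_gram[OF Suc.prems(1) F1(2,3) a(1) _ F1(4)] by (intro exI[of _ F2]) simp
  qed
qed

section \<open>Unitary colligations\<close>

text \<open>\<open>realizes m r U \<Psi>\<close>: \<open>\<Psi>\<close> is the transfer function of the unitary colligation \<open>U\<close> with
  state space of dimension \<open>r\<close>, in relational form.\<close>

definition realizes :: "nat \<Rightarrow> nat \<Rightarrow> complex mat \<Rightarrow> (complex \<Rightarrow> complex mat) \<Rightarrow> bool" where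
  "realizes m r U \<Psi> \<longleftrightarrow> unitary_mat (m + r) U \<and>
    (\<forall>z Q. cmod z < 1 \<longrightarrow> Q \<in> carrier_vec m \<longrightarrow>
      (\<exists>R\<in>carrier_vec r. U *\<^sub>v (Q @\<^sub>v (z \<cdot>\<^sub>v R)) = (\<Psi> z *\<^sub>v Q) @\<^sub>v R))"

lemma realizes_const:
  assumes V: "unitary_mat m V" and \<Psi>: "\<And>z. cmod z < 1 \<Longrightarrow> \<Psi> z = V"
  shows "realizes m 0 V \<Psi>"
  unfolding realizes_def
proof (intro conjI allI impI)
  show "unitary_mat (m + 0) V" using V by simp
  fix z :: complex and Q :: "complex Matrix.vec" assume z: "cmod z < 1" and Q: "Q \<in> carrier_vec m"
  have app: "v @\<^sub>v w = v" if "w \<in> carrier_vec 0" for v w :: "complex Matrix.vec"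
    using that by (intro eq_vecI) auto
  show "\<exists>R\<in>carrier_vec 0. V *\<^sub>v (Q @\<^sub>v (z \<cdot>\<^sub>v R)) = (\<Psi> z *\<^sub>v Q) @\<^sub>v R"
    by (rule bexI[of _ "0\<^sub>v 0"]) (simp_all add: app \<Psi>[OF z])
qed

text \<open>With a unit vector \<open>u\<close> and \<open>s ^ 2 = 1 - cmod a ^ 2\<close>, the
  colligation with one-dimensional state whose transfer function is the Blaschke factor
  \<open>(z - a) / (1 - cnj a * z)\<close> along \<open>u\<close> and the identity on the complement
  of \<open>u\<close>. The state is the last coordinate.\<close>

definition blaschke_colligation :: "complex \<Rightarrow> real \<Rightarrow> complex Matrix.vec \<Rightarrow> complex mat" where
  "blaschke_colligation a s u = (let n = dim_vec u in mat (Suc n) (Suc n) (\<lambda>(i, j).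
     if i < n then (if j < n then (if i = j then 1 else 0) - (1 + a) * u $ i * cnj (u $ j) else of_real s * u $ i)
     else (if j < n then of_real s * cnj (u $ j) else cnj a)))"

lemma defect_square:
  assumes "s\<^sup>2 = 1 - (cmod a)\<^sup>2"
  shows "complex_of_real s * of_real s = 1 - a * cnj a"
proof -
  have "complex_of_real s * of_real s = of_real (s\<^sup>2)" by (simp add: power2_eq_square)
  then show ?thesis by (simp only: assms of_real_diff of_real_1 complex_norm_square)
qed

lemma blaschke_colligation_unitary:
  assumes u: "u \<in> carrier_vec n" "u \<bullet>c u = 1" and s: "s\<^sup>2 = 1 - (cmod a)\<^sup>2"
  shows "unitary_mat (Suc n) (blaschke_colligation a s u)"
proof (rule unitary_matI)
  define M where "M = blaschke_colligation a s u"
  have d: "dim_vec u = n" using u(1) by (rule carrier_vecD)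
  show Mc: "M \<in> carrier_mat (Suc n) (Suc n)"
    unfolding M_def blaschke_colligation_def Let_def d by (rule mat_carrier)
  have idx: "M $$ (i, j) = (if i < n then (if j < n then (if i = j then 1 else 0) - (1 + a) * u $ i * cnj (u $ j) else of_real s * u $ i)
     else (if j < n then of_real s * cnj (u $ j) else cnj a))" if "i < Suc n" "j < Suc n" for i j
    unfolding M_def blaschke_colligation_def Let_def d using that by (simp only: index_mat(1) prod.case)
  have ss: "complex_of_real s * of_real s = 1 - a * cnj a"
  by (rule defect_square[OF s])
  have uu: "(\<Sum>l<n. cnj (u $ l) * u $ l) = 1" by (rule unit_vec_sum[OF u])
  show "mat_adjoint M * M = 1\<^sub>m (Suc n)"
  proof (rule eq_matI)
    fix i j assume "i < dim_row (1\<^sub>m (Suc n))" "j < dim_col (1\<^sub>m (Suc n) :: complex mat)"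
    then have ij: "i < Suc n" "j < Suc n" by auto
    have "(mat_adjoint M * M) $$ (i, j) = (\<Sum>l<Suc n. cnj (M $$ (l, i)) * M $$ (l, j))"
      unfolding mult_index[OF adjoint_carrier[OF Mc] Mc ij]
      using ij Mc by (intro sum.cong refl) (simp add: carrier_matD[OF Mc])
    also have "\<dots> = (\<Sum>l<n. cnj (M $$ (l, i)) * M $$ (l, j)) + cnj (M $$ (n, i)) * M $$ (n, j)" by simp
    also have "\<dots> = (if i = j then 1 else 0)"
    proof -
      consider "i < n" "j < n" | "i < n" "j = n" | "i = n" "j < n" | "i = n" "j = n" using ij by linarith
      then show ?thesis
      proof cases
        case 1
        have "(\<Sum>l<n. cnj (M $$ (l, i)) * M $$ (l, j))
          = (\<Sum>l<n. (if l = i then (if i = j then 1 else 0) - (1 + a) * u $ i * cnj (u $ j) else 0)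
             - (if l = j then (1 + cnj a) * cnj (u $ j) * u $ i else 0)
             + (1 + cnj a) * (1 + a) * u $ i * cnj (u $ j) * (cnj (u $ l) * u $ l))"
          using 1 by (intro sum.cong refl) (auto simp: idx algebra_simps)
        also have "\<dots> = (if i = j then 1 else 0) - (1 + a) * u $ i * cnj (u $ j)
            - (1 + cnj a) * cnj (u $ j) * u $ i + (1 + cnj a) * (1 + a) * u $ i * cnj (u $ j)"
          using 1 unfolding sum.distrib sum_subtractf sum_distrib_left[symmetric] uu by simp
        finally have "(\<Sum>l<n. cnj (M $$ (l, i)) * M $$ (l, j)) + cnj (M $$ (n, i)) * M $$ (n, j)
          = (if i = j then 1 else 0) - (1 + a) * u $ i * cnj (u $ j)
            - (1 + cnj a) * cnj (u $ j) * u $ i + (1 + cnj a) * (1 + a) * u $ i * cnj (u $ j)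
            + (complex_of_real s * of_real s) * (u $ i * cnj (u $ j))"
          using 1 by (simp add: idx mult_ac)
        then show ?thesis unfolding ss by (simp add: algebra_simps)
      next
        case 2
        have "(\<Sum>l<n. cnj (M $$ (l, i)) * M $$ (l, j))
          = (\<Sum>l<n. (if l = i then of_real s * u $ i else 0) - (1 + cnj a) * of_real s * u $ i * (cnj (u $ l) * u $ l))"
          using 2 by (intro sum.cong refl) (auto simp: idx algebra_simps)
        also have "\<dots> = of_real s * u $ i - (1 + cnj a) * of_real s * u $ i"
          using 2 unfolding sum_subtractf sum_distrib_left[symmetric] uu by simp
        finally show ?thesis using 2 by (simp add: idx algebra_simps)
      next
        case 3
        have "(\<Sum>l<n. cnj (M $$ (l, i)) * M $$ (l, j))
          = (\<Sum>l<n. (if l = j then of_real s * cnj (u $ j) else 0) - (1 + a) * of_real s * cnj (u $ j) * (cnj (u $ l) * u $ l))"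
          using 3 by (intro sum.cong refl) (auto simp: idx algebra_simps)
        also have "\<dots> = of_real s * cnj (u $ j) - (1 + a) * of_real s * cnj (u $ j)"
          using 3 unfolding sum_subtractf sum_distrib_left[symmetric] uu by simp
        finally show ?thesis using 3 by (simp add: idx algebra_simps)
      next
        case 4
        have "(\<Sum>l<n. cnj (M $$ (l, i)) * M $$ (l, j))
          = (\<Sum>l<n. (complex_of_real s * of_real s) * (cnj (u $ l) * u $ l))"
          using 4 by (intro sum.cong refl) (auto simp: idx algebra_simps)
        also have "\<dots> = complex_of_real s * of_real s"
          unfolding sum_distrib_left[symmetric] uu by simp
        finally show ?thesis using 4 by (simp add: idx ss mult.commute)
      qed
    qed
    finally show "(mat_adjoint M * M) $$ (i, j) = 1\<^sub>m (Suc n) $$ (i, j)" using ij by simp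
  qed (use Mc in simp_all)
qed

lemma blaschke_colligation_mult_vec:
  assumes u: "u \<in> carrier_vec n" and x: "x \<in> carrier_vec n"
  shows "blaschke_colligation a s u *\<^sub>v (x @\<^sub>v vec 1 (\<lambda>_. t))
    = (x + (of_real s * t - (1 + a) * (x \<bullet>c u)) \<cdot>\<^sub>v u) @\<^sub>v vec 1 (\<lambda>_. of_real s * (x \<bullet>c u) + cnj a * t)"
proof -
  define p where "p = x \<bullet>c u"
  have p: "p = (\<Sum>l<n. x $ l * cnj (u $ l))" unfolding p_def by (rule cinner_sum[OF u])
  define M where "M = blaschke_colligation a s u"
  have d: "dim_vec u = n" "dim_vec x = n" using u x by auto
  have Mc: "M \<in> carrier_mat (Suc n) (Suc n)"
    unfolding M_def blaschke_colligation_def Let_def d by (rule mat_carrier)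
  have idx: "M $$ (i, j) = (if i < n then (if j < n then (if i = j then 1 else 0) - (1 + a) * u $ i * cnj (u $ j) else of_real s * u $ i)
     else (if j < n then of_real s * cnj (u $ j) else cnj a))" if "i < Suc n" "j < Suc n" for i j
    unfolding M_def blaschke_colligation_def Let_def d using that by (simp only: index_mat(1) prod.case)
  define y where "y = x @\<^sub>v vec 1 (\<lambda>_. t)"
  have yc: "y \<in> carrier_vec (Suc n)" unfolding y_def by (rule carrier_vecI) (simp add: d)
  have yi: "y $ l = (if l < n then x $ l else t)" if "l < Suc n" for l
    using that unfolding y_def by (auto simp: d)
  have "M *\<^sub>v y = (x + (of_real s * t - (1 + a) * p) \<cdot>\<^sub>v u) @\<^sub>v vec 1 (\<lambda>_. of_real s * p + cnj a * t)"
  proof (rule eq_vecI)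
    show "dim_vec (M *\<^sub>v y) = dim_vec ((x + (of_real s * t - (1 + a) * p) \<cdot>\<^sub>v u) @\<^sub>v vec 1 (\<lambda>_. of_real s * p + cnj a * t))"
      using Mc by (simp add: d)
    fix i assume "i < dim_vec ((x + (of_real s * t - (1 + a) * p) \<cdot>\<^sub>v u) @\<^sub>v vec 1 (\<lambda>_. of_real s * p + cnj a * t))"
    then have i: "i < Suc n" by (simp add: d)
    have "(M *\<^sub>v y) $ i = (\<Sum>l<n. M $$ (i, l) * x $ l) + M $$ (i, n) * t"
      unfolding mult_vec_index[OF Mc yc i] by (simp add: yi)
    also have "\<dots> = (if i < n then x $ i + (of_real s * t - (1 + a) * p) * u $ i else of_real s * p + cnj a * t)"
    proof (cases "i < n")
      case True
      have "(\<Sum>l<n. M $$ (i, l) * x $ l) = (\<Sum>l<n. (if l = i then x $ i else 0) - (1 + a) * u $ i * (x $ l * cnj (u $ l)))"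
        using True by (intro sum.cong refl) (auto simp: idx algebra_simps)
      also have "\<dots> = x $ i - (1 + a) * u $ i * p"
        using True unfolding sum_subtractf sum_distrib_left[symmetric] p by simp
      finally show ?thesis using True by (simp add: idx algebra_simps)
    next
      case False
      have "(\<Sum>l<n. M $$ (i, l) * x $ l) = (\<Sum>l<n. of_real s * (x $ l * cnj (u $ l)))"
        using False i by (intro sum.cong refl) (auto simp: idx algebra_simps)
      then show ?thesis using False i by (simp add: idx p sum_distrib_left)
    qed
    finally show "(M *\<^sub>v y) $ i = ((x + (of_real s * t - (1 + a) * p) \<cdot>\<^sub>v u) @\<^sub>v vec 1 (\<lambda>_. of_real s * p + cnj a * t)) $ i"
      using i by (simp add: d)
  qed
  then show ?thesis by (simp only: M_def y_def p_def)
qed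

text \<open>Series connection: the output of the old colligation is fed into the colligation of the
  Blaschke factor, and the two states are stacked.\<close>

lemma realizes_cascade:
  assumes real: "realizes m r U \<Psi>" and u: "u \<in> carrier_vec m" "u \<bullet>c u = 1" and a: "cmod a < 1"
    and \<Psi>c: "\<And>z. \<Psi> z \<in> carrier_mat m m"
    and \<Psi>': "\<And>z. cmod z < 1 \<Longrightarrow> \<Psi>' z = rank_one_update ((z - a) / (1 - cnj a * z) - 1) u * \<Psi> z"
  shows "\<exists>U'. realizes m (Suc r) U' \<Psi>'"
proof -
  define s where "s = sqrt (1 - (cmod a)\<^sup>2)"
  have "(cmod a)\<^sup>2 \<le> 1" using a by (simp add: power_le_one)
  then have s: "s\<^sup>2 = 1 - (cmod a)\<^sup>2" by (simp add: s_def)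
  \<comment> \<open>Extended by zero over the old state, which therefore passes through the new
    factor unchanged.\<close>
  define u' where "u' = u @\<^sub>v 0\<^sub>v r"
  have u'c: "u' \<in> carrier_vec (m + r)" using u(1) by (simp add: u'_def)
  have inner_u': "(X @\<^sub>v R) \<bullet>c u' = X \<bullet>c u" if X: "X \<in> carrier_vec m" "R \<in> carrier_vec r" for X R
  proof -
    have "(X @\<^sub>v R) \<bullet>c u' = (\<Sum>i<m. (X @\<^sub>v R) $ i * cnj (u' $ i)) + (\<Sum>i\<in>{m..<m + r}. (X @\<^sub>v R) $ i * cnj (u' $ i))"
      unfolding cinner_sum[OF u'c] by (subst sum.atLeastLessThan_concat[of 0 m "m + r", symmetric, unfolded atLeast0LessThan]) auto
    also have "(\<Sum>i\<in>{m..<m + r}. (X @\<^sub>v R) $ i * cnj (u' $ i)) = 0"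
      using u(1) X by (intro sum.neutral) (auto simp: u'_def)
    also have "(\<Sum>i<m. (X @\<^sub>v R) $ i * cnj (u' $ i)) = (\<Sum>i<m. X $ i * cnj (u $ i))"
      using u(1) X by (intro sum.cong refl) (auto simp: u'_def)
    finally show ?thesis using cinner_sum[OF u(1)] by simp
  qed
  have unit': "u' \<bullet>c u' = 1"
    using inner_u'[OF u(1), of "0\<^sub>v r"] u(2) by (simp add: u'_def)
  define B where "B = blaschke_colligation a s u'"
  have B: "unitary_mat (Suc (m + r)) B" unfolding B_def by (rule blaschke_colligation_unitary[OF u'c unit' s])
  have U: "unitary_mat (m + r) U" using real by (simp add: realizes_def)
  then have Uc: "U \<in> carrier_mat (m + r) (m + r)" by auto
  define V where "V = four_block_mat U (0\<^sub>m (m + r) 1) (0\<^sub>m 1 (m + r)) (1\<^sub>m 1)"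
  have Vc: "V \<in> carrier_mat (Suc (m + r)) (Suc (m + r))"
    using four_block_carrier_mat[OF Uc one_carrier_mat[of 1]] by (simp add: V_def)
  have V: "unitary_mat (Suc (m + r)) V"
  proof (rule unitary_matI[OF Vc])
    have adj: "mat_adjoint V = four_block_mat (mat_adjoint U) (0\<^sub>m (m + r) 1) (0\<^sub>m 1 (m + r)) (1\<^sub>m 1)"
      unfolding V_def using Uc by (intro eq_matI) auto
    have "mat_adjoint V * V = four_block_mat (1\<^sub>m (m + r)) (0\<^sub>m (m + r) 1) (0\<^sub>m 1 (m + r)) (1\<^sub>m 1)"
      unfolding adj unfolding V_def
      using Uc U by (subst mult_four_block_mat[OF adjoint_carrier[OF Uc] zero_carrier_mat zero_carrier_mat one_carrier_mat
          Uc zero_carrier_mat zero_carrier_mat one_carrier_mat]) (simp add: unitary_mat_def)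
    then show "mat_adjoint V * V = 1\<^sub>m (Suc (m + r))"
      using four_block_one_mat[of "m + r" 1] by simp
  qed
  have Vapp: "V *\<^sub>v (x @\<^sub>v vec 1 (\<lambda>_. t)) = (U *\<^sub>v x) @\<^sub>v vec 1 (\<lambda>_. t)" if x: "x \<in> carrier_vec (m + r)" for x t
  proof -
    have "V *\<^sub>v (x @\<^sub>v vec 1 (\<lambda>_. t)) = (U *\<^sub>v x + 0\<^sub>m (m + r) 1 *\<^sub>v vec 1 (\<lambda>_. t)) @\<^sub>v
       (0\<^sub>m 1 (m + r) *\<^sub>v x + 1\<^sub>m 1 *\<^sub>v vec 1 (\<lambda>_. t))"
      unfolding V_def by (rule four_block_mat_mult_vec[OF Uc zero_carrier_mat zero_carrier_mat one_carrier_mat x]) simp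
    also have "0\<^sub>m (m + r) 1 *\<^sub>v vec 1 (\<lambda>_. t) = 0\<^sub>v (m + r)"
      by (rule eq_vecI) auto
    also have "0\<^sub>m 1 (m + r) *\<^sub>v x = 0\<^sub>v 1"
      using x by (intro eq_vecI) auto
    also have "(U *\<^sub>v x + 0\<^sub>v (m + r)) @\<^sub>v (0\<^sub>v 1 + 1\<^sub>m 1 *\<^sub>v vec 1 (\<lambda>_. t)) = (U *\<^sub>v x) @\<^sub>v vec 1 (\<lambda>_. t)"
      using Uc x by simp
    finally show ?thesis .
  qed
  show ?thesis
  proof (rule exI[of _ "B * V"], unfold realizes_def, intro conjI allI impI)
    show "unitary_mat (m + Suc r) (B * V)" using unitary_mat_mult[OF B V] by simp
    fix z :: complex and Q :: "complex Matrix.vec" assume z: "cmod z < 1" and Q: "Q \<in> carrier_vec m"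
    obtain R where R: "R \<in> carrier_vec r" "U *\<^sub>v (Q @\<^sub>v (z \<cdot>\<^sub>v R)) = (\<Psi> z *\<^sub>v Q) @\<^sub>v R"
      using real z Q unfolding realizes_def by blast
    define X where "X = \<Psi> z *\<^sub>v Q"
    have X: "X \<in> carrier_vec m" using \<Psi>c[of z] Q by (simp add: X_def mult_mat_vec_carrier[of _ m m])
    define q where "q = X \<bullet>c u"
    have den: "1 - cnj a * z \<noteq> 0"
    proof
      assume "1 - cnj a * z = 0"
      then have "cmod a * cmod z = 1" by (metis complex_mod_cnj norm_mult norm_one right_minus_eq)
      moreover have "cmod a * cmod z < 1 * 1" by (rule mult_strict_mono) (use z a in auto)
      ultimately show False by simp
    qed
    \<comment> \<open>The new state solves
      \<open>\<rho> = s * q + cnj a * (z * \<rho>)\<close>.\<close>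
    define \<rho> where "\<rho> = of_real s * q / (1 - cnj a * z)"
    have ss: "complex_of_real s * of_real s = 1 - a * cnj a"
    by (rule defect_square[OF s])
    have \<rho>1: "of_real s * q + cnj a * (z * \<rho>) = \<rho>"
      using den by (simp add: \<rho>_def field_simps)
    have \<rho>2: "of_real s * (z * \<rho>) - (1 + a) * q = ((z - a) / (1 - cnj a * z) - 1) * q"
    proof -
      have "of_real s * (z * \<rho>) = (complex_of_real s * of_real s) * (z * q) / (1 - cnj a * z)"
        by (simp add: \<rho>_def mult_ac)
      then show ?thesis unfolding ss using den by (simp add: field_simps)
    qed
    show "\<exists>R\<in>carrier_vec (Suc r). B * V *\<^sub>v (Q @\<^sub>v (z \<cdot>\<^sub>v R)) = (\<Psi>' z *\<^sub>v Q) @\<^sub>v R"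
    proof (rule bexI[of _ "R @\<^sub>v vec 1 (\<lambda>_. \<rho>)"])
      show "R @\<^sub>v vec 1 (\<lambda>_. \<rho>) \<in> carrier_vec (Suc r)" by (rule carrier_vecI) (use R(1) in simp)
      have assoc: "v @\<^sub>v (w @\<^sub>v x) = (v @\<^sub>v w) @\<^sub>v x" for v w x :: "complex Matrix.vec"
        by (rule eq_vecI) auto
      have sm: "z \<cdot>\<^sub>v (R @\<^sub>v vec 1 (\<lambda>_. \<rho>)) = (z \<cdot>\<^sub>v R) @\<^sub>v vec 1 (\<lambda>_. z * \<rho>)"
        by (rule eq_vecI) (use R(1) in auto)
      have zR: "Q @\<^sub>v (z \<cdot>\<^sub>v R) \<in> carrier_vec (m + r)" using Q R by simp
      have XR: "X @\<^sub>v R \<in> carrier_vec (m + r)" using X R by simp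
      have "B * V *\<^sub>v (Q @\<^sub>v (z \<cdot>\<^sub>v (R @\<^sub>v vec 1 (\<lambda>_. \<rho>))))
        = B *\<^sub>v (V *\<^sub>v ((Q @\<^sub>v (z \<cdot>\<^sub>v R)) @\<^sub>v vec 1 (\<lambda>_. z * \<rho>)))"
        unfolding sm assoc
        by (rule assoc_mult_mat_vec[of _ "Suc (m + r)" "Suc (m + r)" _ "Suc (m + r)"])
           (use B V Q R in \<open>auto intro!: carrier_vecI\<close>)
      also have "\<dots> = B *\<^sub>v ((X @\<^sub>v R) @\<^sub>v vec 1 (\<lambda>_. z * \<rho>))"
        unfolding Vapp[OF zR] R(2) X_def ..
      also have "\<dots> = ((X @\<^sub>v R) + (of_real s * (z * \<rho>) - (1 + a) * q) \<cdot>\<^sub>v u') @\<^sub>v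
          vec 1 (\<lambda>_. of_real s * q + cnj a * (z * \<rho>))"
        unfolding B_def blaschke_colligation_mult_vec[OF u'c XR] inner_u'[OF X R(1)] q_def ..
      also have "\<dots> = ((X @\<^sub>v R) + (((z - a) / (1 - cnj a * z) - 1) * q) \<cdot>\<^sub>v u') @\<^sub>v vec 1 (\<lambda>_. \<rho>)"
        unfolding \<rho>1 \<rho>2 ..
      also have "(X @\<^sub>v R) + (((z - a) / (1 - cnj a * z) - 1) * q) \<cdot>\<^sub>v u'
        = (X + (((z - a) / (1 - cnj a * z) - 1) * q) \<cdot>\<^sub>v u) @\<^sub>v R"
        unfolding u'_def by (rule eq_vecI) (use X R(1) u(1) in auto)
      also have "X + (((z - a) / (1 - cnj a * z) - 1) * q) \<cdot>\<^sub>v u = \<Psi>' z *\<^sub>v Q"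
        unfolding \<Psi>'[OF z] q_def rank_one_update_mult_vec[OF u(1) X, symmetric] unfolding X_def
        by (rule assoc_mult_mat_vec[symmetric, OF rank_one_update_carrier[OF u(1)] \<Psi>c Q])
      also have "((\<Psi>' z *\<^sub>v Q) @\<^sub>v R) @\<^sub>v vec 1 (\<lambda>_. \<rho>) = (\<Psi>' z *\<^sub>v Q) @\<^sub>v (R @\<^sub>v vec 1 (\<lambda>_. \<rho>))"
        by (rule assoc[symmetric])
      finally show "B * V *\<^sub>v (Q @\<^sub>v (z \<cdot>\<^sub>v (R @\<^sub>v vec 1 (\<lambda>_. \<rho>)))) = (\<Psi>' z *\<^sub>v Q) @\<^sub>v (R @\<^sub>v vec 1 (\<lambda>_. \<rho>))" .
    qed
  qed
qed

section \<open>Realization of rational inner matrix functions\<close>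

lemma tendsto_0_boundary:
  fixes f :: "complex \<Rightarrow> complex"
  assumes f: "continuous_on (cball 0 1) f" and 0: "\<And>z. cmod z = 1 \<Longrightarrow> f z = 0"
  shows "(f \<longlongrightarrow> 0) boundary"
proof (rule tendstoI)
  fix \<epsilon> :: real assume \<epsilon>: "\<epsilon> > 0"
  define K where "K = {z \<in> cball 0 1. \<epsilon> \<le> cmod (f z)}"
  have "K = cball 0 1 \<inter> (\<lambda>z. cmod (f z)) -` {\<epsilon>..}" by (auto simp: K_def)
  moreover have "closed \<dots>" by (intro continuous_closed_preimage continuous_intros f) auto
  ultimately have "closed K" by simp
  moreover have "bounded K" by (rule bounded_subset[OF bounded_cball[of 0 1]]) (auto simp: K_def)
  ultimately have "compact K" by (simp add: compact_eq_bounded_closed)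
  obtain r where r: "r < 1" "\<And>z. z \<in> K \<Longrightarrow> cmod z \<le> r"
  proof (cases "K = {}")
    case True
    then show ?thesis using that[of 0] by auto
  next
    case False
    have "continuous_on K cmod" by (intro continuous_intros)
    from continuous_attains_sup[OF \<open>compact K\<close> False this]
    obtain z where z: "z \<in> K" "\<And>x. x \<in> K \<Longrightarrow> cmod x \<le> cmod z" by blast
    have "cmod z \<noteq> 1" using z(1) 0[of z] \<epsilon> by (auto simp: K_def)
    then have "cmod z < 1" using z(1) by (auto simp: K_def)
    then show ?thesis using that z(2) by blast
  qed
  show "eventually (\<lambda>z. dist (f z) 0 < \<epsilon>) boundary"
    unfolding eventually_boundary
  proof (intro exI[of _ r] conjI r(1) allI impI)
    fix z assume z: "r < cmod z \<and> cmod z < 1"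
    then have "z \<notin> K" using r(2) by force
    then show "dist (f z) 0 < \<epsilon>" using z by (auto simp: K_def)
  qed
qed

text \<open>On the circle the inverse of \<open>N\<close> is its adjoint divided by
  \<open>cmod d ^ 2\<close>. Expressing the inverse by the adjugate as well shows that the entry
  divided by \<open>d\<close> agrees there with the conjugate of the holomorphic function
  \<open>h\<close>, so it is constant.\<close>

lemma polymat_eq_scalar_multiple:
  assumes N: "polymat m N" and d: "\<And>z. cmod z \<le> 1 \<Longrightarrow> poly d z \<noteq> 0"
    and gram: "\<And>z. cmod z = 1 \<Longrightarrow> mat_adjoint (N z) * N z = of_real ((cmod (poly d z))\<^sup>2) \<cdot>\<^sub>m 1\<^sub>m m"
    and D: "\<And>z. det (N z) = poly D z" and D0: "\<And>z. cmod z \<le> 1 \<Longrightarrow> poly D z \<noteq> 0"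
    and ij: "i < m" "j < m"
  shows "\<exists>c. \<forall>z. N z $$ (i, j) = c * poly d z"
proof -
  have Nc: "N z \<in> carrier_mat m m" for z by (rule polymat_carrier[OF N])
  obtain p where p: "\<And>z. N z $$ (i, j) = poly p z" using polymat_entry[OF N ij] unfolding polyfun_def by metis
  obtain q where q: "\<And>z. adj_mat (N z) $$ (j, i) = poly q z"
    using polymat_entry[OF polymat_adj[OF N] ij(2,1)] unfolding polyfun_def by metis
  have eq: "poly p z * cnj (poly D z) = cnj (poly d z * poly q z) * poly d z" if z: "cmod z = 1" for z
  proof -
    have c: "adj_mat (N z) \<in> carrier_mat m m" "N z * adj_mat (N z) = poly D z \<cdot>\<^sub>m 1\<^sub>m m"
      using adj_mat[OF Nc[of z]] D by auto
    have "mat_adjoint (N z) * (N z * adj_mat (N z)) = mat_adjoint (N z) * N z * adj_mat (N z)"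
      using c Nc by (intro assoc_mult_mat[symmetric, of _ m m _ m _ m]) auto
    then have "mat_adjoint (N z) * (poly D z \<cdot>\<^sub>m 1\<^sub>m m) = (of_real ((cmod (poly d z))\<^sup>2) \<cdot>\<^sub>m 1\<^sub>m m) * adj_mat (N z)"
      unfolding c(2) gram[OF z] .
    then have "poly D z \<cdot>\<^sub>m mat_adjoint (N z) = of_real ((cmod (poly d z))\<^sup>2) \<cdot>\<^sub>m adj_mat (N z)"
      using Nc[of z] c(1)
      by (simp add: mult_smult_distrib[of _ m m _ m] mult_smult_assoc_mat[of _ m m _ m]
          left_mult_one_mat[OF c(1)] right_mult_one_mat[of "mat_adjoint (N z)" m m])
    then have "(poly D z \<cdot>\<^sub>m mat_adjoint (N z)) $$ (j, i) = (of_real ((cmod (poly d z))\<^sup>2) \<cdot>\<^sub>m adj_mat (N z)) $$ (j, i)"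
      by simp
    then have "poly D z * cnj (poly p z) = of_real ((cmod (poly d z))\<^sup>2) * poly q z"
      using ij carrier_matD[OF Nc[of z]] carrier_matD[OF c(1)] by (simp add: p q)
    also have "\<dots> = poly d z * poly q z * cnj (poly d z)"
      by (simp only: complex_norm_square mult_ac)
    finally show ?thesis by (metis complex_cnj_cnj complex_cnj_mult mult.commute)
  qed
  define g where "g z = poly p z / poly d z" for z
  define h where "h z = poly d z * poly q z / poly D z" for z
  have "g constant_on ball 0 1"
  proof (rule constant_of_cnj_boundary)
    show "g holomorphic_on ball 0 1" "h holomorphic_on ball 0 1"
      unfolding g_def h_def using d D0 by (intro holomorphic_intros; simp)+
    show "((\<lambda>z. g z - cnj (h z)) \<longlongrightarrow> 0) boundary"
    proof (rule tendsto_0_boundary)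
      have cp: "continuous_on (cball 0 1) (poly r)" for r :: "complex poly"
        by (rule continuous_on_subset[OF continuous_on_poly_UNIV]) simp
      show "continuous_on (cball 0 1) (\<lambda>z. g z - cnj (h z))"
        unfolding g_def h_def using d D0 by (intro continuous_intros cp) auto
      fix z :: complex assume z: "cmod z = 1"
      then show "g z - cnj (h z) = 0"
        using eq[OF z] d[of z] D0[of z] by (simp add: g_def h_def field_simps)
    qed
  qed
  then obtain c where c: "\<And>z. z \<in> ball 0 1 \<Longrightarrow> g z = c" unfolding constant_on_def by blast
  have "infinite {z. poly (p - Polynomial.smult c d) z = 0}"
  proof (rule infinite_super)
    show "ball 0 1 \<subseteq> {z. poly (p - Polynomial.smult c d) z = 0}"
    proof
      fix z :: complex assume "z \<in> ball 0 1"
      then show "z \<in> {z. poly (p - Polynomial.smult c d) z = 0}"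
        using c[of z] d[of z] by (simp add: g_def field_simps)
    qed
    show "infinite (ball (0::complex) 1)"
      using finite_imp_not_open[OF _ open_ball, of "0::complex" 1] by auto
  qed
  then have "p - Polynomial.smult c d = 0" using poly_roots_finite by blast
  then have "p = Polynomial.smult c d" by simp
  then show ?thesis using p by auto
qed

lemma smult_smult_mat: "a \<cdot>\<^sub>m (b \<cdot>\<^sub>m A) = (a * b) \<cdot>\<^sub>m (A :: 'a :: comm_ring_1 mat)"
  by (rule eq_matI) (auto simp: mult.assoc)

lemma one_smult_mat: "1 \<cdot>\<^sub>m A = (A :: 'a :: comm_ring_1 mat)"
  by (rule eq_matI) auto

text \<open>Blaschke factors are split off on the left until the determinant has no zeros in the
  disc, each adding one state dimension through \<open>realizes_cascade\<close>. What remains is a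
  constant unitary by \<open>polymat_eq_scalar_multiple\<close>.\<close>

theorem inner_matrix_realization:
  assumes "polymat m N" and d: "\<And>z. cmod z \<le> 1 \<Longrightarrow> poly d z \<noteq> 0"
    and "\<And>z. cmod z = 1 \<Longrightarrow> mat_adjoint (N z) * N z = of_real ((cmod (poly d z))\<^sup>2) \<cdot>\<^sub>m 1\<^sub>m m"
  shows "\<exists>r U. realizes m r U (\<lambda>z. (1 / poly d z) \<cdot>\<^sub>m N z)"
proof -
  obtain D where D: "\<And>z. det (N z) = poly D z" using polymat_det_poly[OF assms(1)] by blast
  from assms(1,3) D show ?thesis
  proof (induction "inner_count D" arbitrary: D N)
    case (0 D N)
    note N = 0(2) and gram = 0(3) and D = 0(4)
    have Nc: "N z \<in> carrier_mat m m" for z by (rule polymat_carrier[OF N])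
    have DT: "poly D z \<noteq> 0" if z: "cmod z = 1" for z
    proof
      assume "poly D z = 0"
      then have "det (mat_adjoint (N z) * N z) = 0"
        using det_mult[OF adjoint_carrier[OF Nc] Nc, of z z] D by simp
      then show False using d[of z] z by (simp add: gram[OF z])
    qed
    have "D \<noteq> 0" using DT[of 1] by auto
    then have DD: "poly D z \<noteq> 0" if "cmod z < 1" for z using inner_count_0[of D] 0(1) that by auto
    have D0: "poly D z \<noteq> 0" if "cmod z \<le> 1" for z using DT[of z] DD[of z] that by fastforce
    have "\<forall>i j. \<exists>c. i < m \<longrightarrow> j < m \<longrightarrow> (\<forall>z. N z $$ (i, j) = c * poly d z)"
      using polymat_eq_scalar_multiple[OF N d gram D D0] by blast
    then obtain c where c: "\<And>i j z. i < m \<Longrightarrow> j < m \<Longrightarrow> N z $$ (i, j) = c i j * poly d z" by metis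
    define V where "V = mat m m (\<lambda>(i, j). c i j)"
    have Vc: "V \<in> carrier_mat m m" by (simp add: V_def)
    have NV: "N z = poly d z \<cdot>\<^sub>m V" for z
      using Nc[of z] by (intro eq_matI) (auto simp: c V_def)
    have "unitary_mat m V"
    proof (rule unitary_matI[OF Vc])
      have "mat_adjoint (N 1) * N 1 = (cnj (poly d 1) * poly d 1) \<cdot>\<^sub>m (mat_adjoint V * V)"
        unfolding NV adjoint_smult
        using Vc by (simp add: mult_smult_distrib[of _ m m _ m] mult_smult_assoc_mat[of _ m m _ m] smult_smult_mat mult.commute)
      also have "cnj (poly d 1) * poly d 1 = of_real ((cmod (poly d 1))\<^sup>2)"
        by (simp only: complex_norm_square mult.commute)
      finally have eq: "of_real ((cmod (poly d 1))\<^sup>2) \<cdot>\<^sub>m (mat_adjoint V * V) = complex_of_real ((cmod (poly d 1))\<^sup>2) \<cdot>\<^sub>m 1\<^sub>m m"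
        using gram[of 1] by simp
      have nz: "complex_of_real ((cmod (poly d 1))\<^sup>2) \<noteq> 0" using d[of 1] by simp
      show "mat_adjoint V * V = 1\<^sub>m m"
      proof (rule eq_matI)
        fix i j assume ij: "i < dim_row (1\<^sub>m m :: complex mat)" "j < dim_col (1\<^sub>m m :: complex mat)"
        have "(of_real ((cmod (poly d 1))\<^sup>2) \<cdot>\<^sub>m (mat_adjoint V * V)) $$ (i, j) = (complex_of_real ((cmod (poly d 1))\<^sup>2) \<cdot>\<^sub>m 1\<^sub>m m) $$ (i, j)"
          unfolding eq ..
        then have "complex_of_real ((cmod (poly d 1))\<^sup>2) * (mat_adjoint V * V) $$ (i, j)
            = complex_of_real ((cmod (poly d 1))\<^sup>2) * 1\<^sub>m m $$ (i, j)"
          using ij carrier_matD[OF Vc] by (simp del: index_mult_mat(1))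
        then show "(mat_adjoint V * V) $$ (i, j) = 1\<^sub>m m $$ (i, j)" using nz by (metis mult_left_cancel)
      qed (use Vc in simp_all)
    qed
    moreover have "(1 / poly d z) \<cdot>\<^sub>m N z = V" if "cmod z < 1" for z
      unfolding NV using d[of z] that by (simp add: smult_smult_mat one_smult_mat)
    ultimately show ?case using realizes_const[of m V "\<lambda>z. (1 / poly d z) \<cdot>\<^sub>m N z"] by blast
  next
    case (Suc n D N)
    note N = Suc(3) and gram = Suc(4) and D = Suc(5)
    have D0: "D \<noteq> 0" using Suc(2) by (auto simp: inner_count_def)
    then obtain a where a: "cmod a < 1" "poly D a = 0" using inner_count_0[of D] Suc(2) by auto
    then have "det (N a) = 0" using D by simp
    from blaschke_divide_left[OF N a(1) this] obtain F1 u where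
      F1: "polymat m F1" "u \<in> carrier_vec m" "u \<bullet>c u = 1"
      "\<And>z. z \<noteq> a \<Longrightarrow> F1 z = rank_one_update ((1 - cnj a * z) / (z - a) - 1) u * N z"
      "\<And>z. 1 - cnj a * z \<noteq> 0 \<Longrightarrow> N z = rank_one_update ((z - a) / (1 - cnj a * z) - 1) u * F1 z" by metis
    obtain D1 where D1: "\<And>z. det (F1 z) = poly D1 z" using polymat_det_poly[OF F1(1)] by blast
    have mv: "D1 * [:- a, 1:] = D * [:1, - cnj a:]"
      by (rule blaschke_divide_det[OF N F1(1-4) D D1])
    note im = inner_count_move[OF mv D0 a(1)]
    have "n = inner_count D1" using im(2) Suc(2) by simp
    moreover have "mat_adjoint (F1 z) * F1 z = of_real ((cmod (poly d z))\<^sup>2) \<cdot>\<^sub>m 1\<^sub>m m" if "cmod z = 1" for z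
      using blaschke_divide_gram[OF N F1(2,3) a(1) that F1(4)] gram[OF that] by simp
    ultimately obtain r U where U: "realizes m r U (\<lambda>z. (1 / poly d z) \<cdot>\<^sub>m F1 z)"
      using Suc(1)[OF _ F1(1) _ D1] by blast
    have "\<exists>U'. realizes m (Suc r) U' (\<lambda>z. (1 / poly d z) \<cdot>\<^sub>m N z)"
    proof (rule realizes_cascade[OF U F1(2,3) a(1)])
      show "(1 / poly d z) \<cdot>\<^sub>m F1 z \<in> carrier_mat m m" for z
        using polymat_carrier[OF F1(1), of z] by simp
      fix z :: complex assume z: "cmod z < 1"
      have "1 - cnj a * z \<noteq> 0"
        using poly_reflected_prod_nonzero[of "{#a#}" z] a(1) z by (simp add: mult.commute)
      from F1(5)[OF this]
      show "(1 / poly d z) \<cdot>\<^sub>m N z = rank_one_update ((z - a) / (1 - cnj a * z) - 1) u * ((1 / poly d z) \<cdot>\<^sub>m F1 z)"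
        by (simp only: mult_smult_distrib[OF rank_one_update_carrier[OF F1(2)] polymat_carrier[OF F1(1)]])
    qed
    then show ?case by blast
  qed
qed

section \<open>The companion matrix as an inner function\<close>

lemma trig_cong: "trig f \<Longrightarrow> (\<And>z. cmod z = 1 \<Longrightarrow> g z = f z) \<Longrightarrow> trig g"
  unfolding trig_def by simp

lemma trig_power: "trig f \<Longrightarrow> trig (\<lambda>z. f z ^ n)"
  by (induction n) (auto intro: trig_const trig_mult)

text \<open>On the circle the difference is a polynomial times a unimodular factor, so finitely many
  exceptional points can be filled in.\<close>

lemma trig_eq:
  assumes "trig f" "trig g" "finite S" "\<And>z. cmod z = 1 \<Longrightarrow> z \<notin> S \<Longrightarrow> f z = g z" "cmod z = 1"
  shows "f z = g z"
proof -
  obtain a K where a: "\<And>z. cmod z = 1 \<Longrightarrow> f z - g z = poly a z * cnj z ^ K"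
    using trig_diff[OF assms(1,2)] unfolding trig_def by blast
  have "a = 0"
  proof (rule poly_eq_on_circle[OF assms(3)])
    fix z assume z: "cmod z = 1" "z \<notin> S"
    then have "poly a z * cnj z ^ K = 0" using a[of z] assms(4)[of z] by simp
    then show "poly a z = poly 0 z" using z by auto
  qed
  then show ?thesis using a[OF assms(5)] by simp
qed

lemma linear_factorization:
  fixes p :: "complex poly"
  shows "p = Polynomial.smult (lead_coeff p) (\<Prod>x\<in>#proots p. [:- x, 1:])"
proof (cases "p = 0")
  case False
  obtain A where A: "p = Polynomial.smult (lead_coeff p) (\<Prod>x\<in>#A. [:- x, 1:])"
    using alg_closed_imp_factorization[OF False] by auto
  have "proots p = proots (\<Prod>x\<in>#A. [:- x, 1:])"
    by (subst A, rule proots_smult) (use False in auto)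
  also have "\<dots> = A"
  proof (induction A)
    case (add x A)
    have "(\<Prod>x\<in>#A. [:- x, 1:]) \<noteq> 0" by (auto simp: prod_mset_zero_iff)
    then show ?case using add by (simp add: proots_mult del: mult_pCons_left)
  qed simp
  finally show ?thesis using A by simp
qed simp

text \<open>By Newton's identities the power sums are polynomials in the coefficients divided by the
  leading one, and \<open>d ^ k\<close> clears all denominators.\<close>

lemma power_sum_polynomial:
  fixes f :: "complex poly poly"
  defines "d \<equiv> lead_coeff f"
  shows "\<exists>S. \<forall>z. poly d z \<noteq> 0 \<longrightarrow> poly d z ^ k * (\<Sum>x\<in>#proots (spec f z). x ^ k) = poly S z"
proof (induction k rule: less_induct)
  case (less k)
  show ?case
  proof (cases "k = 0")
    case True
    have "size (proots (spec f z)) = degree f" if "poly d z \<noteq> 0" for z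
      using degree_spec[of f z] that by (simp add: d_def size_proots_complex)
    then show ?thesis using True by (intro exI[of _ "[:of_nat (degree f):]"]) simp
  next
    case False
    obtain S where S: "\<And>j z. j < k \<Longrightarrow> poly d z \<noteq> 0 \<Longrightarrow>
        poly d z ^ j * (\<Sum>x\<in>#proots (spec f z). x ^ j) = poly (S j) z"
      using less by metis
    define E where "E i = (if i \<le> degree f then coeff f (degree f - i) else 0)" for i
    have E: "poly d z * coeff (\<Prod>x\<in>#proots (spec f z). [:1, - x:]) i = poly (E i) z" if z: "poly d z \<noteq> 0" for z i
    proof -
      define P where "P = (\<Prod>x\<in>#proots (spec f z). [:- x, 1:])"
      have deg: "degree (spec f z) = degree f" using degree_spec[of f z] z by (simp add: d_def)
      have dP: "degree P = degree f" unfolding P_def degree_linear_prod size_proots_complex deg ..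
      have fP: "coeff (spec f z) n = poly d z * coeff P n" for n
        using arg_cong[OF linear_factorization[of "spec f z"], of "\<lambda>p. coeff p n"]
        by (simp add: P_def deg d_def)
      have "coeff (\<Prod>x\<in>#proots (spec f z). [:1, - x:]) i = coeff (reflect_poly P) i"
        by (simp add: P_def reflect_linear_prod)
      also have "\<dots> = (if degree f < i then 0 else coeff P (degree f - i))"
        unfolding coeff_reflect_poly dP ..
      finally show ?thesis using fP[of "degree f - i"] by (auto simp: E_def)
    qed
    \<comment> \<open>Newton's identity times \<open>d ^ k\<close>: \<open>e i\<close> takes one
      factor \<open>d\<close>, the power sum of index \<open>k - i\<close> takes
      \<open>d ^ (k - i)\<close>, and \<open>d ^ (i - 1)\<close> is left over.\<close>
    define R where "R = - (Polynomial.smult (of_nat k) (d ^ (k - 1) * E k)) - (\<Sum>i=1..<k. d ^ (i - 1) * E i * S (k - i))"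
    show ?thesis
    proof (intro exI allI impI)
      fix z assume z: "poly d z \<noteq> 0"
      define s where "s j = (\<Sum>x\<in>#proots (spec f z). x ^ j)" for j
      define e where "e = coeff (\<Prod>x\<in>#proots (spec f z). [:1, - x:])"
      have e0: "e 0 = 1"
      proof -
        have "coeff (\<Prod>x\<in>#M. [:1, - x:]) 0 = (1::complex)" for M by (induction M) auto
        then show ?thesis by (simp add: e_def)
      qed
      have "{..<k} = insert 0 {1..<k}" using False by auto
      then have "(\<Sum>i<k. e i * s (k - i)) = s k + (\<Sum>i=1..<k. e i * s (k - i))" by (simp add: e0)
      then have "s k = - (of_nat k * e k) - (\<Sum>i=1..<k. e i * s (k - i))"
        using newton_identity[of k "proots (spec f z)", folded e_def s_def] by simp
      then have "poly d z ^ k * s k = - (of_nat k * (poly d z ^ k * e k)) - (\<Sum>i=1..<k. poly d z ^ k * (e i * s (k - i)))"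
        by (simp only: right_diff_distrib sum_distrib_left mult_minus_right mult.left_commute)
      also have "poly d z ^ k * e k = poly d z ^ (k - 1) * poly (E k) z"
        using E[OF z, of k] False by (cases k) (auto simp: e_def mult_ac)
      also have "(\<Sum>i=1..<k. poly d z ^ k * (e i * s (k - i))) = (\<Sum>i=1..<k. poly d z ^ (i - 1) * poly (E i) z * poly (S (k - i)) z)"
      proof (intro sum.cong refl)
        fix i assume i: "i \<in> {1..<k}"
        then have "poly d z ^ k = poly d z ^ (i - 1) * poly d z * poly d z ^ (k - i)"
          by (simp add: power_add[symmetric] flip: power_Suc2)
        then have "poly d z ^ k * (e i * s (k - i)) = poly d z ^ (i - 1) * (poly d z * e i) * (poly d z ^ (k - i) * s (k - i))"
          by (simp only: mult_ac)
        then show "poly d z ^ k * (e i * s (k - i)) = poly d z ^ (i - 1) * poly (E i) z * poly (S (k - i)) z"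
        proof -
          have "poly d z ^ (k - i) * s (k - i) = poly (S (k - i)) z"
            using S[of "k - i", OF _ z] i by (simp add: s_def)
          then show ?thesis
            using \<open>poly d z ^ k * (e i * s (k - i)) = _\<close> by (simp only: E[OF z, of i, folded e_def])
        qed
      qed
      finally show "poly d z ^ k * (\<Sum>x\<in>#proots (spec f z). x ^ k) = poly R z"
        by (simp add: R_def s_def poly_sum)
    qed
  qed
qed

text \<open>The entries of the Gram matrix of the Vandermonde matrix that has one row of powers for
  each root.\<close>

definition mixed_power_sum :: "complex multiset \<Rightarrow> nat \<Rightarrow> nat \<Rightarrow> complex" where
  "mixed_power_sum M k l = (\<Sum>x\<in>#M. cnj x ^ k * x ^ l)"

lemma cnj_mixed_power_sum: "cnj (mixed_power_sum M k l) = mixed_power_sum M l k"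
  unfolding mixed_power_sum_def by (induction M) (auto simp: mult.commute)

lemma vandermonde_form:
  fixes p q :: "nat \<Rightarrow> complex"
  shows "(\<Sum>a<m. \<Sum>b<m. cnj (p a) * mixed_power_sum M a b * q b)
    = (\<Sum>x\<in>#M. cnj (\<Sum>a<m. p a * x ^ a) * (\<Sum>b<m. q b * x ^ b))"
proof (induction M)
  case (add x M)
  have "(\<Sum>a<m. \<Sum>b<m. cnj (p a) * mixed_power_sum (add_mset x M) a b * q b)
    = (\<Sum>a<m. \<Sum>b<m. (cnj (p a) * cnj x ^ a) * (q b * x ^ b) + cnj (p a) * mixed_power_sum M a b * q b)"
    unfolding mixed_power_sum_def image_mset_add_mset sum_mset.add_mset
    unfolding mixed_power_sum_def[symmetric] by (intro sum.cong refl) (simp add: algebra_simps)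
  also have "\<dots> = cnj (\<Sum>a<m. p a * x ^ a) * (\<Sum>b<m. q b * x ^ b)
      + (\<Sum>a<m. \<Sum>b<m. cnj (p a) * mixed_power_sum M a b * q b)"
    by (simp add: sum.distrib sum_product)
  finally show ?case using add by simp
qed (simp add: mixed_power_sum_def)

text \<open>The power of the leading coefficient clears the denominators of the power sums; this
  makes the entries trigonometric polynomials in \<open>root_gram_trig\<close>.\<close>

definition root_gram :: "complex poly poly \<Rightarrow> nat \<Rightarrow> nat \<Rightarrow> complex \<Rightarrow> complex" where
  "root_gram f k l z = of_real ((cmod (poly (lead_coeff f) z))\<^sup>2) ^ degree f *
     mixed_power_sum (proots (spec f z)) k l"

locale circle_separable =
  fixes f :: "complex poly poly" and c u v
  assumes degree_pos: "degree f > 0"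
    and lead_nonzero: "\<And>z. cmod z \<le> 1 \<Longrightarrow> poly (lead_coeff f) z \<noteq> 0"
    and circle_roots: "\<And>z w. cmod z = 1 \<Longrightarrow> poly (spec f z) w = 0 \<Longrightarrow> cmod w = 1"
    and bezout: "c \<noteq> 0" "u * f + v * pderiv f = [:c:]"
begin

abbreviation "m \<equiv> degree f"
abbreviation "d \<equiv> lead_coeff f"

lemma spec_degree: "cmod z \<le> 1 \<Longrightarrow> degree (spec f z) = m"
  by (rule degree_spec[OF lead_nonzero])

lemma spec_neq_0: "cmod z \<le> 1 \<Longrightarrow> spec f z \<noteq> 0"
  using spec_degree[of z] degree_pos by auto

lemma root_modulus: "cmod z = 1 \<Longrightarrow> x \<in># proots (spec f z) \<Longrightarrow> cmod x = 1"
  using circle_roots[of z x] spec_neq_0[of z] by auto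

text \<open>Roots over the circle are unimodular, so \<open>cnj x ^ k * x ^ l = x ^ (l - k)\<close>
  for \<open>k \<le> l\<close>, and only ordinary power sums with exponent below \<open>m\<close>
  occur.\<close>

lemma root_gram_trig:
  assumes kl: "k < m" "l < m" shows "trig (root_gram f k l)"
proof -
  have low: "trig (root_gram f k l)" if kl: "k \<le> l" "l < m" for k l
  proof -
    obtain S where S: "\<And>z. poly d z \<noteq> 0 \<Longrightarrow> poly d z ^ (l - k) * (\<Sum>x\<in>#proots (spec f z). x ^ (l - k)) = poly S z"
      using power_sum_polynomial[of f "l - k"] by blast
    show ?thesis
    proof (rule trig_cong)
      show "trig (\<lambda>z. cnj (poly d z) ^ m * (poly d z ^ (m - (l - k)) * poly S z))"
        by (intro trig_mult trig_power trig_cnj trig_poly)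
      fix z assume z: "cmod z = 1"
      have "cnj x ^ k * x ^ l = x ^ (l - k)" if "x \<in># proots (spec f z)" for x
      proof -
        have "x ^ l = x ^ k * x ^ (l - k)" using kl by (simp flip: power_add)
        then have "cnj x ^ k * x ^ l = (cnj x ^ k * x ^ k) * x ^ (l - k)" by simp
        then show ?thesis using circle_cnj_mult_power[OF root_modulus[OF z that]] by simp
      qed
      then have "mixed_power_sum (proots (spec f z)) k l = (\<Sum>x\<in>#proots (spec f z). x ^ (l - k))"
        unfolding mixed_power_sum_def by (intro arg_cong[of _ _ sum_mset] image_mset_cong) auto
      moreover have "poly d z ^ m = poly d z ^ (m - (l - k)) * poly d z ^ (l - k)"
        using kl by (simp flip: power_add)
      moreover have "complex_of_real ((cmod (poly d z))\<^sup>2) ^ m = cnj (poly d z) ^ m * poly d z ^ m"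
        unfolding complex_norm_square by (simp add: power_mult_distrib mult.commute)
      ultimately show "root_gram f k l z = cnj (poly d z) ^ m * (poly d z ^ (m - (l - k)) * poly S z)"
        unfolding root_gram_def using S[of z] lead_nonzero[of z] z by (simp add: mult_ac)
    qed
  qed
  show ?thesis
  proof (cases "k \<le> l")
    case False
    have "root_gram f k l z = cnj (root_gram f l k z)" for z
      by (simp add: root_gram_def cnj_mixed_power_sum)
    then show ?thesis by (intro trig_cong[OF trig_cnj[OF low[of l k]]]) (use False kl in auto)
  qed (use low kl in blast)
qed

lemma root_gram_hermitian: "root_gram f l k z = cnj (root_gram f k l z)"
  by (simp add: root_gram_def cnj_mixed_power_sum)

lemma root_gram_form:
  "(\<Sum>k<m. \<Sum>l<m. cnj (p k) * root_gram f k l z * q l) = of_real ((cmod (poly d z))\<^sup>2) ^ m *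
     (\<Sum>x\<in>#proots (spec f z). cnj (\<Sum>a<m. p a * x ^ a) * (\<Sum>b<m. q b * x ^ b))"
  unfolding vandermonde_form[symmetric] root_gram_def by (simp add: sum_distrib_left mult_ac)

text \<open>The form is a positive multiple of the sum of \<open>cmod (poly Y x) ^ 2\<close> over
  the roots, where \<open>Y\<close> has the given coefficients and degree below \<open>m\<close>.
  Where \<open>c\<close> does not vanish, the Bezout identity gives \<open>m\<close> distinct roots,
  too many for all of them to be zeros of \<open>Y\<close>.\<close>

lemma root_gram_positive:
  assumes z: "cmod z = 1" "poly c z \<noteq> 0" and x: "\<exists>i<m. x i \<noteq> 0"
  shows "Re (\<Sum>i<m. \<Sum>j<m. cnj (x i) * root_gram f i j z * x j) > 0"
proof -
  define Y where "Y = (\<Sum>i<m. monom (x i) i)"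
  have Yc: "coeff Y i = (if i < m then x i else 0)" for i by (auto simp: Y_def coeff_sum)
  have Y: "poly Y t = (\<Sum>i<m. x i * t ^ i)" for t by (simp add: Y_def poly_sum poly_monom)
  have "Y \<noteq> 0" using x Yc by (metis coeff_0)
  have degY: "degree Y < m" using degree_pos by (intro degree_lessI) (auto simp: Yc)
  have "rsquarefree (spec f z)"
  proof (unfold rsquarefree_roots, intro allI notI)
    fix w assume w: "poly (spec f z) w = 0 \<and> poly (pderiv (spec f z)) w = 0"
    have "spec u z * spec f z + spec v z * pderiv (spec f z) = spec [:c:] z"
      unfolding bezout(2)[symmetric] by (simp add: spec_add spec_mult spec_pderiv)
    then have "poly (spec u z * spec f z + spec v z * pderiv (spec f z)) w = poly c z" by simp
    then show False using w z(2) by simp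
  qed
  then have card: "card {w. poly (spec f z) w = 0} = m"
    using rsquarefree_card_degree[OF spec_neq_0[of z]] spec_degree[of z] z by simp
  have "\<exists>w. poly (spec f z) w = 0 \<and> poly Y w \<noteq> 0"
  proof (rule ccontr)
    assume "\<not> ?thesis"
    then have "{w. poly (spec f z) w = 0} \<subseteq> {w. poly Y w = 0}" by blast
    then have "m \<le> card {w. poly Y w = 0}"
      unfolding card[symmetric] using poly_roots_finite[OF \<open>Y \<noteq> 0\<close>] by (rule card_mono[rotated])
    also have "\<dots> \<le> degree Y" by (rule poly_roots_degree[OF \<open>Y \<noteq> 0\<close>])
    finally show False using degY by simp
  qed
  then obtain w where w: "w \<in># proots (spec f z)" "poly Y w \<noteq> 0" using spec_neq_0[of z] z by auto
  define T where "T M = (\<Sum>x\<in>#M. (cmod (poly Y x))\<^sup>2)" for M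
  have "(\<Sum>x\<in>#M. cnj (poly Y x) * poly Y x) = of_real (T M)" for M
    unfolding T_def by (induction M) (simp_all only: image_mset_empty sum_mset.empty of_real_0 image_mset_add_mset
        sum_mset.add_mset of_real_add complex_norm_square mult.commute)
  then have form: "(\<Sum>i<m. \<Sum>j<m. cnj (x i) * root_gram f i j z * x j)
      = of_real (((cmod (poly d z))\<^sup>2) ^ m * T (proots (spec f z)))"
    by (simp only: root_gram_form Y[symmetric] of_real_mult of_real_power)
  have "T (proots (spec f z)) > 0"
  proof -
    obtain M where M: "proots (spec f z) = add_mset w M" using w(1) by (metis mset_add)
    have "(\<Sum>x\<in>#M. (cmod (poly Y x))\<^sup>2) \<ge> 0" by (induction M) auto
    then show ?thesis using w(2) unfolding M T_def by (simp add: add_pos_nonneg)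
  qed
  then show ?thesis unfolding form using lead_nonzero[of z] z by simp
qed

text \<open>The companion matrix of the monic fibre polynomial multiplied by its denominator
  \<open>d\<close>, so that the entries are polynomial; the eigenvalues are \<open>d\<close> times
  the roots.\<close>

definition companion :: "complex \<Rightarrow> complex mat" where
  "companion z = mat m m (\<lambda>(i, j). if j = m - 1 then - poly (coeff f i) z else if i = Suc j then poly d z else 0)"

lemma polymat_companion: "polymat m companion"
  unfolding companion_def[abs_def]
proof (rule polymat_mat)
  fix i j
  show "polyfun (\<lambda>z. if j = m - 1 then - poly (coeff f i) z else if i = Suc j then poly d z else 0)"
    by (cases "j = m - 1"; cases "i = Suc j") (auto intro: polyfun_minus polyfun_poly polyfun_const)
qed

text \<open>The row \<open>(1, x, \<dots>, x ^ (m - 1))\<close> acts by evaluation at \<open>x\<close>, so the roots are the left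
  eigenvalues of the companion matrix.\<close>

lemma companion_left:
  assumes j: "j < m"
  shows "(\<Sum>i<m. x ^ i * companion z $$ (i, j)) = poly d z * x ^ Suc j - (if j = m - 1 then poly (spec f z) x else 0)"
proof (cases "j = m - 1")
  case True
  have "poly (spec f z) x = poly (\<Sum>i\<le>m. monom (coeff (spec f z) i) i) x"
    by (simp only: poly_as_sum_of_monoms'[OF degree_spec_le])
  then have "poly (spec f z) x = (\<Sum>i\<le>m. coeff (spec f z) i * x ^ i)"
    by (simp add: poly_sum poly_monom)
  also have "{..m} = insert m {..<m}" by auto
  finally have "poly (spec f z) x = poly d z * x ^ m + (\<Sum>i<m. poly (coeff f i) z * x ^ i)" by simp
  moreover have "(\<Sum>i<m. x ^ i * companion z $$ (i, j)) = - (\<Sum>i<m. poly (coeff f i) z * x ^ i)"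
    unfolding sum_negf[symmetric] using True j by (intro sum.cong refl) (simp add: companion_def)
  moreover have "Suc j = m" using True degree_pos by simp
  ultimately show ?thesis using True by simp
next
  case False
  then have "(\<Sum>i<m. x ^ i * companion z $$ (i, j)) = (\<Sum>i<m. if i = Suc j then poly d z * x ^ Suc j else 0)"
    using j by (intro sum.cong refl) (simp add: companion_def)
  also have "\<dots> = poly d z * x ^ Suc j" using False j by simp
  finally show ?thesis using False by simp
qed

text \<open>Each Vandermonde row is multiplied by \<open>d * x\<close>, and
  \<open>cmod x = 1\<close> over the circle, so the Gram matrix only acquires the factor
  \<open>cmod d ^ 2\<close>.\<close>

lemma companion_gram:
  assumes z: "cmod z = 1" and kl: "k < m" "l < m"
  shows "(\<Sum>a<m. \<Sum>b<m. cnj (companion z $$ (a, k)) * root_gram f a b z * companion z $$ (b, l))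
    = of_real ((cmod (poly d z))\<^sup>2) * root_gram f k l z"
proof -
  have "(\<Sum>x\<in>#proots (spec f z). cnj (\<Sum>a<m. companion z $$ (a, k) * x ^ a) * (\<Sum>b<m. companion z $$ (b, l) * x ^ b))
    = (\<Sum>x\<in>#proots (spec f z). of_real ((cmod (poly d z))\<^sup>2) * (cnj x ^ k * x ^ l))"
  proof (intro arg_cong[of _ _ sum_mset] image_mset_cong)
    fix x assume x: "x \<in># proots (spec f z)"
    then have root: "poly (spec f z) x = 0" using spec_neq_0[of z] z by auto
    have row: "(\<Sum>a<m. companion z $$ (a, j) * x ^ a) = poly d z * x ^ Suc j" if "j < m" for j
      using companion_left[OF that, of x z] root by (simp add: mult.commute)
    have "cnj (poly d z * x ^ Suc k) * (poly d z * x ^ Suc l) = (poly d z * cnj (poly d z)) * (cnj x * x) * (cnj x ^ k * x ^ l)"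
      by (simp add: mult_ac)
    then show "cnj (\<Sum>a<m. companion z $$ (a, k) * x ^ a) * (\<Sum>b<m. companion z $$ (b, l) * x ^ b)
      = of_real ((cmod (poly d z))\<^sup>2) * (cnj x ^ k * x ^ l)"
      unfolding row[OF kl(1)] row[OF kl(2)] circle_cnj_mult[OF root_modulus[OF z x]] complex_norm_square by simp
  qed
  moreover have "(\<Sum>x\<in>#M. of_real ((cmod (poly d z))\<^sup>2) * (cnj x ^ k * x ^ l))
      = of_real ((cmod (poly d z))\<^sup>2) * mixed_power_sum M k l" for M
    unfolding mixed_power_sum_def by (induction M) (auto simp: distrib_left)
  ultimately have "(\<Sum>x\<in>#proots (spec f z). cnj (\<Sum>a<m. companion z $$ (a, k) * x ^ a) * (\<Sum>b<m. companion z $$ (b, l) * x ^ b))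
     = of_real ((cmod (poly d z))\<^sup>2) * mixed_power_sum (proots (spec f z)) k l" by (rule trans)
  then show ?thesis
    unfolding root_gram_form[where p = "\<lambda>a. companion z $$ (a, k)" and q = "\<lambda>b. companion z $$ (b, l)"]
    unfolding root_gram_def by (simp only: mult_ac)
qed

lemma assoc_mult_mat_4:
  fixes A B C D :: "complex mat"
  assumes "A \<in> carrier_mat n n" "B \<in> carrier_mat n n" "C \<in> carrier_mat n n" "D \<in> carrier_mat n n"
  shows "A * B * (C * D) = A * (B * C) * D"
proof -
  have "A * B * (C * D) = A * (B * (C * D))" using assms by (intro assoc_mult_mat[of _ n n _ n _ n]) auto
  also have "B * (C * D) = B * C * D" using assms by (intro assoc_mult_mat[symmetric, of _ n n _ n _ n]) auto
  also have "A * (B * C * D) = A * (B * C) * D" using assms by (intro assoc_mult_mat[symmetric, of _ n n _ n _ n]) auto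
  finally show ?thesis .
qed

lemma gram_entry:
  fixes A :: "complex mat"
  assumes A: "A \<in> carrier_mat n n" and ij: "i < n" "j < n"
  shows "(mat_adjoint A * A) $$ (i, j) = (\<Sum>l<n. cnj (A $$ (l, i)) * A $$ (l, j))"
  unfolding mult_index[OF adjoint_carrier[OF A] A ij]
  using A ij by (intro sum.cong refl) auto

lemma sandwich_entry:
  fixes A G :: "complex mat"
  assumes A: "A \<in> carrier_mat n n" and G: "G \<in> carrier_mat n n" and ij: "i < n" "j < n"
  shows "(mat_adjoint A * G * A) $$ (i, j) = (\<Sum>a<n. \<Sum>b<n. cnj (A $$ (a, i)) * G $$ (a, b) * A $$ (b, j))"
proof -
  have AG: "mat_adjoint A * G \<in> carrier_mat n n" by (rule mult_carrier_mat[OF adjoint_carrier[OF A] G])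
  have "(mat_adjoint A * G * A) $$ (i, j) = (\<Sum>b<n. (\<Sum>a<n. cnj (A $$ (a, i)) * G $$ (a, b)) * A $$ (b, j))"
    unfolding mult_index[OF AG A ij]
  proof (intro sum.cong refl)
    fix b assume b: "b \<in> {..<n}"
    have "(mat_adjoint A * G) $$ (i, b) = (\<Sum>a<n. cnj (A $$ (a, i)) * G $$ (a, b))"
      using mult_index[OF adjoint_carrier[OF A] G ij(1), of b] b A ij by simp
    then show "(mat_adjoint A * G) $$ (i, b) * A $$ (b, j) = (\<Sum>a<n. cnj (A $$ (a, i)) * G $$ (a, b)) * A $$ (b, j)"
      by simp
  qed
  also have "\<dots> = (\<Sum>b<n. \<Sum>a<n. cnj (A $$ (a, i)) * G $$ (a, b) * A $$ (b, j))"
    by (simp only: sum_distrib_right)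
  also have "\<dots> = (\<Sum>a<n. \<Sum>b<n. cnj (A $$ (a, i)) * G $$ (a, b) * A $$ (b, j))" by (rule sum.swap)
  finally show ?thesis .
qed

text \<open>The identity of \<open>companion_gram\<close> is linear in the Gram matrix, so it
  tolerates the factor \<open>cmod b ^ 2\<close> of the factorization; \<open>outer_factor\<close>
  then replaces the factor without changing its Gram matrix on the circle.\<close>

theorem outer_gram_factor:
  shows "\<exists>A S. polymat m A \<and> (\<forall>z. cmod z < 1 \<longrightarrow> det (A z) \<noteq> 0) \<and> finite S \<and>
    (\<forall>z. cmod z = 1 \<longrightarrow> z \<notin> S \<longrightarrow>
      mat_adjoint (companion z) * (mat_adjoint (A z) * A z) * companion z
        = of_real ((cmod (poly d z))\<^sup>2) \<cdot>\<^sub>m (mat_adjoint (A z) * A z))"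
proof -
  define S where "S = {z. poly c z = 0}"
  have S: "finite S" unfolding S_def by (rule poly_roots_finite[OF bezout(1)])
  have "\<exists>c F. c \<noteq> 0 \<and> (\<forall>z k l. cmod z = 1 \<longrightarrow> z \<notin> S \<longrightarrow> k < m \<longrightarrow> l < m \<longrightarrow>
    (\<Sum>i<m. cnj (poly (F i k) z) * poly (F i l) z) = of_real ((cmod (poly c z))\<^sup>2) * root_gram f k l z)"
  proof (rule matrix_factorization_on_circle[OF root_gram_trig S root_gram_hermitian])
    fix z :: complex and x :: "nat \<Rightarrow> complex" assume z: "cmod z = 1" "z \<notin> S" and "\<exists>i<m. x i \<noteq> 0"
    then show "Re (\<Sum>i<m. \<Sum>j<m. cnj (x i) * root_gram f i j z * x j) > 0"
      by (intro root_gram_positive) (auto simp: S_def)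
  qed
  then obtain b F where b: "b \<noteq> 0" and F: "\<And>z k l. cmod z = 1 \<Longrightarrow> z \<notin> S \<Longrightarrow> k < m \<Longrightarrow> l < m \<Longrightarrow>
    (\<Sum>i<m. cnj (poly (F i k) z) * poly (F i l) z) = of_real ((cmod (poly b z))\<^sup>2) * root_gram f k l z"
    by blast
  define A where "A z = mat m m (\<lambda>(i, j). poly (F i j) z)" for z
  have pA: "polymat m A" unfolding A_def[abs_def] by (intro polymat_mat polyfun_poly)
  have Ac: "A z \<in> carrier_mat m m" for z by (rule polymat_carrier[OF pA])
  have gram: "(mat_adjoint (A z) * A z) $$ (k, l) = of_real ((cmod (poly b z))\<^sup>2) * root_gram f k l z"
    if "cmod z = 1" "z \<notin> S" "k < m" "l < m" for z k l
    unfolding gram_entry[OF Ac that(3,4)] F[OF that, symmetric]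
    using that by (intro sum.cong refl) (simp add: A_def)
  \<comment> \<open>At such a point the Gram matrix is definite and \<open>b\<close> does not
    vanish; this certifies that \<open>det (A z)\<close> is not identically zero, as
    \<open>outer_factor\<close> requires.\<close>
  obtain z0 where z0: "cmod z0 = 1" "z0 \<notin> S" "poly b z0 \<noteq> 0"
    using infinite_imp_nonempty[OF Diff_infinite_finite[OF finite_UnI[OF S poly_roots_finite[OF b]] infinite_circle]]
    by auto
  have "det (A z0) \<noteq> 0"
  proof
    assume "det (A z0) = 0"
    then obtain x where x: "x \<in> carrier_vec m" "x \<noteq> 0\<^sub>v m" "A z0 *\<^sub>v x = 0\<^sub>v m"
      using det_0_iff_vec_prod_zero[OF Ac] by blast
    have "\<exists>i<m. x $ i \<noteq> 0"
    proof (rule ccontr)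
      assume "\<not> (\<exists>i<m. x $ i \<noteq> 0)"
      then have "x = 0\<^sub>v m" using x(1) by (intro eq_vecI) auto
      then show False using x(2) by blast
    qed
    then have pos: "Re (\<Sum>i<m. \<Sum>j<m. cnj (x $ i) * root_gram f i j z0 * x $ j) > 0"
      using root_gram_positive[OF z0(1), of "\<lambda>i. x $ i"] z0(2) by (simp add: S_def)
    have zero: "of_real ((cmod (poly b z0))\<^sup>2) * (\<Sum>i<m. \<Sum>j<m. cnj (x $ i) * root_gram f i j z0 * x $ j) = 0"
    proof -
      have "of_real ((cmod (poly b z0))\<^sup>2) * (\<Sum>i<m. \<Sum>j<m. cnj (x $ i) * root_gram f i j z0 * x $ j)
        = (\<Sum>i<m. \<Sum>j<m. cnj (x $ i) * (mat_adjoint (A z0) * A z0) $$ (i, j) * x $ j)"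
        unfolding sum_distrib_left using gram[OF z0(1,2)] by (intro sum.cong refl) (simp add: mult_ac)
      also have "\<dots> = (\<Sum>i<m. cnj (x $ i) * (\<Sum>j<m. (mat_adjoint (A z0) * A z0) $$ (i, j) * x $ j))"
        by (simp only: sum_distrib_left mult.assoc)
      also have "\<dots> = (\<Sum>i<m. cnj (x $ i) * ((mat_adjoint (A z0) * A z0) *\<^sub>v x) $ i)"
        using mult_vec_index[OF mult_carrier_mat[OF adjoint_carrier[OF Ac] Ac] x(1)]
        by (intro sum.cong refl) (simp only: lessThan_iff)
      also have "(mat_adjoint (A z0) * A z0) *\<^sub>v x = 0\<^sub>v m"
        using assoc_mult_mat_vec[OF adjoint_carrier[OF Ac] Ac x(1)] x(3) Ac[of z0] by auto
      finally show ?thesis by simp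
    qed
    have "complex_of_real ((cmod (poly b z0))\<^sup>2) \<noteq> 0" using z0(3) by simp
    then have "(\<Sum>i<m. \<Sum>j<m. cnj (x $ i) * root_gram f i j z0 * x $ j) = 0"
      using mult_eq_0_iff[THEN iffD1, OF zero] by blast
    then show False using pos by (simp only: zero_complex.sel less_irrefl)
  qed
  from outer_factor[OF pA this] obtain B where B: "polymat m B" "\<And>z. cmod z < 1 \<Longrightarrow> det (B z) \<noteq> 0"
    "\<And>z. cmod z = 1 \<Longrightarrow> mat_adjoint (B z) * B z = mat_adjoint (A z) * A z" by blast
  show ?thesis
  proof (rule exI[of _ B], rule exI[of _ S], intro conjI allI impI B S)
    fix z assume z: "cmod z = 1" "z \<notin> S"
    have Cc: "companion z \<in> carrier_mat m m" by (rule polymat_carrier[OF polymat_companion])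
    have Gc: "mat_adjoint (A z) * A z \<in> carrier_mat m m" by (rule mult_carrier_mat[OF adjoint_carrier[OF Ac] Ac])
    show "mat_adjoint (companion z) * (mat_adjoint (B z) * B z) * companion z
        = of_real ((cmod (poly d z))\<^sup>2) \<cdot>\<^sub>m (mat_adjoint (B z) * B z)"
      unfolding B(3)[OF z(1)]
    proof (rule eq_matI)
      fix k l assume "k < dim_row (of_real ((cmod (poly d z))\<^sup>2) \<cdot>\<^sub>m (mat_adjoint (A z) * A z))"
        "l < dim_col (of_real ((cmod (poly d z))\<^sup>2) \<cdot>\<^sub>m (mat_adjoint (A z) * A z))"
      then have kl: "k < m" "l < m" using Ac[of z] by auto
      have "(mat_adjoint (companion z) * (mat_adjoint (A z) * A z) * companion z) $$ (k, l)
        = of_real ((cmod (poly b z))\<^sup>2) * (\<Sum>a<m. \<Sum>b<m. cnj (companion z $$ (a, k)) * root_gram f a b z * companion z $$ (b, l))"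
        unfolding sandwich_entry[OF Cc Gc kl] sum_distrib_left using gram[OF z]
        by (intro sum.cong refl) (simp add: mult_ac del: index_mult_mat(1))
      also have "\<dots> = of_real ((cmod (poly d z))\<^sup>2) * (mat_adjoint (A z) * A z) $$ (k, l)"
        unfolding companion_gram[OF z(1) kl] gram[OF z kl] by (simp only: mult_ac)
      also have "\<dots> = (of_real ((cmod (poly d z))\<^sup>2) \<cdot>\<^sub>m (mat_adjoint (A z) * A z)) $$ (k, l)"
        using kl carrier_matD[OF Gc] by (intro index_smult_mat(1)[symmetric]) auto
      finally show "(mat_adjoint (companion z) * (mat_adjoint (A z) * A z) * companion z) $$ (k, l)
        = (of_real ((cmod (poly d z))\<^sup>2) \<cdot>\<^sub>m (mat_adjoint (A z) * A z)) $$ (k, l)" .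
    qed (use Cc Ac[of z] in auto)
  qed
qed

end

section \<open>Conjugation of the companion matrix by the outer factor\<close>

lemma smult_mat_mult_mat_vec_assoc:
  fixes A :: "complex mat"
  assumes "A \<in> carrier_mat n k" "v \<in> carrier_vec k"
  shows "(c \<cdot>\<^sub>m A) *\<^sub>v v = c \<cdot>\<^sub>v (A *\<^sub>v v)"
proof (rule eq_vecI)
  fix i assume "i < dim_vec (c \<cdot>\<^sub>v (A *\<^sub>v v))"
  then have i: "i < n" using assms by simp
  have cA: "c \<cdot>\<^sub>m A \<in> carrier_mat n k" using assms(1) by simp
  have "((c \<cdot>\<^sub>m A) *\<^sub>v v) $ i = c * (\<Sum>l<k. A $$ (i, l) * v $ l)"
    unfolding mult_vec_index[OF cA assms(2) i] sum_distrib_left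
    using assms i by (intro sum.cong refl) auto
  then show "((c \<cdot>\<^sub>m A) *\<^sub>v v) $ i = (c \<cdot>\<^sub>v (A *\<^sub>v v)) $ i"
    using mult_vec_index[OF assms i] assms i by simp
qed (use assms in auto)

lemma smult_vec_zero: "c \<cdot>\<^sub>v 0\<^sub>v n = (0\<^sub>v n :: complex Matrix.vec)"
  by (rule eq_vecI) auto

lemma scalar_mat_mult_vec:
  "Q \<in> carrier_vec n \<Longrightarrow> (c \<cdot>\<^sub>m 1\<^sub>m n) *\<^sub>v Q = c \<cdot>\<^sub>v (Q :: complex Matrix.vec)"
  by (simp only: smult_mat_mult_mat_vec_assoc[OF one_carrier_mat] one_mult_mat_vec)

lemma trig_if: "trig f \<Longrightarrow> trig (\<lambda>z. if P then f z else 0)"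
  by (cases P) (simp_all add: trig_const)

text \<open>The outer factor can be singular on the circle, which gives the denominator zeros there.
  At such a zero \<open>t\<close> the sum of squares of each column of \<open>N\<close> vanishes, so
  all entries share the factor \<open>z - t\<close> with \<delta>.\<close>

lemma cancel_circle_zeros:
  assumes "polymat m N" "\<delta> \<noteq> 0" "\<And>z. cmod z < 1 \<Longrightarrow> poly \<delta> z \<noteq> 0"
    and "\<And>z i j. cmod z = 1 \<Longrightarrow> i < m \<Longrightarrow> j < m \<Longrightarrow>
      (\<Sum>l<m. cnj (N z $$ (l, i)) * N z $$ (l, j)) = (if i = j then of_real ((cmod (poly \<delta> z))\<^sup>2) else 0)"
  shows "\<exists>N' \<delta>'. polymat m N' \<and> (\<forall>z. cmod z \<le> 1 \<longrightarrow> poly \<delta>' z \<noteq> 0) \<and>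
    (\<forall>z i j. cmod z = 1 \<longrightarrow> i < m \<longrightarrow> j < m \<longrightarrow>
      (\<Sum>l<m. cnj (N' z $$ (l, i)) * N' z $$ (l, j)) = (if i = j then of_real ((cmod (poly \<delta>' z))\<^sup>2) else 0)) \<and>
    (\<forall>z. poly \<delta>' z \<cdot>\<^sub>m N z = poly \<delta> z \<cdot>\<^sub>m N' z)"
  using assms
proof (induction "degree \<delta>" arbitrary: N \<delta> rule: less_induct)
  case less
  note N = less.prems(1) and \<delta> = less.prems(2,3) and gram = less.prems(4)
  show ?case
  proof (cases "\<exists>t. cmod t = 1 \<and> poly \<delta> t = 0")
    case False
    then have "poly \<delta> z \<noteq> 0" if "cmod z \<le> 1" for z using \<delta>(2)[of z] that by fastforce
    then show ?thesis using N gram by (intro exI[of _ N] exI[of _ \<delta>]) auto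
  next
    case True
    then obtain t where t: "cmod t = 1" "poly \<delta> t = 0" by blast
    then obtain \<delta>1 where \<delta>1: "\<delta> = [:- t, 1:] * \<delta>1" by (auto simp: poly_eq_0_iff_dvd elim: dvdE)
    have \<delta>1z: "poly \<delta> z = (z - t) * poly \<delta>1 z" for z unfolding \<delta>1 by (simp add: algebra_simps)
    have \<delta>10: "\<delta>1 \<noteq> 0" using \<delta>(1) \<delta>1 by auto
    have "\<exists>q. \<forall>z. N z $$ (i, j) = (z - t) * poly q z" if ij: "i < m" "j < m" for i j
    proof -
      have "(\<Sum>l<m. cnj (N t $$ (l, j)) * N t $$ (l, j)) = 0" using gram[OF t(1) ij(2) ij(2)] t(2) by simp
      moreover have "(\<Sum>l<m. cnj (N t $$ (l, j)) * N t $$ (l, j)) = of_real (\<Sum>l<m. (cmod (N t $$ (l, j)))\<^sup>2)"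
        by (simp only: of_real_sum complex_norm_square mult.commute)
      ultimately have "(\<Sum>l<m. (cmod (N t $$ (l, j)))\<^sup>2) = 0" by (simp only: of_real_eq_0_iff)
      then have z: "N t $$ (i, j) = 0" using ij by (simp add: sum_nonneg_eq_0_iff)
      obtain p where p: "\<And>z. N z $$ (i, j) = poly p z" using polymat_entry[OF N ij] unfolding polyfun_def by metis
      then obtain q where q: "p = [:- t, 1:] * q" using z by (auto simp: poly_eq_0_iff_dvd elim: dvdE)
      have "poly p z = (z - t) * poly q z" for z unfolding q by (simp add: algebra_simps)
      then show ?thesis using p by auto
    qed
    then obtain q where q: "\<And>i j z. i < m \<Longrightarrow> j < m \<Longrightarrow> N z $$ (i, j) = (z - t) * poly (q i j) z"
      by metis
    define N1 where "N1 z = mat m m (\<lambda>(i, j). poly (q i j) z)" for z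
    have N1: "polymat m N1" unfolding N1_def[abs_def] by (intro polymat_mat polyfun_poly)
    have N1i: "N1 z $$ (i, j) = poly (q i j) z" if "i < m" "j < m" for z i j using that by (simp add: N1_def)
    have NN1: "N z = (z - t) \<cdot>\<^sub>m N1 z" for z
      using polymat_dims[OF N, of z] by (intro eq_matI) (auto simp: q N1_def)
    have gram1: "(\<Sum>l<m. cnj (N1 z $$ (l, i)) * N1 z $$ (l, j)) = (if i = j then of_real ((cmod (poly \<delta>1 z))\<^sup>2) else 0)"
      if z: "cmod z = 1" and ij: "i < m" "j < m" for z i j
    \<comment> \<open>Dividing by \<open>cmod (z - t) ^ 2\<close> is legitimate only off
      \<open>t\<close>.\<close>
    proof (rule trig_eq[where S = "{t}", OF _ _ _ _ z])
      show "trig (\<lambda>z. \<Sum>l<m. cnj (N1 z $$ (l, i)) * N1 z $$ (l, j))"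
        using polymat_entry[OF N1] ij by (intro trig_sum trig_mult trig_cnj) (auto intro: polyfun_trig)
      have "trig (\<lambda>z. if i = j then poly \<delta>1 z * cnj (poly \<delta>1 z) else 0)"
        by (intro trig_if trig_mult trig_cnj trig_poly)
      then show "trig (\<lambda>z. if i = j then of_real ((cmod (poly \<delta>1 z))\<^sup>2) else 0)"
        by (simp only: complex_norm_square)
      fix z assume z: "cmod z = 1" "z \<notin> {t}"
      have r: "complex_of_real ((cmod (z - t))\<^sup>2) \<noteq> 0" using z by simp
      have "of_real ((cmod (z - t))\<^sup>2) * (\<Sum>l<m. cnj (N1 z $$ (l, i)) * N1 z $$ (l, j))
        = (\<Sum>l<m. cnj (N z $$ (l, i)) * N z $$ (l, j))"
        unfolding sum_distrib_left complex_norm_square using ij by (intro sum.cong refl) (simp add: q N1i)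
      also have "\<dots> = of_real ((cmod (z - t))\<^sup>2) * (if i = j then of_real ((cmod (poly \<delta>1 z))\<^sup>2) else 0)"
        unfolding gram[OF z(1) ij] \<delta>1z by (simp add: norm_mult power_mult_distrib)
      finally show "(\<Sum>l<m. cnj (N1 z $$ (l, i)) * N1 z $$ (l, j)) = (if i = j then of_real ((cmod (poly \<delta>1 z))\<^sup>2) else 0)"
        using r by (simp only: mult_left_cancel[OF r])
    qed simp
    have "degree \<delta>1 < degree \<delta>" using \<delta>10 by (simp add: \<delta>1 degree_mult_eq del: mult_pCons_left)
    moreover have "\<And>z. cmod z < 1 \<Longrightarrow> poly \<delta>1 z \<noteq> 0" using \<delta>(2) \<delta>1z by auto
    ultimately obtain N' \<delta>' where IH: "polymat m N'" "\<forall>z. cmod z \<le> 1 \<longrightarrow> poly \<delta>' z \<noteq> 0"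
      "\<forall>z i j. cmod z = 1 \<longrightarrow> i < m \<longrightarrow> j < m \<longrightarrow>
        (\<Sum>l<m. cnj (N' z $$ (l, i)) * N' z $$ (l, j)) = (if i = j then of_real ((cmod (poly \<delta>' z))\<^sup>2) else 0)"
      "\<forall>z. poly \<delta>' z \<cdot>\<^sub>m N1 z = poly \<delta>1 z \<cdot>\<^sub>m N' z"
      using less.hyps[of \<delta>1 N1, OF _ N1 \<delta>10 _ gram1] by blast
    have "poly \<delta>' z \<cdot>\<^sub>m N z = poly \<delta> z \<cdot>\<^sub>m N' z" for z
    proof -
      have "poly \<delta>' z \<cdot>\<^sub>m N z = (z - t) \<cdot>\<^sub>m (poly \<delta>' z \<cdot>\<^sub>m N1 z)"
        unfolding NN1 smult_smult_mat by (simp add: mult.commute)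
      also have "\<dots> = poly \<delta> z \<cdot>\<^sub>m N' z" using IH(4) by (simp add: smult_smult_mat \<delta>1z)
      finally show ?thesis .
    qed
    then show ?thesis using IH by blast
  qed
qed

context circle_separable begin

text \<open>Null vectors of \<open>T\<close> are examined on the left, where they are explicit: all
  columns but the last force a geometric sequence \<open>y 0 * w ^ i\<close>, and the last column is
  then the equation of the root.\<close>

lemma companion_eigenvalue:
  assumes z: "cmod z \<le> 1"
  shows "(\<exists>x\<in>carrier_vec m. x \<noteq> 0\<^sub>v m \<and> companion z *\<^sub>v x = (poly d z * w) \<cdot>\<^sub>v x) \<longleftrightarrow> poly (spec f z) w = 0"
proof -
  have Cc: "companion z \<in> carrier_mat m m" by (rule polymat_carrier[OF polymat_companion])
  define T where "T = companion z + (- (poly d z * w)) \<cdot>\<^sub>m 1\<^sub>m m"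
  have Tc: "T \<in> carrier_mat m m" using Cc by (simp add: T_def)
  have Ti: "T $$ (i, j) = companion z $$ (i, j) - (if i = j then poly d z * w else 0)" if "i < m" "j < m" for i j
    using that Cc by (simp add: T_def)
  have dz: "poly d z \<noteq> 0" by (rule lead_nonzero[OF z])
  have right: "(\<exists>x\<in>carrier_vec m. x \<noteq> 0\<^sub>v m \<and> companion z *\<^sub>v x = (poly d z * w) \<cdot>\<^sub>v x) \<longleftrightarrow> det T = 0"
  proof -
    have "companion z *\<^sub>v x = (poly d z * w) \<cdot>\<^sub>v x \<longleftrightarrow> T *\<^sub>v x = 0\<^sub>v m" if x: "x \<in> carrier_vec m" for x
    proof -
      have "(T *\<^sub>v x) $ i = (companion z *\<^sub>v x) $ i - (poly d z * w) * x $ i" if i: "i < m" for i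
      proof -
        have "(T *\<^sub>v x) $ i = (\<Sum>l<m. companion z $$ (i, l) * x $ l - (if l = i then poly d z * w * x $ l else 0))"
          unfolding mult_vec_index[OF Tc x i] using i by (intro sum.cong refl) (auto simp: Ti algebra_simps)
        then show ?thesis unfolding mult_vec_index[OF Cc x i] sum_subtractf using i by simp
      qed
      then show ?thesis using x Tc Cc by (auto simp: vec_eq_iff)
    qed
    then show ?thesis unfolding det_0_iff_vec_prod_zero[OF Tc] by blast
  qed
  have left: "det T = 0 \<longleftrightarrow> poly (spec f z) w = 0"
  proof
    assume "det T = 0"
    then obtain u where u: "u \<in> carrier_vec m" "u \<bullet>c u = 1" "\<And>j. j < m \<Longrightarrow> (\<Sum>l<m. cnj (u $ l) * T $$ (l, j)) = 0"
      using left_null_vector[OF Tc] by blast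
    define y where "y i = cnj (u $ i)" for i
    have y: "(\<Sum>i<m. y i * companion z $$ (i, j)) = poly d z * w * y j" if j: "j < m" for j
    proof -
      have "(\<Sum>l<m. cnj (u $ l) * T $$ (l, j))
          = (\<Sum>i<m. y i * companion z $$ (i, j) - (if i = j then poly d z * w * y i else 0))"
        unfolding y_def using j by (intro sum.cong refl) (auto simp: Ti algebra_simps)
      then show ?thesis using j u(3)[OF j] by (simp add: sum_subtractf)
    qed
    have step: "y (Suc j) = w * y j" if j: "Suc j < m" for j
    proof -
      have "(\<Sum>i<m. y i * companion z $$ (i, j)) = (\<Sum>i<m. if i = Suc j then poly d z * y i else 0)"
        using j by (intro sum.cong refl) (auto simp: companion_def)
      also have "\<dots> = poly d z * y (Suc j)" using j by simp
      finally show ?thesis using y[of j] j dz by (simp add: mult_ac)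
    qed
    have yw: "y i = y 0 * w ^ i" if "i < m" for i
      using that by (induction i) (auto simp: step)
    have "y 0 \<noteq> 0"
    proof
      assume "y 0 = 0"
      then have "u $ i = 0" if "i < m" for i using yw[OF that] by (simp add: y_def)
      then have "u \<bullet>c u = 0" unfolding cinner_sum[OF u(1)] by simp
      then show False using u(2) by simp
    qed
    moreover have "y 0 * poly (spec f z) w = 0"
    proof -
      have j: "m - 1 < m" using degree_pos by simp
      have "(\<Sum>i<m. y i * companion z $$ (i, m - 1)) = y 0 * (\<Sum>i<m. w ^ i * companion z $$ (i, m - 1))"
        unfolding sum_distrib_left
      proof (intro sum.cong refl)
        fix i assume "i \<in> {..<m}"
        then have "y i = y 0 * w ^ i" by (intro yw) simp
        then show "y i * companion z $$ (i, m - 1) = y 0 * (w ^ i * companion z $$ (i, m - 1))"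
          by (simp only: mult.assoc)
      qed
      also have "\<dots> = y 0 * (poly d z * w ^ Suc (m - 1) - poly (spec f z) w)"
        unfolding companion_left[OF j] by simp
      finally have "poly d z * w * (y 0 * w ^ (m - 1)) = y 0 * (poly d z * w ^ Suc (m - 1) - poly (spec f z) w)"
        unfolding y[OF j] yw[OF j] .
      then show ?thesis by (simp add: algebra_simps)
    qed
    ultimately show "poly (spec f z) w = 0" by simp
  next
    assume w: "poly (spec f z) w = 0"
    define x where "x = vec m (\<lambda>i. w ^ i)"
    have xc: "x \<in> carrier_vec m" by (simp add: x_def)
    have "transpose_mat T *\<^sub>v x = 0\<^sub>v m"
    proof (rule eq_vecI)
      fix j assume "j < dim_vec (0\<^sub>v m :: complex Matrix.vec)"
      then have j: "j < m" by simp
      have "(transpose_mat T *\<^sub>v x) $ j = (\<Sum>i<m. transpose_mat T $$ (j, i) * x $ i)"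
        by (rule mult_vec_index[OF _ xc j]) (use Tc in simp)
      also have "\<dots> = (\<Sum>i<m. w ^ i * companion z $$ (i, j) - (if i = j then poly d z * w * w ^ i else 0))"
        using j Tc by (intro sum.cong refl) (auto simp: Ti x_def algebra_simps)
      also have "\<dots> = 0" unfolding sum_subtractf companion_left[OF j] using j w by simp
      finally show "(transpose_mat T *\<^sub>v x) $ j = 0\<^sub>v m $ j" using j by simp
    qed (use Tc in simp)
    moreover have "x \<noteq> 0\<^sub>v m"
    proof
      assume "x = 0\<^sub>v m"
      then have "x $ 0 = 0" using degree_pos by simp
      then show False using degree_pos by (simp add: x_def)
    qed
    ultimately have "det (transpose_mat T) = 0"
      using det_0_iff_vec_prod_zero[of "transpose_mat T" m] Tc xc by auto
    then show "det T = 0" using det_transpose[OF Tc] by simp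
  qed
  show ?thesis unfolding right left ..
qed

theorem inner_realization:
  obtains r U \<Psi> where "realizes m r U \<Psi>"
    "\<And>z w. cmod z < 1 \<Longrightarrow> (\<exists>Q\<in>carrier_vec m. Q \<noteq> 0\<^sub>v m \<and> \<Psi> z *\<^sub>v Q = w \<cdot>\<^sub>v Q) \<longleftrightarrow> poly (spec f z) w = 0"
    "\<And>z. \<Psi> z \<in> carrier_mat m m"
proof -
  obtain A S where A: "polymat m A" "\<And>z. cmod z < 1 \<Longrightarrow> det (A z) \<noteq> 0" "finite S"
    and gramA: "\<And>z. cmod z = 1 \<Longrightarrow> z \<notin> S \<Longrightarrow>
      mat_adjoint (companion z) * (mat_adjoint (A z) * A z) * companion z
        = of_real ((cmod (poly d z))\<^sup>2) \<cdot>\<^sub>m (mat_adjoint (A z) * A z)"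
    using outer_gram_factor by blast
  obtain D where D: "\<And>z. det (A z) = poly D z" using polymat_det_poly[OF A(1)] by blast
  have Ac: "A z \<in> carrier_mat m m" for z by (rule polymat_carrier[OF A(1)])
  have Cc: "companion z \<in> carrier_mat m m" for z by (rule polymat_carrier[OF polymat_companion])
  have Bc: "adj_mat (A z) \<in> carrier_mat m m" for z by (rule adj_mat(1)[OF Ac])
  have AB: "A z * adj_mat (A z) = poly D z \<cdot>\<^sub>m 1\<^sub>m m" "adj_mat (A z) * A z = poly D z \<cdot>\<^sub>m 1\<^sub>m m" for z
    using adj_mat(2,3)[OF Ac[of z]] D by auto
  define X where "X z = A z * companion z" for z
  have Xc: "X z \<in> carrier_mat m m" for z unfolding X_def by (rule mult_carrier_mat[OF Ac Cc])
  \<comment> \<open>Divided by \<open>d * D\<close> inside the disc this is the conjugate of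
    \<open>companion z\<close> over \<open>d\<close> by \<open>A z\<close>, with the adjugate in
    place of the inverse.\<close>
  define N where "N z = X z * adj_mat (A z)" for z
  have N: "polymat m N" unfolding N_def[abs_def] X_def
    by (intro polymat_mult polymat_adj A polymat_companion)
  have Nc: "N z \<in> carrier_mat m m" for z by (rule polymat_carrier[OF N])
  define \<delta> where "\<delta> = d * D"
  have \<delta>z: "poly \<delta> z \<noteq> 0" if "cmod z < 1" for z
    using lead_nonzero[of z] A(2)[OF that] that by (simp add: \<delta>_def D)
  have \<delta>0: "\<delta> \<noteq> 0" using \<delta>z[of 0] by auto
  have gram0: "mat_adjoint (N z) * N z = of_real ((cmod (poly \<delta> z))\<^sup>2) \<cdot>\<^sub>m 1\<^sub>m m" if z: "cmod z = 1" "z \<notin> S" for z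
  proof -
    let ?g = "mat_adjoint (A z) * A z"
    have gc: "?g \<in> carrier_mat m m" by (rule mult_carrier_mat[OF adjoint_carrier[OF Ac] Ac])
    have XX: "mat_adjoint (X z) * X z = of_real ((cmod (poly d z))\<^sup>2) \<cdot>\<^sub>m ?g"
      unfolding X_def adjoint_mult[OF Ac Cc] gramA[OF z, symmetric]
      by (rule assoc_mult_mat_4[OF adjoint_carrier[OF Cc] adjoint_carrier[OF Ac] Ac Cc])
    have "mat_adjoint (N z) * N z = mat_adjoint (adj_mat (A z)) * (mat_adjoint (X z) * X z) * adj_mat (A z)"
      unfolding N_def adjoint_mult[OF Xc Bc]
      by (rule assoc_mult_mat_4[OF adjoint_carrier[OF Bc] adjoint_carrier[OF Xc] Xc Bc])
    also have "\<dots> = of_real ((cmod (poly d z))\<^sup>2) \<cdot>\<^sub>m (mat_adjoint (adj_mat (A z)) * ?g * adj_mat (A z))"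
      unfolding XX mult_smult_distrib[OF adjoint_carrier[OF Bc] gc]
      by (rule mult_smult_assoc_mat[OF mult_carrier_mat[OF adjoint_carrier[OF Bc] gc] Bc])
    also have "mat_adjoint (adj_mat (A z)) * ?g * adj_mat (A z) = mat_adjoint (A z * adj_mat (A z)) * (A z * adj_mat (A z))"
      unfolding adjoint_mult[OF Ac Bc]
      by (rule assoc_mult_mat_4[symmetric, OF adjoint_carrier[OF Bc] adjoint_carrier[OF Ac] Ac Bc])
    also have "\<dots> = (cnj (poly D z) * poly D z) \<cdot>\<^sub>m 1\<^sub>m m"
      unfolding AB adjoint_smult adjoint_one
      by (rule eq_matI) (auto simp: mult_smult_distrib[of _ m m _ m] mult_smult_assoc_mat[of _ m m _ m] smult_smult_mat mult.commute)
    also have "of_real ((cmod (poly d z))\<^sup>2) \<cdot>\<^sub>m ((cnj (poly D z) * poly D z) \<cdot>\<^sub>m 1\<^sub>m m) = of_real ((cmod (poly \<delta> z))\<^sup>2) \<cdot>\<^sub>m 1\<^sub>m m"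
      unfolding smult_smult_mat complex_norm_square \<delta>_def poly_mult complex_cnj_mult by (simp only: mult_ac)
    finally show ?thesis .
  qed
  have gram: "(\<Sum>l<m. cnj (N z $$ (l, i)) * N z $$ (l, j)) = (if i = j then of_real ((cmod (poly \<delta> z))\<^sup>2) else 0)"
    if z: "cmod z = 1" and ij: "i < m" "j < m" for z i j
  proof (rule trig_eq[OF _ _ A(3) _ z])
    show "trig (\<lambda>z. \<Sum>l<m. cnj (N z $$ (l, i)) * N z $$ (l, j))"
      using polymat_entry[OF N] ij by (intro trig_sum trig_mult trig_cnj) (auto intro: polyfun_trig)
    have "trig (\<lambda>z. if i = j then poly \<delta> z * cnj (poly \<delta> z) else 0)"
      by (intro trig_if trig_mult trig_cnj trig_poly)
    then show "trig (\<lambda>z. if i = j then of_real ((cmod (poly \<delta> z))\<^sup>2) else 0)"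
      by (simp only: complex_norm_square)
    fix z assume "cmod z = 1" "z \<notin> S"
    from gram0[OF this] show "(\<Sum>l<m. cnj (N z $$ (l, i)) * N z $$ (l, j)) = (if i = j then of_real ((cmod (poly \<delta> z))\<^sup>2) else 0)"
      unfolding gram_entry[OF Nc ij, symmetric] using ij by simp
  qed
  obtain N' \<delta>' where N': "polymat m N'" "\<And>z. cmod z \<le> 1 \<Longrightarrow> poly \<delta>' z \<noteq> 0"
    and gram': "\<And>z i j. cmod z = 1 \<Longrightarrow> i < m \<Longrightarrow> j < m \<Longrightarrow>
        (\<Sum>l<m. cnj (N' z $$ (l, i)) * N' z $$ (l, j)) = (if i = j then of_real ((cmod (poly \<delta>' z))\<^sup>2) else 0)"
    and eq: "\<And>z. poly \<delta>' z \<cdot>\<^sub>m N z = poly \<delta> z \<cdot>\<^sub>m N' z"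
    using cancel_circle_zeros[OF N \<delta>0 \<delta>z gram] by blast
  have N'c: "N' z \<in> carrier_mat m m" for z by (rule polymat_carrier[OF N'(1)])
  have "mat_adjoint (N' z) * N' z = of_real ((cmod (poly \<delta>' z))\<^sup>2) \<cdot>\<^sub>m 1\<^sub>m m" if z: "cmod z = 1" for z
  proof (rule eq_matI)
    fix i j assume "i < dim_row (of_real ((cmod (poly \<delta>' z))\<^sup>2) \<cdot>\<^sub>m 1\<^sub>m m :: complex mat)"
      "j < dim_col (of_real ((cmod (poly \<delta>' z))\<^sup>2) \<cdot>\<^sub>m 1\<^sub>m m :: complex mat)"
    then have ij: "i < m" "j < m" by auto
    show "(mat_adjoint (N' z) * N' z) $$ (i, j) = (of_real ((cmod (poly \<delta>' z))\<^sup>2) \<cdot>\<^sub>m 1\<^sub>m m) $$ (i, j)"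
      unfolding gram_entry[OF N'c ij] gram'[OF z ij] using ij by simp
  qed (use N'c[of z] in auto)
  then obtain r U where rU: "realizes m r U (\<lambda>z. (1 / poly \<delta>' z) \<cdot>\<^sub>m N' z)"
    using inner_matrix_realization[OF N'] by blast
  show ?thesis
  proof (rule that[OF rU])
    show "(1 / poly \<delta>' z) \<cdot>\<^sub>m N' z \<in> carrier_mat m m" for z using N'c[of z] by simp
  next
    fix z w :: complex assume z: "cmod z < 1"
    have n': "poly \<delta>' z \<noteq> 0" and n: "poly \<delta> z \<noteq> 0" and nd: "poly d z \<noteq> 0" and nD: "poly D z \<noteq> 0"
      using N'(2)[of z] \<delta>z[OF z] z by (auto simp: \<delta>_def)
    have \<Psi>: "(1 / poly \<delta>' z) \<cdot>\<^sub>m N' z = (1 / poly \<delta> z) \<cdot>\<^sub>m N z"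
    proof -
      have "(1 / poly \<delta> z) \<cdot>\<^sub>m N z = (1 / (poly \<delta> z * poly \<delta>' z)) \<cdot>\<^sub>m (poly \<delta>' z \<cdot>\<^sub>m N z)"
        using n n' by (simp add: smult_smult_mat)
      also have "\<dots> = (1 / poly \<delta>' z) \<cdot>\<^sub>m N' z" unfolding eq using n n' by (simp add: smult_smult_mat)
      finally show ?thesis ..
    qed
    have app: "((1 / poly \<delta> z) \<cdot>\<^sub>m N z) *\<^sub>v Q = (1 / poly \<delta> z) \<cdot>\<^sub>v (A z *\<^sub>v (companion z *\<^sub>v (adj_mat (A z) *\<^sub>v Q)))"
      if Q: "Q \<in> carrier_vec m" for Q
    proof -
      have "N z *\<^sub>v Q = X z *\<^sub>v (adj_mat (A z) *\<^sub>v Q)"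
        unfolding N_def by (rule assoc_mult_mat_vec[OF Xc Bc Q])
      also have "\<dots> = A z *\<^sub>v (companion z *\<^sub>v (adj_mat (A z) *\<^sub>v Q))"
        unfolding X_def by (rule assoc_mult_mat_vec[OF Ac Cc mult_mat_vec_carrier[OF Bc Q]])
      finally show ?thesis by (simp only: smult_mat_mult_mat_vec_assoc[OF Nc Q])
    qed
    have AB_vec: "A z *\<^sub>v (adj_mat (A z) *\<^sub>v Q) = poly D z \<cdot>\<^sub>v Q" "adj_mat (A z) *\<^sub>v (A z *\<^sub>v Q) = poly D z \<cdot>\<^sub>v Q"
      if Q: "Q \<in> carrier_vec m" for Q
      by (simp_all only: assoc_mult_mat_vec[OF Ac Bc Q, symmetric] assoc_mult_mat_vec[OF Bc Ac Q, symmetric]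
          AB scalar_mat_mult_vec[OF Q])
    have "(\<exists>Q\<in>carrier_vec m. Q \<noteq> 0\<^sub>v m \<and> ((1 / poly \<delta> z) \<cdot>\<^sub>m N z) *\<^sub>v Q = w \<cdot>\<^sub>v Q)
      \<longleftrightarrow> (\<exists>x\<in>carrier_vec m. x \<noteq> 0\<^sub>v m \<and> companion z *\<^sub>v x = (poly d z * w) \<cdot>\<^sub>v x)"
    proof
      assume "\<exists>Q\<in>carrier_vec m. Q \<noteq> 0\<^sub>v m \<and> ((1 / poly \<delta> z) \<cdot>\<^sub>m N z) *\<^sub>v Q = w \<cdot>\<^sub>v Q"
      then obtain Q where Q: "Q \<in> carrier_vec m" "Q \<noteq> 0\<^sub>v m" "((1 / poly \<delta> z) \<cdot>\<^sub>m N z) *\<^sub>v Q = w \<cdot>\<^sub>v Q" by blast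
      define x where "x = adj_mat (A z) *\<^sub>v Q"
      have x: "x \<in> carrier_vec m" unfolding x_def by (rule mult_mat_vec_carrier[OF Bc Q(1)])
      have Cx: "companion z *\<^sub>v x \<in> carrier_vec m" by (rule mult_mat_vec_carrier[OF Cc x])
      have "x \<noteq> 0\<^sub>v m"
      proof
        assume "x = 0\<^sub>v m"
        then have "A z *\<^sub>v x = 0\<^sub>v m" using Ac[of z] by auto
        then have "poly D z \<cdot>\<^sub>v Q = 0\<^sub>v m" using AB_vec(1)[OF Q(1)] by (simp add: x_def)
        then have "(1 / poly D z) \<cdot>\<^sub>v (poly D z \<cdot>\<^sub>v Q) = 0\<^sub>v m" by (simp add: smult_vec_zero)
        then show False using Q(2) nD by (simp add: smult_smult_assoc)
      qed
      moreover have "companion z *\<^sub>v x = (poly d z * w) \<cdot>\<^sub>v x"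
      proof -
        have "(1 / poly \<delta> z) \<cdot>\<^sub>v (A z *\<^sub>v (companion z *\<^sub>v x)) = w \<cdot>\<^sub>v Q"
          using Q(3) unfolding app[OF Q(1)] x_def .
        then have "adj_mat (A z) *\<^sub>v ((1 / poly \<delta> z) \<cdot>\<^sub>v (A z *\<^sub>v (companion z *\<^sub>v x))) = adj_mat (A z) *\<^sub>v (w \<cdot>\<^sub>v Q)"
          by (rule arg_cong)
        then have "(1 / poly \<delta> z) \<cdot>\<^sub>v (poly D z \<cdot>\<^sub>v (companion z *\<^sub>v x)) = w \<cdot>\<^sub>v x"
          unfolding mult_mat_vec[OF Bc mult_mat_vec_carrier[OF Ac Cx]] mult_mat_vec[OF Bc Q(1)] AB_vec(2)[OF Cx]
            x_def[symmetric] .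
        then have "poly d z \<cdot>\<^sub>v ((1 / poly d z) \<cdot>\<^sub>v (companion z *\<^sub>v x)) = poly d z \<cdot>\<^sub>v (w \<cdot>\<^sub>v x)"
          using nD by (simp add: smult_smult_assoc \<delta>_def)
        then show ?thesis using nd by (simp add: smult_smult_assoc)
      qed
      ultimately show "\<exists>x\<in>carrier_vec m. x \<noteq> 0\<^sub>v m \<and> companion z *\<^sub>v x = (poly d z * w) \<cdot>\<^sub>v x" using x by blast
    next
      assume "\<exists>x\<in>carrier_vec m. x \<noteq> 0\<^sub>v m \<and> companion z *\<^sub>v x = (poly d z * w) \<cdot>\<^sub>v x"
      then obtain x where x: "x \<in> carrier_vec m" "x \<noteq> 0\<^sub>v m" "companion z *\<^sub>v x = (poly d z * w) \<cdot>\<^sub>v x" by blast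
      define Q where "Q = A z *\<^sub>v x"
      have Q: "Q \<in> carrier_vec m" unfolding Q_def by (rule mult_mat_vec_carrier[OF Ac x(1)])
      have "Q \<noteq> 0\<^sub>v m"
      proof
        assume "Q = 0\<^sub>v m"
        then have "poly D z \<cdot>\<^sub>v x = adj_mat (A z) *\<^sub>v 0\<^sub>v m" using AB_vec(2)[OF x(1)] by (simp add: Q_def)
        also have "\<dots> = 0\<^sub>v m" using Bc[of z] by auto
        finally have "(1 / poly D z) \<cdot>\<^sub>v (poly D z \<cdot>\<^sub>v x) = 0\<^sub>v m" by (simp add: smult_vec_zero)
        then show False using x(2) nD by (simp add: smult_smult_assoc)
      qed
      moreover have "((1 / poly \<delta> z) \<cdot>\<^sub>m N z) *\<^sub>v Q = w \<cdot>\<^sub>v Q"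
        unfolding app[OF Q] unfolding Q_def AB_vec(2)[OF x(1)] mult_mat_vec[OF Cc x(1)] x(3)
        using nd nD by (simp add: mult_mat_vec[OF Ac x(1)] smult_smult_assoc \<delta>_def)
      ultimately show "\<exists>Q\<in>carrier_vec m. Q \<noteq> 0\<^sub>v m \<and> ((1 / poly \<delta> z) \<cdot>\<^sub>m N z) *\<^sub>v Q = w \<cdot>\<^sub>v Q" using Q by blast
    qed
    then show "(\<exists>Q\<in>carrier_vec m. Q \<noteq> 0\<^sub>v m \<and> ((1 / poly \<delta>' z) \<cdot>\<^sub>m N' z) *\<^sub>v Q = w \<cdot>\<^sub>v Q) \<longleftrightarrow> poly (spec f z) w = 0"
      unfolding \<Psi> using companion_eigenvalue[of z w] z by simp
  qed
qed

end

section \<open>The numerical radius\<close>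

definition vec_sq_norm :: "complex Matrix.vec \<Rightarrow> real" where
  "vec_sq_norm v = (\<Sum>i<dim_vec v. (cmod (v $ i))\<^sup>2)"

lemma cinner_self: "v \<bullet>c v = of_real (vec_sq_norm v)"
proof -
  have "v \<bullet>c v = (\<Sum>i<dim_vec v. v $ i * cnj (v $ i))" by (rule cinner_sum) (rule carrier_vecI, rule refl)
  then show ?thesis unfolding vec_sq_norm_def of_real_sum complex_norm_square .
qed

lemma unit_iff: "v \<bullet>c v = 1 \<longleftrightarrow> vec_sq_norm v = 1"
  unfolding cinner_self by simp

lemma sq_norm_nonneg: "vec_sq_norm v \<ge> 0"
  unfolding vec_sq_norm_def by (rule sum_nonneg) simp

lemma sq_norm_eq_0:
  assumes "v \<in> carrier_vec n" "vec_sq_norm v = 0" shows "v = 0\<^sub>v n"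
proof (rule eq_vecI)
  have d: "dim_vec v = n" using assms(1) by (rule carrier_vecD)
  fix i assume "i < dim_vec (0\<^sub>v n :: complex Matrix.vec)"
  then have i: "i < n" by simp
  have "\<forall>i\<in>{..<n}. (cmod (v $ i))\<^sup>2 = 0"
    using assms(2) unfolding vec_sq_norm_def d by (subst (asm) sum_nonneg_eq_0_iff) auto
  then show "v $ i = 0\<^sub>v n $ i" using i by simp
qed (use assms in simp)

lemma sq_norm_zero: "vec_sq_norm (0\<^sub>v n) = 0"
  by (simp add: vec_sq_norm_def)

lemma sq_norm_smult: "vec_sq_norm (c \<cdot>\<^sub>v v) = (cmod c)\<^sup>2 * vec_sq_norm v"
  unfolding vec_sq_norm_def sum_distrib_left index_smult_vec(2)
  by (intro sum.cong refl) (simp add: norm_mult power_mult_distrib)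

lemma sq_norm_add_smult:
  assumes a: "a \<in> carrier_vec n" and b: "b \<in> carrier_vec n"
  shows "vec_sq_norm (a + z \<cdot>\<^sub>v b) = vec_sq_norm a + (cmod z)\<^sup>2 * vec_sq_norm b + 2 * Re (cnj z * (a \<bullet>c b))"
proof -
  have d: "dim_vec a = n" "dim_vec b = n" "dim_vec (a + z \<cdot>\<^sub>v b) = n" using a b by auto
  have "vec_sq_norm (a + z \<cdot>\<^sub>v b) = (\<Sum>i<n. (cmod (a $ i))\<^sup>2 + (cmod z)\<^sup>2 * (cmod (b $ i))\<^sup>2
      + 2 * Re (cnj z * (a $ i * cnj (b $ i))))"
    unfolding vec_sq_norm_def d
  proof (intro sum.cong refl)
    fix i assume i: "i \<in> {..<n}"
    have "(a + z \<cdot>\<^sub>v b) $ i = a $ i + z * b $ i" using i d by simp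
    moreover have "(cmod (p + z * q))\<^sup>2 = (cmod p)\<^sup>2 + (cmod z)\<^sup>2 * (cmod q)\<^sup>2 + 2 * Re (cnj z * (p * cnj q))" for p q :: complex
      unfolding cmod_power2 by (simp add: power2_eq_square algebra_simps)
    ultimately show "(cmod ((a + z \<cdot>\<^sub>v b) $ i))\<^sup>2 = (cmod (a $ i))\<^sup>2 + (cmod z)\<^sup>2 * (cmod (b $ i))\<^sup>2
      + 2 * Re (cnj z * (a $ i * cnj (b $ i)))" by simp
  qed
  also have "\<dots> = (\<Sum>i<n. (cmod (a $ i))\<^sup>2) + (cmod z)\<^sup>2 * (\<Sum>i<n. (cmod (b $ i))\<^sup>2)
      + 2 * Re (cnj z * (\<Sum>i<n. a $ i * cnj (b $ i)))"
    by (simp only: sum.distrib sum_distrib_left Re_sum)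
  finally show ?thesis unfolding vec_sq_norm_def d cinner_sum[OF b] .
qed

text \<open>The norm of \<open>a\<close> plus \<open>z\<close> times \<open>h\<close> is expanded,
  with a unimodular \<open>z\<close> that turns the cross term into minus twice the modulus of the
  inner product.\<close>

lemma cinner_le:
  assumes a: "a \<in> carrier_vec n" and h: "h \<in> carrier_vec n"
  shows "2 * cmod (a \<bullet>c h) \<le> vec_sq_norm a + vec_sq_norm h"
proof (cases "a \<bullet>c h = 0")
  case True
  then show ?thesis using sq_norm_nonneg[of a] sq_norm_nonneg[of h] by simp
next
  case False
  define l where "l = a \<bullet>c h"
  define z where "z = - l / of_real (cmod l)"
  have l: "l \<noteq> 0" using False by (simp add: l_def)
  have z: "cmod z = 1" using l by (simp add: z_def norm_divide)
  have "cnj z * l = - of_real (cmod l)"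
  proof -
    have "cnj l * l = of_real ((cmod l)\<^sup>2)" by (simp only: complex_norm_square mult.commute)
    then show ?thesis using l by (simp add: z_def power2_eq_square)
  qed
  then have "Re (cnj z * l) = - cmod l" by simp
  then show ?thesis
    using sq_norm_add_smult[OF a h, of z] sq_norm_nonneg[of "a + z \<cdot>\<^sub>v h"] z by (simp add: l_def)
qed

text \<open>Equality in Cauchy--Schwarz: \<open>l\<close> is the inner product itself, of modulus 1,
  and the expansion bounds the squared norm of \<open>a\<close> minus \<open>l\<close> times
  \<open>h\<close> by 0.\<close>

lemma cinner_extremal:
  assumes a: "a \<in> carrier_vec n" and h: "h \<in> carrier_vec n"
    and na: "vec_sq_norm a \<le> 1" and nh: "vec_sq_norm h = 1" and ge: "1 \<le> cmod (a \<bullet>c h)"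
  obtains l where "cmod l = 1" "a = l \<cdot>\<^sub>v h"
proof -
  define l where "l = a \<bullet>c h"
  define z where "z = - l"
  have l: "cmod l = 1" using cinner_le[OF a h] na nh ge by (simp add: l_def)
  have "cnj z * l = - 1"
  proof -
    have "cnj l * l = of_real ((cmod l)\<^sup>2)" by (simp only: complex_norm_square mult.commute)
    then show ?thesis using l by (simp add: z_def)
  qed
  then have "Re (cnj z * l) = - 1" by simp
  then have "vec_sq_norm (a + z \<cdot>\<^sub>v h) \<le> 0"
    using sq_norm_add_smult[OF a h, of z] na nh l by (simp add: l_def z_def)
  then have "vec_sq_norm (a + z \<cdot>\<^sub>v h) = 0" using sq_norm_nonneg[of "a + z \<cdot>\<^sub>v h"] by linarith
  moreover have "a + z \<cdot>\<^sub>v h \<in> carrier_vec n" using a h by simp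
  ultimately have 0: "a + z \<cdot>\<^sub>v h = 0\<^sub>v n" by (intro sq_norm_eq_0)
  have "a = l \<cdot>\<^sub>v h"
  proof (rule eq_vecI)
    fix i assume "i < dim_vec (l \<cdot>\<^sub>v h)"
    then have i: "i < n" using h by simp
    have "(a + z \<cdot>\<^sub>v h) $ i = 0" unfolding 0 using i by simp
    then show "a $ i = (l \<cdot>\<^sub>v h) $ i" using i a h by (simp add: z_def)
  qed (use a h in simp)
  then show ?thesis using that l by blast
qed

lemma le_sum_square_mult: "0 \<le> b \<Longrightarrow> cmod z < 1 \<Longrightarrow> a + (cmod z)\<^sup>2 * b \<le> a + b"
  by (simp add: abs_square_le_1 mult_left_le_one_le)

lemma eq_sum_square_mult: "0 \<le> b \<Longrightarrow> cmod z < 1 \<Longrightarrow> a + (cmod z)\<^sup>2 * b = a + b \<Longrightarrow> b = 0"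
  using power_strict_mono[of "cmod z" 1 2] by auto

text \<open>Vectors of length \<open>n\<close> are encoded as functions that vanish from
  \<open>n\<close> on; the sphere is then a closed subset of a product of discs and points.\<close>

lemma compact_unit_sphere_fun:
  "compact {f :: nat \<Rightarrow> complex. (\<forall>i. f i \<in> (if i < n then cball 0 1 else {0})) \<and> (\<Sum>i<n. (cmod (f i))\<^sup>2) = 1}"
proof -
  define C where "C i = (if i < n then cball 0 1 else {0 :: complex})" for i :: nat
  have "compactin (product_topology (\<lambda>i. euclidean) UNIV) (PiE UNIV C)"
    unfolding compactin_PiE by (auto simp: C_def)
  then have c: "compact (PiE UNIV C)" by (simp add: euclidean_product_topology)
  have "closed {f :: nat \<Rightarrow> complex. (\<Sum>i<n. (cmod (f i))\<^sup>2) = 1}"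
  proof (rule closed_Collect_eq)
    have "continuous_on UNIV (\<lambda>f. (cmod (f i))\<^sup>2)" for i :: nat
      by (rule continuous_on_power[OF continuous_on_norm[OF continuous_on_product_coordinates]])
    then show "continuous_on UNIV (\<lambda>f. \<Sum>i<n. (cmod (f i))\<^sup>2)" by (rule continuous_on_sum)
  qed (rule continuous_on_const)
  from compact_Int_closed[OF c this]
  have "compact {f :: nat \<Rightarrow> complex. (\<forall>i. f i \<in> C i) \<and> (\<Sum>i<n. (cmod (f i))\<^sup>2) = 1}"
    unfolding PiE_UNIV_domain Pi_def Int_def by (simp only: mem_Collect_eq UNIV_I simp_thms)
  then show ?thesis unfolding C_def .
qed

text \<open>Compactness turns the supremum into a maximum, so that a numerical radius of at least 1
  is witnessed by an actual unit vector.\<close>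

lemma numerical_radius_attained:
  assumes A: "A \<in> carrier_mat n n" and n: "0 < n"
  obtains h where "h \<in> carrier_vec n" "h \<bullet>c h = 1" "numerical_radius A = cmod ((A *\<^sub>v h) \<bullet>c h)"
    "\<And>k. k \<in> carrier_vec n \<Longrightarrow> k \<bullet>c k = 1 \<Longrightarrow> cmod ((A *\<^sub>v k) \<bullet>c k) \<le> numerical_radius A"
proof -
  define K where "K = {f :: nat \<Rightarrow> complex. (\<forall>i. f i \<in> (if i < n then cball 0 1 else {0})) \<and> (\<Sum>i<n. (cmod (f i))\<^sup>2) = 1}"
  define \<phi> where "\<phi> f = cmod (\<Sum>i<n. (\<Sum>j<n. A $$ (i, j) * f j) * cnj (f i))" for f :: "nat \<Rightarrow> complex"
  have \<phi>: "cmod ((A *\<^sub>v k) \<bullet>c k) = \<phi> (\<lambda>i. if i < n then k $ i else 0)" if k: "k \<in> carrier_vec n" for k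
    unfolding cinner_sum[OF k] \<phi>_def
    by (intro arg_cong[of _ _ cmod] sum.cong refl) (simp add: mult_vec_index[OF A k])
  have inK: "(\<lambda>i. if i < n then k $ i else 0) \<in> K" if k: "k \<in> carrier_vec n" "k \<bullet>c k = 1" for k
  proof -
    have s: "(\<Sum>i<n. (cmod (k $ i))\<^sup>2) = 1"
      using k(2) carrier_vecD[OF k(1)] unfolding unit_iff vec_sq_norm_def by simp
    have "cmod (k $ i) \<le> 1" if "i < n" for i
    proof -
      have "(cmod (k $ i))\<^sup>2 \<le> (\<Sum>i<n. (cmod (k $ i))\<^sup>2)"
        using that by (intro member_le_sum) auto
      then show ?thesis unfolding s by (simp add: abs_square_le_1)
    qed
    then show ?thesis using s by (simp add: K_def)
  qed
  have ofK: "vec n f \<in> carrier_vec n \<and> vec n f \<bullet>c vec n f = 1 \<and> (\<lambda>i. if i < n then vec n f $ i else 0) = f"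
    if f: "f \<in> K" for f
  proof (intro conjI ext)
    have f': "f i \<in> (if i < n then cball 0 1 else {0})" for i using f unfolding K_def by blast
    show "(if i < n then vec n f $ i else 0) = f i" for i using f'[of i] by (cases "i < n") auto
    show "vec n f \<bullet>c vec n f = 1" using f unfolding unit_iff vec_sq_norm_def K_def by simp
  qed simp
  have set: "{cmod ((A *\<^sub>v h) \<bullet>c h) | h. h \<in> carrier_vec (dim_row A) \<and> h \<bullet>c h = 1} = \<phi> ` K"
  proof
    show "{cmod ((A *\<^sub>v h) \<bullet>c h) | h. h \<in> carrier_vec (dim_row A) \<and> h \<bullet>c h = 1} \<subseteq> \<phi> ` K"
      using \<phi> inK A by auto
    show "\<phi> ` K \<subseteq> {cmod ((A *\<^sub>v h) \<bullet>c h) | h. h \<in> carrier_vec (dim_row A) \<and> h \<bullet>c h = 1}"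
    proof
      fix r assume "r \<in> \<phi> ` K"
      then obtain f where f: "f \<in> K" "r = \<phi> f" by blast
      note o = ofK[OF f(1)]
      have "cmod ((A *\<^sub>v vec n f) \<bullet>c vec n f) = \<phi> f" using \<phi>[of "vec n f"] o by metis
      then show "r \<in> {cmod ((A *\<^sub>v h) \<bullet>c h) | h. h \<in> carrier_vec (dim_row A) \<and> h \<bullet>c h = 1}"
        using f(2) o A by (auto intro!: exI[of _ "vec n f"])
    qed
  qed
  have "(\<lambda>i. if i < n then unit_vec n 0 $ i else 0) \<in> K"
  proof (rule inK)
    have "(\<Sum>i<n. (cmod (unit_vec n 0 $ i))\<^sup>2) = (\<Sum>i<n. if i = 0 then 1 else 0)"
      by (intro sum.cong) (auto simp: unit_vec_def)
    then show "unit_vec n 0 \<bullet>c unit_vec n 0 = (1::complex)"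
      using n by (simp add: unit_iff vec_sq_norm_def)
  qed simp
  then have ne: "K \<noteq> {}" by blast
  have co: "continuous_on K (\<lambda>f. f i)" for i :: nat
    by (rule continuous_on_subset[OF continuous_on_product_coordinates]) simp
  have "continuous_on K \<phi>" unfolding \<phi>_def
    by (rule continuous_on_norm, rule continuous_on_sum, rule continuous_on_mult, rule continuous_on_sum,
        rule continuous_on_mult_left, rule co, rule continuous_on_cnj, rule co)
  from continuous_attains_sup[OF _ ne this] compact_unit_sphere_fun[of n, folded K_def]
  obtain f where f: "f \<in> K" "\<And>g. g \<in> K \<Longrightarrow> \<phi> g \<le> \<phi> f" by blast
  have nr: "numerical_radius A = \<phi> f"
    unfolding numerical_radius_def set by (rule cSup_eq_maximum) (use f in auto)
  note o = ofK[OF f(1)]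
  show ?thesis
  proof (rule that[of "vec n f"])
    show "numerical_radius A = cmod ((A *\<^sub>v vec n f) \<bullet>c vec n f)" unfolding nr using \<phi>[of "vec n f"] o by metis
    show "\<And>k. k \<in> carrier_vec n \<Longrightarrow> k \<bullet>c k = 1 \<Longrightarrow> cmod ((A *\<^sub>v k) \<bullet>c k) \<le> numerical_radius A"
      unfolding nr \<phi> using f(2) inK by blast
  qed (use o in auto)
qed

section \<open>The variety of a projection and a unitary\<close>

lemma add_uminus_smult_eq_0_iff:
  assumes "a \<in> carrier_vec n" "b \<in> carrier_vec n"
  shows "a + (- k) \<cdot>\<^sub>v b = 0\<^sub>v n \<longleftrightarrow> a = (k :: complex) \<cdot>\<^sub>v b"
proof
  assume *: "a + (- k) \<cdot>\<^sub>v b = 0\<^sub>v n"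
  show "a = k \<cdot>\<^sub>v b"
  proof (rule eq_vecI)
    fix i assume "i < dim_vec (k \<cdot>\<^sub>v b)"
    then have i: "i < n" using assms by simp
    have "(a + (- k) \<cdot>\<^sub>v b) $ i = 0" unfolding * using i by simp
    then show "a $ i = (k \<cdot>\<^sub>v b) $ i" using i assms by simp
  qed (use assms in simp)
next
  assume "a = k \<cdot>\<^sub>v b"
  then show "a + (- k) \<cdot>\<^sub>v b = 0\<^sub>v n" using assms by (intro eq_vecI) auto
qed

lemma mult_mat_zero_vec: "A \<in> carrier_mat n k \<Longrightarrow> A *\<^sub>v 0\<^sub>v k = (0\<^sub>v n :: complex Matrix.vec)"
  by (intro eq_vecI) (auto simp: scalar_prod_def)

lemma smult_vec_eq_iff:
  assumes "k \<noteq> (0 :: complex)"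
  shows "k \<cdot>\<^sub>v a = b \<longleftrightarrow> a = inverse k \<cdot>\<^sub>v b"
  using assms by (auto simp: smult_smult_assoc)

lemma smult_vec_eq_0:
  assumes "cmod l = 1" "l \<cdot>\<^sub>v v = 0\<^sub>v n" shows "v = 0\<^sub>v n"
proof -
  have "l \<noteq> 0" using assms(1) by auto
  from smult_vec_eq_iff[OF this, THEN iffD1, OF assms(2)] show ?thesis by (simp only: smult_vec_zero)
qed

locale projection_unitary =
  fixes n :: nat and P U :: "complex mat"
  assumes n_pos: "0 < n" and P: "orthogonal_projection n P" and U: "unitary_mat n U"
begin

abbreviation "Q \<equiv> mat_perp P"

lemma P_carrier [simp]: "P \<in> carrier_mat n n" using P by (simp add: orthogonal_projection_def)
lemma U_carrier [simp]: "U \<in> carrier_mat n n" using U by auto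
lemma Q_carrier [simp]: "Q \<in> carrier_mat n n" 
  unfolding mat_perp_def carrier_matD(1)[OF P_carrier] by (rule minus_carrier_mat[OF P_carrier])

lemma products_carrier [simp]:
  "P * U \<in> carrier_mat n n" "Q * U \<in> carrier_mat n n"
  "mat_adjoint U * P \<in> carrier_mat n n" "mat_adjoint U * Q \<in> carrier_mat n n"
  by (auto intro!: mult_carrier_mat[of _ n n])

lemma P_vec [simp]: "x \<in> carrier_vec n \<Longrightarrow> P *\<^sub>v x \<in> carrier_vec n" by (rule mult_mat_vec_carrier[OF P_carrier])
lemma U_vec [simp]: "x \<in> carrier_vec n \<Longrightarrow> U *\<^sub>v x \<in> carrier_vec n" by (rule mult_mat_vec_carrier[OF U_carrier])
lemma Q_vec [simp]: "x \<in> carrier_vec n \<Longrightarrow> Q *\<^sub>v x \<in> carrier_vec n" by (rule mult_mat_vec_carrier[OF Q_carrier])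
lemma U_adjoint_vec [simp]: "x \<in> carrier_vec n \<Longrightarrow> mat_adjoint U *\<^sub>v x \<in> carrier_vec n"
  by (rule mult_mat_vec_carrier[OF adjoint_carrier[OF U_carrier]])

lemma Q_mult: "x \<in> carrier_vec n \<Longrightarrow> Q *\<^sub>v x = x - P *\<^sub>v x"
  using minus_mult_distrib_mat_vec[of "1\<^sub>m n" n n P x] carrier_matD[OF P_carrier] by (simp add: mat_perp_def)

lemma P_add_Q: "x \<in> carrier_vec n \<Longrightarrow> P *\<^sub>v x + Q *\<^sub>v x = x"
  using carrier_vecD[OF P_vec[of x]] by (auto simp: Q_mult intro!: eq_vecI)

lemma P_linear:
  "x \<in> carrier_vec n \<Longrightarrow> y \<in> carrier_vec n \<Longrightarrow> P *\<^sub>v (x + y) = P *\<^sub>v x + P *\<^sub>v y"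
  "x \<in> carrier_vec n \<Longrightarrow> P *\<^sub>v (k \<cdot>\<^sub>v x) = k \<cdot>\<^sub>v (P *\<^sub>v x)"
  by (rule mult_add_distrib_mat_vec[OF P_carrier], assumption+) (rule mult_mat_vec[OF P_carrier])

lemma Q_linear:
  "x \<in> carrier_vec n \<Longrightarrow> y \<in> carrier_vec n \<Longrightarrow> Q *\<^sub>v (x + y) = Q *\<^sub>v x + Q *\<^sub>v y"
  "x \<in> carrier_vec n \<Longrightarrow> Q *\<^sub>v (k \<cdot>\<^sub>v x) = k \<cdot>\<^sub>v (Q *\<^sub>v x)"
  by (rule mult_add_distrib_mat_vec[OF Q_carrier], assumption+) (rule mult_mat_vec[OF Q_carrier])

lemma U_linear:
  "x \<in> carrier_vec n \<Longrightarrow> y \<in> carrier_vec n \<Longrightarrow> U *\<^sub>v (x + y) = U *\<^sub>v x + U *\<^sub>v y"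
  "x \<in> carrier_vec n \<Longrightarrow> U *\<^sub>v (k \<cdot>\<^sub>v x) = k \<cdot>\<^sub>v (U *\<^sub>v x)"
  by (rule mult_add_distrib_mat_vec[OF U_carrier], assumption+) (rule mult_mat_vec[OF U_carrier])

lemma P_P: "x \<in> carrier_vec n \<Longrightarrow> P *\<^sub>v (P *\<^sub>v x) = P *\<^sub>v x"
  using P assoc_mult_mat_vec[OF P_carrier P_carrier, of x] by (simp add: orthogonal_projection_def)

lemma Q_P: "x \<in> carrier_vec n \<Longrightarrow> Q *\<^sub>v (P *\<^sub>v x) = 0\<^sub>v n"
  using carrier_vecD[OF P_vec[of x]] by (auto simp: Q_mult P_P intro!: eq_vecI)

lemma P_Q: "x \<in> carrier_vec n \<Longrightarrow> P *\<^sub>v (Q *\<^sub>v x) = 0\<^sub>v n"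
  using mult_minus_distrib_mat_vec[OF P_carrier, of x "P *\<^sub>v x"] carrier_vecD[OF P_vec[of x]]
  by (auto simp: Q_mult P_P intro!: eq_vecI)

lemma Q_Q: "x \<in> carrier_vec n \<Longrightarrow> Q *\<^sub>v (Q *\<^sub>v x) = Q *\<^sub>v x"
  using P_add_Q[of x] Q_linear(1)[of "P *\<^sub>v x" "Q *\<^sub>v x"] by (simp add: Q_P)

lemma adjoint_P: "mat_adjoint P = P" using P by (simp add: orthogonal_projection_def)

lemma adjoint_Q: "mat_adjoint Q = Q"
proof -
  have "cnj (P $$ (i, j)) = P $$ (j, i)" if "i < n" "j < n" for i j
    using adjoint_index[of j P i] that carrier_matD[OF P_carrier] by (simp add: adjoint_P)
  then show ?thesis using carrier_matD[OF P_carrier] by (intro eq_matI) (auto simp: mat_perp_def)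
qed

lemma sum_eq_0_iff:
  assumes a: "a \<in> carrier_vec n" and b: "b \<in> carrier_vec n"
  shows "P *\<^sub>v a + Q *\<^sub>v b = 0\<^sub>v n \<longleftrightarrow> P *\<^sub>v a = 0\<^sub>v n \<and> Q *\<^sub>v b = 0\<^sub>v n"
proof
  assume *: "P *\<^sub>v a + Q *\<^sub>v b = 0\<^sub>v n"
  have "P *\<^sub>v (P *\<^sub>v a + Q *\<^sub>v b) = P *\<^sub>v a" "Q *\<^sub>v (P *\<^sub>v a + Q *\<^sub>v b) = Q *\<^sub>v b"
    using a b by (simp_all add: P_linear Q_linear P_P P_Q Q_P Q_Q)
  moreover have "P *\<^sub>v 0\<^sub>v n = 0\<^sub>v n" "Q *\<^sub>v 0\<^sub>v n = 0\<^sub>v n"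
    by (rule mult_mat_zero_vec[OF P_carrier], rule mult_mat_zero_vec[OF Q_carrier])
  ultimately show "P *\<^sub>v a = 0\<^sub>v n \<and> Q *\<^sub>v b = 0\<^sub>v n" unfolding * by simp
qed simp

lemma norm_combination:
  assumes x: "x \<in> carrier_vec n" and y: "y \<in> carrier_vec n"
  shows "vec_sq_norm (P *\<^sub>v x + k \<cdot>\<^sub>v (Q *\<^sub>v y)) = vec_sq_norm (P *\<^sub>v x) + (cmod k)\<^sup>2 * vec_sq_norm (Q *\<^sub>v y)"
    "vec_sq_norm (Q *\<^sub>v x + k \<cdot>\<^sub>v (P *\<^sub>v y)) = vec_sq_norm (Q *\<^sub>v x) + (cmod k)\<^sup>2 * vec_sq_norm (P *\<^sub>v y)"
proof -
  have z: "x \<bullet>c 0\<^sub>v n = 0" unfolding cinner_sum[OF zero_carrier_vec] by simp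
  have "(P *\<^sub>v x) \<bullet>c (Q *\<^sub>v y) = 0" "(Q *\<^sub>v x) \<bullet>c (P *\<^sub>v y) = 0"
    using cinner_adjoint[OF P_carrier x Q_vec[OF y]] cinner_adjoint[OF Q_carrier x P_vec[OF y]] z
    by (simp_all add: adjoint_P adjoint_Q P_Q Q_P y)
  then show "vec_sq_norm (P *\<^sub>v x + k \<cdot>\<^sub>v (Q *\<^sub>v y)) = vec_sq_norm (P *\<^sub>v x) + (cmod k)\<^sup>2 * vec_sq_norm (Q *\<^sub>v y)"
    "vec_sq_norm (Q *\<^sub>v x + k \<cdot>\<^sub>v (P *\<^sub>v y)) = vec_sq_norm (Q *\<^sub>v x) + (cmod k)\<^sup>2 * vec_sq_norm (P *\<^sub>v y)"
    using sq_norm_add_smult[OF P_vec[OF x] Q_vec[OF y], of k] sq_norm_add_smult[OF Q_vec[OF x] P_vec[OF y], of k]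
    by simp_all
qed

lemma norm_split: "x \<in> carrier_vec n \<Longrightarrow> vec_sq_norm x = vec_sq_norm (P *\<^sub>v x) + vec_sq_norm (Q *\<^sub>v x)"
  using norm_combination(1)[of x x 1] P_add_Q[of x] by simp

lemma norm_U: "x \<in> carrier_vec n \<Longrightarrow> vec_sq_norm (U *\<^sub>v x) = vec_sq_norm x"
  using unitary_mat_cinner[OF U, of x x] by (simp add: cinner_self)

lemma U_eq_iff:
  assumes "x \<in> carrier_vec n" "y \<in> carrier_vec n"
  shows "mat_adjoint U *\<^sub>v y = x \<longleftrightarrow> y = U *\<^sub>v x"
  using unitary_mat_cancel[OF U] assms by metis

lemma product_vec:
  "A \<in> carrier_mat n n \<Longrightarrow> B \<in> carrier_mat n n \<Longrightarrow> x \<in> carrier_vec n \<Longrightarrow> (A * B) *\<^sub>v x = A *\<^sub>v (B *\<^sub>v x)"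
  by (rule assoc_mult_mat_vec)

lemma pencil_mult:
  assumes x: "x \<in> carrier_vec n"
  shows "pencil1 P U z *\<^sub>v x = Q *\<^sub>v (U *\<^sub>v x) + z \<cdot>\<^sub>v (P *\<^sub>v (U *\<^sub>v x))"
    "pencil2 P U z *\<^sub>v x = mat_adjoint U *\<^sub>v (P *\<^sub>v x + z \<cdot>\<^sub>v (Q *\<^sub>v x))"
proof -
  note U' = adjoint_carrier[OF U_carrier]
  show "pencil1 P U z *\<^sub>v x = Q *\<^sub>v (U *\<^sub>v x) + z \<cdot>\<^sub>v (P *\<^sub>v (U *\<^sub>v x))"
    unfolding pencil1_def add_mult_distrib_mat_vec[OF products_carrier(2) smult_carrier_mat[OF products_carrier(1)] x]
      smult_mat_mult_mat_vec_assoc[OF products_carrier(1) x]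
      product_vec[OF Q_carrier U_carrier x] product_vec[OF P_carrier U_carrier x] ..
  show "pencil2 P U z *\<^sub>v x = mat_adjoint U *\<^sub>v (P *\<^sub>v x + z \<cdot>\<^sub>v (Q *\<^sub>v x))"
    unfolding pencil2_def add_mult_distrib_mat_vec[OF products_carrier(3) smult_carrier_mat[OF products_carrier(4)] x]
      smult_mat_mult_mat_vec_assoc[OF products_carrier(4) x]
      product_vec[OF U' P_carrier x] product_vec[OF U' Q_carrier x]
      mult_add_distrib_mat_vec[OF U' P_vec[OF x] smult_carrier_vec[THEN iffD2, OF Q_vec[OF x]]]
      mult_mat_vec[OF U' Q_vec[OF x]] ..
qed

lemma pencil_carrier [simp]: "pencil1 P U z \<in> carrier_mat n n" "pencil2 P U z \<in> carrier_mat n n"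
  unfolding pencil1_def pencil2_def by simp_all

text \<open>The equations \<open>A x = z1 x\<close>, \<open>B x = z2 x\<close> for the two pencils have four components with respect
  to \<open>P\<close> and its complement; the two kept here imply the other two when \<open>z = z1 * z2\<close>.\<close>

definition joint_vector :: "complex Matrix.vec \<Rightarrow> complex \<Rightarrow> complex \<Rightarrow> bool" where
  "joint_vector x z1 z2 \<longleftrightarrow> x \<in> carrier_vec n \<and> x \<noteq> 0\<^sub>v n \<and>
     P *\<^sub>v x = z2 \<cdot>\<^sub>v (P *\<^sub>v (U *\<^sub>v x)) \<and> Q *\<^sub>v (U *\<^sub>v x) = z1 \<cdot>\<^sub>v (Q *\<^sub>v x)"

lemma pencil1_eigen_iff:
  assumes x: "x \<in> carrier_vec n"
  shows "pencil1 P U z *\<^sub>v x = l \<cdot>\<^sub>v x \<longleftrightarrow>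
    Q *\<^sub>v (U *\<^sub>v x) = l \<cdot>\<^sub>v (Q *\<^sub>v x) \<and> z \<cdot>\<^sub>v (P *\<^sub>v (U *\<^sub>v x)) = l \<cdot>\<^sub>v (P *\<^sub>v x)"
proof
  assume *: "pencil1 P U z *\<^sub>v x = l \<cdot>\<^sub>v x"
  have "Q *\<^sub>v (pencil1 P U z *\<^sub>v x) = Q *\<^sub>v (U *\<^sub>v x)" "P *\<^sub>v (pencil1 P U z *\<^sub>v x) = z \<cdot>\<^sub>v (P *\<^sub>v (U *\<^sub>v x))"
    unfolding pencil_mult[OF x] using x by (simp_all add: P_linear Q_linear P_P P_Q Q_P Q_Q smult_vec_zero)
  then show "Q *\<^sub>v (U *\<^sub>v x) = l \<cdot>\<^sub>v (Q *\<^sub>v x) \<and> z \<cdot>\<^sub>v (P *\<^sub>v (U *\<^sub>v x)) = l \<cdot>\<^sub>v (P *\<^sub>v x)"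
    unfolding * using x by (simp add: P_linear Q_linear)
next
  assume *: "Q *\<^sub>v (U *\<^sub>v x) = l \<cdot>\<^sub>v (Q *\<^sub>v x) \<and> z \<cdot>\<^sub>v (P *\<^sub>v (U *\<^sub>v x)) = l \<cdot>\<^sub>v (P *\<^sub>v x)"
  have "l \<cdot>\<^sub>v (Q *\<^sub>v x) + l \<cdot>\<^sub>v (P *\<^sub>v x) = l \<cdot>\<^sub>v (P *\<^sub>v x + Q *\<^sub>v x)"
    using x carrier_vecD[OF P_vec[OF x]] carrier_vecD[OF Q_vec[OF x]]
    by (intro eq_vecI) (simp_all add: algebra_simps)
  then show "pencil1 P U z *\<^sub>v x = l \<cdot>\<^sub>v x" unfolding pencil_mult[OF x] using * P_add_Q[OF x] by simp
qed

lemma pencil2_eigen_iff: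
  assumes x: "x \<in> carrier_vec n"
  shows "pencil2 P U z *\<^sub>v x = l \<cdot>\<^sub>v x \<longleftrightarrow>
    P *\<^sub>v x = l \<cdot>\<^sub>v (P *\<^sub>v (U *\<^sub>v x)) \<and> z \<cdot>\<^sub>v (Q *\<^sub>v x) = l \<cdot>\<^sub>v (Q *\<^sub>v (U *\<^sub>v x))"
proof -
  have "pencil2 P U z *\<^sub>v x = l \<cdot>\<^sub>v x \<longleftrightarrow> P *\<^sub>v x + z \<cdot>\<^sub>v (Q *\<^sub>v x) = l \<cdot>\<^sub>v (U *\<^sub>v x)"
    unfolding pencil_mult[OF x] using x by (subst U_eq_iff) (simp_all add: U_linear)
  also have "\<dots> \<longleftrightarrow> P *\<^sub>v x = l \<cdot>\<^sub>v (P *\<^sub>v (U *\<^sub>v x)) \<and> z \<cdot>\<^sub>v (Q *\<^sub>v x) = l \<cdot>\<^sub>v (Q *\<^sub>v (U *\<^sub>v x))"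
  proof
    assume *: "P *\<^sub>v x + z \<cdot>\<^sub>v (Q *\<^sub>v x) = l \<cdot>\<^sub>v (U *\<^sub>v x)"
    have "P *\<^sub>v (P *\<^sub>v x + z \<cdot>\<^sub>v (Q *\<^sub>v x)) = P *\<^sub>v x" "Q *\<^sub>v (P *\<^sub>v x + z \<cdot>\<^sub>v (Q *\<^sub>v x)) = z \<cdot>\<^sub>v (Q *\<^sub>v x)"
      using x by (simp_all add: P_linear Q_linear P_P P_Q Q_P Q_Q smult_vec_zero)
    then show "P *\<^sub>v x = l \<cdot>\<^sub>v (P *\<^sub>v (U *\<^sub>v x)) \<and> z \<cdot>\<^sub>v (Q *\<^sub>v x) = l \<cdot>\<^sub>v (Q *\<^sub>v (U *\<^sub>v x))"
      unfolding * using x by (simp add: P_linear Q_linear)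
  next
    assume *: "P *\<^sub>v x = l \<cdot>\<^sub>v (P *\<^sub>v (U *\<^sub>v x)) \<and> z \<cdot>\<^sub>v (Q *\<^sub>v x) = l \<cdot>\<^sub>v (Q *\<^sub>v (U *\<^sub>v x))"
    have "l \<cdot>\<^sub>v (P *\<^sub>v (U *\<^sub>v x)) + l \<cdot>\<^sub>v (Q *\<^sub>v (U *\<^sub>v x)) = l \<cdot>\<^sub>v (U *\<^sub>v x)"
      using smult_add_distrib_vec[of "P *\<^sub>v (U *\<^sub>v x)" n "Q *\<^sub>v (U *\<^sub>v x)" l] P_add_Q[of "U *\<^sub>v x"] x by simp
    then show "P *\<^sub>v x + z \<cdot>\<^sub>v (Q *\<^sub>v x) = l \<cdot>\<^sub>v (U *\<^sub>v x)" using * by simp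
  qed
  finally show ?thesis .
qed

text \<open>The product of the two pencils is \<open>z\<close> times the identity, which forces
  \<open>z = z1 * z2\<close>. In components: otherwise \<open>P *\<^sub>v (U *\<^sub>v x)\<close>
  and \<open>Q *\<^sub>v x\<close> vanish, then \<open>P *\<^sub>v x\<close> too, and
  \<open>x\<close> would be zero.\<close>

lemma joint_spectrum_iff:
  "(z1, z2) \<in> joint_spectrum (pencil1 P U z) (pencil2 P U z) \<longleftrightarrow> z = z1 * z2 \<and> (\<exists>x. joint_vector x z1 z2)"
proof -
  have ev: "eigenvector A x l \<longleftrightarrow> x \<in> carrier_vec n \<and> x \<noteq> 0\<^sub>v n \<and> A *\<^sub>v x = l \<cdot>\<^sub>v x"
    if "A \<in> carrier_mat n n" for A :: "complex mat" and x l
    using carrier_matD[OF that] unfolding eigenvector_def by simp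
  have "(eigenvector (pencil1 P U z) x z1 \<and> eigenvector (pencil2 P U z) x z2) \<longleftrightarrow> z = z1 * z2 \<and> joint_vector x z1 z2" for x
  proof
    assume "eigenvector (pencil1 P U z) x z1 \<and> eigenvector (pencil2 P U z) x z2"
    then have x: "x \<in> carrier_vec n" "x \<noteq> 0\<^sub>v n" and e1: "pencil1 P U z *\<^sub>v x = z1 \<cdot>\<^sub>v x"
      and e2: "pencil2 P U z *\<^sub>v x = z2 \<cdot>\<^sub>v x"
      unfolding ev[OF pencil_carrier(1)] ev[OF pencil_carrier(2)] by simp_all
    note e = e1[unfolded pencil1_eigen_iff[OF x(1)]] e2[unfolded pencil2_eigen_iff[OF x(1)]]
    have "z = z1 * z2"
    proof (rule ccontr)
      assume z: "z \<noteq> z1 * z2"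
      have eq: "a = 0\<^sub>v n" if "a \<in> carrier_vec n" "z \<cdot>\<^sub>v a = (z1 * z2) \<cdot>\<^sub>v a" for a :: "complex Matrix.vec"
      proof (rule eq_vecI)
        fix i assume "i < dim_vec (0\<^sub>v n :: complex Matrix.vec)"
        then have i: "i < n" by simp
        then have "z * a $ i = (z1 * z2) * a $ i" using arg_cong[OF that(2), of "\<lambda>v. v $ i"] that(1) by simp
        then show "a $ i = 0\<^sub>v n $ i" using z i by simp
      qed (use that in simp)
      have "z \<cdot>\<^sub>v (P *\<^sub>v (U *\<^sub>v x)) = z1 \<cdot>\<^sub>v (z2 \<cdot>\<^sub>v (P *\<^sub>v (U *\<^sub>v x)))" using e by metis
      then have p: "P *\<^sub>v (U *\<^sub>v x) = 0\<^sub>v n" using x by (intro eq) (simp_all add: smult_smult_assoc)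
      have "z \<cdot>\<^sub>v (Q *\<^sub>v x) = z2 \<cdot>\<^sub>v (z1 \<cdot>\<^sub>v (Q *\<^sub>v x))" using e by metis
      then have q: "Q *\<^sub>v x = 0\<^sub>v n" using x by (intro eq) (simp_all add: smult_smult_assoc mult.commute)
      have "P *\<^sub>v x = 0\<^sub>v n" using e p by (simp add: smult_vec_zero)
      then show False using P_add_Q[OF x(1)] q x(2) by simp
    qed
    then show "z = z1 * z2 \<and> joint_vector x z1 z2" using e x by (simp add: joint_vector_def)
  next
    assume *: "z = z1 * z2 \<and> joint_vector x z1 z2"
    then have x: "x \<in> carrier_vec n" "x \<noteq> 0\<^sub>v n" and e: "P *\<^sub>v x = z2 \<cdot>\<^sub>v (P *\<^sub>v (U *\<^sub>v x))"
      "Q *\<^sub>v (U *\<^sub>v x) = z1 \<cdot>\<^sub>v (Q *\<^sub>v x)" and z: "z = z1 * z2" unfolding joint_vector_def by simp_all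
    have "z \<cdot>\<^sub>v (P *\<^sub>v (U *\<^sub>v x)) = z1 \<cdot>\<^sub>v (P *\<^sub>v x)" unfolding e(1) z smult_smult_assoc ..
    moreover have "z \<cdot>\<^sub>v (Q *\<^sub>v x) = z2 \<cdot>\<^sub>v (Q *\<^sub>v (U *\<^sub>v x))" unfolding e(2) z smult_smult_assoc by (simp add: mult.commute)
    ultimately show "eigenvector (pencil1 P U z) x z1 \<and> eigenvector (pencil2 P U z) x z2"
      unfolding ev[OF pencil_carrier(1)] ev[OF pencil_carrier(2)] pencil1_eigen_iff[OF x(1)] pencil2_eigen_iff[OF x(1)]
      using x e by blast
  qed
  then show ?thesis unfolding joint_spectrum_def by simp
qed

lemma W_set_iff: "(z1, z2) \<in> W_set P U \<longleftrightarrow> (\<exists>x. joint_vector x z1 z2)"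
  unfolding W_set_def by (simp add: joint_spectrum_iff)

lemma W_set_Union: "W_set P U = (\<Union>z. joint_spectrum (pencil1 P U z) (pencil2 P U z))"
  by (auto simp: W_set_iff joint_spectrum_iff)

end

section \<open>Positions relative to the bidisc and the torus\<close>

lemma disc_iff: "z \<in> unit_disc \<longleftrightarrow> cmod z < 1" "z \<in> unit_circle \<longleftrightarrow> cmod z = 1" "z \<in> exterior_disc \<longleftrightarrow> cmod z > 1"
  unfolding unit_disc_def unit_circle_def exterior_disc_def by auto

lemma frontier_bidisc_iff:
  "(z1, z2) \<in> frontier (unit_disc \<times> unit_disc) \<longleftrightarrow> cmod z1 \<le> 1 \<and> cmod z2 \<le> 1 \<and> \<not> (cmod z1 < 1 \<and> cmod z2 < 1)"
proof -
  have "closure unit_disc = cball (0::complex) 1" "interior unit_disc = unit_disc"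
    unfolding unit_disc_def by simp_all
  then show ?thesis unfolding frontier_def closure_Times interior_Times by (auto simp: disc_iff)
qed

lemma distinguished_variety_iff:
  "distinguished_variety W \<longleftrightarrow> algebraic_variety W \<and> (\<exists>z1 z2. (z1, z2) \<in> W \<and> cmod z1 < 1 \<and> cmod z2 < 1) \<and>
    (\<forall>z1 z2. (z1, z2) \<in> W \<longrightarrow> cmod z1 \<le> 1 \<longrightarrow> cmod z2 \<le> 1 \<longrightarrow>
      cmod z1 < 1 \<and> cmod z2 < 1 \<or> cmod z1 = 1 \<and> cmod z2 = 1)"
proof -
  have "W \<inter> (unit_disc \<times> unit_disc) \<noteq> {} \<longleftrightarrow> (\<exists>z1 z2. (z1, z2) \<in> W \<and> cmod z1 < 1 \<and> cmod z2 < 1)"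
    by (auto simp: disc_iff)
  moreover have "W \<inter> frontier (unit_disc \<times> unit_disc) = W \<inter> (unit_circle \<times> unit_circle) \<longleftrightarrow>
    (\<forall>z1 z2. (z1, z2) \<in> W \<longrightarrow> cmod z1 \<le> 1 \<longrightarrow> cmod z2 \<le> 1 \<longrightarrow>
      cmod z1 < 1 \<and> cmod z2 < 1 \<or> cmod z1 = 1 \<and> cmod z2 = 1)"
    unfolding set_eq_iff split_paired_All Int_iff frontier_bidisc_iff mem_Times_iff fst_conv snd_conv disc_iff
    by (auto; fastforce)
  ultimately show ?thesis unfolding distinguished_variety_def by simp
qed

lemma toral_iff: "(z1, z2) \<in> toral_region \<longleftrightarrow>
    cmod z1 < 1 \<and> cmod z2 < 1 \<or> cmod z1 = 1 \<and> cmod z2 = 1 \<or> cmod z1 > 1 \<and> cmod z2 > 1"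
  unfolding toral_region_def by (auto simp: disc_iff)

section \<open>The defining determinant and the symmetry of the variety\<close>

context projection_unitary
begin

text \<open>The two equations of \<open>joint_vector\<close> take values in the complementary ranges
  of \<open>P\<close> and \<open>Q\<close>, so they can be added to one square linear system without
  loss.\<close>

definition joint_matrix :: "complex \<Rightarrow> complex \<Rightarrow> complex mat" where
  "joint_matrix z1 z2 = (P + (- z2) \<cdot>\<^sub>m (P * U)) + (Q * U + (- z1) \<cdot>\<^sub>m Q)"

lemma joint_matrix_carrier [simp]: "joint_matrix z1 z2 \<in> carrier_mat n n"
  unfolding joint_matrix_def by simp

lemma joint_matrix_kernel:
  assumes x: "x \<in> carrier_vec n"
  shows "joint_matrix z1 z2 *\<^sub>v x = 0\<^sub>v n \<longleftrightarrow>
    P *\<^sub>v x = z2 \<cdot>\<^sub>v (P *\<^sub>v (U *\<^sub>v x)) \<and> Q *\<^sub>v (U *\<^sub>v x) = z1 \<cdot>\<^sub>v (Q *\<^sub>v x)"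
proof -
  have c: "P + (- z2) \<cdot>\<^sub>m (P * U) \<in> carrier_mat n n" "Q * U + (- z1) \<cdot>\<^sub>m Q \<in> carrier_mat n n" by simp_all
  have "joint_matrix z1 z2 *\<^sub>v x
      = (P *\<^sub>v x + (- z2) \<cdot>\<^sub>v (P *\<^sub>v (U *\<^sub>v x))) + (Q *\<^sub>v (U *\<^sub>v x) + (- z1) \<cdot>\<^sub>v (Q *\<^sub>v x))"
    unfolding joint_matrix_def add_mult_distrib_mat_vec[OF c x]
      add_mult_distrib_mat_vec[OF P_carrier smult_carrier_mat[OF products_carrier(1)] x]
      add_mult_distrib_mat_vec[OF products_carrier(2) smult_carrier_mat[OF Q_carrier] x]
      smult_mat_mult_mat_vec_assoc[OF products_carrier(1) x] smult_mat_mult_mat_vec_assoc[OF Q_carrier x]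
      product_vec[OF Q_carrier U_carrier x] product_vec[OF P_carrier U_carrier x] ..
  also have "\<dots> = P *\<^sub>v (x + (- z2) \<cdot>\<^sub>v (U *\<^sub>v x)) + Q *\<^sub>v (U *\<^sub>v x + (- z1) \<cdot>\<^sub>v x)"
    using x by (simp add: P_linear Q_linear)
  finally have eq: "joint_matrix z1 z2 *\<^sub>v x = P *\<^sub>v (x + (- z2) \<cdot>\<^sub>v (U *\<^sub>v x)) + Q *\<^sub>v (U *\<^sub>v x + (- z1) \<cdot>\<^sub>v x)" .
  have "joint_matrix z1 z2 *\<^sub>v x = 0\<^sub>v n \<longleftrightarrow>
      P *\<^sub>v (x + (- z2) \<cdot>\<^sub>v (U *\<^sub>v x)) = 0\<^sub>v n \<and> Q *\<^sub>v (U *\<^sub>v x + (- z1) \<cdot>\<^sub>v x) = 0\<^sub>v n"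
    unfolding eq using x by (intro sum_eq_0_iff) simp_all
  also have "P *\<^sub>v (x + (- z2) \<cdot>\<^sub>v (U *\<^sub>v x)) = P *\<^sub>v x + (- z2) \<cdot>\<^sub>v (P *\<^sub>v (U *\<^sub>v x))"
    using x by (simp add: P_linear)
  also have "Q *\<^sub>v (U *\<^sub>v x + (- z1) \<cdot>\<^sub>v x) = Q *\<^sub>v (U *\<^sub>v x) + (- z1) \<cdot>\<^sub>v (Q *\<^sub>v x)"
    using x by (simp add: Q_linear)
  also have "P *\<^sub>v x + (- z2) \<cdot>\<^sub>v (P *\<^sub>v (U *\<^sub>v x)) = 0\<^sub>v n \<longleftrightarrow> P *\<^sub>v x = z2 \<cdot>\<^sub>v (P *\<^sub>v (U *\<^sub>v x))"
    using x by (intro add_uminus_smult_eq_0_iff) simp_all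
  also have "Q *\<^sub>v (U *\<^sub>v x) + (- z1) \<cdot>\<^sub>v (Q *\<^sub>v x) = 0\<^sub>v n \<longleftrightarrow> Q *\<^sub>v (U *\<^sub>v x) = z1 \<cdot>\<^sub>v (Q *\<^sub>v x)"
    using x by (intro add_uminus_smult_eq_0_iff) simp_all
  finally show ?thesis .
qed

lemma W_set_iff_det: "(z1, z2) \<in> W_set P U \<longleftrightarrow> det (joint_matrix z1 z2) = 0"
  unfolding W_set_iff det_0_iff_vec_prod_zero[OF joint_matrix_carrier] joint_vector_def
  using joint_matrix_kernel by blast

text \<open>The determinant is taken over \<open>complex poly poly\<close> and specialised
  afterwards, since evaluation is a ring homomorphism and commutes with \<open>det\<close>. Having a
  single polynomial matters again in the final comparison of varieties.\<close>

lemma W_set_zero_set: "\<exists>q. W_set P U = zero_set q"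
proof -
  define M where "M = mat n n (\<lambda>(i, j). [:[:P $$ (i, j) + (Q * U) $$ (i, j), - Q $$ (i, j):], [:- (P * U) $$ (i, j):]:])"
  have "poly (poly (det M) [:z2:]) z1 = det (joint_matrix z1 z2)" for z1 z2
  proof -
    interpret comm_ring_hom "\<lambda>p. poly (poly p [:z2:]) z1" by unfold_locales auto
    have "joint_matrix z1 z2 = map_mat (\<lambda>p. poly (poly p [:z2:]) z1) M"
    proof (rule eq_matI)
      fix i j assume "i < dim_row (map_mat (\<lambda>p. poly (poly p [:z2:]) z1) M)" "j < dim_col (map_mat (\<lambda>p. poly (poly p [:z2:]) z1) M)"
      then have ij: "i < n" "j < n" by (simp_all add: M_def)
      note d = carrier_matD[OF P_carrier] carrier_matD[OF Q_carrier] carrier_matD[OF products_carrier(1)]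
        carrier_matD[OF products_carrier(2)]
      have "joint_matrix z1 z2 $$ (i, j) = P $$ (i, j) - z2 * (P * U) $$ (i, j) + ((Q * U) $$ (i, j) - z1 * Q $$ (i, j))"
        unfolding joint_matrix_def using ij d by (simp del: index_mult_mat)
      moreover have "map_mat (\<lambda>p. poly (poly p [:z2:]) z1) M $$ (i, j)
          = P $$ (i, j) - z2 * (P * U) $$ (i, j) + ((Q * U) $$ (i, j) - z1 * Q $$ (i, j))"
        unfolding M_def using ij by (simp del: index_mult_mat)
      ultimately show "joint_matrix z1 z2 $$ (i, j) = map_mat (\<lambda>p. poly (poly p [:z2:]) z1) M $$ (i, j)" by simp
    qed (use carrier_matD[OF joint_matrix_carrier[of z1 z2]] in \<open>simp_all add: M_def\<close>)
    then show ?thesis by (simp only: hom_det)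
  qed
  then have "W_set P U = zero_set (det M)"
    unfolding zero_set_def by (auto simp: W_set_iff_det)
  then show ?thesis by blast
qed

lemma algebraic_W_set: "algebraic_variety (W_set P U)"
proof -
  obtain q where "W_set P U = zero_set q" using W_set_zero_set by blast
  then have "W_set P U = (\<Inter>p\<in>{q}. zero_set p)" by simp
  then show ?thesis unfolding algebraic_variety_def by blast
qed

text \<open>A kernel vector \<open>v\<close> of the adjoint of \<open>joint_matrix z1 z2\<close> gives the joint eigenvector
  \<open>P v - cnj z1 Q v\<close> at the reflected point.\<close>

lemma W_set_reflect:
  assumes W: "(z1, z2) \<in> W_set P U" and z: "z1 \<noteq> 0" "z2 \<noteq> 0"
  shows "(1 / cnj z1, 1 / cnj z2) \<in> W_set P U"
proof -
  define c1 c2 where "c1 = cnj z1" and "c2 = cnj z2"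
  have c: "c1 \<noteq> 0" "c2 \<noteq> 0" using z by (auto simp: c1_def c2_def)
  have "det (mat_adjoint (joint_matrix z1 z2)) = 0"
  proof -
    obtain u where u: "u \<in> carrier_vec n" "u \<bullet>c u = 1"
      "\<And>j. j < n \<Longrightarrow> (\<Sum>l<n. cnj (u $ l) * joint_matrix z1 z2 $$ (l, j)) = 0"
      using left_null_vector[OF joint_matrix_carrier] W unfolding W_set_iff_det by blast
    have a: "mat_adjoint (joint_matrix z1 z2) \<in> carrier_mat n n" by simp
    have "mat_adjoint (joint_matrix z1 z2) *\<^sub>v u = 0\<^sub>v n"
    proof (rule eq_vecI)
      fix j assume "j < dim_vec (0\<^sub>v n :: complex Matrix.vec)"
      then have j: "j < n" by simp
      have "(mat_adjoint (joint_matrix z1 z2) *\<^sub>v u) $ j = (\<Sum>l<n. mat_adjoint (joint_matrix z1 z2) $$ (j, l) * u $ l)"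
        by (rule mult_vec_index[OF a u(1) j])
      also have "\<dots> = (\<Sum>l<n. cnj (cnj (u $ l) * joint_matrix z1 z2 $$ (l, j)))"
        using j carrier_matD[OF joint_matrix_carrier[of z1 z2]] by (intro sum.cong refl) (simp add: mult.commute)
      also have "\<dots> = 0" unfolding cnj_sum[symmetric] u(3)[OF j] by simp
      finally show "(mat_adjoint (joint_matrix z1 z2) *\<^sub>v u) $ j = 0\<^sub>v n $ j" using j by simp
    qed (use carrier_matD[OF a] in simp)
    moreover have "u \<noteq> 0\<^sub>v n" using u(2) by (auto simp: unit_iff sq_norm_zero)
    ultimately show ?thesis unfolding det_0_iff_vec_prod_zero[OF a] using u(1) by blast
  qed
  then obtain v where v: "v \<in> carrier_vec n" "v \<noteq> 0\<^sub>v n" and ker: "mat_adjoint (joint_matrix z1 z2) *\<^sub>v v = 0\<^sub>v n"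
    unfolding det_0_iff_vec_prod_zero[OF adjoint_carrier[OF joint_matrix_carrier]] by blast
  note U' = adjoint_carrier[OF U_carrier]
  have m: "mat_adjoint (joint_matrix z1 z2) = (P + (- c2) \<cdot>\<^sub>m (mat_adjoint U * P)) + (mat_adjoint U * Q + (- c1) \<cdot>\<^sub>m Q)"
    unfolding joint_matrix_def
    by (simp add: adjoint_add[of _ n n] adjoint_smult adjoint_mult[OF P_carrier U_carrier] adjoint_mult[OF Q_carrier U_carrier]
        adjoint_P adjoint_Q c1_def c2_def)
  define a b where "a = P *\<^sub>v v" and "b = Q *\<^sub>v v"
  have ab: "a \<in> carrier_vec n" "b \<in> carrier_vec n" using v by (simp_all add: a_def b_def)
  define x where "x = a + (- c1) \<cdot>\<^sub>v b"
  have x: "x \<in> carrier_vec n" using ab by (simp add: x_def)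
  have Ux: "U *\<^sub>v x = c2 \<cdot>\<^sub>v a + (- 1) \<cdot>\<^sub>v b"
  proof -
    have cc: "P + (- c2) \<cdot>\<^sub>m (mat_adjoint U * P) \<in> carrier_mat n n" "mat_adjoint U * Q + (- c1) \<cdot>\<^sub>m Q \<in> carrier_mat n n" by simp_all
    have "mat_adjoint (joint_matrix z1 z2) *\<^sub>v v
        = (a + (- c2) \<cdot>\<^sub>v (mat_adjoint U *\<^sub>v a)) + (mat_adjoint U *\<^sub>v b + (- c1) \<cdot>\<^sub>v b)"
      unfolding m add_mult_distrib_mat_vec[OF cc v(1)]
        add_mult_distrib_mat_vec[OF P_carrier smult_carrier_mat[OF products_carrier(3)] v(1)]
        add_mult_distrib_mat_vec[OF products_carrier(4) smult_carrier_mat[OF Q_carrier] v(1)]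
        smult_mat_mult_mat_vec_assoc[OF products_carrier(3) v(1)] smult_mat_mult_mat_vec_assoc[OF Q_carrier v(1)]
        product_vec[OF U' P_carrier v(1)] product_vec[OF U' Q_carrier v(1)] a_def b_def ..
    then have 0: "(a + (- c2) \<cdot>\<^sub>v (mat_adjoint U *\<^sub>v a)) + (mat_adjoint U *\<^sub>v b + (- c1) \<cdot>\<^sub>v b) = 0\<^sub>v n"
      using ker by simp
    have "x = mat_adjoint U *\<^sub>v (c2 \<cdot>\<^sub>v a + (- 1) \<cdot>\<^sub>v b)"
    proof -
      have "x = c2 \<cdot>\<^sub>v (mat_adjoint U *\<^sub>v a) + (- 1) \<cdot>\<^sub>v (mat_adjoint U *\<^sub>v b)"
      proof (rule eq_vecI)
        fix i assume "i < dim_vec (c2 \<cdot>\<^sub>v (mat_adjoint U *\<^sub>v a) + (- 1) \<cdot>\<^sub>v (mat_adjoint U *\<^sub>v b))"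
        then have i: "i < n" using carrier_vecD[OF U_adjoint_vec[OF ab(2)]] by simp
        have e: "((a + (- c2) \<cdot>\<^sub>v (mat_adjoint U *\<^sub>v a)) + (mat_adjoint U *\<^sub>v b + (- c1) \<cdot>\<^sub>v b)) $ i = 0"
          unfolding 0 using i by simp
        have d: "dim_vec a = n" "dim_vec b = n" "dim_vec (mat_adjoint U *\<^sub>v a) = n" "dim_vec (mat_adjoint U *\<^sub>v b) = n"
          using carrier_vecD ab U_adjoint_vec by blast+
        define s t where "s = mat_adjoint U *\<^sub>v a" and "t = mat_adjoint U *\<^sub>v b"
        have "a $ i - c2 * s $ i + (t $ i - c1 * b $ i) = 0"
          using e i d unfolding s_def[symmetric] t_def[symmetric] by simp
        then have "a $ i - c1 * b $ i = c2 * s $ i - t $ i" by (simp add: algebra_simps)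
        then show "x $ i = (c2 \<cdot>\<^sub>v (mat_adjoint U *\<^sub>v a) + (- 1) \<cdot>\<^sub>v (mat_adjoint U *\<^sub>v b)) $ i"
          using i d unfolding s_def[symmetric] t_def[symmetric] x_def by simp
      next
        show "dim_vec x = dim_vec (c2 \<cdot>\<^sub>v (mat_adjoint U *\<^sub>v a) + (- 1) \<cdot>\<^sub>v (mat_adjoint U *\<^sub>v b))"
          using carrier_vecD[OF x] carrier_vecD[OF U_adjoint_vec[OF ab(2)]] by simp
      qed
      also have "\<dots> = mat_adjoint U *\<^sub>v (c2 \<cdot>\<^sub>v a + (- 1) \<cdot>\<^sub>v b)"
        using ab mult_add_distrib_mat_vec[OF U', of "c2 \<cdot>\<^sub>v a" "(- 1) \<cdot>\<^sub>v b"] mult_mat_vec[OF U' ab(1)] mult_mat_vec[OF U' ab(2)]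
        by simp
      finally show ?thesis .
    qed
    then show ?thesis using U_eq_iff[OF x, of "c2 \<cdot>\<^sub>v a + (- 1) \<cdot>\<^sub>v b"] ab by simp
  qed
  have Pa: "P *\<^sub>v a = a" "P *\<^sub>v b = 0\<^sub>v n" "Q *\<^sub>v a = 0\<^sub>v n" "Q *\<^sub>v b = b"
    using v by (simp_all add: a_def b_def P_P P_Q Q_P Q_Q)
  have px: "P *\<^sub>v x = a" "Q *\<^sub>v x = (- c1) \<cdot>\<^sub>v b" "P *\<^sub>v (U *\<^sub>v x) = c2 \<cdot>\<^sub>v a" "Q *\<^sub>v (U *\<^sub>v x) = (- 1) \<cdot>\<^sub>v b"
    unfolding Ux using ab by (simp_all add: x_def P_linear Q_linear Pa smult_vec_zero)
  have "x \<noteq> 0\<^sub>v n"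
  proof
    assume "x = 0\<^sub>v n"
    then have "a = 0\<^sub>v n" "(- c1) \<cdot>\<^sub>v b = 0\<^sub>v n"
      using px(1,2) mult_mat_zero_vec[OF P_carrier] mult_mat_zero_vec[OF Q_carrier] by simp_all
    moreover from this(2) have "b = 0\<^sub>v n" using c smult_vec_eq_iff[of "- c1" b "0\<^sub>v n"] by (simp add: smult_vec_zero)
    ultimately show False using P_add_Q[OF v(1)] v(2) by (simp add: a_def b_def)
  qed
  then have "joint_vector x (1 / cnj z1) (1 / cnj z2)"
    unfolding joint_vector_def px using x c by (simp add: smult_smult_assoc flip: c1_def c2_def)
  then show ?thesis by (auto simp: W_set_iff)
qed

lemma symmetric_W_set: "symmetric_set (W_set P U)"
  unfolding symmetric_set_def
proof (intro allI impI iffI)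
  fix z1 z2 :: complex assume z: "z1 \<noteq> 0" "z2 \<noteq> 0"
  show "(1 / cnj z1, 1 / cnj z2) \<in> W_set P U" if "(z1, z2) \<in> W_set P U" by (rule W_set_reflect[OF that z])
  show "(z1, z2) \<in> W_set P U" if "(1 / cnj z1, 1 / cnj z2) \<in> W_set P U"
    using W_set_reflect[OF that] z by simp
qed

end

section \<open>Numerical radius conditions and the toral region\<close>

context projection_unitary
begin

text \<open>The matrices of the numerical radius condition, in factored form; on vectors they agree
  with \<open>pencil1 P U z\<close> and \<open>pencil2 P U z\<close>.\<close>

abbreviation "compression1 z \<equiv> (Q + z \<cdot>\<^sub>m P) * U"
abbreviation "compression2 z \<equiv> mat_adjoint U * (P + z \<cdot>\<^sub>m Q)"

lemma compression_carrier: "compression1 z \<in> carrier_mat n n" "compression2 z \<in> carrier_mat n n"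
  by (auto intro!: mult_carrier_mat[of _ n n])

lemma compression_mult:
  assumes x: "x \<in> carrier_vec n"
  shows "compression1 z *\<^sub>v x = Q *\<^sub>v (U *\<^sub>v x) + z \<cdot>\<^sub>v (P *\<^sub>v (U *\<^sub>v x))"
    "compression2 z *\<^sub>v x = mat_adjoint U *\<^sub>v (P *\<^sub>v x + z \<cdot>\<^sub>v (Q *\<^sub>v x))"
proof -
  note zP = smult_carrier_mat[OF P_carrier, of z] and zQ = smult_carrier_mat[OF Q_carrier, of z]
  have c: "Q + z \<cdot>\<^sub>m P \<in> carrier_mat n n" "P + z \<cdot>\<^sub>m Q \<in> carrier_mat n n" by simp_all
  show "compression1 z *\<^sub>v x = Q *\<^sub>v (U *\<^sub>v x) + z \<cdot>\<^sub>v (P *\<^sub>v (U *\<^sub>v x))"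
    unfolding product_vec[OF c(1) U_carrier x] add_mult_distrib_mat_vec[OF Q_carrier zP U_vec[OF x]]
      smult_mat_mult_mat_vec_assoc[OF P_carrier U_vec[OF x]] ..
  show "compression2 z *\<^sub>v x = mat_adjoint U *\<^sub>v (P *\<^sub>v x + z \<cdot>\<^sub>v (Q *\<^sub>v x))"
    unfolding product_vec[OF adjoint_carrier[OF U_carrier] c(2) x] add_mult_distrib_mat_vec[OF P_carrier zQ x]
      smult_mat_mult_mat_vec_assoc[OF Q_carrier x] ..
qed

lemma norm_U_adjoint: "x \<in> carrier_vec n \<Longrightarrow> vec_sq_norm (mat_adjoint U *\<^sub>v x) = vec_sq_norm x"
  using norm_U[of "mat_adjoint U *\<^sub>v x"] unitary_mat_cancel(2)[OF U] by simp

lemma norm_compression: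
  assumes x: "x \<in> carrier_vec n"
  shows "vec_sq_norm (compression1 z *\<^sub>v x) = vec_sq_norm (Q *\<^sub>v (U *\<^sub>v x)) + (cmod z)\<^sup>2 * vec_sq_norm (P *\<^sub>v (U *\<^sub>v x))"
    "vec_sq_norm (compression2 z *\<^sub>v x) = vec_sq_norm (P *\<^sub>v x) + (cmod z)\<^sup>2 * vec_sq_norm (Q *\<^sub>v x)"
  unfolding compression_mult[OF x] using x by (simp_all add: norm_combination norm_U_adjoint)

lemma joint_vector_compression:
  assumes "joint_vector x z1 z2"
  shows "compression1 (z1 * z2) *\<^sub>v x = z1 \<cdot>\<^sub>v x" "compression2 (z1 * z2) *\<^sub>v x = z2 \<cdot>\<^sub>v x"
proof -
  have x: "x \<in> carrier_vec n" and e: "P *\<^sub>v x = z2 \<cdot>\<^sub>v (P *\<^sub>v (U *\<^sub>v x))" "Q *\<^sub>v (U *\<^sub>v x) = z1 \<cdot>\<^sub>v (Q *\<^sub>v x)"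
    using assms by (simp_all add: joint_vector_def)
  have "pencil1 P U (z1 * z2) *\<^sub>v x = z1 \<cdot>\<^sub>v x"
    unfolding pencil1_eigen_iff[OF x] using e by (metis smult_smult_assoc)
  then show "compression1 (z1 * z2) *\<^sub>v x = z1 \<cdot>\<^sub>v x" unfolding compression_mult[OF x] pencil_mult[OF x] .
  have "pencil2 P U (z1 * z2) *\<^sub>v x = z2 \<cdot>\<^sub>v x"
    unfolding pencil2_eigen_iff[OF x] using e by (metis smult_smult_assoc mult.commute)
  then show "compression2 (z1 * z2) *\<^sub>v x = z2 \<cdot>\<^sub>v x" unfolding compression_mult[OF x] pencil_mult[OF x] .
qed

lemma eigenvalue_le_numerical_radius:
  assumes A: "A \<in> carrier_mat n n" and x: "x \<in> carrier_vec n" "x \<noteq> 0\<^sub>v n" and e: "A *\<^sub>v x = l \<cdot>\<^sub>v x"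
  shows "cmod l \<le> numerical_radius A"
proof -
  have pos: "vec_sq_norm x > 0"
    using sq_norm_eq_0[OF x(1)] x(2) sq_norm_nonneg[of x] by fastforce
  define k where "k = complex_of_real (1 / sqrt (vec_sq_norm x)) \<cdot>\<^sub>v x"
  have k: "k \<in> carrier_vec n" using x by (simp add: k_def)
  have "vec_sq_norm k = 1"
    unfolding k_def sq_norm_smult using pos by (simp add: norm_divide power_divide)
  then have kk: "k \<bullet>c k = 1" by (simp add: unit_iff)
  have "A *\<^sub>v k = l \<cdot>\<^sub>v k"
    unfolding k_def using mult_mat_vec[OF A x(1)] e by (simp add: smult_smult_assoc mult.commute)
  then have "(A *\<^sub>v k) \<bullet>c k = l * (k \<bullet>c k)"
    using k unfolding cinner_sum[OF k] by (simp add: sum_distrib_left mult.assoc)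
  then have "cmod ((A *\<^sub>v k) \<bullet>c k) = cmod l" using kk by simp
  then show ?thesis using numerical_radius_attained[OF A n_pos] k kk by metis
qed

text \<open>For a contraction, a value of modulus at least 1 at a maximizing unit vector is the
  equality case of Cauchy--Schwarz, so this vector is an eigenvector.\<close>

lemma numerical_radius_ge_1:
  assumes A: "A \<in> carrier_mat n n" and contr: "\<And>x. x \<in> carrier_vec n \<Longrightarrow> vec_sq_norm (A *\<^sub>v x) \<le> vec_sq_norm x"
    and ge: "\<not> numerical_radius A < 1"
  obtains h l where "h \<in> carrier_vec n" "vec_sq_norm h = 1" "cmod l = 1" "A *\<^sub>v h = l \<cdot>\<^sub>v h"
proof -
  obtain h where h: "h \<in> carrier_vec n" "h \<bullet>c h = 1" "numerical_radius A = cmod ((A *\<^sub>v h) \<bullet>c h)"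
    using numerical_radius_attained[OF A n_pos] by blast
  have n1: "vec_sq_norm h = 1" using h(2) by (simp add: unit_iff)
  have "1 \<le> cmod ((A *\<^sub>v h) \<bullet>c h)" using ge h(3) by simp
  moreover have "vec_sq_norm (A *\<^sub>v h) \<le> 1" using contr[OF h(1)] n1 by simp
  ultimately obtain l where "cmod l = 1" "A *\<^sub>v h = l \<cdot>\<^sub>v h"
    using cinner_extremal[OF mult_mat_vec_carrier[OF A h(1)] h(1)] n1 by blast
  then show ?thesis using that h(1) n1 by blast
qed

text \<open>A unit vector at which the numerical radius is at least 1 is an eigenvector of modulus 1 on which
  \<open>P U\<close> (respectively \<open>Q\<close>) vanishes. This puts \<open>(l, 0)\<close> (respectively \<open>(0, l)\<close>) on the variety.\<close>

lemma distinguished_imp_numerical_radius: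
  assumes D: "distinguished_variety (W_set P U)" and z: "cmod z < 1"
  shows "numerical_radius (compression1 z) < 1" "numerical_radius (compression2 z) < 1"
proof -
  have no: "(z1, z2) \<notin> W_set P U" if "cmod z1 \<le> 1" "cmod z2 \<le> 1" "cmod z1 = 1 \<and> z2 = 0 \<or> z1 = 0 \<and> cmod z2 = 1" for z1 z2
    using D that unfolding distinguished_variety_iff by fastforce
  show "numerical_radius (compression1 z) < 1"
  proof (rule ccontr)
    assume *: "\<not> numerical_radius (compression1 z) < 1"
    have nc: "vec_sq_norm (compression1 z *\<^sub>v x) \<le> vec_sq_norm x" if x: "x \<in> carrier_vec n" for x
      using le_sum_square_mult[OF sq_norm_nonneg z] norm_split[of "U *\<^sub>v x"] x
      unfolding norm_compression[OF x] by (simp add: norm_U add.commute)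
    obtain h l where h: "h \<in> carrier_vec n" "vec_sq_norm h = 1" "cmod l = 1" "compression1 z *\<^sub>v h = l \<cdot>\<^sub>v h"
      using numerical_radius_ge_1[OF compression_carrier(1) nc *] by blast
    have "vec_sq_norm (Q *\<^sub>v (U *\<^sub>v h)) + (cmod z)\<^sup>2 * vec_sq_norm (P *\<^sub>v (U *\<^sub>v h))
        = vec_sq_norm (Q *\<^sub>v (U *\<^sub>v h)) + vec_sq_norm (P *\<^sub>v (U *\<^sub>v h))"
      using norm_compression(1)[OF h(1), of z] norm_split[of "U *\<^sub>v h"] h by (simp add: sq_norm_smult norm_U)
    then have "vec_sq_norm (P *\<^sub>v (U *\<^sub>v h)) = 0" by (rule eq_sum_square_mult[OF sq_norm_nonneg z])
    then have p: "P *\<^sub>v (U *\<^sub>v h) = 0\<^sub>v n" using h(1) by (intro sq_norm_eq_0) simp_all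
    have "pencil1 P U z *\<^sub>v h = l \<cdot>\<^sub>v h" using h(4) unfolding compression_mult[OF h(1)] pencil_mult[OF h(1)] .
    then have "Q *\<^sub>v (U *\<^sub>v h) = l \<cdot>\<^sub>v (Q *\<^sub>v h)" "l \<cdot>\<^sub>v (P *\<^sub>v h) = 0\<^sub>v n"
      unfolding pencil1_eigen_iff[OF h(1)] p smult_vec_zero by simp_all
    moreover from this(2) have "P *\<^sub>v h = 0\<^sub>v n"
      by (rule smult_vec_eq_0[OF h(3)])
    moreover have "h \<noteq> 0\<^sub>v n" using h(2) by (auto simp: sq_norm_zero)
    ultimately have "joint_vector h l 0" using h(1) p by (simp add: joint_vector_def smult_vec_zero)
    then have "(l, 0) \<in> W_set P U" by (auto simp: W_set_iff)
    then show False using no[of l 0] h(3) by simp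
  qed
  show "numerical_radius (compression2 z) < 1"
  proof (rule ccontr)
    assume *: "\<not> numerical_radius (compression2 z) < 1"
    have nc: "vec_sq_norm (compression2 z *\<^sub>v x) \<le> vec_sq_norm x" if x: "x \<in> carrier_vec n" for x
      using le_sum_square_mult[OF sq_norm_nonneg z] norm_split[of x] x
      unfolding norm_compression[OF x] by simp
    obtain h l where h: "h \<in> carrier_vec n" "vec_sq_norm h = 1" "cmod l = 1" "compression2 z *\<^sub>v h = l \<cdot>\<^sub>v h"
      using numerical_radius_ge_1[OF compression_carrier(2) nc *] by blast
    have "vec_sq_norm (P *\<^sub>v h) + (cmod z)\<^sup>2 * vec_sq_norm (Q *\<^sub>v h)
        = vec_sq_norm (P *\<^sub>v h) + vec_sq_norm (Q *\<^sub>v h)"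
      using norm_compression(2)[OF h(1), of z] norm_split[of h] h by (simp add: sq_norm_smult)
    then have "vec_sq_norm (Q *\<^sub>v h) = 0" by (rule eq_sum_square_mult[OF sq_norm_nonneg z])
    then have q: "Q *\<^sub>v h = 0\<^sub>v n" using h(1) by (intro sq_norm_eq_0) simp_all
    have "pencil2 P U z *\<^sub>v h = l \<cdot>\<^sub>v h" using h(4) unfolding compression_mult[OF h(1)] pencil_mult[OF h(1)] .
    then have "P *\<^sub>v h = l \<cdot>\<^sub>v (P *\<^sub>v (U *\<^sub>v h))" "l \<cdot>\<^sub>v (Q *\<^sub>v (U *\<^sub>v h)) = 0\<^sub>v n"
      unfolding pencil2_eigen_iff[OF h(1)] q smult_vec_zero by simp_all
    moreover from this(2) have "Q *\<^sub>v (U *\<^sub>v h) = 0\<^sub>v n"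
      by (rule smult_vec_eq_0[OF h(3)])
    moreover have "h \<noteq> 0\<^sub>v n" using h(2) by (auto simp: sq_norm_zero)
    ultimately have "joint_vector h 0 l" using h(1) q by (simp add: joint_vector_def smult_vec_zero)
    then have "(0, l) \<in> W_set P U" by (auto simp: W_set_iff)
    then show False using no[of 0 l] h(3) by simp
  qed
qed

text \<open>Cases by \<open>cmod (z1 * z2)\<close>. Below 1 the coordinates are eigenvalues of the
  two matrices and bounded by their numerical radii. At 1 the second matrix is isometric, so
  \<open>cmod z2 = 1\<close>. Above 1 the symmetric point falls under the first case.\<close>

lemma numerical_radius_imp_toral:
  assumes nr: "\<And>z. cmod z < 1 \<Longrightarrow> numerical_radius (compression1 z) < 1 \<and> numerical_radius (compression2 z) < 1"
  shows "W_set P U \<subseteq> toral_region"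
proof
  have inner: "cmod z1 < 1 \<and> cmod z2 < 1" if W: "(z1, z2) \<in> W_set P U" and z: "cmod (z1 * z2) < 1" for z1 z2
  proof -
    obtain x where jv: "joint_vector x z1 z2" using W unfolding W_set_iff by blast
    then have x: "x \<in> carrier_vec n" "x \<noteq> 0\<^sub>v n" by (simp_all add: joint_vector_def)
    show ?thesis
      using eigenvalue_le_numerical_radius[OF compression_carrier(1) x joint_vector_compression(1)[OF jv]]
        eigenvalue_le_numerical_radius[OF compression_carrier(2) x joint_vector_compression(2)[OF jv]] nr[OF z]
      by linarith
  qed
  fix w assume "w \<in> W_set P U"
  then obtain z1 z2 where w: "w = (z1, z2)" and W: "(z1, z2) \<in> W_set P U" by (cases w) auto
  consider "cmod (z1 * z2) < 1" | "cmod (z1 * z2) = 1" | "cmod (z1 * z2) > 1" by linarith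
  then have "(z1, z2) \<in> toral_region"
  proof cases
    case 1
    then show ?thesis using inner[OF W] by (simp add: toral_iff)
  next
    case 2
    obtain x where jv: "joint_vector x z1 z2" using W unfolding W_set_iff by blast
    then have x: "x \<in> carrier_vec n" "x \<noteq> 0\<^sub>v n" by (simp_all add: joint_vector_def)
    have "vec_sq_norm x > 0"
      using sq_norm_eq_0[OF x(1)] x(2) sq_norm_nonneg[of x] by fastforce
    moreover have "vec_sq_norm (z2 \<cdot>\<^sub>v x) = vec_sq_norm x"
      using norm_compression(2)[OF x(1), of "z1 * z2"] norm_split[OF x(1)] 2
      unfolding joint_vector_compression[OF jv] by simp
    ultimately have "(cmod z2)\<^sup>2 = 1" unfolding sq_norm_smult by simp
    then have "cmod z2 = 1" using power2_eq_iff_nonneg[of "cmod z2" 1] by simp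
    then show ?thesis using 2 by (simp add: toral_iff norm_mult)
  next
    case 3
    then have z: "z1 \<noteq> 0" "z2 \<noteq> 0" by auto
    have "cmod (1 / cnj z1) < 1 \<and> cmod (1 / cnj z2) < 1"
      using 3 by (intro inner W_set_reflect[OF W z]) (simp add: norm_divide norm_mult)
    then show ?thesis using z by (simp add: toral_iff norm_divide)
  qed
  then show "w \<in> toral_region" using w by simp
qed

text \<open>The main point is to find a point in the bidisc. An eigenvector of the first pencil at a
  nonzero point of the disc, here \<open>1 / 4\<close>, yields a point of the variety whose
  coordinates have that product; within the toral region it can only lie in the bidisc.\<close>

lemma toral_imp_distinguished:
  assumes T: "W_set P U \<subseteq> toral_region"
  shows "distinguished_variety (W_set P U)"
proof -
  have "\<exists>l x. eigenvector (pencil1 P U (1 / 4)) x l"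
    using spectrum_non_empty[OF pencil_carrier(1) n_pos] unfolding spectrum_def eigenvalue_def by blast
  then obtain l x where ev: "eigenvector (pencil1 P U (1 / 4)) x l" by blast
  then have x: "x \<in> carrier_vec n" "x \<noteq> 0\<^sub>v n" and e: "pencil1 P U (1 / 4) *\<^sub>v x = l \<cdot>\<^sub>v x"
    using carrier_matD[OF pencil_carrier(1)] unfolding eigenvector_def by simp_all
  note e = e[unfolded pencil1_eigen_iff[OF x(1)]]
  have p: "P *\<^sub>v (U *\<^sub>v x) = (4 * l) \<cdot>\<^sub>v (P *\<^sub>v x)"
    using e smult_vec_eq_iff[of "1 / 4" "P *\<^sub>v (U *\<^sub>v x)" "l \<cdot>\<^sub>v (P *\<^sub>v x)"] by (simp add: smult_smult_assoc)
  have z0: "0 \<cdot>\<^sub>v a = 0\<^sub>v n" if "a \<in> carrier_vec n" for a :: "complex Matrix.vec"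
    using that by (intro eq_vecI) auto
  have l: "l \<noteq> 0"
  proof
    assume "l = 0"
    then have "U *\<^sub>v x = 0\<^sub>v n" using e p x P_add_Q[of "U *\<^sub>v x"] by (simp add: z0)
    then have "vec_sq_norm x = 0" using norm_U[OF x(1)] by (simp add: sq_norm_zero)
    then show False using sq_norm_eq_0 x by blast
  qed
  then have "joint_vector x l (1 / (4 * l))"
    unfolding joint_vector_def p using e x by (simp add: smult_smult_assoc)
  then have "(l, 1 / (4 * l)) \<in> W_set P U" by (auto simp: W_set_iff)
  moreover from this have "(l, 1 / (4 * l)) \<in> toral_region" using T by blast
  moreover have "cmod l * cmod (1 / (4 * l)) < 1" using l by (simp add: norm_divide norm_mult)
  moreover have "1 \<le> cmod l \<Longrightarrow> 1 \<le> cmod (1 / (4 * l)) \<Longrightarrow> 1 \<le> cmod l * cmod (1 / (4 * l))"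
    using mult_mono[of 1 "cmod l" 1 "cmod (1 / (4 * l))"] by simp
  ultimately have "(l, 1 / (4 * l)) \<in> W_set P U \<and> cmod l < 1 \<and> cmod (1 / (4 * l)) < 1"
    unfolding toral_iff by linarith
  moreover have "cmod z1 < 1 \<and> cmod z2 < 1 \<or> cmod z1 = 1 \<and> cmod z2 = 1"
    if "(z1, z2) \<in> W_set P U" "cmod z1 \<le> 1" "cmod z2 \<le> 1" for z1 z2
    using that subsetD[OF T that(1)] unfolding toral_iff by linarith
  ultimately show ?thesis unfolding distinguished_variety_iff using algebraic_W_set by blast
qed

theorem W_set_properties:
  "algebraic_variety (W_set P U) \<and> symmetric_set (W_set P U) \<and>
    (distinguished_variety (W_set P U) \<longleftrightarrow>
       (\<forall>z\<in>unit_disc. numerical_radius (compression2 z) < 1 \<and> numerical_radius (compression1 z) < 1)) \<and>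
    (distinguished_variety (W_set P U) \<longleftrightarrow> W_set P U \<subseteq> toral_region) \<and>
    W_set P U = (\<Union>z. joint_spectrum (pencil1 P U z) (pencil2 P U z))"
proof -
  have 1: "distinguished_variety (W_set P U) \<Longrightarrow>
      \<forall>z\<in>unit_disc. numerical_radius (compression2 z) < 1 \<and> numerical_radius (compression1 z) < 1"
    using distinguished_imp_numerical_radius by (simp add: disc_iff)
  have 2: "\<forall>z\<in>unit_disc. numerical_radius (compression2 z) < 1 \<and> numerical_radius (compression1 z) < 1 \<Longrightarrow>
      W_set P U \<subseteq> toral_region"
    by (rule numerical_radius_imp_toral) (simp add: disc_iff)
  show ?thesis using algebraic_W_set symmetric_W_set W_set_Union 1 2 toral_imp_distinguished by blast
qed

end

section \<open>Realization of distinguished varieties\<close>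

lemma zero_set_iff: "(z, w) \<in> zero_set p \<longleftrightarrow> poly (spec p z) w = 0"
  by (simp add: zero_set_def poly_spec)

lemma sq_norm_append:
  assumes "a \<in> carrier_vec m" "b \<in> carrier_vec r"
  shows "vec_sq_norm (a @\<^sub>v b) = vec_sq_norm a + vec_sq_norm b"
proof -
  have "conjugate (a @\<^sub>v b) = conjugate a @\<^sub>v conjugate b" by (rule eq_vecI) (auto simp: conjugate_vec_def)
  then have "(a @\<^sub>v b) \<bullet>c (a @\<^sub>v b) = a \<bullet>c a + b \<bullet>c b"
    using scalar_prod_append[OF assms, of "conjugate a" "conjugate b"] assms by simp
  then show ?thesis unfolding cinner_self of_real_add[symmetric] of_real_eq_iff .
qed

lemma zero_append: "0\<^sub>v m @\<^sub>v 0\<^sub>v r = (0\<^sub>v (m + r) :: complex Matrix.vec)"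
  by (intro eq_vecI) auto

lemma smult_append: "k \<cdot>\<^sub>v (a @\<^sub>v b) = (k \<cdot>\<^sub>v a) @\<^sub>v (k \<cdot>\<^sub>v b :: complex Matrix.vec)"
  by (intro eq_vecI) auto

section \<open>Eigenvalues of a transfer function as points of the variety\<close>

locale realized =
  fixes m r U \<Psi>
  assumes real: "realizes m r U \<Psi>" and m_pos: "0 < m" and \<Psi>: "\<And>z. \<Psi> z \<in> carrier_mat m m"
begin

definition P :: "complex mat" where "P = four_block_mat (1\<^sub>m m) (0\<^sub>m m r) (0\<^sub>m r m) (0\<^sub>m r r)"

lemma realizing_unitary: "unitary_mat (m + r) U" using real by (simp add: realizes_def)

lemma projection_carrier: "P \<in> carrier_mat (m + r) (m + r)"
  unfolding P_def by (rule four_block_carrier_mat[OF one_carrier_mat zero_carrier_mat])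

lemma P_append:
  assumes "a \<in> carrier_vec m" "b \<in> carrier_vec r"
  shows "P *\<^sub>v (a @\<^sub>v b) = a @\<^sub>v 0\<^sub>v r"
proof -
  have "0\<^sub>m r r *\<^sub>v b = 0\<^sub>v r" using assms by (intro eq_vecI) (auto simp: scalar_prod_def)
  then show ?thesis
    unfolding P_def using mult_mat_vec_split[OF one_carrier_mat zero_carrier_mat assms] assms(1) by simp
qed

lemma orthogonal_P: "orthogonal_projection (m + r) P"
  unfolding orthogonal_projection_def
proof (intro conjI)
  show "P \<in> carrier_mat (m + r) (m + r)" by (rule projection_carrier)
  show "mat_adjoint P = P" by (rule eq_matI) (auto simp: P_def)
  show "P * P = P" unfolding P_def
    by (subst mult_four_block_mat[OF one_carrier_mat zero_carrier_mat zero_carrier_mat zero_carrier_mat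
        one_carrier_mat zero_carrier_mat zero_carrier_mat zero_carrier_mat]) simp
qed

text \<open>The adjoint is the right unitary: a joint vector has the form \<open>z2\<close> times
  \<open>c\<close> above \<open>b\<close>, its image under the adjoint is \<open>c\<close> above
  \<open>z1\<close> times \<open>b\<close>, and the colligation maps the latter back to the
  former.\<close>

sublocale projection_unitary "m + r" P "mat_adjoint U"
  by unfold_locales (use m_pos orthogonal_P unitary_mat_adjoint[OF realizing_unitary] in simp_all)

lemma Q_append:
  assumes "a \<in> carrier_vec m" "b \<in> carrier_vec r"
  shows "mat_perp P *\<^sub>v (a @\<^sub>v b) = 0\<^sub>v m @\<^sub>v b"
proof -
  have c: "a @\<^sub>v b \<in> carrier_vec (m + r)" using assms by simp
  show ?thesis unfolding Q_mult[OF c] P_append[OF assms] using assms by (intro eq_vecI) auto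
qed

lemma append_eq_iff:
  assumes "a \<in> carrier_vec m" "a' \<in> carrier_vec m"
  shows "a @\<^sub>v b = a' @\<^sub>v b' \<longleftrightarrow> a = a' \<and> b = (b' :: complex Matrix.vec)"
  by (rule append_vec_eq[OF assms])

lemma joint_vector_append:
  assumes a: "a \<in> carrier_vec m" and b: "b \<in> carrier_vec r" and c: "c \<in> carrier_vec m" and d: "d \<in> carrier_vec r"
    and cd: "mat_adjoint U *\<^sub>v (a @\<^sub>v b) = c @\<^sub>v d"
  shows "joint_vector (a @\<^sub>v b) z1 z2 \<longleftrightarrow> a @\<^sub>v b \<noteq> 0\<^sub>v (m + r) \<and> a = z2 \<cdot>\<^sub>v c \<and> d = z1 \<cdot>\<^sub>v b"
  unfolding joint_vector_def cd P_append[OF a b] P_append[OF c d] Q_append[OF a b] Q_append[OF c d] smult_append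
  using a b c d by (simp add: append_eq_iff smult_vec_zero)

lemma norm_realizing: "x \<in> carrier_vec (m + r) \<Longrightarrow> vec_sq_norm (U *\<^sub>v x) = vec_sq_norm x"
  using norm_U_adjoint[of x] by (simp add: adjoint_adjoint)

text \<open>Uniqueness of the state for zero input: \<open>U\<close> preserves norms, so the norm of
  \<open>b\<close> scaled by \<open>cmod z < 1\<close> would have to account for both
  \<open>a\<close> and \<open>b\<close>.\<close>

lemma strict_contraction_zero:
  assumes z: "cmod z < 1" and b: "b \<in> carrier_vec r" and a: "a \<in> carrier_vec m"
    and e: "U *\<^sub>v (0\<^sub>v m @\<^sub>v (z \<cdot>\<^sub>v b)) = a @\<^sub>v b"
  shows "a = 0\<^sub>v m" "b = 0\<^sub>v r"
proof -
  have "vec_sq_norm (0\<^sub>v m @\<^sub>v (z \<cdot>\<^sub>v b)) = vec_sq_norm (a @\<^sub>v b)"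
    unfolding e[symmetric] using b by (intro norm_realizing[symmetric]) simp
  then have n: "(cmod z)\<^sup>2 * vec_sq_norm b = vec_sq_norm a + vec_sq_norm b"
    using sq_norm_append[of "0\<^sub>v m" m "z \<cdot>\<^sub>v b" r] sq_norm_append[OF a b] b
    by (simp add: sq_norm_zero sq_norm_smult)
  moreover have "(cmod z)\<^sup>2 * vec_sq_norm b \<le> vec_sq_norm b"
    using z le_sum_square_mult[OF sq_norm_nonneg, of z 0 b] by simp
  ultimately have na: "vec_sq_norm a = 0" using sq_norm_nonneg[of a] by linarith
  then have "vec_sq_norm b = 0" using n eq_sum_square_mult[OF sq_norm_nonneg z, of 0 b] by simp
  then show "a = 0\<^sub>v m" "b = 0\<^sub>v r" using sq_norm_eq_0 na a b by blast+
qed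

text \<open>An eigenvector \<open>q\<close> with its state \<open>R\<close> gives the joint vector
  \<open>z2\<close> times \<open>q\<close> above \<open>R\<close>. Conversely, the state part of a
  joint vector and the state supplied by \<open>realizes\<close> belong to the same input
  \<open>c\<close>; subtracting the two relations leaves zero input, and
  \<open>strict_contraction_zero\<close> yields the eigenvalue equation.\<close>

lemma W_set_realized:
  assumes z1: "cmod z1 < 1"
  shows "(z1, z2) \<in> W_set P (mat_adjoint U) \<longleftrightarrow> (\<exists>q\<in>carrier_vec m. q \<noteq> 0\<^sub>v m \<and> \<Psi> z1 *\<^sub>v q = z2 \<cdot>\<^sub>v q)"
proof
  assume "\<exists>q\<in>carrier_vec m. q \<noteq> 0\<^sub>v m \<and> \<Psi> z1 *\<^sub>v q = z2 \<cdot>\<^sub>v q"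
  then obtain q where q: "q \<in> carrier_vec m" "q \<noteq> 0\<^sub>v m" "\<Psi> z1 *\<^sub>v q = z2 \<cdot>\<^sub>v q" by blast
  then obtain R where R: "R \<in> carrier_vec r" "U *\<^sub>v (q @\<^sub>v (z1 \<cdot>\<^sub>v R)) = (z2 \<cdot>\<^sub>v q) @\<^sub>v R"
    using real z1 unfolding realizes_def by metis
  have qR: "q @\<^sub>v (z1 \<cdot>\<^sub>v R) \<in> carrier_vec (m + r)" using q R by simp
  have e: "mat_adjoint U *\<^sub>v ((z2 \<cdot>\<^sub>v q) @\<^sub>v R) = q @\<^sub>v (z1 \<cdot>\<^sub>v R)"
    unfolding R(2)[symmetric] by (rule unitary_mat_cancel(1)[OF realizing_unitary qR])
  have "(z2 \<cdot>\<^sub>v q) @\<^sub>v R \<noteq> 0\<^sub>v (m + r)"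
  proof
    assume "(z2 \<cdot>\<^sub>v q) @\<^sub>v R = 0\<^sub>v (m + r)"
    then have "q @\<^sub>v (z1 \<cdot>\<^sub>v R) = 0\<^sub>v m @\<^sub>v 0\<^sub>v r"
      using e mult_mat_zero_vec[OF adjoint_carrier[OF unitary_mat_carrier[OF realizing_unitary]]] by (simp add: zero_append)
    then show False using append_eq_iff[OF q(1) zero_carrier_vec] q(2) by blast
  qed
  then have "joint_vector ((z2 \<cdot>\<^sub>v q) @\<^sub>v R) z1 z2"
    using joint_vector_append[of "z2 \<cdot>\<^sub>v q" R q "z1 \<cdot>\<^sub>v R" z1 z2] e q R by simp
  then show "(z1, z2) \<in> W_set P (mat_adjoint U)" by (auto simp: W_set_iff)
next
  assume "(z1, z2) \<in> W_set P (mat_adjoint U)"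
  then obtain x where jv: "joint_vector x z1 z2" unfolding W_set_iff by blast
  then have x: "x \<in> carrier_vec (m + r)" by (simp add: joint_vector_def)
  define a b where "a = vec_first x m" and "b = vec_last x r"
  define y where "y = mat_adjoint U *\<^sub>v x"
  have y: "y \<in> carrier_vec (m + r)" unfolding y_def by (rule U_vec[OF x])
  define c d where "c = vec_first y m" and "d = vec_last y r"
  have car: "a \<in> carrier_vec m" "b \<in> carrier_vec r" "c \<in> carrier_vec m" "d \<in> carrier_vec r"
    unfolding a_def b_def c_def d_def by simp_all
  have ab: "x = a @\<^sub>v b" and cd: "y = c @\<^sub>v d"
    unfolding a_def b_def c_def d_def using x y by simp_all
  have "mat_adjoint U *\<^sub>v (a @\<^sub>v b) = c @\<^sub>v d" using y_def ab cd by simp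
  from jv[unfolded ab joint_vector_append[OF car this]]
  have nz: "a @\<^sub>v b \<noteq> 0\<^sub>v (m + r)" and a: "a = z2 \<cdot>\<^sub>v c" and d: "d = z1 \<cdot>\<^sub>v b" by blast+
  have e1: "U *\<^sub>v (c @\<^sub>v (z1 \<cdot>\<^sub>v b)) = (z2 \<cdot>\<^sub>v c) @\<^sub>v b"
    using unitary_mat_cancel(2)[OF realizing_unitary x] unfolding y_def[symmetric] unfolding ab cd a d .
  obtain R where R: "R \<in> carrier_vec r" "U *\<^sub>v (c @\<^sub>v (z1 \<cdot>\<^sub>v R)) = (\<Psi> z1 *\<^sub>v c) @\<^sub>v R"
    using real z1 car(3) unfolding realizes_def by metis
  define g where "g = \<Psi> z1 *\<^sub>v c"
  have g: "g \<in> carrier_vec m" unfolding g_def by (rule mult_mat_vec_carrier[OF \<Psi> car(3)])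
  have zc: "c @\<^sub>v (z1 \<cdot>\<^sub>v b) \<in> carrier_vec (m + r)" "c @\<^sub>v (z1 \<cdot>\<^sub>v R) \<in> carrier_vec (m + r)" using car R by simp_all
  have "0\<^sub>v m @\<^sub>v (z1 \<cdot>\<^sub>v (b + (- 1) \<cdot>\<^sub>v R)) = (c @\<^sub>v (z1 \<cdot>\<^sub>v b)) + (- 1) \<cdot>\<^sub>v (c @\<^sub>v (z1 \<cdot>\<^sub>v R))"
    using car R by (intro eq_vecI) (auto simp: algebra_simps)
  then have "U *\<^sub>v (0\<^sub>v m @\<^sub>v (z1 \<cdot>\<^sub>v (b + (- 1) \<cdot>\<^sub>v R))) = ((z2 \<cdot>\<^sub>v c) @\<^sub>v b) + (- 1) \<cdot>\<^sub>v (g @\<^sub>v R)"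
    using mult_add_distrib_mat_vec[OF unitary_mat_carrier[OF realizing_unitary] zc(1), of "(- 1) \<cdot>\<^sub>v (c @\<^sub>v (z1 \<cdot>\<^sub>v R))"]
      mult_mat_vec[OF unitary_mat_carrier[OF realizing_unitary] zc(2)] zc e1 R(2) by (simp add: g_def)
  also have "\<dots> = (z2 \<cdot>\<^sub>v c + (- 1) \<cdot>\<^sub>v g) @\<^sub>v (b + (- 1) \<cdot>\<^sub>v R)"
    using car R g by (intro eq_vecI) auto
  finally have "z2 \<cdot>\<^sub>v c + (- 1) \<cdot>\<^sub>v g = 0\<^sub>v m"
    using car R g by (intro strict_contraction_zero(1)[OF z1, of "b + (- 1) \<cdot>\<^sub>v R"]) simp_all
  then have eig: "\<Psi> z1 *\<^sub>v c = z2 \<cdot>\<^sub>v c"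
    using add_uminus_smult_eq_0_iff[of "z2 \<cdot>\<^sub>v c" m g 1] car g unfolding g_def by (simp add: one_smult_vec)
  have "c \<noteq> 0\<^sub>v m"
  proof
    assume c: "c = 0\<^sub>v m"
    have a0: "a = 0\<^sub>v m" unfolding a c smult_vec_zero ..
    have "U *\<^sub>v (0\<^sub>v m @\<^sub>v (z1 \<cdot>\<^sub>v b)) = 0\<^sub>v m @\<^sub>v b" using e1 unfolding c smult_vec_zero .
    then have "b = 0\<^sub>v r" by (rule strict_contraction_zero(2)[OF z1 car(2) zero_carrier_vec])
    then show False using nz a0 by (simp add: zero_append)
  qed
  then show "\<exists>q\<in>carrier_vec m. q \<noteq> 0\<^sub>v m \<and> \<Psi> z1 *\<^sub>v q = z2 \<cdot>\<^sub>v q" using car(3) eig by blast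
qed

end

lemma distinguished_realization:
  assumes D: "distinguished_variety (zero_set p)"
  shows "\<exists>n P U. 0 < n \<and> orthogonal_projection n P \<and> unitary_mat n U \<and>
    zero_set p \<inter> (unit_disc \<times> unit_disc) = W_set P U \<inter> (unit_disc \<times> unit_disc)"
proof -
  note D' = D[unfolded distinguished_variety_iff zero_set_iff]
  have dp: "distinguished_poly p"
  proof
    show "poly (spec p z) w \<noteq> 0" if "cmod z < 1" "cmod w = 1" for z w using D' that by fastforce
    show "poly (spec p z) w \<noteq> 0" if "cmod z = 1" "cmod w < 1" for z w using D' that by fastforce
    show "\<exists>z w. cmod z < 1 \<and> cmod w < 1 \<and> poly (spec p z) w = 0" using D' by blast
  qed
  obtain f c u v where f: "degree f > 0" "\<And>z. cmod z \<le> 1 \<Longrightarrow> poly (lead_coeff f) z \<noteq> 0"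
    "\<And>z w. cmod z < 1 \<Longrightarrow> poly (spec f z) w = 0 \<longleftrightarrow> cmod w < 1 \<and> poly (spec p z) w = 0"
    "\<And>z w. cmod z = 1 \<Longrightarrow> poly (spec f z) w = 0 \<Longrightarrow> cmod w = 1"
    "c \<noteq> 0" "u * f + v * pderiv f = [:c:]"
    by (rule distinguished_poly.inner_polynomial_separable[OF dp]) (rule that; blast)
  have cs: "circle_separable f c u v" by unfold_locales (use f in blast)+
  have "\<exists>r U \<Psi>. realizes (degree f) r U \<Psi> \<and> (\<forall>z. \<Psi> z \<in> carrier_mat (degree f) (degree f)) \<and>
    (\<forall>z w. cmod z < 1 \<longrightarrow> (\<exists>q\<in>carrier_vec (degree f). q \<noteq> 0\<^sub>v (degree f) \<and> \<Psi> z *\<^sub>v q = w \<cdot>\<^sub>v q) = (poly (spec f z) w = 0))"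
  proof (rule circle_separable.inner_realization[OF cs], goal_cases)
    case (1 r U \<Psi>)
    show ?case
      by (rule exI[of _ r], rule exI[of _ U], rule exI[of _ \<Psi>]) (intro conjI allI impI 1)
  qed
  then obtain r U \<Psi> where R1: "realizes (degree f) r U \<Psi>" and R3: "\<forall>z. \<Psi> z \<in> carrier_mat (degree f) (degree f)"
    and R2: "\<forall>z w. cmod z < 1 \<longrightarrow>
      (\<exists>q\<in>carrier_vec (degree f). q \<noteq> 0\<^sub>v (degree f) \<and> \<Psi> z *\<^sub>v q = w \<cdot>\<^sub>v q) = (poly (spec f z) w = 0)"
    by (elim exE conjE)
  interpret realized "degree f" r U \<Psi> by unfold_locales (rule R1, rule f(1), rule R3[rule_format])
  have "w \<in> zero_set p \<inter> (unit_disc \<times> unit_disc) \<longleftrightarrow> w \<in> W_set P (mat_adjoint U) \<inter> (unit_disc \<times> unit_disc)" for w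
  proof -
    obtain z1 z2 where w: "w = (z1, z2)" by (cases w)
    show ?thesis
      unfolding w Int_iff mem_Times_iff fst_conv snd_conv disc_iff zero_set_iff
      using W_set_realized[of z1 z2] R2[rule_format, of z1 z2] f(3)[of z1 z2] by blast
  qed
  then show ?thesis
    using n_pos orthogonal_P unitary_mat_adjoint[OF realizing_unitary] by blast
qed

text \<open>Over the disc the whole fibre of the first set lies in the bidisc, so the inclusion is
  known for infinitely many fibres and \<open>zero_subset_of_infinite_fibres\<close> spreads it. No
  fibre over a point outside the disc is the full line, because that line would contain
  \<open>(z0, 0)\<close>, which is not toral.\<close>

lemma toral_zero_set_subset:
  assumes T: "zero_set p \<subseteq> toral_region" and I: "zero_set p \<inter> (unit_disc \<times> unit_disc) \<subseteq> zero_set q"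
  shows "zero_set p \<subseteq> zero_set q"
proof
  fix w assume w: "w \<in> zero_set p"
  obtain z0 w0 where z: "w = (z0, w0)" by (cases w)
  have inner: "poly (spec q z) t = 0" if "cmod z < 1" "poly (spec p z) t = 0" for z t
  proof -
    have zt: "(z, t) \<in> zero_set p" using that(2) by (simp add: zero_set_iff)
    then have "(z, t) \<in> toral_region" using T by blast
    then have "(z, t) \<in> unit_disc \<times> unit_disc" using that(1) by (simp add: toral_iff disc_iff)
    then show ?thesis using subsetD[OF I, of "(z, t)"] zt by (simp add: zero_set_iff)
  qed
  have "poly (spec q z0) w0 = 0"
  proof (cases "cmod z0 < 1")
    case True
    then show ?thesis using inner w z by (simp add: zero_set_iff)
  next
    case False
    have inf: "infinite (ball 0 1 :: complex set)" using uncountable_ball[of 1 "0 :: complex"] countable_finite by auto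
    have "ball 0 1 \<subseteq> {z. \<forall>t. poly (spec p z) t = 0 \<longrightarrow> poly (spec q z) t = 0}" using inner by auto
    then have inf: "infinite {z. \<forall>t. poly (spec p z) t = 0 \<longrightarrow> poly (spec q z) t = 0}"
      using inf finite_subset by blast
    have "spec p z0 \<noteq> 0"
    proof
      assume "spec p z0 = 0"
      then have "(z0, 0) \<in> zero_set p" by (simp add: zero_set_iff)
      then have "(z0, 0) \<in> toral_region" using T by blast
      then show False using False by (simp add: toral_iff)
    qed
    then show ?thesis using zero_subset_of_infinite_fibres[OF inf] w z by (simp add: zero_set_iff)
  qed
  then show "w \<in> zero_set q" by (simp add: z zero_set_iff)
qed

theorem theorem3p2:
  shows
    "(\<forall>n P U. 0 < n \<longrightarrow> orthogonal_projection n P \<longrightarrow> unitary_mat n U \<longrightarrow>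
        algebraic_variety (W_set P U) \<and> symmetric_set (W_set P U) \<and>
        (distinguished_variety (W_set P U) \<longleftrightarrow>
           (\<forall>z\<in>unit_disc.
              numerical_radius (mat_adjoint U * (P + z \<cdot>\<^sub>m mat_perp P)) < 1 \<and>
              numerical_radius ((mat_perp P + z \<cdot>\<^sub>m P) * U) < 1)) \<and>
        (distinguished_variety (W_set P U) \<longleftrightarrow> W_set P U \<subseteq> toral_region) \<and>
        W_set P U = (\<Union>z. joint_spectrum (pencil1 P U z) (pencil2 P U z)))
     \<and>
     (\<forall>W. distinguished_variety W \<longrightarrow> (\<exists>p. W = zero_set p) \<longrightarrow>
        (\<exists>n P U. 0 < n \<and> orthogonal_projection n P \<and> unitary_mat n U \<and>
           W \<inter> (unit_disc \<times> unit_disc) = W_set P U \<inter> (unit_disc \<times> unit_disc)) \<and>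
        (\<forall>n P U. 0 < n \<longrightarrow> orthogonal_projection n P \<longrightarrow> unitary_mat n U \<longrightarrow>
           W \<inter> (unit_disc \<times> unit_disc) = W_set P U \<inter> (unit_disc \<times> unit_disc) \<longrightarrow>
           (W = W_set P U \<longleftrightarrow> W \<subseteq> toral_region \<and> W_set P U \<subseteq> toral_region)))"
proof (intro conjI[of "\<forall>n. _ n"] allI impI)
  fix n P U assume "0 < (n :: nat)" "orthogonal_projection n P" "unitary_mat n U"
  then interpret projection_unitary n P U by unfold_locales
  show "algebraic_variety (W_set P U) \<and> symmetric_set (W_set P U) \<and>
        (distinguished_variety (W_set P U) \<longleftrightarrow>
           (\<forall>z\<in>unit_disc.
              numerical_radius (mat_adjoint U * (P + z \<cdot>\<^sub>m mat_perp P)) < 1 \<and>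
              numerical_radius ((mat_perp P + z \<cdot>\<^sub>m P) * U) < 1)) \<and>
        (distinguished_variety (W_set P U) \<longleftrightarrow> W_set P U \<subseteq> toral_region) \<and>
        W_set P U = (\<Union>z. joint_spectrum (pencil1 P U z) (pencil2 P U z))"
    by (rule W_set_properties)
next
  fix W assume D: "distinguished_variety W" and "\<exists>p. W = zero_set p"
  then obtain p where p: "W = zero_set p" by blast
  show "(\<exists>n P U. 0 < n \<and> orthogonal_projection n P \<and> unitary_mat n U \<and>
           W \<inter> (unit_disc \<times> unit_disc) = W_set P U \<inter> (unit_disc \<times> unit_disc)) \<and>
        (\<forall>n P U. 0 < n \<longrightarrow> orthogonal_projection n P \<longrightarrow> unitary_mat n U \<longrightarrow>
           W \<inter> (unit_disc \<times> unit_disc) = W_set P U \<inter> (unit_disc \<times> unit_disc) \<longrightarrow>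
           (W = W_set P U \<longleftrightarrow> W \<subseteq> toral_region \<and> W_set P U \<subseteq> toral_region))"
  proof (rule conjI)
    show "\<exists>n P U. 0 < n \<and> orthogonal_projection n P \<and> unitary_mat n U \<and>
           W \<inter> (unit_disc \<times> unit_disc) = W_set P U \<inter> (unit_disc \<times> unit_disc)"
      unfolding p by (rule distinguished_realization[OF D[unfolded p]])
    show "\<forall>n P U. 0 < n \<longrightarrow> orthogonal_projection n P \<longrightarrow> unitary_mat n U \<longrightarrow>
           W \<inter> (unit_disc \<times> unit_disc) = W_set P U \<inter> (unit_disc \<times> unit_disc) \<longrightarrow>
           (W = W_set P U \<longleftrightarrow> W \<subseteq> toral_region \<and> W_set P U \<subseteq> toral_region)"
    proof (intro allI impI iffI)
      fix n P U assume "0 < (n :: nat)" "orthogonal_projection n P" "unitary_mat n U"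
      then interpret projection_unitary n P U by unfold_locales
      assume eq: "W \<inter> (unit_disc \<times> unit_disc) = W_set P U \<inter> (unit_disc \<times> unit_disc)"
      \<comment> \<open>If the two sets agree, \<open>W_set P U\<close> is itself distinguished, and
        the equivalence in the first half places it in the toral region.\<close>
      show "W \<subseteq> toral_region \<and> W_set P U \<subseteq> toral_region" if "W = W_set P U"
        using W_set_properties D unfolding that by blast
      assume T: "W \<subseteq> toral_region \<and> W_set P U \<subseteq> toral_region"
      obtain q where q: "W_set P U = zero_set q" using W_set_zero_set by blast
      have "zero_set p \<subseteq> zero_set q"
        by (rule toral_zero_set_subset) (use T eq p q in blast)+
      moreover have "zero_set q \<subseteq> zero_set p"
        by (rule toral_zero_set_subset) (use T eq p q in blast)+
      ultimately show "W = W_set P U" using p q by simp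
    qed
  qed
qed

end
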